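(* Let $\Bbbk$ be a principal ideal domain of characteristic $0$ with field of fractions $\mathbb K$, let $(A,\mathfrak a)$ be a unital good pair over $\Bbbk$ with $A$ of finite rank over $\Bbbk$, and let $n\ge1$, $0\le d\le n$. Let $e\in A_{\bar0}$ be an idempotent which is a double centralizer idempotent for $A$. Then $\xi^e$ is a double centralizer idempotent for $S^A(n,d)$. In particular, $\xi^e$ is a double centralizer idempotent for $S^A(n,d)_{\mathbb K}=T^A_{\mathfrak a}(n,d)_{\mathbb K}$.
   Context: For a $\Bbbk$-algebra (or $\mathbb K$-algebra) $S$ and an idempotent $f\in S$, regard $Sf$ as a right $fSf$-module; $f$ is a double centralizer idempotent for $S$ if the algebra homomorphism $S\to\mathrm{End}_{fSf}(Sf)$, $s\mapsto(s'f\mapsto ss'f)$, is an isomorphism. For a $\Bbbk$-module $V$ put $V_{\mathbb K}:=V\otimes_\Bbbk\mathbb K$. Superalgebras are $\mathbb Z/2$-graded associative $\Bbbk$-algebras $A=A_{\bar 0}\oplus A_{\bar 1}$; $\bar a$ denotes the parity of a homogeneous element $a$; tensor products of superalgebras carry the product $(x\otimes y)(z\otimes w)=(-1)^{\bar y\bar z}xz\otimes yw$. A unital good pair $(A,\mathfrak a)$ consists of a unital superalgebra $A$ with $A_{\bar 0},A_{\bar 1}$ free over $\Bbbk$ and a subalgebra $\mathfrak a\subseteq A_{\bar 0}$ containing $1_A$ such that $\mathfrak a$ and $A/\mathfrak a$ are free $\Bbbk$-modules. An $(A,\mathfrak a)$-basis is a $\Bbbk$-basis $B=B_{\mathfrak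 a}\sqcup B_{\mathfrak c}\sqcup B_{\bar 1}$ of $A$, where $B_{\mathfrak a}$, $B_{\mathfrak c}$, $B_{\bar 1}$ are bases of $\mathfrak a$, of a chosen complement $\mathfrak c$ of $\mathfrak a$ in $A_{\bar 0}$, and of $A_{\bar 1}$, respectively; one such basis is fixed. For $a\in A$ put $\xi^a_{r,s}:=aE_{r,s}\in M_n(A)$ ($E_{r,s}$ the matrix units; $M_n(A)$ is a superalgebra via parities of entries). Write $[1,n]=\{1,\dots,n\}$. The symmetric group $\mathfrak S_d$ acts on the right on words by $(x_1\cdots x_d)\sigma=x_{\sigma 1}\cdots x_{\sigma d}$, diagonally on tuples of words, and on $M_n(A)^{\otimes d}$ by superalgebra automorphisms $(\xi^{a_1}_{r_1,s_1}\otimes\cdots\otimes\xi^{a_d}_{r_d,s_d})^\sigma=(-1)^{\langle\sigma;\boldsymbol a\rangle}\xi^{a_{\sigma1}}_{r_{\sigma1},s_{\sigma1}}\otimes\cdots\otimes\xi^{a_{\sigma d}}_{r_{\sigma d},s_{\sigma d}}$ for homogeneous $a_i$, where $\langle\sigma;\boldsymbol a\rangle=\#\{(k,l): k<l,\ \sigma^{-1}k>\sigma^{-1}l,\ a_k,a_l \text{ odd}\}$. Define $S^A(n,d):=(M_n(A)^{\otimes d})^{\mathfrak S_d}$. For an idempotent $e\in A_{\bar0}$ put $E^e:=\sum_{r=1}^n\xi^e_{r,r}$ and $\xi^e:=E^e\otimes\cdots\otimes E^e$ ($d$ factors), an idempotent of $S^A(n,d)$. $\mathrm{Tri}^B(n,d)$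 is the set of triples $(\boldsymbol b,\boldsymbol r,\boldsymbol s)\in B^d\times[1,n]^d\times[1,n]^d$ such that for $k\ne l$ the equality $(b_k,r_k,s_k)=(b_l,r_l,s_l)$ holds only if $b_k$ is even. For such a triple let $\xi^{\boldsymbol b}_{\boldsymbol r,\boldsymbol s}:=\sum_\sigma(\xi^{b_1}_{r_1,s_1}\otimes\cdots\otimes\xi^{b_d}_{r_d,s_d})^\sigma$, with $\sigma$ over representatives of the cosets of the stabilizer of the triple, $\mathfrak S_{\boldsymbol b,\boldsymbol r,\boldsymbol s}\backslash\mathfrak S_d$. Let $[\boldsymbol b,\boldsymbol r,\boldsymbol s]^b_{r,s}:=\#\{k: (b_k,r_k,s_k)=(b,r,s)\}$, $[\boldsymbol b,\boldsymbol r,\boldsymbol s]^!_{\mathfrak c}:=\prod_{b\in B_{\mathfrak c},\,r,s\in[1,n]}[\boldsymbol b,\boldsymbol r,\boldsymbol s]^b_{r,s}!$, and $\eta^{\boldsymbol b}_{\boldsymbol r,\boldsymbol s}:=[\boldsymbol b,\boldsymbol r,\boldsymbol s]^!_{\mathfrak c}\,\xi^{\boldsymbol b}_{\boldsymbol r,\boldsymbol s}$. $T^A_{\mathfrak a}(n,d)$ is the $\Bbbk$-span of all these $\eta^{\boldsymbol b}_{\boldsymbol r,\boldsymbol s}$, a full-rank subalgebra of $S^A(n,d)$. *)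

theory Defs
  imports
    "HOL-Algebra.Algebraic_Closure_Type"
    "HOL-Algebra.QuotRing"
    "HOL-Library.Z2"
    "HOL-Library.Poly_Mapping"
    "HOL-Computational_Algebra.Fraction_Field"
    "HOL-Combinatorics.Permutations"
    "Jordan_Normal_Form.Matrix"
begin

text \<open>
  The ground ring and the superalgebra are types; algebras that live on subsets or quotients
  (tensor powers, invariants, scalar extensions) are HOL-Algebra records of type
  \<open>('k, 's) module\<close>, i.e.\ rings with an additional scalar multiplication.  Note that
  \<open>Modules.module\<close> is the type class based module locale of HOL, while the record type
  \<open>module\<close> comes from HOL-Algebra.
\<close>

section \<open>Double centralizer idempotents\<close>

definition alg_iso :: "('k, 's) module \<Rightarrow> ('k, 't) module \<Rightarrow> ('s \<Rightarrow> 't) set" where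
  "alg_iso S T = {h \<in> ring_iso S T.
     \<forall>a. \<forall>s\<in>carrier S. h (a \<odot>\<^bsub>S\<^esub> s) = a \<odot>\<^bsub>T\<^esub> h s}"

definition left_part :: "('k, 's) module \<Rightarrow> 's \<Rightarrow> 's set" where
  "left_part S f = (\<lambda>s. s \<otimes>\<^bsub>S\<^esub> f) ` carrier S"

definition corner :: "('k, 's) module \<Rightarrow> 's \<Rightarrow> 's set" where
  "corner S f = (\<lambda>s. f \<otimes>\<^bsub>S\<^esub> s \<otimes>\<^bsub>S\<^esub> f) ` carrier S"

text \<open>
  The endomorphism algebra of \<open>Sf\<close> as a right \<open>fSf\<close>-module.  For a \<open>\<k>\<close>-algebra \<open>S\<close> such
  endomorphisms are automatically linear over the ground ring, as \<open>a \<odot> x = x \<otimes> (a \<odot> f)\<close>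
  on \<open>Sf\<close>.
\<close>

definition corner_End :: "('k, 's) module \<Rightarrow> 's \<Rightarrow> ('k, 's \<Rightarrow> 's) module" where
  "corner_End S f =
    \<lparr>carrier = {\<phi> \<in> left_part S f \<rightarrow>\<^sub>E left_part S f.
       (\<forall>x\<in>left_part S f. \<forall>y\<in>left_part S f. \<phi> (x \<oplus>\<^bsub>S\<^esub> y) = \<phi> x \<oplus>\<^bsub>S\<^esub> \<phi> y) \<and>
       (\<forall>x\<in>left_part S f. \<forall>c\<in>corner S f. \<phi> (x \<otimes>\<^bsub>S\<^esub> c) = \<phi> x \<otimes>\<^bsub>S\<^esub> c)},
     monoid.mult = (\<lambda>\<phi> \<psi>. \<lambda>x\<in>left_part S f. \<phi> (\<psi> x)),
     one = (\<lambda>x\<in>left_part S f. x),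
     zero = (\<lambda>x\<in>left_part S f. \<zero>\<^bsub>S\<^esub>),
     add = (\<lambda>\<phi> \<psi>. \<lambda>x\<in>left_part S f. \<phi> x \<oplus>\<^bsub>S\<^esub> \<psi> x),
     Module.module.smult = (\<lambda>a \<phi>. \<lambda>x\<in>left_part S f. a \<odot>\<^bsub>S\<^esub> \<phi> x)\<rparr>"

definition double_centralizer_idempotent :: "('k, 's) module \<Rightarrow> 's \<Rightarrow> bool" where
  "double_centralizer_idempotent S f \<longleftrightarrow>
     f \<in> carrier S \<and> f \<otimes>\<^bsub>S\<^esub> f = f \<and>
     (\<lambda>s. \<lambda>x\<in>left_part S f. s \<otimes>\<^bsub>S\<^esub> x) \<in> alg_iso S (corner_End S f)"


section \<open>Superalgebras and unital good pairs\<close>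

text \<open>
  The class intersection \<open>{ring, monoid_mult}\<close> is used instead of \<open>ring_1\<close> because the latter
  excludes the zero algebra.
\<close>

locale superalgebra = Modules.module scale
  for scale :: "'k::comm_ring_1 \<Rightarrow> 'a::{ring,monoid_mult} \<Rightarrow> 'a" (infixr \<open>*s\<close> 75) +
  fixes A :: "bit \<Rightarrow> 'a set"
  assumes scale_mult_left: "c *s (x * y) = (c *s x) * y"
    and scale_mult_right: "c *s (x * y) = x * (c *s y)"
    and subspace_A: "subspace (A p)"
    and A_inter: "A 0 \<inter> A 1 = {0}"
    and A_sum: "\<exists>y\<in>A 0. \<exists>z\<in>A 1. x = y + z"
    and A_mult: "x \<in> A p \<Longrightarrow> y \<in> A q \<Longrightarrow> x * y \<in> A (p + q)"

definition is_basis ::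
    "('k::comm_ring_1 \<Rightarrow> 'a::ab_group_add \<Rightarrow> 'a) \<Rightarrow> 'a set \<Rightarrow> 'a set \<Rightarrow> bool" where
  "is_basis scale Y V \<longleftrightarrow> \<not> Modules.module.dependent scale Y \<and> Modules.module.span scale Y = V"

definition free_submodule ::
    "('k::comm_ring_1 \<Rightarrow> 'a::ab_group_add \<Rightarrow> 'a) \<Rightarrow> 'a set \<Rightarrow> bool" where
  "free_submodule scale V \<longleftrightarrow> (\<exists>Y. is_basis scale Y V)"

text \<open>
  The quotient of the whole module by the submodule \<open>W\<close> is free: for some set \<open>Y\<close> of
  representatives, every coset is a linear combination of the cosets \<open>x + W\<close>, \<open>x \<in> Y\<close>, in
  exactly one way.
\<close>

definition free_quotient ::
    "('k::comm_ring_1 \<Rightarrow> 'a::ab_group_add \<Rightarrow> 'a) \<Rightarrow> 'a set \<Rightarrow> bool" where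
  "free_quotient scale W \<longleftrightarrow>
     (\<exists>Y. \<forall>v. \<exists>!c :: 'a \<Rightarrow>\<^sub>0 'k.
        Poly_Mapping.keys c \<subseteq> Y \<and> v - (\<Sum>x\<in>Poly_Mapping.keys c. scale (Poly_Mapping.lookup c x) x) \<in> W)"

locale unital_good_pair = superalgebra scale A
  for scale :: "'k::comm_ring_1 \<Rightarrow> 'a::{ring,monoid_mult} \<Rightarrow> 'a" (infixr \<open>*s\<close> 75)
    and A :: "bit \<Rightarrow> 'a set" +
  fixes \<aa> :: "'a set"
  assumes free_even: "free_submodule scale (A 0)"
    and free_odd: "free_submodule scale (A 1)"
    and subspace_\<aa>: "subspace \<aa>"
    and \<aa>_even: "\<aa> \<subseteq> A 0"
    and \<aa>_one: "1 \<in> \<aa>"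
    and \<aa>_mult: "x \<in> \<aa> \<Longrightarrow> y \<in> \<aa> \<Longrightarrow> x * y \<in> \<aa>"
    and free_\<aa>: "free_submodule scale \<aa>"
    and free_quotient_\<aa>: "free_quotient scale \<aa>"

locale good_pair_basis = unital_good_pair scale A \<aa>
  for scale :: "'k::comm_ring_1 \<Rightarrow> 'a::{ring,monoid_mult} \<Rightarrow> 'a" (infixr \<open>*s\<close> 75)
    and A :: "bit \<Rightarrow> 'a set" and \<aa> :: "'a set" +
  fixes \<cc> B\<^sub>\<aa> B\<^sub>\<cc> B\<^sub>1 :: "'a set"
  assumes subspace_\<cc>: "subspace \<cc>"
    and \<cc>_even: "\<cc> \<subseteq> A 0"
    and \<aa>_inter_\<cc>: "\<aa> \<inter> \<cc> = {0}"
    and \<aa>_plus_\<cc>: "x \<in> A 0 \<Longrightarrow> \<exists>y\<in>\<aa>. \<exists>z\<in>\<cc>. x = y + z"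
    and basis_\<aa>: "is_basis scale B\<^sub>\<aa> \<aa>"
    and basis_\<cc>: "is_basis scale B\<^sub>\<cc> \<cc>"
    and basis_odd: "is_basis scale B\<^sub>1 (A 1)"

definition finite_rank :: "('k::comm_ring_1 \<Rightarrow> 'a::ab_group_add \<Rightarrow> 'a) \<Rightarrow> bool" where
  "finite_rank scale \<longleftrightarrow> (\<exists>Y. finite Y \<and> is_basis scale Y UNIV)"

definition type_alg ::
    "('k \<Rightarrow> 'a::{ring,monoid_mult} \<Rightarrow> 'a) \<Rightarrow> ('k, 'a) module" where
  "type_alg scale =
    \<lparr>carrier = UNIV, monoid.mult = (*), one = 1, zero = 0, add = (+), Module.module.smult = scale\<rparr>"


section \<open>Quotients of free modules\<close>

text \<open>
  The free module on a set is modelled by finitely supported functions; \<open>Poly_Mapping.single x 1\<close>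
  is the generator \<open>x\<close>.
\<close>

definition free_smult :: "'r::comm_ring_1 \<Rightarrow> ('x \<Rightarrow>\<^sub>0 'r) \<Rightarrow> ('x \<Rightarrow>\<^sub>0 'r)" where
  "free_smult c p = Poly_Mapping.map ((*) c) p"

definition free_extend ::
    "('x \<Rightarrow> ('y \<Rightarrow>\<^sub>0 'r::comm_ring_1)) \<Rightarrow> ('x \<Rightarrow>\<^sub>0 'r) \<Rightarrow> ('y \<Rightarrow>\<^sub>0 'r)" where
  "free_extend g p = (\<Sum>x\<in>Poly_Mapping.keys p. free_smult (Poly_Mapping.lookup p x) (g x))"

definition free_extend2 ::
    "('x \<Rightarrow> 'x \<Rightarrow> ('y \<Rightarrow>\<^sub>0 'r::comm_ring_1)) \<Rightarrow> ('x \<Rightarrow>\<^sub>0 'r) \<Rightarrow> ('x \<Rightarrow>\<^sub>0 'r) \<Rightarrow> ('y \<Rightarrow>\<^sub>0 'r)" where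
  "free_extend2 g p q = free_extend (\<lambda>x. free_extend (g x) q) p"

text \<open>
  \<open>FactRing\<close> together with the induced scalar multiplication.  It is only applied when the
  operations of \<open>F\<close> are compatible with \<open>N\<close>; the ring laws need only hold modulo \<open>N\<close>.
\<close>

definition quot_alg :: "('k, 'x) module \<Rightarrow> 'x set \<Rightarrow> ('k, 'x set) module" where
  "quot_alg F N =
    \<lparr>carrier = a_rcosets\<^bsub>F\<^esub> N, monoid.mult = rcoset_mult F N, one = N +>\<^bsub>F\<^esub> \<one>\<^bsub>F\<^esub>, zero = N,
     add = set_add F, Module.module.smult = (\<lambda>a U. \<Union>u\<in>U. N +>\<^bsub>F\<^esub> (a \<odot>\<^bsub>F\<^esub> u))\<rparr>"

inductive_set lin_span :: "('k, 's) module \<Rightarrow> 's set \<Rightarrow> 's set"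
  for S :: "('k, 's) module" and Y :: "'s set" where
  zero: "\<zero>\<^bsub>S\<^esub> \<in> lin_span S Y"
| incl: "x \<in> Y \<Longrightarrow> x \<in> lin_span S Y"
| add: "u \<in> lin_span S Y \<Longrightarrow> v \<in> lin_span S Y \<Longrightarrow> u \<oplus>\<^bsub>S\<^esub> v \<in> lin_span S Y"
| smult: "u \<in> lin_span S Y \<Longrightarrow> a \<odot>\<^bsub>S\<^esub> u \<in> lin_span S Y"


section \<open>Tensor powers of superalgebras\<close>

text \<open>
  \<open>M\<close> is an algebra with homogeneous parts \<open>G 0\<close> and \<open>G 1\<close>.  The \<open>d\<close>-th tensor power is the free
  module on the words of length \<open>d\<close> over \<open>M\<close> modulo multilinearity.
\<close>

definition hcomp :: "('k, 'm) module \<Rightarrow> (bit \<Rightarrow> 'm set) \<Rightarrow> bit \<Rightarrow> 'm \<Rightarrow> 'm" where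
  "hcomp M G p x = (THE y. y \<in> G p \<and> (\<exists>z\<in>G (p + 1). x = y \<oplus>\<^bsub>M\<^esub> z))"

definition hcomps :: "('k, 'm) module \<Rightarrow> (bit \<Rightarrow> 'm set) \<Rightarrow> bit list \<Rightarrow> 'm list \<Rightarrow> 'm list" where
  "hcomps M G ps w = map2 (hcomp M G) ps w"

definition bit_sign :: "bit \<Rightarrow> 'k::comm_ring_1" where
  "bit_sign p = (if p = 1 then - 1 else 1)"

definition words :: "'m set \<Rightarrow> nat \<Rightarrow> 'm list set" where
  "words Y d = {w. length w = d \<and> set w \<subseteq> Y}"

definition tensor_rels :: "('k::comm_ring_1, 'm) module \<Rightarrow> nat \<Rightarrow> ('m list \<Rightarrow>\<^sub>0 'k) set" where
  "tensor_rels M d = Modules.module.span free_smult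
    ({Poly_Mapping.single (u @ [x \<oplus>\<^bsub>M\<^esub> y] @ v) 1 - Poly_Mapping.single (u @ [x] @ v) 1 - Poly_Mapping.single (u @ [y] @ v) 1 | u x y v.
        u @ [x] @ v \<in> words (carrier M) d \<and> y \<in> carrier M} \<union>
     {Poly_Mapping.single (u @ [a \<odot>\<^bsub>M\<^esub> x] @ v) 1 - Poly_Mapping.single (u @ [x] @ v) a | u a x v.
        u @ [x] @ v \<in> words (carrier M) d})"

text \<open>
  Iterating \<open>(x \<otimes> y) (z \<otimes> w) = (-1)\<^bsup>|y||z|\<^esup> xz \<otimes> yw\<close> gives, for words of homogeneous elements of
  parities \<open>ps\<close> and \<open>qs\<close>, the sign with exponent \<open>\<Sum>\<^bsub>l<k\<^esub> ps\<^sub>k qs\<^sub>l\<close> (computed in \<open>\<int>/2\<close>).  On arbitrary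
  words the product is obtained by splitting every letter into homogeneous components.
\<close>

definition tensor_sign :: "bit list \<Rightarrow> bit list \<Rightarrow> 'k::comm_ring_1" where
  "tensor_sign ps qs = bit_sign (\<Sum>k<length ps. \<Sum>l<k. ps ! k * qs ! l)"

definition word_mult :: "('k::comm_ring_1, 'm) module \<Rightarrow> (bit \<Rightarrow> 'm set) \<Rightarrow> nat \<Rightarrow>
    'm list \<Rightarrow> 'm list \<Rightarrow> ('m list \<Rightarrow>\<^sub>0 'k)" where
  "word_mult M G d v w =
    (\<Sum>ps\<in>words UNIV d. \<Sum>qs\<in>words UNIV d.
       Poly_Mapping.single (map2 (monoid.mult M) (hcomps M G ps v) (hcomps M G qs w)) (tensor_sign ps qs))"

definition free_words :: "('k::comm_ring_1, 'm) module \<Rightarrow> (bit \<Rightarrow> 'm set) \<Rightarrow> nat \<Rightarrow>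
    ('k, 'm list \<Rightarrow>\<^sub>0 'k) module" where
  "free_words M G d =
    \<lparr>carrier = {p. Poly_Mapping.keys p \<subseteq> words (carrier M) d},
     monoid.mult = free_extend2 (word_mult M G d),
     one = Poly_Mapping.single (replicate d \<one>\<^bsub>M\<^esub>) 1,
     zero = 0, add = (+), Module.module.smult = free_smult\<rparr>"

definition tensor_power :: "('k::comm_ring_1, 'm) module \<Rightarrow> (bit \<Rightarrow> 'm set) \<Rightarrow> nat \<Rightarrow>
    ('k, ('m list \<Rightarrow>\<^sub>0 'k) set) module" where
  "tensor_power M G d = quot_alg (free_words M G d) (tensor_rels M d)"

definition pure_tensor :: "('k::comm_ring_1, 'm) module \<Rightarrow> (bit \<Rightarrow> 'm set) \<Rightarrow>
    'm list \<Rightarrow> ('m list \<Rightarrow>\<^sub>0 'k) set" where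
  "pure_tensor M G w =
    tensor_rels M (length w) +>\<^bsub>free_words M G (length w)\<^esub> Poly_Mapping.single w 1"

text \<open>
  The right action of permutations.  Positions are \<open>0, \<dots>, d - 1\<close>, and \<open>permute_list \<sigma> w\<close> has the
  letter \<open>w ! \<sigma> i\<close> at position \<open>i\<close>.
\<close>

definition perm_sign :: "(nat \<Rightarrow> nat) \<Rightarrow> bit list \<Rightarrow> 'k::comm_ring_1" where
  "perm_sign \<sigma> ps = (- 1) ^ card {(k, l). k < l \<and> l < length ps \<and> inv_into UNIV \<sigma> k > inv_into UNIV \<sigma> l \<and>
     ps ! k = 1 \<and> ps ! l = 1}"

definition word_act :: "('k::comm_ring_1, 'm) module \<Rightarrow> (bit \<Rightarrow> 'm set) \<Rightarrow> nat \<Rightarrow>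
    (nat \<Rightarrow> nat) \<Rightarrow> 'm list \<Rightarrow> ('m list \<Rightarrow>\<^sub>0 'k)" where
  "word_act M G d \<sigma> w =
    (\<Sum>ps\<in>words UNIV d. Poly_Mapping.single (permute_list \<sigma> (hcomps M G ps w)) (perm_sign \<sigma> ps))"

definition tensor_act :: "('k::comm_ring_1, 'm) module \<Rightarrow> (bit \<Rightarrow> 'm set) \<Rightarrow> nat \<Rightarrow>
    (nat \<Rightarrow> nat) \<Rightarrow> ('m list \<Rightarrow>\<^sub>0 'k) set \<Rightarrow> ('m list \<Rightarrow>\<^sub>0 'k) set" where
  "tensor_act M G d \<sigma> U =
    (\<Union>u\<in>U. tensor_rels M d +>\<^bsub>free_words M G d\<^esub> free_extend (word_act M G d \<sigma>) u)"

definition tensor_invariants :: "('k::comm_ring_1, 'm) module \<Rightarrow> (bit \<Rightarrow> 'm set) \<Rightarrow> nat \<Rightarrow>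
    ('k, ('m list \<Rightarrow>\<^sub>0 'k) set) module" where
  "tensor_invariants M G d = (tensor_power M G d)
    \<lparr>carrier := {t \<in> carrier (tensor_power M G d).
       \<forall>\<sigma>. \<sigma> permutes {..<d} \<longrightarrow> tensor_act M G d \<sigma> t = t}\<rparr>"


section \<open>Generalized Schur algebras\<close>

text \<open>Matrix indices range over \<open>{0..<n}\<close>, as usual for the type \<open>'a mat\<close>.\<close>

definition mat_alg :: "('k \<Rightarrow> 'a::{ring,monoid_mult} \<Rightarrow> 'a) \<Rightarrow> nat \<Rightarrow> ('k, 'a mat) module" where
  "mat_alg scale n =
    \<lparr>carrier = carrier_mat n n, monoid.mult = (*), one = 1\<^sub>m n, zero = 0\<^sub>m n n, add = (+),
     Module.module.smult = (\<lambda>c. map_mat (scale c))\<rparr>"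

definition mat_gr :: "(bit \<Rightarrow> 'a set) \<Rightarrow> nat \<Rightarrow> bit \<Rightarrow> 'a mat set" where
  "mat_gr A n p = {m \<in> carrier_mat n n. \<forall>i<n. \<forall>j<n. m $$ (i, j) \<in> A p}"

definition \<xi>_unit :: "nat \<Rightarrow> 'a::zero \<Rightarrow> nat \<Rightarrow> nat \<Rightarrow> 'a mat" where
  "\<xi>_unit n a r s = mat n n (\<lambda>(i, j). if i = r \<and> j = s then a else 0)"

definition schur_alg :: "('k::comm_ring_1 \<Rightarrow> 'a::{ring,monoid_mult} \<Rightarrow> 'a) \<Rightarrow>
    (bit \<Rightarrow> 'a set) \<Rightarrow> nat \<Rightarrow> nat \<Rightarrow> ('k, ('a mat list \<Rightarrow>\<^sub>0 'k) set) module" where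
  "schur_alg scale A n d = tensor_invariants (mat_alg scale n) (mat_gr A n) d"

definition E_idem :: "('k \<Rightarrow> 'a::{ring,monoid_mult} \<Rightarrow> 'a) \<Rightarrow> nat \<Rightarrow> 'a \<Rightarrow> 'a mat" where
  "E_idem scale n e = (\<Oplus>\<^bsub>mat_alg scale n\<^esub>r\<in>{..<n}. \<xi>_unit n e r r)"

definition \<xi>_idem :: "('k::comm_ring_1 \<Rightarrow> 'a::{ring,monoid_mult} \<Rightarrow> 'a) \<Rightarrow>
    (bit \<Rightarrow> 'a set) \<Rightarrow> nat \<Rightarrow> nat \<Rightarrow> 'a \<Rightarrow> ('a mat list \<Rightarrow>\<^sub>0 'k) set" where
  "\<xi>_idem scale A n d e =
     pure_tensor (mat_alg scale n) (mat_gr A n) (replicate d (E_idem scale n e))"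

type_synonym 'a triple = "'a list \<times> nat list \<times> nat list"

definition Tri :: "(bit \<Rightarrow> 'a set) \<Rightarrow> 'a set \<Rightarrow> nat \<Rightarrow> nat \<Rightarrow> 'a triple set" where
  "Tri A B n d = {(bs, rs, ss).
     bs \<in> words B d \<and> rs \<in> words {..<n} d \<and> ss \<in> words {..<n} d \<and>
     (\<forall>k<d. \<forall>l<d. k \<noteq> l \<and> (bs ! k, rs ! k, ss ! k) = (bs ! l, rs ! l, ss ! l) \<longrightarrow> bs ! k \<in> A 0)}"

definition triple_act :: "(nat \<Rightarrow> nat) \<Rightarrow> 'a triple \<Rightarrow> 'a triple" where
  "triple_act \<sigma> = (\<lambda>(bs, rs, ss). (permute_list \<sigma> bs, permute_list \<sigma> rs, permute_list \<sigma> ss))"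

definition triple_stab :: "nat \<Rightarrow> 'a triple \<Rightarrow> (nat \<Rightarrow> nat) set" where
  "triple_stab d t = {\<sigma>. \<sigma> permutes {..<d} \<and> triple_act \<sigma> t = t}"

text \<open>
  For the right action the product \<open>\<sigma>\<tau>\<close> is \<open>\<sigma> \<circ> \<tau>\<close>, so \<open>{\<tau> \<circ> \<sigma> | \<tau> \<in> stabilizer}\<close> are
  the relevant cosets.
\<close>

definition stab_cosets :: "nat \<Rightarrow> 'a triple \<Rightarrow> (nat \<Rightarrow> nat) set set" where
  "stab_cosets d t = (\<lambda>\<sigma>. (\<lambda>\<tau>. \<tau> \<circ> \<sigma>) ` triple_stab d t) ` {\<sigma>. \<sigma> permutes {..<d}}"

definition triple_word :: "nat \<Rightarrow> 'a::zero triple \<Rightarrow> 'a mat list" where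
  "triple_word n = (\<lambda>(bs, rs, ss).
     map (\<lambda>k. \<xi>_unit n (bs ! k) (rs ! k) (ss ! k)) [0..<length bs])"

definition \<xi>_elem :: "('k::comm_ring_1 \<Rightarrow> 'a::{ring,monoid_mult} \<Rightarrow> 'a) \<Rightarrow>
    (bit \<Rightarrow> 'a set) \<Rightarrow> nat \<Rightarrow> nat \<Rightarrow> 'a triple \<Rightarrow> ('a mat list \<Rightarrow>\<^sub>0 'k) set" where
  "\<xi>_elem scale A n d t =
    (\<Oplus>\<^bsub>tensor_power (mat_alg scale n) (mat_gr A n) d\<^esub>C\<in>stab_cosets d t.
       tensor_act (mat_alg scale n) (mat_gr A n) d (SOME \<sigma>. \<sigma> \<in> C)
         (pure_tensor (mat_alg scale n) (mat_gr A n) (triple_word n t)))"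

definition triple_count :: "'a triple \<Rightarrow> 'a \<Rightarrow> nat \<Rightarrow> nat \<Rightarrow> nat" where
  "triple_count = (\<lambda>(bs, rs, ss) b r s.
     card {k. k < length bs \<and> (bs ! k, rs ! k, ss ! k) = (b, r, s)})"

text \<open>Meaningful for finite \<open>B\<^sub>\<cc>\<close> only, as a product over an infinite set is \<open>1\<close>.\<close>

definition triple_fact :: "'a set \<Rightarrow> nat \<Rightarrow> 'a triple \<Rightarrow> nat" where
  "triple_fact B\<^sub>\<cc> n t = (\<Prod>b\<in>B\<^sub>\<cc>. \<Prod>r<n. \<Prod>s<n. fact (triple_count t b r s))"

definition \<eta>_elem :: "('k::comm_ring_1 \<Rightarrow> 'a::{ring,monoid_mult} \<Rightarrow> 'a) \<Rightarrow>
    (bit \<Rightarrow> 'a set) \<Rightarrow> 'a set \<Rightarrow> nat \<Rightarrow> nat \<Rightarrow> 'a triple \<Rightarrow> ('a mat list \<Rightarrow>\<^sub>0 'k) set" where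
  "\<eta>_elem scale A B\<^sub>\<cc> n d t =
     of_nat (triple_fact B\<^sub>\<cc> n t) \<odot>\<^bsub>schur_alg scale A n d\<^esub> \<xi>_elem scale A n d t"

definition T_alg :: "('k::comm_ring_1 \<Rightarrow> 'a::{ring,monoid_mult} \<Rightarrow> 'a) \<Rightarrow>
    (bit \<Rightarrow> 'a set) \<Rightarrow> 'a set \<Rightarrow> 'a set \<Rightarrow> 'a set \<Rightarrow> nat \<Rightarrow> nat \<Rightarrow>
    ('k, ('a mat list \<Rightarrow>\<^sub>0 'k) set) module" where
  "T_alg scale A B\<^sub>\<aa> B\<^sub>\<cc> B\<^sub>1 n d = (schur_alg scale A n d)
    \<lparr>carrier := lin_span (schur_alg scale A n d)
       (\<eta>_elem scale A B\<^sub>\<cc> n d ` Tri A (B\<^sub>\<aa> \<union> B\<^sub>\<cc> \<union> B\<^sub>1) n d)\<rparr>"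


section \<open>Extension of scalars to the field of fractions\<close>

text \<open>
  \<open>S \<otimes> K\<close> for the field of fractions \<open>K\<close> is the free module over the ground ring on
  \<open>S \<times> K\<close> modulo bilinearity, with \<open>(s \<otimes> x) (t \<otimes> y) = st \<otimes> xy\<close> and with \<open>K\<close> acting on
  the second factor.
\<close>

definition ext_rels :: "('k::idom, 's) module \<Rightarrow> ('s \<times> 'k fract \<Rightarrow>\<^sub>0 'k) set" where
  "ext_rels S = Modules.module.span free_smult
    ({Poly_Mapping.single (s \<oplus>\<^bsub>S\<^esub> t, x) 1 - Poly_Mapping.single (s, x) 1 - Poly_Mapping.single (t, x) 1 | s t x.
        s \<in> carrier S \<and> t \<in> carrier S} \<union>
     {Poly_Mapping.single (s, x + y) 1 - Poly_Mapping.single (s, x) 1 - Poly_Mapping.single (s, y) 1 | s x y. s \<in> carrier S} \<union>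
     {Poly_Mapping.single (a \<odot>\<^bsub>S\<^esub> s, x) 1 - Poly_Mapping.single (s, x) a | a s x. s \<in> carrier S} \<union>
     {Poly_Mapping.single (s, Fract a 1 * x) 1 - Poly_Mapping.single (s, x) a | a s x. s \<in> carrier S})"

definition ext_free :: "('k::idom, 's) module \<Rightarrow>
    ('k fract, 's \<times> 'k fract \<Rightarrow>\<^sub>0 'k) module" where
  "ext_free S =
    \<lparr>carrier = {p. Poly_Mapping.keys p \<subseteq> carrier S \<times> UNIV},
     monoid.mult = free_extend2 (\<lambda>(s, x) (t, y). Poly_Mapping.single (s \<otimes>\<^bsub>S\<^esub> t, x * y) 1),
     one = Poly_Mapping.single (\<one>\<^bsub>S\<^esub>, 1) 1,
     zero = 0, add = (+),
     Module.module.smult = (\<lambda>c. free_extend (\<lambda>(s, x). Poly_Mapping.single (s, c * x) 1))\<rparr>"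

definition scalar_ext :: "('k::idom, 's) module \<Rightarrow>
    ('k fract, ('s \<times> 'k fract \<Rightarrow>\<^sub>0 'k) set) module" where
  "scalar_ext S = quot_alg (ext_free S) (ext_rels S)"

definition ext_tensor :: "('k::idom, 's) module \<Rightarrow> 's \<Rightarrow> 'k fract \<Rightarrow>
    ('s \<times> 'k fract \<Rightarrow>\<^sub>0 'k) set" where
  "ext_tensor S s x = ext_rels S +>\<^bsub>ext_free S\<^esub> Poly_Mapping.single (s, x) 1"

text \<open>
  For a subalgebra of \<open>S\<close>, the map induced on scalar extensions by the inclusion into \<open>S\<close>,
  that is \<open>t \<otimes> x \<mapsto> t \<otimes> x\<close>.
\<close>

definition ext_incl :: "('k::idom, 's) module \<Rightarrow>
    ('s \<times> 'k fract \<Rightarrow>\<^sub>0 'k) set \<Rightarrow> ('s \<times> 'k fract \<Rightarrow>\<^sub>0 'k) set" where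
  "ext_incl S U = (\<Union>u\<in>U. ext_rels S +>\<^bsub>ext_free S\<^esub> u)"

end

(*
  The ring S = S^A(n,d) is the ring of symmetric group invariants of the tensor power of R = M_n(A).

  (1) If e is a double centralizer idempotent for A, then so is E^e for R.  (2) Over a principal
  ideal domain the double centralizer property is a linear condition: the map from R into the
  functionals describing left multiplication on R E^e is injective with saturated image, so it has
  a dual family of functionals, and tensor products of these show that the property passes to
  tensor powers.  The signs disappear after a twist because E^e is even.  (3) It passes to the
  invariants because d <= n: the idempotent w = E_11 e x ... x E_dd e lies below F = xi^e, is
  orthogonal to its nontrivial permutations, and generates F as a sum of a_t b_t with a_t in (-)w
  and b_t in w(-).  An endomorphism of S F therefore extends to one of the tensor power times F.
  (4) Since S is finitely generated, denominators of an endomorphism after scalar extension to the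
  field of fractions are bounded, so the property survives.  (5) In coordinates T consists of the
  invariants whose coordinate at a word w is divisible by the product of the factorials of the
  multiplicities in w of letters from B_c; a nonzero scalar multiplies S into T, and so both have
  the same scalar extension.
*)

theory Submission
  imports Defs "HOL-Library.Function_Algebras" "HOL-Combinatorics.Multiset_Permutations"
begin

section \<open>Algebras carried by subsets of a type, and transport of the double centralizer
  property to them\<close>

section \<open>Algebras on subsets of abelian groups\<close>

text \<open>The delicate point is to tensor the double centralizer property. With all tensor
  positions but one frozen, an endomorphism of a tensor power becomes a left multiplication in the
  remaining position; these left multiplications, one for each position and each choice of frozen
  letters, must be assembled into a single tensor. Over a field that is a fact about intersections
  of tensor products of subspaces; here it needs the left multiplications to form a direct summand
  of the matrices. Saturation comes from the property itself: if a nonzero multiple of a matrix is a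
  left multiplication, the matrix commutes with the corner and so is one as well. The twist works
  because input and output words determine the parity of the left factor, hence the sign. The bound
  on \<open>d\<close> supplies \<open>d\<close> different diagonal matrix units. The records of the
  statement are quotients of free modules for which no ring laws are at hand; each is identified
  through \<open>faithful_rep\<close> with an algebra of coordinate functions, and the arguments
  take place there.\<close>

locale calg =
  fixes C :: "'r::ab_group_add set" and mul :: "'r \<Rightarrow> 'r \<Rightarrow> 'r" (infixl \<open>\<star>\<close> 70)
    and u :: 'r and sm :: "'k \<Rightarrow> 'r \<Rightarrow> 'r"
  assumes zero_closed: "0 \<in> C"
    and add_closed: "x \<in> C \<Longrightarrow> y \<in> C \<Longrightarrow> x + y \<in> C"
    and uminus_closed: "x \<in> C \<Longrightarrow> - x \<in> C"
    and mul_closed: "x \<in> C \<Longrightarrow> y \<in> C \<Longrightarrow> x \<star> y \<in> C"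
    and one_closed: "u \<in> C"
    and sm_closed: "x \<in> C \<Longrightarrow> sm a x \<in> C"
    and assoc: "x \<in> C \<Longrightarrow> y \<in> C \<Longrightarrow> z \<in> C \<Longrightarrow> (x \<star> y) \<star> z = x \<star> (y \<star> z)"
    and distl: "x \<in> C \<Longrightarrow> y \<in> C \<Longrightarrow> z \<in> C \<Longrightarrow> (x + y) \<star> z = x \<star> z + y \<star> z"
    and distr: "x \<in> C \<Longrightarrow> y \<in> C \<Longrightarrow> z \<in> C \<Longrightarrow> z \<star> (x + y) = z \<star> x + z \<star> y"
    and one_l: "x \<in> C \<Longrightarrow> u \<star> x = x"
    and one_r: "x \<in> C \<Longrightarrow> x \<star> u = x"
    and sm_l: "x \<in> C \<Longrightarrow> y \<in> C \<Longrightarrow> sm a x \<star> y = sm a (x \<star> y)"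
    and sm_r: "x \<in> C \<Longrightarrow> y \<in> C \<Longrightarrow> x \<star> sm a y = sm a (x \<star> y)"
begin

lemma diff_closed: "x \<in> C \<Longrightarrow> y \<in> C \<Longrightarrow> x - y \<in> C"
  using add_closed[of x "- y"] uminus_closed[of y] by simp

lemma zero_l: "x \<in> C \<Longrightarrow> 0 \<star> x = 0"
  using distl[of 0 0 x] zero_closed by simp

lemma zero_r: "x \<in> C \<Longrightarrow> x \<star> 0 = 0"
  using distr[of 0 0 x] zero_closed by simp

lemma diff_l: "x \<in> C \<Longrightarrow> y \<in> C \<Longrightarrow> z \<in> C \<Longrightarrow> (x - y) \<star> z = x \<star> z - y \<star> z"
  using distl[of "x - y" y z] diff_closed[of x y] by (simp add: algebra_simps)

lemma sum_closed: "(\<And>i. i \<in> J \<Longrightarrow> g i \<in> C) \<Longrightarrow> sum g J \<in> C"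
  by (induction J rule: infinite_finite_induct) (auto simp: zero_closed add_closed)

lemma sum_l: "(\<And>i. i \<in> J \<Longrightarrow> g i \<in> C) \<Longrightarrow> x \<in> C \<Longrightarrow> sum g J \<star> x = (\<Sum>i\<in>J. g i \<star> x)"
  by (induction J rule: infinite_finite_induct) (auto simp: zero_l distl sum_closed)

lemma sum_r: "(\<And>i. i \<in> J \<Longrightarrow> g i \<in> C) \<Longrightarrow> x \<in> C \<Longrightarrow> x \<star> sum g J = (\<Sum>i\<in>J. x \<star> g i)"
  by (induction J rule: infinite_finite_induct) (auto simp: zero_r distr sum_closed)

end

definition sub_alg :: "'r::ab_group_add set \<Rightarrow> ('r \<Rightarrow> 'r \<Rightarrow> 'r) \<Rightarrow> 'r \<Rightarrow> ('k \<Rightarrow> 'r \<Rightarrow> 'r) \<Rightarrow> ('k, 'r) module" where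
  "sub_alg C mul u sm =
    \<lparr>carrier = C, monoid.mult = mul, one = u, zero = 0, add = (+), Module.module.smult = sm\<rparr>"

text \<open>Membership in \<open>alg_iso\<close> says nothing about closure of the source or about
  its zero, and the source is usually a record not known to be a ring, so both are demanded
  separately.\<close>

definition faithful_rep :: "('k, 's) module \<Rightarrow> ('s \<Rightarrow> 'r) \<Rightarrow> 'r::ab_group_add set \<Rightarrow>
    ('r \<Rightarrow> 'r \<Rightarrow> 'r) \<Rightarrow> 'r \<Rightarrow> ('k \<Rightarrow> 'r \<Rightarrow> 'r) \<Rightarrow> bool" where
  "faithful_rep S h C mul u sm \<longleftrightarrow>
     (\<forall>x\<in>carrier S. \<forall>y\<in>carrier S. x \<oplus>\<^bsub>S\<^esub> y \<in> carrier S \<and> x \<otimes>\<^bsub>S\<^esub> y \<in> carrier S) \<and>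
     (\<forall>a. \<forall>x\<in>carrier S. a \<odot>\<^bsub>S\<^esub> x \<in> carrier S) \<and> \<one>\<^bsub>S\<^esub> \<in> carrier S \<and> \<zero>\<^bsub>S\<^esub> \<in> carrier S \<and>
     h \<zero>\<^bsub>S\<^esub> = 0 \<and> h \<in> alg_iso S (sub_alg C mul u sm)"

lemma faithful_repD:
  assumes "faithful_rep S h C mul u sm"
  shows "x \<in> carrier S \<Longrightarrow> y \<in> carrier S \<Longrightarrow> x \<oplus>\<^bsub>S\<^esub> y \<in> carrier S"
    and "x \<in> carrier S \<Longrightarrow> y \<in> carrier S \<Longrightarrow> x \<otimes>\<^bsub>S\<^esub> y \<in> carrier S"
    and "x \<in> carrier S \<Longrightarrow> a \<odot>\<^bsub>S\<^esub> x \<in> carrier S" and "\<one>\<^bsub>S\<^esub> \<in> carrier S" and "\<zero>\<^bsub>S\<^esub> \<in> carrier S"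
    and "h \<zero>\<^bsub>S\<^esub> = 0" and "h \<one>\<^bsub>S\<^esub> = u"
    and "x \<in> carrier S \<Longrightarrow> y \<in> carrier S \<Longrightarrow> h (x \<oplus>\<^bsub>S\<^esub> y) = h x + h y"
    and "x \<in> carrier S \<Longrightarrow> y \<in> carrier S \<Longrightarrow> h (x \<otimes>\<^bsub>S\<^esub> y) = mul (h x) (h y)"
    and "x \<in> carrier S \<Longrightarrow> h (a \<odot>\<^bsub>S\<^esub> x) = sm a (h x)"
    and "bij_betw h (carrier S) C"
    and "x \<in> carrier S \<Longrightarrow> h x \<in> C"
  using assms unfolding faithful_rep_def alg_iso_def ring_iso_def Ring.ring_hom_def sub_alg_def by auto

lemma faithful_repI:
  assumes "\<And>x y. x \<in> carrier S \<Longrightarrow> y \<in> carrier S \<Longrightarrow> x \<oplus>\<^bsub>S\<^esub> y \<in> carrier S"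
    and "\<And>x y. x \<in> carrier S \<Longrightarrow> y \<in> carrier S \<Longrightarrow> x \<otimes>\<^bsub>S\<^esub> y \<in> carrier S"
    and "\<And>a x. x \<in> carrier S \<Longrightarrow> a \<odot>\<^bsub>S\<^esub> x \<in> carrier S" and "\<one>\<^bsub>S\<^esub> \<in> carrier S" and "\<zero>\<^bsub>S\<^esub> \<in> carrier S"
    and "h \<zero>\<^bsub>S\<^esub> = 0" and "h \<one>\<^bsub>S\<^esub> = u"
    and "\<And>x y. x \<in> carrier S \<Longrightarrow> y \<in> carrier S \<Longrightarrow> h (x \<oplus>\<^bsub>S\<^esub> y) = h x + h y"
    and "\<And>x y. x \<in> carrier S \<Longrightarrow> y \<in> carrier S \<Longrightarrow> h (x \<otimes>\<^bsub>S\<^esub> y) = mul (h x) (h y)"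
    and "\<And>a x. x \<in> carrier S \<Longrightarrow> h (a \<odot>\<^bsub>S\<^esub> x) = sm a (h x)"
    and "bij_betw h (carrier S) C"
  shows "faithful_rep S h C mul u sm"
  using assms unfolding faithful_rep_def alg_iso_def ring_iso_def Ring.ring_hom_def sub_alg_def
  by (auto simp: bij_betw_def)

text \<open>For an idempotent \<open>f\<close> the left ideal \<open>C f\<close> is the set of
  \<open>x\<close> with \<open>x f = x\<close>, and the corner consists of the \<open>c\<close>
  fixed from both sides; in this form no images have to be handled. The two clauses after
  idempotency are injectivity and surjectivity of the map to the endomorphism ring. The function
  \<open>\<phi>\<close> is total but constrained only on the left ideal.\<close>

definition dci :: "'r::ab_group_add set \<Rightarrow> ('r \<Rightarrow> 'r \<Rightarrow> 'r) \<Rightarrow> 'r \<Rightarrow> bool" where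
  "dci C mul f \<longleftrightarrow> f \<in> C \<and> mul f f = f \<and>
     (\<forall>s\<in>C. (\<forall>x\<in>C. mul s (mul x f) = 0) \<longrightarrow> s = 0) \<and>
     (\<forall>\<phi>. (\<forall>x\<in>C. mul x f = x \<longrightarrow> \<phi> x \<in> C \<and> mul (\<phi> x) f = \<phi> x) \<longrightarrow>
        (\<forall>x\<in>C. \<forall>y\<in>C. mul x f = x \<longrightarrow> mul y f = y \<longrightarrow> \<phi> (x + y) = \<phi> x + \<phi> y) \<longrightarrow>
        (\<forall>x\<in>C. \<forall>c\<in>C. mul x f = x \<longrightarrow> mul f c = c \<longrightarrow> mul c f = c \<longrightarrow> \<phi> (mul x c) = mul (\<phi> x) c) \<longrightarrow>
        (\<exists>s\<in>C. \<forall>x\<in>C. mul x f = x \<longrightarrow> \<phi> x = mul s x))"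

lemma dci_inj: "dci C mul f \<Longrightarrow> s \<in> C \<Longrightarrow> (\<And>x. x \<in> C \<Longrightarrow> mul s (mul x f) = 0) \<Longrightarrow> s = 0"
  unfolding dci_def by blast

lemma dci_surj:
  assumes "dci C mul f"
    and "\<And>x. x \<in> C \<Longrightarrow> mul x f = x \<Longrightarrow> \<phi> x \<in> C \<and> mul (\<phi> x) f = \<phi> x"
    and "\<And>x y. x \<in> C \<Longrightarrow> y \<in> C \<Longrightarrow> mul x f = x \<Longrightarrow> mul y f = y \<Longrightarrow> \<phi> (x + y) = \<phi> x + \<phi> y"
    and "\<And>x c. x \<in> C \<Longrightarrow> c \<in> C \<Longrightarrow> mul x f = x \<Longrightarrow> mul f c = c \<Longrightarrow> mul c f = c \<Longrightarrow>
           \<phi> (mul x c) = mul (\<phi> x) c"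
  obtains s where "s \<in> C" "\<And>x. x \<in> C \<Longrightarrow> mul x f = x \<Longrightarrow> \<phi> x = mul s x"
proof -
  have "\<exists>s\<in>C. \<forall>x\<in>C. mul x f = x \<longrightarrow> \<phi> x = mul s x"
    using assms(1)[unfolded dci_def, THEN conjunct2, THEN conjunct2, THEN conjunct2, rule_format, of \<phi>]
      assms(2-4) by simp
  then show thesis using that by blast
qed

lemma dciI:
  assumes "f \<in> C" "mul f f = f"
    and "\<And>s. s \<in> C \<Longrightarrow> (\<And>x. x \<in> C \<Longrightarrow> mul s (mul x f) = 0) \<Longrightarrow> s = 0"
    and "\<And>\<phi>. \<lbrakk>\<And>x. x \<in> C \<Longrightarrow> mul x f = x \<Longrightarrow> \<phi> x \<in> C \<and> mul (\<phi> x) f = \<phi> x;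
      \<And>x y. x \<in> C \<Longrightarrow> y \<in> C \<Longrightarrow> mul x f = x \<Longrightarrow> mul y f = y \<Longrightarrow> \<phi> (x + y) = \<phi> x + \<phi> y;
      \<And>x c. x \<in> C \<Longrightarrow> c \<in> C \<Longrightarrow> mul x f = x \<Longrightarrow> mul f c = c \<Longrightarrow> mul c f = c \<Longrightarrow>
           \<phi> (mul x c) = mul (\<phi> x) c\<rbrakk> \<Longrightarrow> \<exists>s\<in>C. \<forall>x\<in>C. mul x f = x \<longrightarrow> \<phi> x = mul s x"
  shows "dci C mul f"
  unfolding dci_def using assms(1,2) assms(3,4) by simp

text \<open>The property is invariant under isomorphism and can be tested after transport along
  \<open>h\<close>. The equivalence serves in both directions: to unpack the hypothesis on
  \<open>A\<close>, to move between models of the matrix algebra, and to conclude for the records of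
  the statement.\<close>

lemma (in calg) double_centralizer_iff_dci:
  assumes rep: "faithful_rep S h C (\<star>) u sm" and f: "f \<in> carrier S"
  shows "double_centralizer_idempotent S f \<longleftrightarrow> dci C (\<star>) (h f)"
proof -
  note R = faithful_repD[OF rep]
  have inj: "x \<in> carrier S \<Longrightarrow> y \<in> carrier S \<Longrightarrow> h x = h y \<longleftrightarrow> x = y" for x y
    using R(11) by (auto simp: bij_betw_def inj_on_def)
  define g where "g = inv_into (carrier S) h"
  have g: "g x \<in> carrier S" "h (g x) = x" if "x \<in> C" for x
    using R(11) that unfolding g_def
    by (auto simp: bij_betw_def inv_into_into f_inv_into_f)
  have gh: "g (h x) = x" if "x \<in> carrier S" for x
    using R(11) that unfolding g_def by (auto simp: bij_betw_def)
  note cl = R(1-5) R(12) add_closed mul_closed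
  note hs = R(6-10)
  have idem: "f \<otimes>\<^bsub>S\<^esub> f = f \<longleftrightarrow> h f \<star> h f = h f"
    by (subst inj[symmetric]) (auto simp: cl hs f)
  show ?thesis
  proof (cases "f \<otimes>\<^bsub>S\<^esub> f = f")
    case False
    then show ?thesis
      using idem unfolding double_centralizer_idempotent_def dci_def by auto
  next
    case ff: True
    then have hff: "h f \<star> h f = h f" using idem by simp
    let ?L = "left_part S f" and ?K = "corner S f"
    have L: "x \<in> ?L \<longleftrightarrow> x \<in> carrier S \<and> h x \<star> h f = h x" for x
    proof
      assume "x \<in> ?L"
      then obtain s where s: "s \<in> carrier S" "x = s \<otimes>\<^bsub>S\<^esub> f" by (auto simp: left_part_def)
      then show "x \<in> carrier S \<and> h x \<star> h f = h x"
        using f by (simp add: cl hs assoc hff)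
    next
      assume x: "x \<in> carrier S \<and> h x \<star> h f = h x"
      then have "x = x \<otimes>\<^bsub>S\<^esub> f" using f by (subst inj[symmetric]) (auto simp: cl hs)
      then show "x \<in> ?L" using x unfolding left_part_def by blast
    qed
    have K: "x \<in> ?K \<longleftrightarrow> x \<in> carrier S \<and> h f \<star> h x = h x \<and> h x \<star> h f = h x" for x
    proof
      assume "x \<in> ?K"
      then obtain s where s: "s \<in> carrier S" "x = f \<otimes>\<^bsub>S\<^esub> s \<otimes>\<^bsub>S\<^esub> f" by (auto simp: corner_def)
      have "h f \<star> (h f \<star> h s \<star> h f) = h f \<star> h f \<star> h s \<star> h f" using s f by (simp add: cl assoc)
      moreover have "h f \<star> h s \<star> h f \<star> h f = h f \<star> h s \<star> (h f \<star> h f)" using s f by (simp add: cl assoc)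
      ultimately show "x \<in> carrier S \<and> h f \<star> h x = h x \<and> h x \<star> h f = h x"
        using f s by (simp add: cl hs hff)
    next
      assume x: "x \<in> carrier S \<and> h f \<star> h x = h x \<and> h x \<star> h f = h x"
      then have "x = f \<otimes>\<^bsub>S\<^esub> x \<otimes>\<^bsub>S\<^esub> f" using f by (subst inj[symmetric]) (auto simp: cl hs)
      then show "x \<in> ?K" using x unfolding corner_def by blast
    qed
    let ?lam = "\<lambda>s. \<lambda>x\<in>?L. s \<otimes>\<^bsub>S\<^esub> x"
    have eqL: "restrict p ?L = restrict q ?L \<longleftrightarrow> (\<forall>x\<in>?L. p x = q x)" for p q :: "_ \<Rightarrow> _"
      by (auto simp: fun_eq_iff restrict_def) 
    have Lc: "s \<in> carrier S \<Longrightarrow> x \<in> ?L \<Longrightarrow> s \<otimes>\<^bsub>S\<^esub> x \<in> ?L" for s x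
      using f by (auto simp: L cl hs assoc)
    have Ladd: "x \<in> ?L \<Longrightarrow> y \<in> ?L \<Longrightarrow> x \<oplus>\<^bsub>S\<^esub> y \<in> ?L" for x y
      using f by (auto simp: L cl hs distl)
    have LK: "x \<in> ?L \<Longrightarrow> c \<in> ?K \<Longrightarrow> x \<otimes>\<^bsub>S\<^esub> c \<in> ?L" for x c
      using f by (auto simp: L K cl hs assoc)
    have lamc: "?lam s \<in> carrier (corner_End S f)" if s: "s \<in> carrier S" for s
    proof -
      have "s \<otimes>\<^bsub>S\<^esub> (x \<oplus>\<^bsub>S\<^esub> y) = s \<otimes>\<^bsub>S\<^esub> x \<oplus>\<^bsub>S\<^esub> s \<otimes>\<^bsub>S\<^esub> y" if "x \<in> ?L" "y \<in> ?L" for x y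
        using that s by (subst inj[symmetric]) (auto simp: L cl hs distr)
      moreover have "s \<otimes>\<^bsub>S\<^esub> (x \<otimes>\<^bsub>S\<^esub> c) = s \<otimes>\<^bsub>S\<^esub> x \<otimes>\<^bsub>S\<^esub> c" if "x \<in> ?L" "c \<in> ?K" for x c
        using that s by (subst inj[symmetric]) (auto simp: L K cl hs assoc)
      ultimately show ?thesis
        using Lc[OF s] Ladd LK by (auto simp: corner_End_def)
    qed
    have lamh: "?lam \<in> Ring.ring_hom S (corner_End S f)"
    proof (rule ring_hom_memI)
      fix x y assume x: "x \<in> carrier S" and y: "y \<in> carrier S"
      show "?lam (x \<otimes>\<^bsub>S\<^esub> y) = ?lam x \<otimes>\<^bsub>corner_End S f\<^esub> ?lam y"
        unfolding corner_End_def monoid.simps eqL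
      proof
        fix z assume z: "z \<in> ?L"
        have "x \<otimes>\<^bsub>S\<^esub> y \<otimes>\<^bsub>S\<^esub> z = x \<otimes>\<^bsub>S\<^esub> (y \<otimes>\<^bsub>S\<^esub> z)"
          using x y z by (subst inj[symmetric]) (auto simp: L cl hs assoc)
        then show "x \<otimes>\<^bsub>S\<^esub> y \<otimes>\<^bsub>S\<^esub> z = ?lam x (?lam y z)"
          using z Lc[OF y z] by simp
      qed
      show "?lam (x \<oplus>\<^bsub>S\<^esub> y) = ?lam x \<oplus>\<^bsub>corner_End S f\<^esub> ?lam y"
        unfolding corner_End_def ring.simps eqL
      proof
        fix z assume z: "z \<in> ?L"
        have "(x \<oplus>\<^bsub>S\<^esub> y) \<otimes>\<^bsub>S\<^esub> z = x \<otimes>\<^bsub>S\<^esub> z \<oplus>\<^bsub>S\<^esub> y \<otimes>\<^bsub>S\<^esub> z"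
          using x y z by (subst inj[symmetric]) (auto simp: L cl hs distl)
        then show "(x \<oplus>\<^bsub>S\<^esub> y) \<otimes>\<^bsub>S\<^esub> z = ?lam x z \<oplus>\<^bsub>S\<^esub> ?lam y z"
          using z by simp
      qed
    next
      show "?lam \<one>\<^bsub>S\<^esub> = \<one>\<^bsub>corner_End S f\<^esub>"
        unfolding corner_End_def monoid.simps eqL
      proof
        fix z assume z: "z \<in> ?L"
        then show "\<one>\<^bsub>S\<^esub> \<otimes>\<^bsub>S\<^esub> z = z"
          by (subst inj[symmetric]) (auto simp: L cl hs one_l)
      qed
    qed (use lamc in auto)
    have lams: "?lam (a \<odot>\<^bsub>S\<^esub> s) = a \<odot>\<^bsub>corner_End S f\<^esub> ?lam s" if s: "s \<in> carrier S" for a s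
      unfolding corner_End_def Module.module.simps eqL
    proof
      fix z assume z: "z \<in> ?L"
      have "(a \<odot>\<^bsub>S\<^esub> s) \<otimes>\<^bsub>S\<^esub> z = a \<odot>\<^bsub>S\<^esub> (s \<otimes>\<^bsub>S\<^esub> z)"
        using s z by (subst inj[symmetric]) (auto simp: L cl hs sm_l)
      then show "(a \<odot>\<^bsub>S\<^esub> s) \<otimes>\<^bsub>S\<^esub> z = a \<odot>\<^bsub>S\<^esub> ?lam s z"
        using z by simp
    qed
    have dc: "double_centralizer_idempotent S f \<longleftrightarrow> bij_betw ?lam (carrier S) (carrier (corner_End S f))"
      unfolding double_centralizer_idempotent_def alg_iso_def ring_iso_def
      using f ff lamh lams by auto
    have inj_iff: "inj_on ?lam (carrier S) \<longleftrightarrow> (\<forall>s\<in>C. (\<forall>x\<in>C. s \<star> (x \<star> h f) = 0) \<longrightarrow> s = 0)"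
    proof safe
      fix s assume i: "inj_on ?lam (carrier S)" and s: "s \<in> C" and z: "\<forall>x\<in>C. s \<star> (x \<star> h f) = 0"
      have "?lam (g s) = ?lam \<zero>\<^bsub>S\<^esub>"
        unfolding eqL
      proof
        fix x assume x: "x \<in> ?L"
        then have "s \<star> h x = 0" using z R(12) by (metis L)
        then show "g s \<otimes>\<^bsub>S\<^esub> x = \<zero>\<^bsub>S\<^esub> \<otimes>\<^bsub>S\<^esub> x"
          using s x by (subst inj[symmetric]) (auto simp: L cl hs g zero_l)
      qed
      then have "g s = \<zero>\<^bsub>S\<^esub>" using i g[OF s] cl by (auto simp: inj_on_def)
      then show "s = 0" using g[OF s] R(6) by simp
    next
      assume *: "\<forall>s\<in>C. (\<forall>x\<in>C. s \<star> (x \<star> h f) = 0) \<longrightarrow> s = 0"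
      show "inj_on ?lam (carrier S)"
      proof (rule inj_onI)
        fix s t assume s: "s \<in> carrier S" and t: "t \<in> carrier S" and e: "?lam s = ?lam t"
        have "(h s - h t) \<star> (x \<star> h f) = 0" if x: "x \<in> C" for x
        proof -
          have gx: "g x \<otimes>\<^bsub>S\<^esub> f \<in> ?L" unfolding left_part_def using g[OF x] by auto
          then have "s \<otimes>\<^bsub>S\<^esub> (g x \<otimes>\<^bsub>S\<^esub> f) = t \<otimes>\<^bsub>S\<^esub> (g x \<otimes>\<^bsub>S\<^esub> f)" using e unfolding eqL by blast
          then have "h s \<star> (x \<star> h f) = h t \<star> (x \<star> h f)"
            using s t g[OF x] f by (subst (asm) inj[symmetric]) (auto simp: cl hs)
          then show ?thesis using s t x f by (simp add: diff_l cl)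
        qed
        then have "h s - h t = 0" using *[rule_format, of "h s - h t"] s t by (simp add: diff_closed cl)
        then show "s = t" using inj[OF s t] by simp
      qed
    qed
    have surj_iff: "?lam ` carrier S = carrier (corner_End S f) \<longleftrightarrow>
      (\<forall>\<phi>. (\<forall>x\<in>C. x \<star> h f = x \<longrightarrow> \<phi> x \<in> C \<and> \<phi> x \<star> h f = \<phi> x) \<longrightarrow>
        (\<forall>x\<in>C. \<forall>y\<in>C. x \<star> h f = x \<longrightarrow> y \<star> h f = y \<longrightarrow> \<phi> (x + y) = \<phi> x + \<phi> y) \<longrightarrow>
        (\<forall>x\<in>C. \<forall>c\<in>C. x \<star> h f = x \<longrightarrow> h f \<star> c = c \<longrightarrow> c \<star> h f = c \<longrightarrow> \<phi> (x \<star> c) = \<phi> x \<star> c) \<longrightarrow>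
        (\<exists>s\<in>C. \<forall>x\<in>C. x \<star> h f = x \<longrightarrow> \<phi> x = s \<star> x))"
      (is "_ \<longleftrightarrow> ?R")
    proof
      assume e: "?lam ` carrier S = carrier (corner_End S f)"
      show ?R
      proof (intro allI impI)
        fix \<phi> :: "'r \<Rightarrow> 'r"
        assume 1: "\<forall>x\<in>C. x \<star> h f = x \<longrightarrow> \<phi> x \<in> C \<and> \<phi> x \<star> h f = \<phi> x"
          and 2: "\<forall>x\<in>C. \<forall>y\<in>C. x \<star> h f = x \<longrightarrow> y \<star> h f = y \<longrightarrow> \<phi> (x + y) = \<phi> x + \<phi> y"
          and 3: "\<forall>x\<in>C. \<forall>c\<in>C. x \<star> h f = x \<longrightarrow> h f \<star> c = c \<longrightarrow> c \<star> h f = c \<longrightarrow> \<phi> (x \<star> c) = \<phi> x \<star> c"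
        \<comment> \<open>This is \<open>\<phi>\<close> transported back through \<open>h\<close>;
          it is restricted because members of \<open>corner_End\<close> are extensional.\<close>
        let ?\<psi> = "\<lambda>x\<in>?L. g (\<phi> (h x))"
        have \<psi>L: "g (\<phi> (h x)) \<in> ?L" if "x \<in> ?L" for x
          using that 1 g R(12) by (auto simp: L)
        have \<phi>C: "\<phi> (h x) \<in> C" if "x \<in> ?L" for x
          using that 1 R(12) by (auto simp: L)
        have "?\<psi> \<in> carrier (corner_End S f)"
        proof -
          have "g (\<phi> (h (x \<oplus>\<^bsub>S\<^esub> y))) = g (\<phi> (h x)) \<oplus>\<^bsub>S\<^esub> g (\<phi> (h y))"
            if "x \<in> ?L" "y \<in> ?L" for x y
            using that \<psi>L[OF that(1)] \<psi>L[OF that(2)] \<psi>L[OF Ladd[OF that]] 2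
              \<phi>C[OF that(1)] \<phi>C[OF that(2)]
            by (subst inj[symmetric]) (auto simp: Ladd L cl hs g)
          moreover have "g (\<phi> (h (x \<otimes>\<^bsub>S\<^esub> c))) = g (\<phi> (h x)) \<otimes>\<^bsub>S\<^esub> c"
            if "x \<in> ?L" "c \<in> ?K" for x c
            using that \<psi>L[OF that(1)] \<psi>L[OF LK[OF that]] 3 \<phi>C[OF that(1)]
            by (subst inj[symmetric]) (auto simp: LK L K cl hs g)
          ultimately show ?thesis
            using \<psi>L Ladd LK by (auto simp: corner_End_def)
        qed
        then obtain s where s: "s \<in> carrier S" "?\<psi> = ?lam s" using e by blast
        show "\<exists>s\<in>C. \<forall>x\<in>C. x \<star> h f = x \<longrightarrow> \<phi> x = s \<star> x"
        proof (intro bexI ballI impI)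
          fix x assume x: "x \<in> C" "x \<star> h f = x"
          then have gx: "g x \<in> ?L" by (simp add: L g)
          then have "g (\<phi> x) = s \<otimes>\<^bsub>S\<^esub> g x" using s(2) x unfolding eqL by (force simp: g)
          then have "h (g (\<phi> x)) = h s \<star> x" using s x by (simp add: hs g)
          then show "\<phi> x = h s \<star> x" using \<phi>C[OF gx] x by (simp add: g)
        qed (use s in \<open>auto simp: cl\<close>)
      qed
    next
      assume r: ?R
      show "?lam ` carrier S = carrier (corner_End S f)"
      proof (rule equalityI)
        show "?lam ` carrier S \<subseteq> carrier (corner_End S f)" using lamc by auto
        show "carrier (corner_End S f) \<subseteq> ?lam ` carrier S"
        proof
          fix \<psi> assume \<psi>: "\<psi> \<in> carrier (corner_End S f)"
          then have \<psi>1: "\<psi> x \<in> ?L" if "x \<in> ?L" for x using that by (auto simp: corner_End_def)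
          have \<psi>2: "\<psi> (x \<oplus>\<^bsub>S\<^esub> y) = \<psi> x \<oplus>\<^bsub>S\<^esub> \<psi> y" if "x \<in> ?L" "y \<in> ?L" for x y
            using that \<psi> by (auto simp: corner_End_def)
          have \<psi>3: "\<psi> (x \<otimes>\<^bsub>S\<^esub> y) = \<psi> x \<otimes>\<^bsub>S\<^esub> y" if "x \<in> ?L" "y \<in> ?K" for x y
            using that \<psi> by (auto simp: corner_End_def)
          have \<psi>e: "\<psi> \<in> extensional ?L" using \<psi> by (auto simp: corner_End_def PiE_def)
          have gL: "g x \<in> ?L" if "x \<in> C" "x \<star> h f = x" for x using that by (simp add: L g)
          have gK: "g x \<in> ?K" if "x \<in> C" "x \<star> h f = x" "h f \<star> x = x" for x using that by (simp add: K g)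
          have gadd: "g (x + y) = g x \<oplus>\<^bsub>S\<^esub> g y" if "x \<in> C" "y \<in> C" for x y
            using that by (subst inj[symmetric]) (auto simp: g cl hs)
          have gmul: "g (x \<star> y) = g x \<otimes>\<^bsub>S\<^esub> g y" if "x \<in> C" "y \<in> C" for x y
            using that by (subst inj[symmetric]) (auto simp: g cl hs)
          have "\<exists>s\<in>C. \<forall>x\<in>C. x \<star> h f = x \<longrightarrow> h (\<psi> (g x)) = s \<star> x"
          proof (rule r[rule_format, of "\<lambda>x. h (\<psi> (g x))"])
            fix x assume x: "x \<in> C" "x \<star> h f = x"
            show "h (\<psi> (g x)) \<in> C \<and> h (\<psi> (g x)) \<star> h f = h (\<psi> (g x))"
              using \<psi>1[OF gL[OF x]] by (auto simp: L cl)
          next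
            fix x y assume x: "x \<in> C" "x \<star> h f = x" and y: "y \<in> C" "y \<star> h f = y"
            show "h (\<psi> (g (x + y))) = h (\<psi> (g x)) + h (\<psi> (g y))"
              using \<psi>2[OF gL[OF x] gL[OF y]] \<psi>1[OF gL[OF x]] \<psi>1[OF gL[OF y]] x y
              by (simp add: gadd hs L)
          next
            fix x y assume x: "x \<in> C" "x \<star> h f = x" and y: "y \<in> C" "y \<star> h f = y" "h f \<star> y = y"
            show "h (\<psi> (g (x \<star> y))) = h (\<psi> (g x)) \<star> y"
              using \<psi>3[OF gL[OF x] gK[OF y]] \<psi>1[OF gL[OF x]] x y
              by (simp add: gmul hs L g)
          qed
          then obtain s where s: "s \<in> C" "\<And>x. x \<in> C \<Longrightarrow> x \<star> h f = x \<Longrightarrow> h (\<psi> (g x)) = s \<star> x" by blast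
          have "\<psi> = ?lam (g s)"
          proof (rule extensionalityI[OF \<psi>e, of "?lam (g s)"])
            fix x assume x: "x \<in> ?L"
            then have "h (\<psi> x) = s \<star> h x" using s(2)[of "h x"] by (simp add: L cl gh)
            then show "\<psi> x = ?lam (g s) x"
              using x \<psi>1[OF x] s(1) by (subst inj[symmetric]) (auto simp: L cl hs g)
          qed simp
          then show "\<psi> \<in> ?lam ` carrier S" using g[OF s(1)] by blast
        qed
      qed
    qed
    show ?thesis
      unfolding dc bij_betw_def inj_iff surj_iff dci_def using hff f cl(6) by blast
  qed
qed

text \<open>The cosets of \<open>N\<close> are the fibres of \<open>\<theta>\<close>, so every
  operation of \<open>quot_alg\<close> gives a single coset whichever representatives are taken.
  Ring laws are not asked of \<open>F\<close>, only compatibility of its operations with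
  \<open>\<theta>\<close>. Both the tensor power and the scalar extension are identified in this
  way.\<close>

lemma faithful_rep_quot_alg:
  fixes F :: "('k, 'x::ab_group_add) module" and \<theta> :: "'x \<Rightarrow> 'r::ab_group_add"
  assumes add: "add F = (+)" and sub: "\<And>p q. p \<in> carrier F \<Longrightarrow> q \<in> carrier F \<Longrightarrow> p - q \<in> carrier F"
    and one: "\<one>\<^bsub>F\<^esub> \<in> carrier F" "\<theta> \<one>\<^bsub>F\<^esub> = u"
    and mult: "\<And>p q. p \<in> carrier F \<Longrightarrow> q \<in> carrier F \<Longrightarrow> p \<otimes>\<^bsub>F\<^esub> q \<in> carrier F"
    and smult: "\<And>a p. p \<in> carrier F \<Longrightarrow> a \<odot>\<^bsub>F\<^esub> p \<in> carrier F"
    and \<theta>_add: "\<And>p q. p \<in> carrier F \<Longrightarrow> q \<in> carrier F \<Longrightarrow> \<theta> (p + q) = \<theta> p + \<theta> q"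
    and \<theta>_mult: "\<And>p q. p \<in> carrier F \<Longrightarrow> q \<in> carrier F \<Longrightarrow> \<theta> (p \<otimes>\<^bsub>F\<^esub> q) = mul (\<theta> p) (\<theta> q)"
    and \<theta>_smult: "\<And>a p. p \<in> carrier F \<Longrightarrow> \<theta> (a \<odot>\<^bsub>F\<^esub> p) = sm a (\<theta> p)"
    and N: "N = {p \<in> carrier F. \<theta> p = 0}"
  defines "h \<equiv> \<lambda>U. \<theta> (SOME p. p \<in> U)"
  shows "faithful_rep (quot_alg F N) h (\<theta> ` carrier F) mul u sm"
    and "\<And>p. p \<in> carrier F \<Longrightarrow> h (N +>\<^bsub>F\<^esub> p) = \<theta> p"
    and "\<And>p. p \<in> carrier F \<Longrightarrow> N +>\<^bsub>F\<^esub> p = {q \<in> carrier F. \<theta> q = \<theta> p}"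
    and "carrier (quot_alg F N) = (\<lambda>p. N +>\<^bsub>F\<^esub> p) ` carrier F"
proof -
  have z: "0 \<in> carrier F" using sub[OF one(1) one(1)] by simp
  have pl: "p + q \<in> carrier F" if "p \<in> carrier F" "q \<in> carrier F" for p q
    using sub[OF that(1) sub[OF z that(2)]] by simp
  have \<theta>0: "\<theta> 0 = 0" using \<theta>_add[OF z z] by simp
  have \<theta>_diff: "\<theta> (p - q) = \<theta> p - \<theta> q" if "p \<in> carrier F" "q \<in> carrier F" for p q
    using \<theta>_add[OF sub[OF that] that(2)] by (simp add: algebra_simps)
  show coset: "N +>\<^bsub>F\<^esub> p = {q \<in> carrier F. \<theta> q = \<theta> p}" if p: "p \<in> carrier F" for p
  proof -
    have "q \<in> N +>\<^bsub>F\<^esub> p \<longleftrightarrow> q - p \<in> N" for q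
      unfolding a_r_coset_def r_coset_def by (force simp: add)
    moreover have "q \<in> carrier F" if "q - p \<in> carrier F" for q
      using pl[OF that p] by simp
    moreover have "q - p \<in> N \<longleftrightarrow> \<theta> q = \<theta> p" if "q \<in> carrier F" for q
      using \<theta>_diff[OF that p] sub[OF that p] by (simp add: N)
    ultimately show ?thesis unfolding N by blast
  qed
  show car: "carrier (quot_alg F N) = (\<lambda>p. N +>\<^bsub>F\<^esub> p) ` carrier F"
    unfolding quot_alg_def A_RCOSETS_def' by auto
  show hc: "h (N +>\<^bsub>F\<^esub> p) = \<theta> p" if p: "p \<in> carrier F" for p
  proof -
    have "(SOME q. q \<in> N +>\<^bsub>F\<^esub> p) \<in> N +>\<^bsub>F\<^esub> p" by (rule someI[of _ p]) (simp add: coset p)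
    then show ?thesis unfolding h_def using coset[OF p] by blast
  qed
  have eqc: "{q \<in> carrier F. \<theta> q = \<theta> p} = {q \<in> carrier F. \<theta> q = \<theta> p'}"
    if "\<theta> p = \<theta> p'" for p p' using that by simp
  have mulc: "(N +>\<^bsub>F\<^esub> p) \<otimes>\<^bsub>quot_alg F N\<^esub> (N +>\<^bsub>F\<^esub> q) = N +>\<^bsub>F\<^esub> (p \<otimes>\<^bsub>F\<^esub> q)"
    if "p \<in> carrier F" "q \<in> carrier F" for p q
  proof -
    have "N +>\<^bsub>F\<^esub> (p' \<otimes>\<^bsub>F\<^esub> q') = N +>\<^bsub>F\<^esub> (p \<otimes>\<^bsub>F\<^esub> q)" if "p' \<in> N +>\<^bsub>F\<^esub> p" "q' \<in> N +>\<^bsub>F\<^esub> q" for p' q'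
    proof -
      have "p' \<in> carrier F" "q' \<in> carrier F" "\<theta> p' = \<theta> p" "\<theta> q' = \<theta> q"
        using that \<open>p \<in> carrier F\<close> \<open>q \<in> carrier F\<close> by (auto simp: coset)
      then show ?thesis using \<open>p \<in> carrier F\<close> \<open>q \<in> carrier F\<close> by (simp add: coset mult \<theta>_mult)
    qed
    moreover have "p \<in> N +>\<^bsub>F\<^esub> p" "q \<in> N +>\<^bsub>F\<^esub> q" using that by (auto simp: coset)
    ultimately show ?thesis unfolding quot_alg_def rcoset_mult_def monoid.simps by blast
  qed
  have addc: "(N +>\<^bsub>F\<^esub> p) \<oplus>\<^bsub>quot_alg F N\<^esub> (N +>\<^bsub>F\<^esub> q) = N +>\<^bsub>F\<^esub> (p + q)"
    if "p \<in> carrier F" "q \<in> carrier F" for p q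
  proof -
    have "(N +>\<^bsub>F\<^esub> p) \<oplus>\<^bsub>quot_alg F N\<^esub> (N +>\<^bsub>F\<^esub> q) = {a + b |a b. a \<in> N +>\<^bsub>F\<^esub> p \<and> b \<in> N +>\<^bsub>F\<^esub> q}"
      unfolding quot_alg_def by (auto simp: set_add_def set_mult_def add)
    also have "\<dots> = N +>\<^bsub>F\<^esub> (p + q)"
    proof (intro equalityI subsetI)
      fix r assume "r \<in> N +>\<^bsub>F\<^esub> (p + q)"
      then have r: "r \<in> carrier F" "\<theta> r = \<theta> p + \<theta> q" using that by (auto simp: coset pl \<theta>_add)
      have "r = p + (r - p)" "p \<in> N +>\<^bsub>F\<^esub> p" "r - p \<in> N +>\<^bsub>F\<^esub> q"
        using r that by (auto simp: coset sub \<theta>_diff)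
      then show "r \<in> {a + b |a b. a \<in> N +>\<^bsub>F\<^esub> p \<and> b \<in> N +>\<^bsub>F\<^esub> q}" by blast
    qed (use that in \<open>auto simp: coset pl \<theta>_add\<close>)
    finally show ?thesis .
  qed
  have smc: "a \<odot>\<^bsub>quot_alg F N\<^esub> (N +>\<^bsub>F\<^esub> p) = N +>\<^bsub>F\<^esub> (a \<odot>\<^bsub>F\<^esub> p)"
    if "p \<in> carrier F" for a p
  proof -
    have "N +>\<^bsub>F\<^esub> (a \<odot>\<^bsub>F\<^esub> p') = N +>\<^bsub>F\<^esub> (a \<odot>\<^bsub>F\<^esub> p)" if "p' \<in> N +>\<^bsub>F\<^esub> p" for p'
    proof -
      have "p' \<in> carrier F" "\<theta> p' = \<theta> p" using that \<open>p \<in> carrier F\<close> by (auto simp: coset)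
      then show ?thesis using \<open>p \<in> carrier F\<close> by (simp add: coset smult \<theta>_smult)
    qed
    moreover have "p \<in> N +>\<^bsub>F\<^esub> p" using that by (auto simp: coset)
    ultimately show ?thesis unfolding quot_alg_def Module.module.simps by blast
  qed
  have zc: "\<zero>\<^bsub>quot_alg F N\<^esub> = N +>\<^bsub>F\<^esub> 0"
    using coset[OF z] by (simp add: quot_alg_def N \<theta>0)
  have onec: "\<one>\<^bsub>quot_alg F N\<^esub> = N +>\<^bsub>F\<^esub> \<one>\<^bsub>F\<^esub>" by (simp add: quot_alg_def)
  show "faithful_rep (quot_alg F N) h (\<theta> ` carrier F) mul u sm"
  proof (rule faithful_repI)
    show "bij_betw h (carrier (quot_alg F N)) (\<theta> ` carrier F)"
      unfolding bij_betw_def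
    proof
      show "inj_on h (carrier (quot_alg F N))"
      proof (rule inj_onI)
        fix U V assume "U \<in> carrier (quot_alg F N)" "V \<in> carrier (quot_alg F N)" and e: "h U = h V"
        then obtain p q where "U = N +>\<^bsub>F\<^esub> p" "V = N +>\<^bsub>F\<^esub> q" "p \<in> carrier F" "q \<in> carrier F"
          unfolding car by blast
        moreover from this have "\<theta> p = \<theta> q" using e by (simp add: hc)
        ultimately show "U = V" by (simp add: coset)
      qed
      show "h ` carrier (quot_alg F N) = \<theta> ` carrier F" unfolding car by (force simp: hc)
    qed
  next
    fix U assume "U \<in> carrier (quot_alg F N)"
    then obtain p where p: "U = N +>\<^bsub>F\<^esub> p" "p \<in> carrier F" unfolding car by blast
    fix a
    show "a \<odot>\<^bsub>quot_alg F N\<^esub> U \<in> carrier (quot_alg F N)" "h (a \<odot>\<^bsub>quot_alg F N\<^esub> U) = sm a (h U)"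
      using p by (auto simp: smc car smult hc \<theta>_smult)
    fix V assume "V \<in> carrier (quot_alg F N)"
    then obtain q where q: "V = N +>\<^bsub>F\<^esub> q" "q \<in> carrier F" unfolding car by blast
    show "U \<oplus>\<^bsub>quot_alg F N\<^esub> V \<in> carrier (quot_alg F N)"
      "h (U \<oplus>\<^bsub>quot_alg F N\<^esub> V) = h U + h V"
      unfolding p(1) q(1) addc[OF p(2) q(2)] using p q by (auto simp: car pl hc \<theta>_add)
    show "U \<otimes>\<^bsub>quot_alg F N\<^esub> V \<in> carrier (quot_alg F N)"
      "h (U \<otimes>\<^bsub>quot_alg F N\<^esub> V) = mul (h U) (h V)"
      unfolding p(1) q(1) mulc[OF p(2) q(2)] using p q by (auto simp: car mult hc \<theta>_mult)
  next
    show "\<one>\<^bsub>quot_alg F N\<^esub> \<in> carrier (quot_alg F N)" "h \<one>\<^bsub>quot_alg F N\<^esub> = u"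
      using one by (auto simp: onec car hc)
    show "\<zero>\<^bsub>quot_alg F N\<^esub> \<in> carrier (quot_alg F N)" "h \<zero>\<^bsub>quot_alg F N\<^esub> = 0"
      using z \<theta>0 by (auto simp: zc car hc)
  qed
qed

section \<open>Traces over a permutation group and descent of the property to fixed points\<close>

section \<open>Invariants of a permutation group\<close>

locale calg_act = calg C mul u sm
  for C :: "'r::ab_group_add set" and mul :: "'r \<Rightarrow> 'r \<Rightarrow> 'r" (infixl \<open>\<star>\<close> 70)
    and u :: 'r and sm :: "'k \<Rightarrow> 'r \<Rightarrow> 'r" +
  fixes d :: nat and act :: "(nat \<Rightarrow> nat) \<Rightarrow> 'r \<Rightarrow> 'r"
  assumes act_closed: "\<sigma> permutes {..<d} \<Longrightarrow> x \<in> C \<Longrightarrow> act \<sigma> x \<in> C"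
    and act_add: "\<sigma> permutes {..<d} \<Longrightarrow> x \<in> C \<Longrightarrow> y \<in> C \<Longrightarrow> act \<sigma> (x + y) = act \<sigma> x + act \<sigma> y"
    and act_mul: "\<sigma> permutes {..<d} \<Longrightarrow> x \<in> C \<Longrightarrow> y \<in> C \<Longrightarrow> act \<sigma> (x \<star> y) = act \<sigma> x \<star> act \<sigma> y"
    and act_one: "\<sigma> permutes {..<d} \<Longrightarrow> act \<sigma> u = u"
    and act_sm: "\<sigma> permutes {..<d} \<Longrightarrow> x \<in> C \<Longrightarrow> act \<sigma> (sm a x) = sm a (act \<sigma> x)"
    and act_id: "x \<in> C \<Longrightarrow> act id x = x"
    and act_comp: "\<sigma> permutes {..<d} \<Longrightarrow> \<tau> permutes {..<d} \<Longrightarrow> x \<in> C \<Longrightarrow>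
      act (\<sigma> \<circ> \<tau>) x = act \<tau> (act \<sigma> x)"
begin

abbreviation "Sym \<equiv> {\<sigma>. \<sigma> permutes {..<d}}"

definition "invs = {x \<in> C. \<forall>\<sigma>. \<sigma> permutes {..<d} \<longrightarrow> act \<sigma> x = x}"

text \<open>The transfer from \<open>C\<close> to its invariants. It is linear over the invariants
  on both sides but not multiplicative, which is the reason for the orthogonality assumptions
  below.\<close>

definition "Tr x = (\<Sum>\<sigma>\<in>Sym. act \<sigma> x)"

lemma finite_Sym: "finite Sym" by (simp add: finite_permutations)

lemma act_zero: "\<sigma> permutes {..<d} \<Longrightarrow> act \<sigma> 0 = 0"
  using act_add[of \<sigma> 0 0] zero_closed by simp

lemma act_uminus:
  assumes "\<sigma> permutes {..<d}" "x \<in> C" shows "act \<sigma> (- x) = - act \<sigma> x"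
proof -
  have "act \<sigma> (- x) + act \<sigma> x = 0"
    using act_add[OF assms(1) uminus_closed[OF assms(2)] assms(2)] act_zero[OF assms(1)] by simp
  then show ?thesis by (simp add: eq_neg_iff_add_eq_0)
qed

lemma act_sum: "\<sigma> permutes {..<d} \<Longrightarrow> (\<And>i. i \<in> J \<Longrightarrow> g i \<in> C) \<Longrightarrow> act \<sigma> (sum g J) = (\<Sum>i\<in>J. act \<sigma> (g i))"
  by (induction J rule: infinite_finite_induct) (auto simp: act_zero act_add sum_closed)

lemma invs_C: "x \<in> invs \<Longrightarrow> x \<in> C" by (simp add: invs_def)

lemma invs_act: "x \<in> invs \<Longrightarrow> \<sigma> permutes {..<d} \<Longrightarrow> act \<sigma> x = x" by (simp add: invs_def)

lemma calg_invs: "calg invs (\<star>) u sm"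
  by unfold_locales
    (auto simp: invs_def zero_closed add_closed uminus_closed mul_closed one_closed sm_closed
      assoc distl distr one_l one_r sm_l sm_r act_zero act_add act_uminus act_mul act_one act_sm)

lemma Tr_closed: "x \<in> C \<Longrightarrow> Tr x \<in> C"
  unfolding Tr_def by (intro sum_closed) (auto simp: act_closed)

lemma Tr_invs: assumes x: "x \<in> C" shows "Tr x \<in> invs"
proof -
  have "act \<tau> (Tr x) = Tr x" if \<tau>: "\<tau> permutes {..<d}" for \<tau>
  proof -
    have "act \<tau> (Tr x) = (\<Sum>\<sigma>\<in>Sym. act (\<sigma> \<circ> \<tau>) x)"
      unfolding Tr_def using \<tau> x by (subst act_sum) (auto simp: act_closed act_comp)
    also have "\<dots> = (\<Sum>\<sigma>\<in>(\<lambda>\<sigma>. \<sigma> \<circ> \<tau>) ` Sym. act \<sigma> x)"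
      by (subst sum.reindex) (auto intro!: inj_on_inverseI[where g = "\<lambda>\<sigma>. \<sigma> \<circ> inv_into UNIV \<tau>"]
          simp: fun_eq_iff permutes_inverses[OF \<tau>])
    also have "(\<lambda>\<sigma>. \<sigma> \<circ> \<tau>) ` Sym = Sym"
    proof (intro equalityI subsetI)
      fix \<sigma> assume "\<sigma> \<in> Sym"
      then have "\<sigma> \<circ> inv_into UNIV \<tau> \<in> Sym" "\<sigma> = (\<sigma> \<circ> inv_into UNIV \<tau>) \<circ> \<tau>"
        using \<tau> by (auto simp: permutes_compose permutes_inv fun_eq_iff permutes_inverses[OF \<tau>])
      then show "\<sigma> \<in> (\<lambda>\<sigma>. \<sigma> \<circ> \<tau>) ` Sym" by blast
    qed (use \<tau> in \<open>auto simp: permutes_compose\<close>)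
    finally show ?thesis unfolding Tr_def .
  qed
  then show ?thesis using x by (simp add: invs_def Tr_closed)
qed

lemma Tr_add: "x \<in> C \<Longrightarrow> y \<in> C \<Longrightarrow> Tr (x + y) = Tr x + Tr y"
  unfolding Tr_def by (simp add: act_add sum.distrib)

lemma Tr_sum: "(\<And>i. i \<in> J \<Longrightarrow> g i \<in> C) \<Longrightarrow> Tr (sum g J) = (\<Sum>i\<in>J. Tr (g i))"
  unfolding Tr_def by (subst sum.swap) (auto simp: act_sum)

lemma Tr_mul_l: "x \<in> invs \<Longrightarrow> y \<in> C \<Longrightarrow> Tr (x \<star> y) = x \<star> Tr y"
  unfolding Tr_def by (subst sum_r) (auto simp: act_closed act_mul invs_C invs_act)

lemma Tr_mul_r: "x \<in> C \<Longrightarrow> y \<in> invs \<Longrightarrow> Tr (x \<star> y) = Tr x \<star> y"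
  unfolding Tr_def by (subst sum_l) (auto simp: act_closed act_mul invs_C invs_act)

text \<open>With \<open>x = x \<star> w\<close> and \<open>y = w \<star> y\<close>, every term of
  the product of the two sums that belongs to different permutations contains a product of two
  different conjugates of \<open>w\<close>, which vanishes; only the diagonal survives. For the same
  reason multiplication by \<open>y\<close> picks one term out of \<open>Tr x\<close>.\<close>

lemma
  assumes w: "w \<in> C" "w \<star> w = w"
    and orth: "\<And>\<sigma>. \<sigma> permutes {..<d} \<Longrightarrow> \<sigma> \<noteq> id \<Longrightarrow> w \<star> act \<sigma> w = 0"
    and x: "x \<in> C" "x \<star> w = x" and y: "y \<in> C" "w \<star> y = y"
  shows Tr_mul: "Tr x \<star> Tr y = Tr (x \<star> y)" and Tr_mul_corner: "Tr x \<star> y = x \<star> y"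
proof -
  have z: "act \<sigma> x \<star> act \<tau> y = 0" if \<sigma>: "\<sigma> permutes {..<d}" and \<tau>: "\<tau> permutes {..<d}" and ne: "\<sigma> \<noteq> \<tau>" for \<sigma> \<tau>
  proof -
    \<comment> \<open>The product of the conjugates of \<open>w\<close> under
      \<open>\<sigma>\<close> and \<open>\<tau>\<close> is the conjugate under
      \<open>\<sigma>\<close> of \<open>w \<star> act ?\<rho> w\<close>, so orthogonality is needed
      for \<open>?\<rho>\<close> only.\<close>
    let ?\<rho> = "\<tau> \<circ> inv_into UNIV \<sigma>"
    have \<rho>: "?\<rho> permutes {..<d}" using \<sigma> \<tau> by (simp add: permutes_compose permutes_inv)
    have e: "\<tau> = ?\<rho> \<circ> \<sigma>" by (simp add: fun_eq_iff permutes_inverses[OF \<sigma>])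
    have "?\<rho> \<noteq> id" using ne e by force
    then have "act \<sigma> (w \<star> act ?\<rho> w) = 0" using orth[OF \<rho>] act_zero[OF \<sigma>] by simp
    then have o: "act \<sigma> w \<star> act \<tau> w = 0"
      using e act_comp[OF \<rho> \<sigma> w(1)] \<sigma> \<rho> w by (simp add: act_mul act_closed)
    have "act \<sigma> x \<star> act \<tau> y = act \<sigma> (x \<star> w) \<star> act \<tau> (w \<star> y)" using x y by simp
    also have "\<dots> = act \<sigma> x \<star> (act \<sigma> w \<star> act \<tau> w) \<star> act \<tau> y"
      using \<sigma> \<tau> x(1) y(1) w by (simp add: act_mul act_closed assoc mul_closed)
    finally show ?thesis using o \<sigma> \<tau> x y by (simp add: zero_l zero_r act_closed)
  qed
  have "Tr x \<star> Tr y = (\<Sum>\<sigma>\<in>Sym. \<Sum>\<tau>\<in>Sym. act \<sigma> x \<star> act \<tau> y)"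
    using x y unfolding Tr_def
    by (subst sum_l) (auto intro!: sum.cong sum_r sum_closed simp: act_closed)
  also have "\<dots> = (\<Sum>\<sigma>\<in>Sym. \<Sum>\<tau>\<in>Sym. if \<tau> = \<sigma> then act \<sigma> (x \<star> y) else 0)"
    using z x y by (intro sum.cong refl) (auto simp: act_mul)
  also have "\<dots> = Tr (x \<star> y)" unfolding Tr_def using finite_Sym by (simp add: sum.delta)
  finally show "Tr x \<star> Tr y = Tr (x \<star> y)" .
  have "Tr x \<star> y = (\<Sum>\<sigma>\<in>Sym. act \<sigma> x \<star> act id y)"
    using x y unfolding Tr_def by (subst sum_l) (auto simp: act_closed act_id)
  also have "\<dots> = (\<Sum>\<sigma>\<in>Sym. if \<sigma> = id then x \<star> y else 0)"
    using z[OF _ permutes_id] x y by (intro sum.cong refl) (auto simp: act_id)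
  finally show "Tr x \<star> y = x \<star> y" using finite_Sym by (simp add: sum.delta permutes_id)
qed

text \<open>
  An endomorphism \<open>\<phi>\<close> of \<open>C\<^sup>G F\<close> extends to the endomorphism \<open>x \<mapsto> \<Sum>\<^sub>t \<phi> (Tr (x a\<^sub>t)) b\<^sub>t\<close> of \<open>C F\<close>,
  which is left multiplication by some \<open>r \<in> C\<close>; that \<open>r\<close> is invariant follows from injectivity.
\<close>

lemma dci_invs:
  assumes dci: "dci C (\<star>) F" and F: "F \<in> invs"
    and w: "w \<in> C" "w \<star> w = w" "w \<star> F = w" "F \<star> w = w"
    and orth: "\<And>\<sigma>. \<sigma> permutes {..<d} \<Longrightarrow> \<sigma> \<noteq> id \<Longrightarrow> w \<star> act \<sigma> w = 0"
    and a: "\<And>t. t \<in> J \<Longrightarrow> a t \<in> C \<and> a t \<star> w = a t \<and> F \<star> a t = a t"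
    and b: "\<And>t. t \<in> J \<Longrightarrow> b t \<in> C \<and> w \<star> b t = b t \<and> b t \<star> F = b t"
    and ab: "(\<Sum>t\<in>J. a t \<star> b t) = F"
  shows "dci invs (\<star>) F"
proof -
  interpret I: calg invs "(\<star>)" u sm by (rule calg_invs)
  have FC: "F \<in> C" and FF: "F \<star> F = F" using dci by (auto simp: dci_def)
  note TC = Tr_mul_corner[OF w(1,2) orth] and TM = Tr_mul[OF w(1,2) orth]
  have aF: "a t \<star> F = a t" if "t \<in> J" for t
    using a[OF that] w FC assoc[of "a t" w F] by simp
  have wa: "x \<star> a t \<in> C \<and> (x \<star> a t) \<star> w = x \<star> a t" if "x \<in> C" "t \<in> J" for x t
    using a[OF that(2)] that(1) w by (simp add: assoc mul_closed)
  \<comment> \<open>Multiplication by \<open>b t\<close> undoes the trace, so every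
    \<open>x \<star> F\<close> is recovered from elements of the invariant left ideal.\<close>
  have exp: "(\<Sum>t\<in>J. Tr (x \<star> a t) \<star> b t) = x \<star> F" if x: "x \<in> C" for x
  proof -
    have "Tr (x \<star> a t) \<star> b t = x \<star> (a t \<star> b t)" if t: "t \<in> J" for t
      using TC[of "x \<star> a t" "b t"] wa[OF x t] a[OF t] b[OF t] x by (simp add: assoc)
    then have "(\<Sum>t\<in>J. Tr (x \<star> a t) \<star> b t) = x \<star> (\<Sum>t\<in>J. a t \<star> b t)"
      using x a b by (subst sum_r) (auto simp: mul_closed)
    then show ?thesis by (simp add: ab)
  qed
  have TF: "Tr (x \<star> a t) \<in> invs \<and> Tr (x \<star> a t) \<star> F = Tr (x \<star> a t)" if "x \<in> C" "t \<in> J" for x t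
    using that a[OF that(2)] aF[OF that(2)] FC
    by (simp add: Tr_mul_r[OF _ F, symmetric] mul_closed assoc Tr_invs)
  \<comment> \<open>By \<open>exp\<close>, an element annihilating the invariant part of
    \<open>C F\<close> annihilates all of \<open>C F\<close>, and injectivity for \<open>C\<close>
    applies.\<close>
  have kill: "r = 0" if r: "r \<in> C" and rk: "\<And>x. x \<in> invs \<Longrightarrow> x \<star> F = x \<Longrightarrow> r \<star> x = 0" for r
  proof (rule dci_inj[OF dci r])
    fix x assume x: "x \<in> C"
    have "r \<star> (Tr (x \<star> a t) \<star> b t) = 0" if t: "t \<in> J" for t
    proof -
      have "r \<star> (Tr (x \<star> a t) \<star> b t) = (r \<star> Tr (x \<star> a t)) \<star> b t"
        using x t a b r by (subst assoc) (auto simp: Tr_closed mul_closed)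
      then show ?thesis using rk[of "Tr (x \<star> a t)"] TF[OF x t] b[OF t] by (simp add: zero_l)
    qed
    then have "(\<Sum>t\<in>J. r \<star> (Tr (x \<star> a t) \<star> b t)) = 0" by simp
    then show "r \<star> (x \<star> F) = 0"
      using x a b r by (subst exp[OF x, symmetric], subst sum_r) (auto simp: Tr_closed mul_closed)
  qed
  show ?thesis
  proof (rule dciI)
    show "F \<in> invs" "F \<star> F = F" by (fact F FF)+
  next
    fix s assume s: "s \<in> invs" and sk: "\<And>x. x \<in> invs \<Longrightarrow> s \<star> (x \<star> F) = 0"
    show "s = 0"
    proof (rule kill)
      fix x assume "x \<in> invs" "x \<star> F = x"
      then show "s \<star> x = 0" using sk[of x] by simp
    qed (use s in \<open>simp add: invs_C\<close>)
  next
    fix \<phi>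
    assume \<phi>1: "\<And>x. x \<in> invs \<Longrightarrow> x \<star> F = x \<Longrightarrow> \<phi> x \<in> invs \<and> \<phi> x \<star> F = \<phi> x"
      and \<phi>2: "\<And>x y. x \<in> invs \<Longrightarrow> y \<in> invs \<Longrightarrow> x \<star> F = x \<Longrightarrow> y \<star> F = y \<Longrightarrow> \<phi> (x + y) = \<phi> x + \<phi> y"
      and \<phi>3: "\<And>x c. x \<in> invs \<Longrightarrow> c \<in> invs \<Longrightarrow> x \<star> F = x \<Longrightarrow> F \<star> c = c \<Longrightarrow> c \<star> F = c \<Longrightarrow>
                 \<phi> (x \<star> c) = \<phi> x \<star> c"
    define \<Phi> where "\<Phi> x = (\<Sum>t\<in>J. \<phi> (Tr (x \<star> a t)) \<star> b t)" for x
    have \<phi>T: "\<phi> (Tr (x \<star> a t)) \<in> invs" "\<phi> (Tr (x \<star> a t)) \<in> C" if "x \<in> C" "t \<in> J" for x t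
      using \<phi>1 TF[OF that] by (auto simp: invs_C)
    have sub: "\<phi> (\<Sum>t\<in>J'. g t) = (\<Sum>t\<in>J'. \<phi> (g t))"
      if "J' \<subseteq> J" "\<And>t. t \<in> J \<Longrightarrow> g t \<in> invs \<and> g t \<star> F = g t" for J' g
      using that(1)
    proof (induction J' rule: infinite_finite_induct)
      case (insert t J')
      then have "sum g J' \<in> invs" "sum g J' \<star> F = sum g J'"
        using that(2) by (auto intro!: I.sum_closed sum.cong simp: I.sum_l[OF _ F] subset_iff)
      then show ?case using insert that(2)[of t] by (simp add: \<phi>2)
    next
      case empty
      have "\<phi> 0 = \<phi> 0 + \<phi> 0" using \<phi>2[of 0 0] I.zero_closed by (simp add: zero_l FC)
      then show ?case by simp
    next
      case (infinite J')
      have "\<phi> 0 = \<phi> 0 + \<phi> 0" using \<phi>2[of 0 0] I.zero_closed by (simp add: zero_l FC)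
      then show ?case using infinite by simp
    qed
    obtain r where r: "r \<in> C" "\<And>x. x \<in> C \<Longrightarrow> x \<star> F = x \<Longrightarrow> \<Phi> x = r \<star> x"
    proof (rule dci_surj[OF dci, of \<Phi>])
      fix x assume x: "x \<in> C" "x \<star> F = x"
      have "\<Phi> x \<in> C" unfolding \<Phi>_def using b \<phi>T[OF x(1)] by (intro sum_closed) (auto simp: mul_closed)
      moreover have "\<Phi> x \<star> F = \<Phi> x"
        unfolding \<Phi>_def using b \<phi>T[OF x(1)] FC
        by (subst sum_l) (auto intro!: sum.cong simp: mul_closed assoc)
      ultimately show "\<Phi> x \<in> C \<and> \<Phi> x \<star> F = \<Phi> x" by simp
    next
      fix x y assume x: "x \<in> C" "x \<star> F = x" and y: "y \<in> C" "y \<star> F = y"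
      have "\<phi> (Tr ((x + y) \<star> a t)) = \<phi> (Tr (x \<star> a t)) + \<phi> (Tr (y \<star> a t))" if "t \<in> J" for t
        using x y a[OF that] TF[OF _ that] by (simp add: distl Tr_add mul_closed \<phi>2)
      then show "\<Phi> (x + y) = \<Phi> x + \<Phi> y"
        unfolding \<Phi>_def using \<phi>T[OF x(1)] \<phi>T[OF y(1)] b
        by (simp add: sum.distrib[symmetric] distl)
    next
      fix x c assume x: "x \<in> C" "x \<star> F = x" and c: "c \<in> C" "F \<star> c = c" "c \<star> F = c"
      \<comment> \<open>The corner element \<open>c\<close> is not invariant, so
        \<open>\<phi>3\<close> cannot be applied to it. Inserting \<open>F\<close>, written as the
        sum of the \<open>a s \<star> b s\<close>, in front of \<open>c\<close> replaces it by the
        elements \<open>b s \<star> (c \<star> a t)\<close> of the corner of \<open>w\<close>, whose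
        traces are invariant and lie in the corner of \<open>F\<close>.\<close>
      have y: "b s \<star> (c \<star> a t) \<in> C" "w \<star> (b s \<star> (c \<star> a t)) = b s \<star> (c \<star> a t)"
        "(b s \<star> (c \<star> a t)) \<star> w = b s \<star> (c \<star> a t)" "F \<star> Tr (b s \<star> (c \<star> a t)) = Tr (b s \<star> (c \<star> a t))"
        "Tr (b s \<star> (c \<star> a t)) \<star> F = Tr (b s \<star> (c \<star> a t))"
        if "s \<in> J" "t \<in> J" for s t
      proof -
        note ab = a[OF that(2)] b[OF that(1)]
        show 1: "b s \<star> (c \<star> a t) \<in> C" using ab c by (simp add: mul_closed)
        show 2: "w \<star> (b s \<star> (c \<star> a t)) = b s \<star> (c \<star> a t)"
          using ab c w by (subst assoc[symmetric]) (auto simp: mul_closed)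
        show "(b s \<star> (c \<star> a t)) \<star> w = b s \<star> (c \<star> a t)"
          using ab c w by (simp add: assoc mul_closed)
        show "F \<star> Tr (b s \<star> (c \<star> a t)) = Tr (b s \<star> (c \<star> a t))"
          using Tr_mul_l[OF F 1] assoc[OF FC w(1) 1] 2 w by simp
        show "Tr (b s \<star> (c \<star> a t)) \<star> F = Tr (b s \<star> (c \<star> a t))"
          using Tr_mul_r[OF 1 F] ab c FC aF[OF that(2)] by (simp add: assoc mul_closed)
      qed
      have "\<phi> (Tr ((x \<star> c) \<star> a t)) \<star> b t = \<Phi> x \<star> c \<star> (a t \<star> b t)" if t: "t \<in> J" for t
      proof -
        note at = a[OF t] and bt = b[OF t]
        have ca: "c \<star> a t \<in> C" using c at by (simp add: mul_closed)
        have "c \<star> a t = (\<Sum>s\<in>J. a s \<star> b s) \<star> (c \<star> a t)"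
          using ab assoc[of F c "a t"] c at FC by simp
        also have "\<dots> = (\<Sum>s\<in>J. a s \<star> (b s \<star> (c \<star> a t)))"
          using ca a b by (subst sum_l) (auto simp: mul_closed assoc)
        finally have "x \<star> (c \<star> a t) = x \<star> (\<Sum>s\<in>J. a s \<star> (b s \<star> (c \<star> a t)))"
          by (rule arg_cong)
        then have "Tr (x \<star> (c \<star> a t)) = (\<Sum>s\<in>J. Tr (x \<star> a s \<star> (b s \<star> (c \<star> a t))))"
          using x(1) a b ca by (simp add: sum_r mul_closed Tr_sum assoc)
        also have "\<dots> = (\<Sum>s\<in>J. Tr (x \<star> a s) \<star> Tr (b s \<star> (c \<star> a t)))"
          using TM y[OF _ t] wa[OF x(1)] by (intro sum.cong refl) simp
        finally have "\<phi> (Tr (x \<star> (c \<star> a t))) = \<phi> (\<Sum>s\<in>J. Tr (x \<star> a s) \<star> Tr (b s \<star> (c \<star> a t)))" by simp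
        also have "\<dots> = (\<Sum>s\<in>J. \<phi> (Tr (x \<star> a s) \<star> Tr (b s \<star> (c \<star> a t))))"
          using TF[OF x(1)] y[OF _ t] FC
          by (intro sub) (auto simp: I.mul_closed Tr_invs assoc invs_C Tr_closed)
        also have "\<dots> = (\<Sum>s\<in>J. \<phi> (Tr (x \<star> a s)) \<star> Tr (b s \<star> (c \<star> a t)))"
          using TF[OF x(1)] y[OF _ t] by (intro sum.cong refl \<phi>3) (auto simp: Tr_invs)
        finally have "\<phi> (Tr (x \<star> (c \<star> a t))) \<star> b t
            = (\<Sum>s\<in>J. \<phi> (Tr (x \<star> a s)) \<star> (Tr (b s \<star> (c \<star> a t)) \<star> b t))"
          using \<phi>T[OF x(1)] y[OF _ t] bt by (simp add: sum_l mul_closed Tr_closed assoc)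
        also have "\<dots> = (\<Sum>s\<in>J. \<phi> (Tr (x \<star> a s)) \<star> b s \<star> (c \<star> a t \<star> b t))"
        proof (intro sum.cong refl)
          fix s assume s: "s \<in> J"
          have "Tr (b s \<star> (c \<star> a t)) \<star> b t = b s \<star> (c \<star> a t) \<star> b t"
            using TC y[OF s t] bt by simp
          then show "\<phi> (Tr (x \<star> a s)) \<star> (Tr (b s \<star> (c \<star> a t)) \<star> b t)
              = \<phi> (Tr (x \<star> a s)) \<star> b s \<star> (c \<star> a t \<star> b t)"
            using \<phi>T[OF x(1) s] b[OF s] bt ca by (simp add: assoc mul_closed)
        qed
        also have "\<dots> = \<Phi> x \<star> (c \<star> a t \<star> b t)"
          unfolding \<Phi>_def using \<phi>T[OF x(1)] b bt ca by (subst sum_l) (auto simp: mul_closed)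
        finally show ?thesis
          using x c at bt \<phi>T[OF x(1)] b
          by (simp add: assoc mul_closed \<Phi>_def sum_closed)
      qed
      then have "\<Phi> (x \<star> c) = (\<Sum>t\<in>J. \<Phi> x \<star> c \<star> (a t \<star> b t))"
        unfolding \<Phi>_def[of "x \<star> c"] by simp
      also have "\<dots> = \<Phi> x \<star> c \<star> F"
        unfolding ab[symmetric] using x c a b \<phi>T[OF x(1)]
        by (subst sum_r) (auto simp: mul_closed \<Phi>_def sum_closed)
      also have "\<dots> = \<Phi> x \<star> c"
        using x c b \<phi>T[OF x(1)] FC by (subst assoc) (auto simp: mul_closed \<Phi>_def sum_closed)
      finally show "\<Phi> (x \<star> c) = \<Phi> x \<star> c" .
    qed (use that in blast)
    \<comment> \<open>For invariant \<open>x\<close> the trace of \<open>x \<star> a t\<close> is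
      \<open>x \<star> Tr (a t)\<close>, and \<open>Tr (a t)\<close> lies in the invariant corner,
      so it can be pulled out of \<open>\<phi>\<close>. Thus \<open>\<Phi>\<close> extends
      \<open>\<phi>\<close>.\<close>
    have \<phi>r: "\<phi> x = r \<star> x" if x: "x \<in> invs" "x \<star> F = x" for x
    proof -
      have "\<phi> (Tr (x \<star> a t)) \<star> b t = \<phi> x \<star> (a t \<star> b t)" if t: "t \<in> J" for t
      proof -
        have "F \<star> Tr (a t) = Tr (a t)" "Tr (a t) \<star> F = Tr (a t)"
          using a[OF t] aF[OF t] by (auto simp: Tr_mul_l[OF F, symmetric] Tr_mul_r[OF _ F, symmetric])
        then have "\<phi> (Tr (x \<star> a t)) = \<phi> x \<star> Tr (a t)"
          using x a[OF t] by (simp add: Tr_mul_l \<phi>3 Tr_invs)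
        moreover have "Tr (a t) \<star> b t = a t \<star> b t" using TC a[OF t] b[OF t] by simp
        ultimately show ?thesis
          using \<phi>1[OF x] a[OF t] b[OF t] by (simp add: assoc invs_C Tr_closed)
      qed
      then have "\<Phi> x = \<phi> x \<star> F"
        unfolding \<Phi>_def ab[symmetric] using a b \<phi>1[OF x] by (subst sum_r) (auto simp: mul_closed invs_C)
      then show ?thesis using r(2)[of x] x \<phi>1[OF x] by (simp add: invs_C)
    qed
    have "act \<sigma> r = r" if \<sigma>: "\<sigma> permutes {..<d}" for \<sigma>
    proof -
      have "act \<sigma> r - r = 0"
      proof (rule kill)
        show "act \<sigma> r - r \<in> C" using \<sigma> r by (simp add: diff_closed act_closed)
        fix x assume x: "x \<in> invs" "x \<star> F = x"
        have "act \<sigma> r \<star> x = act \<sigma> (r \<star> x)" using act_mul[OF \<sigma> r(1) invs_C[OF x(1)]] invs_act[OF x(1) \<sigma>] by simp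
        also have "\<dots> = r \<star> x" using \<phi>r[OF x] \<phi>1[OF x] \<sigma> by (simp add: invs_act)
        finally show "(act \<sigma> r - r) \<star> x = 0"
          using r x \<sigma> by (simp add: diff_l act_closed invs_C)
      qed
      then show ?thesis by simp
    qed
    then show "\<exists>s\<in>invs. \<forall>x\<in>invs. x \<star> F = x \<longrightarrow> \<phi> x = s \<star> x"
      using r(1) \<phi>r by (intro bexI[of _ r]) (auto simp: invs_def)
  qed
qed

end

section \<open>Linear algebra over a principal ideal domain: splitting off saturated
  submodules\<close>

section \<open>Saturated submodules over a principal ideal domain\<close>

text \<open>The linear combinations of the \<open>x e\<close> form an ideal. Its generator divides
  every \<open>x e\<close>, so it is a unit by \<open>prim\<close>, and then 1 is a combination as
  well.\<close>

lemma principal_domain_bezout: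
  fixes x :: "'e \<Rightarrow> 'k::idom"
  assumes pid: "principal_domain (ring_of_type_algebra :: 'k ring)" and fin: "finite E"
    and prim: "\<And>g. (\<forall>e\<in>E. g dvd x e) \<Longrightarrow> g dvd 1"
  obtains \<mu> where "(\<Sum>e\<in>E. \<mu> e * x e) = 1"
proof -
  let ?R = "ring_of_type_algebra :: 'k ring"
  interpret R: principal_domain ?R by (rule pid)
  have sel: "carrier ?R = UNIV" "monoid.mult ?R = (*)" "add ?R = (+)" "\<zero>\<^bsub>?R\<^esub> = 0" "\<one>\<^bsub>?R\<^esub> = 1"
    by (simp_all add: ring_of_type_algebra_def fun_eq_iff)
  define I where "I = range (\<lambda>\<mu>. \<Sum>e\<in>E. \<mu> e * x e)"
  have "ideal I ?R"
  proof (rule idealI)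
    show "ring ?R" by (rule R.ring_axioms)
    show "subgroup I (add_monoid ?R)"
    proof (rule R.add.subgroupI)
      show "I \<subseteq> carrier ?R" by (simp add: sel)
      show "I \<noteq> {}" by (simp add: I_def)
    next
      fix a assume "a \<in> I"
      then obtain \<mu> where "a = (\<Sum>e\<in>E. \<mu> e * x e)" by (auto simp: I_def)
      then have "- a = (\<Sum>e\<in>E. (- \<mu> e) * x e)" by (simp add: sum_negf)
      then have "- a \<in> I" unfolding I_def by (rule range_eqI[where x = "\<lambda>e. - \<mu> e"])
      moreover have "\<ominus>\<^bsub>?R\<^esub> a = - a" by (rule R.minus_equality) (auto simp: sel)
      ultimately show "\<ominus>\<^bsub>?R\<^esub> a \<in> I" by simp
    next
      fix a b assume "a \<in> I" "b \<in> I"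
      then obtain \<mu> \<nu> where "a = (\<Sum>e\<in>E. \<mu> e * x e)" "b = (\<Sum>e\<in>E. \<nu> e * x e)" by (auto simp: I_def)
      then have "a + b = (\<Sum>e\<in>E. (\<mu> e + \<nu> e) * x e)" by (simp add: sum.distrib distrib_right)
      then show "a \<oplus>\<^bsub>?R\<^esub> b \<in> I" unfolding I_def by (auto simp: sel)
    qed
  next
    fix a c assume "a \<in> I"
    then obtain \<mu> where "a = (\<Sum>e\<in>E. \<mu> e * x e)" by (auto simp: I_def)
    then have "c * a = (\<Sum>e\<in>E. (c * \<mu> e) * x e)" by (simp add: sum_distrib_left mult.assoc)
    then show "c \<otimes>\<^bsub>?R\<^esub> a \<in> I" "a \<otimes>\<^bsub>?R\<^esub> c \<in> I" unfolding I_def by (auto simp: sel mult.commute)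
  qed
  then obtain g where g: "I = PIdl\<^bsub>?R\<^esub> g" using R.exists_gen by (auto simp: sel)
  have gI: "g \<in> I" unfolding g using R.cgenideal_self[of g] by (simp add: sel)
  have "g dvd x e" if e: "e \<in> E" for e
  proof -
    have "x e = (\<Sum>e'\<in>E. (if e' = e then 1 else 0) * x e')"
      using e fin by (simp add: if_distrib[of "\<lambda>c. c * _"] sum.delta cong: if_cong)
    then have "x e \<in> I" unfolding I_def by (intro range_eqI) 
    then show ?thesis unfolding g cgenideal_def by (auto simp: sel)
  qed
  then have "g dvd 1" by (intro prim) blast
  then obtain k where k: "1 = g * k" by (rule dvdE)
  from gI obtain \<mu> where "g = (\<Sum>e\<in>E. \<mu> e * x e)" by (auto simp: I_def)
  then have "(\<Sum>e\<in>E. (k * \<mu> e) * x e) = 1" 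
    using k mult.commute[of g k] by (simp add: sum_distrib_left mult.assoc)
  then show thesis by (rule that)
qed

text \<open>
  The first vector \<open>v\<^sub>i\<close> is primitive by saturation, so some functional \<open>\<mu>\<close> maps it to \<open>1\<close>; the
  projections of the other vectors along it to \<open>ker \<mu>\<close> again span a saturated submodule.
\<close>

lemma saturated_dual_functionals:
  fixes v :: "'i \<Rightarrow> 'e \<Rightarrow> 'k::idom"
  assumes pid: "principal_domain (ring_of_type_algebra :: 'k ring)" and finE: "finite E" and finI: "finite I"
    and indep: "\<And>a. (\<And>e. e \<in> E \<Longrightarrow> (\<Sum>i\<in>I. a i * v i e) = 0) \<Longrightarrow> \<forall>i\<in>I. a i = 0"
    and sat: "\<And>x c a. c \<noteq> 0 \<Longrightarrow> (\<And>e. e \<in> E \<Longrightarrow> c * x e = (\<Sum>i\<in>I. a i * v i e)) \<Longrightarrow>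
                \<exists>b. \<forall>e\<in>E. x e = (\<Sum>i\<in>I. b i * v i e)"
  obtains \<Lambda> where "\<And>i j. i \<in> I \<Longrightarrow> j \<in> I \<Longrightarrow> (\<Sum>e\<in>E. \<Lambda> i e * v j e) = (if i = j then 1 else 0)"
proof -
  have "\<exists>\<Lambda>. \<forall>i\<in>I. \<forall>j\<in>I. (\<Sum>e\<in>E. \<Lambda> i e * v j e) = (if i = j then 1 else 0)"
    using finI indep sat
  proof (induction I arbitrary: v rule: finite_induct)
    case (insert k I v)
    note indep = insert.prems(1) and sat = insert.prems(2) and fin = insert.hyps(1) and kI = insert.hyps(2)
    \<comment> \<open>A common divisor \<open>g\<close> of the entries gives
      \<open>v k = g x\<close>. Saturation expresses \<open>x\<close> through the family, and
      independence compares coefficients at \<open>k\<close>: \<open>g * b k = 1\<close>. If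
      \<open>g\<close> were 0, the vector \<open>v k\<close> would vanish, against
      independence.\<close>
    obtain \<mu> where \<mu>: "(\<Sum>e\<in>E. \<mu> e * v k e) = 1"
    proof (rule principal_domain_bezout[OF pid finE, of "v k"])
      fix g assume g: "\<forall>e\<in>E. g dvd v k e"
      show "g dvd 1"
      proof (cases "g = 0")
        case True
        then have "\<forall>i\<in>insert k I. (if i = k then 1 else 0) = (0::'k)"
          using g fin kI by (intro indep) (auto simp: if_distrib[of "\<lambda>c. c * _"] sum.delta cong: if_cong)
        then show ?thesis by simp
      next
        case False
        from g obtain x where x: "\<And>e. e \<in> E \<Longrightarrow> v k e = g * x e" unfolding dvd_def by metis
        have "\<exists>b. \<forall>e\<in>E. x e = (\<Sum>i\<in>insert k I. b i * v i e)"
          using False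
        proof (rule sat[where a = "\<lambda>i. if i = k then 1 else 0"])
          fix e assume "e \<in> E"
          then show "g * x e = (\<Sum>i\<in>insert k I. (if i = k then 1 else 0) * v i e)"
            using fin kI x by (simp add: if_distrib[of "\<lambda>c. c * _"] sum.delta cong: if_cong)
        qed
        then obtain b where b: "\<And>e. e \<in> E \<Longrightarrow> x e = (\<Sum>i\<in>insert k I. b i * v i e)" by blast
        have "\<forall>i\<in>insert k I. g * b i - (if i = k then 1 else 0) = 0"
        proof (rule indep)
          fix e assume e: "e \<in> E"
          have "(\<Sum>i\<in>insert k I. (g * b i - (if i = k then 1 else 0)) * v i e)
             = g * (\<Sum>i\<in>insert k I. b i * v i e) - (\<Sum>i\<in>insert k I. (if i = k then 1 else 0) * v i e)"
            by (simp only: left_diff_distrib sum_subtractf sum_distrib_left mult.assoc)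
          also have "(\<Sum>i\<in>insert k I. (if i = k then 1 else 0) * v i e) = v k e"
            using fin kI by (simp add: if_distrib[of "\<lambda>c. c * _"] sum.delta cong: if_cong)
          finally show "(\<Sum>i\<in>insert k I. (g * b i - (if i = k then 1 else 0)) * v i e) = 0"
            using b[OF e] x[OF e] by simp
        qed
        then have "g * b k = 1" by simp
        then show ?thesis by (metis dvd_triv_left)
      qed
    qed (rule that)
    define m where "m i = (\<Sum>e\<in>E. \<mu> e * v i e)" for i
    define v' where "v' i e = v i e - m i * v k e" for i e
    have comb: "(\<Sum>i\<in>I. a i * v' i e) = (\<Sum>i\<in>insert k I. (if i = k then - (\<Sum>j\<in>I. a j * m j) else a i) * v i e)" for a e
    proof -
      have "(\<Sum>i\<in>I. (if i = k then - (\<Sum>j\<in>I. a j * m j) else a i) * v i e) = (\<Sum>i\<in>I. a i * v i e)"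
        using kI by (intro sum.cong) auto
      then show ?thesis
        using fin kI by (simp add: v'_def right_diff_distrib sum_subtractf sum_distrib_right mult.assoc)
    qed
    have kill: "(\<Sum>e\<in>E. \<mu> e * v' i e) = 0" for i
    proof -
      have "(\<Sum>e\<in>E. \<mu> e * v' i e) = m i - m i * (\<Sum>e\<in>E. \<mu> e * v k e)"
        unfolding m_def v'_def by (simp add: right_diff_distrib sum_subtractf sum_distrib_left mult.left_commute)
      then show ?thesis by (simp add: \<mu>)
    qed
    have "\<exists>\<Lambda>. \<forall>i\<in>I. \<forall>j\<in>I. (\<Sum>e\<in>E. \<Lambda> i e * v' j e) = (if i = j then 1 else 0)"
    proof (rule insert.IH)
      fix a assume "\<And>e. e \<in> E \<Longrightarrow> (\<Sum>i\<in>I. a i * v' i e) = 0"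
      then have "\<forall>i\<in>insert k I. (if i = k then - (\<Sum>j\<in>I. a j * m j) else a i) = 0"
        by (intro indep) (simp add: comb)
      then show "\<forall>i\<in>I. a i = 0" using kI by (metis insertCI)
    next
      fix x c a assume c: "c \<noteq> (0::'k)" and cx: "\<And>e. e \<in> E \<Longrightarrow> c * x e = (\<Sum>i\<in>I. a i * v' i e)"
      have "\<exists>b. \<forall>e\<in>E. x e = (\<Sum>i\<in>insert k I. b i * v i e)"
        using cx by (intro sat[OF c]) (simp add: comb)
      then obtain b where b: "\<And>e. e \<in> E \<Longrightarrow> x e = (\<Sum>i\<in>insert k I. b i * v i e)" by blast
      define b0 where "b0 = b k + (\<Sum>i\<in>I. b i * m i)"
      have xb: "x e = b0 * v k e + (\<Sum>i\<in>I. b i * v' i e)" if "e \<in> E" for e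
        using b[OF that] fin kI unfolding b0_def v'_def
        by (simp add: right_diff_distrib sum_subtractf sum_distrib_right distrib_right mult.assoc)
      \<comment> \<open>The functional \<open>\<mu>\<close> kills every \<open>v' i\<close>, so it
        maps \<open>x\<close> to \<open>b0\<close> on one side and to zero, after cancelling
        \<open>c\<close>, on the other. The component along \<open>v k\<close> disappears.\<close>
      have "(\<Sum>e\<in>E. \<mu> e * (c * x e)) = (\<Sum>i\<in>I. a i * (\<Sum>e\<in>E. \<mu> e * v' i e))"
        using cx by (simp add: sum_distrib_left mult.left_commute sum.swap[of _ I])
      then have z: "c * (\<Sum>e\<in>E. \<mu> e * x e) = 0"
        by (simp add: kill sum_distrib_left mult.left_commute)
      have "(\<Sum>e\<in>E. \<mu> e * x e) = b0 * (\<Sum>e\<in>E. \<mu> e * v k e) + (\<Sum>i\<in>I. b i * (\<Sum>e\<in>E. \<mu> e * v' i e))"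
        using xb by (simp add: distrib_left sum.distrib sum_distrib_left mult.left_commute sum.swap[of _ I])
      then have "b0 = 0" using z c by (simp add: kill \<mu>)
      then show "\<exists>b. \<forall>e\<in>E. x e = (\<Sum>i\<in>I. b i * v' i e)" using xb by auto
    qed
    then obtain \<Lambda> where \<Lambda>: "\<And>i j. i \<in> I \<Longrightarrow> j \<in> I \<Longrightarrow> (\<Sum>e\<in>E. \<Lambda> i e * v' j e) = (if i = j then 1 else 0)"
      by blast
    \<comment> \<open>Subtracting a multiple of \<open>\<mu>\<close> makes the functional vanish at
      \<open>v k\<close>; on \<open>v j\<close> it then takes the value of
      \<open>\<Lambda> i\<close> on the projection \<open>v' j\<close>.\<close>
    define L where "L i e = \<Lambda> i e - (\<Sum>e'\<in>E. \<Lambda> i e' * v k e') * \<mu> e" for i e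
    have Lv: "(\<Sum>e\<in>E. L i e * v j e) = (\<Sum>e\<in>E. \<Lambda> i e * v' j e)" for i j
    proof -
      have "(\<Sum>e\<in>E. L i e * v j e) = (\<Sum>e\<in>E. \<Lambda> i e * v j e) - (\<Sum>e'\<in>E. \<Lambda> i e' * v k e') * m j"
        unfolding L_def m_def by (simp add: left_diff_distrib sum_subtractf sum_distrib_left mult.assoc)
      also have "\<dots> = (\<Sum>e\<in>E. \<Lambda> i e * v' j e)"
        unfolding v'_def by (simp add: right_diff_distrib sum_subtractf sum_distrib_left sum_distrib_right mult_ac)
      finally show ?thesis .
    qed
    have mk: "m k = 1" using \<mu> by (simp add: m_def)
    have v'k: "v' k e = 0" for e by (simp add: v'_def mk)
    \<comment> \<open>The functional dual to \<open>v k\<close> is \<open>\<mu>\<close>, corrected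
      by the \<open>L j\<close> so that its values \<open>m j\<close> at the other vectors
      cancel.\<close>
    define M where "M i e = (if i = k then \<mu> e - (\<Sum>j\<in>I. m j * L j e) else L i e)" for i e
    have Mk: "(\<Sum>e\<in>E. M k e * v j e) = m j - (\<Sum>i\<in>I. m i * (\<Sum>e\<in>E. L i e * v j e))" for j
      unfolding M_def m_def[of j]
      by (simp add: left_diff_distrib sum_subtractf sum_distrib_right sum_distrib_left mult.assoc sum.swap[of _ I])
    have "(\<Sum>e\<in>E. M i e * v j e) = (if i = j then 1 else 0)" if "i \<in> insert k I" "j \<in> insert k I" for i j
    proof (cases "i = k")
      case True
      show ?thesis
      proof (cases "j = k")
        case True
        then show ?thesis using \<open>i = k\<close> by (simp add: Mk Lv v'k mk)
      next
        case False
        then have "j \<in> I" using that by simp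
        then have "(\<Sum>i\<in>I. m i * (\<Sum>e\<in>E. L i e * v j e)) = (\<Sum>i\<in>I. if i = j then m i else 0)"
          by (intro sum.cong) (auto simp: Lv \<Lambda>)
        then show ?thesis using \<open>i = k\<close> False \<open>j \<in> I\<close> fin by (simp add: Mk)
      qed
    next
      case False
      then have "(\<Sum>e\<in>E. M i e * v j e) = (\<Sum>e\<in>E. \<Lambda> i e * v' j e)" by (simp add: M_def Lv)
      then show ?thesis using False that \<Lambda> by (cases "j = k") (auto simp: v'k)
    qed
    then show ?case by blast
  qed simp
  then show thesis using that by blast
qed

section \<open>Expansion of products over words\<close>

section \<open>Sums over words\<close>

lemma words_0 [simp]: "words Y 0 = {[]}" by (auto simp: words_def)

lemma words_Suc: "words Y (Suc d) = (\<lambda>(x, w). x # w) ` (Y \<times> words Y d)"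
  by (force simp: words_def length_Suc_conv)

lemma finite_words: "finite Y \<Longrightarrow> finite (words Y d)"
  unfolding words_def using finite_lists_length_eq[of Y d] by (simp add: conj_commute)

lemma words_length: "w \<in> words Y d \<Longrightarrow> length w = d" by (simp add: words_def)

lemma words_nth: "w \<in> words Y d \<Longrightarrow> p < d \<Longrightarrow> w ! p \<in> Y" by (auto simp: words_def)

lemma wordsI: "length w = d \<Longrightarrow> (\<And>p. p < d \<Longrightarrow> w ! p \<in> Y) \<Longrightarrow> w \<in> words Y d"
  by (auto simp: words_def in_set_conv_nth)

lemma sum_words_Suc: "(\<Sum>w\<in>words Y (Suc d). f w) = (\<Sum>x\<in>Y. \<Sum>w\<in>words Y d. f (x # w))"
  unfolding words_Suc by (subst sum.reindex) (auto simp: inj_on_def sum.cartesian_product case_prod_unfold)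

text \<open>Distributivity, a word being a choice of one summand in each position. Through this
  identity computations with tensors reduce to computations with single letters.\<close>

lemma sum_words_prod:
  "(\<Sum>w\<in>words Y d. \<Prod>p<d. f p (w ! p)) = (\<Prod>p<d. \<Sum>x\<in>Y. (f p x :: 'k::comm_semiring_1))"
proof (induction d arbitrary: f)
  case (Suc d)
  have "(\<Sum>w\<in>words Y (Suc d). \<Prod>p<Suc d. f p (w ! p)) = (\<Sum>x\<in>Y. f 0 x * (\<Sum>w\<in>words Y d. \<Prod>p<d. f (Suc p) (w ! p)))"
    by (simp add: sum_words_Suc prod.lessThan_Suc_shift sum_distrib_left del: prod.lessThan_Suc)
  also have "\<dots> = (\<Prod>p<Suc d. \<Sum>x\<in>Y. f p x)"
    by (subst Suc.IH) (simp add: prod.lessThan_Suc_shift sum_distrib_right del: prod.lessThan_Suc)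
  finally show ?case .
qed simp

lemma prod_delta_words:
  assumes "length v = d" "length w = d"
  shows "(\<Prod>p<d. if v ! p = w ! p then 1 else 0) = (if v = w then 1 else (0::'k::comm_semiring_1))"
proof (cases "v = w")
  case False
  then obtain p where p: "p < d" "v ! p \<noteq> w ! p" using assms by (auto simp: list_eq_iff_nth_eq)
  have "(\<Prod>p<d. if v ! p = w ! p then 1 else (0::'k)) = 0"
    using p by (intro prod_zero) auto
  then show ?thesis using False by simp
qed simp

section \<open>Assembling one-position left multiplications into a tensor\<close>

section \<open>Tensor products of saturated submodules\<close>

text \<open>Each \<open>L i\<close> is a matrix and each \<open>\<Lambda> i\<close> a functional on
  matrices, dual to the family \<open>L\<close>. In the application \<open>L i j k\<close> is the
  coefficient at the \<open>j\<close>-th basis element of the \<open>i\<close>-th one times the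
  product of the \<open>k\<close>-th one with the idempotent.\<close>

locale dual_functionals =
  fixes I :: "'i set" and L :: "'i \<Rightarrow> 'i \<Rightarrow> 'i \<Rightarrow> 'k::idom" and \<Lambda> :: "'i \<Rightarrow> 'i \<Rightarrow> 'i \<Rightarrow> 'k"
  assumes finI: "finite I"
    and dual: "i \<in> I \<Longrightarrow> i' \<in> I \<Longrightarrow> (\<Sum>j\<in>I. \<Sum>k\<in>I. \<Lambda> i j k * L i' j k) = (if i = i' then 1 else 0)"
begin

definition slice :: "('i \<Rightarrow> 'i \<Rightarrow> 'k) \<Rightarrow> bool" where
  "slice f \<longleftrightarrow> (\<exists>a. \<forall>j\<in>I. \<forall>k\<in>I. f j k = (\<Sum>i\<in>I. a i * L i j k))"

text \<open>Duality makes the coefficients of a combination the values of the functionals, so they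
  depend linearly on the matrix. This linear choice is what the induction over positions rests
  on.\<close>

lemma slice_dual:
  assumes "slice f" "j \<in> I" "k \<in> I"
  shows "f j k = (\<Sum>i\<in>I. (\<Sum>j\<in>I. \<Sum>k\<in>I. \<Lambda> i j k * f j k) * L i j k)"
proof -
  obtain a where a: "\<And>j k. j \<in> I \<Longrightarrow> k \<in> I \<Longrightarrow> f j k = (\<Sum>i\<in>I. a i * L i j k)"
    using assms(1) by (auto simp: slice_def)
  have "(\<Sum>j\<in>I. \<Sum>k\<in>I. \<Lambda> i j k * f j k) = a i" if i: "i \<in> I" for i
  proof -
    have "(\<Sum>j\<in>I. \<Sum>k\<in>I. \<Lambda> i j k * f j k) = (\<Sum>j\<in>I. \<Sum>k\<in>I. \<Sum>i'\<in>I. a i' * (\<Lambda> i j k * L i' j k))"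
      using a by (auto intro!: sum.cong simp: sum_distrib_left mult.left_commute)
    also have "\<dots> = (\<Sum>j\<in>I. \<Sum>i'\<in>I. \<Sum>k\<in>I. a i' * (\<Lambda> i j k * L i' j k))"
      by (intro sum.cong refl sum.swap)
    also have "\<dots> = (\<Sum>i'\<in>I. \<Sum>j\<in>I. \<Sum>k\<in>I. a i' * (\<Lambda> i j k * L i' j k))"
      by (rule sum.swap)
    also have "\<dots> = (\<Sum>i'\<in>I. a i' * (if i = i' then 1 else 0))"
      using i by (intro sum.cong refl) (simp add: dual[symmetric] sum_distrib_left)
    also have "\<dots> = a i" using i finI by (simp add: if_distrib[of "\<lambda>c. _ * c"] sum.delta cong: if_cong)
    finally show ?thesis .
  qed
  then show ?thesis using a[OF assms(2,3)] by simp
qed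

lemma slice_sum:
  assumes "finite X'" "\<And>x. x \<in> X' \<Longrightarrow> slice (f x)"
  shows "slice (\<lambda>j k. \<Sum>x\<in>X'. c x * f x j k)"
proof -
  obtain a where *: "\<And>x j k. x \<in> X' \<Longrightarrow> j \<in> I \<Longrightarrow> k \<in> I \<Longrightarrow> f x j k = (\<Sum>i\<in>I. a x i * L i j k)"
    using assms(2) unfolding slice_def by metis
  have "(\<Sum>x\<in>X'. c x * f x j k) = (\<Sum>i\<in>I. (\<Sum>x\<in>X'. c x * a x i) * L i j k)" if "j \<in> I" "k \<in> I" for j k
  proof -
    have "(\<Sum>x\<in>X'. c x * f x j k) = (\<Sum>x\<in>X'. \<Sum>i\<in>I. c x * a x i * L i j k)"
      using * that by (intro sum.cong refl) (simp add: sum_distrib_left mult.assoc)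
    also have "\<dots> = (\<Sum>i\<in>I. \<Sum>x\<in>X'. c x * a x i * L i j k)" by (rule sum.swap)
    finally show ?thesis by (simp add: sum_distrib_right)
  qed
  then show ?thesis
    unfolding slice_def by (intro exI[of _ "\<lambda>i. \<Sum>x\<in>X'. c x * a x i"]) simp
qed

text \<open>Induction on the number of positions: contracting the first position by
  \<open>\<Lambda> i\<close> yields a function of words shorter by one letter whose slices are
  linear combinations of slices of \<open>\<Psi>\<close>, and \<open>slice_dual\<close> rebuilds
  \<open>\<Psi>\<close> from these contractions. The guard \<open>0 < d\<close> is there because
  \<open>d - 1\<close> is truncated at 0, where there is no position to vary.\<close>

lemma slices_imp_tensor:
  assumes "\<And>w1 w2 v1 v2. w1 @ w2 \<in> words I (d - 1) \<Longrightarrow> v1 @ v2 \<in> words I (d - 1) \<Longrightarrow>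
      length w1 = length v1 \<Longrightarrow> 0 < d \<Longrightarrow> slice (\<lambda>j k. \<Psi> (w1 @ j # w2) (v1 @ k # v2))"
  shows "\<exists>r. \<forall>w\<in>words I d. \<forall>v\<in>words I d. \<Psi> w v = (\<Sum>x\<in>words I d. r x * (\<Prod>p<d. L (x ! p) (w ! p) (v ! p)))"
  using assms
proof (induction d arbitrary: \<Psi>)
  case 0
  show ?case by (intro exI[of _ "\<lambda>_. \<Psi> [] []"]) simp
next
  case (Suc d)
  define \<Psi>' where "\<Psi>' i w v = (\<Sum>j\<in>I. \<Sum>k\<in>I. \<Lambda> i j k * \<Psi> (j # w) (k # v))" for i w v
  have ex: "\<exists>r. \<forall>w\<in>words I d. \<forall>v\<in>words I d. \<Psi>' i w v
      = (\<Sum>x\<in>words I d. r x * (\<Prod>p<d. L (x ! p) (w ! p) (v ! p)))" for i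
  proof (rule Suc.IH)
    fix w1 w2 v1 v2 :: "'i list"
    assume w: "w1 @ w2 \<in> words I (d - 1)" and v: "v1 @ v2 \<in> words I (d - 1)"
      and l: "length w1 = length v1" and d: "0 < d"
    have "slice (\<lambda>j k. \<Sum>x\<in>I\<times>I. \<Lambda> i (fst x) (snd x) * \<Psi> (fst x # w1 @ j # w2) (snd x # v1 @ k # v2))"
    proof (rule slice_sum)
      fix x assume x: "x \<in> I \<times> I"
      have "slice (\<lambda>j k. \<Psi> ((fst x # w1) @ j # w2) ((snd x # v1) @ k # v2))"
        using w v l d x by (intro Suc.prems) (auto simp: words_def)
      then show "slice (\<lambda>j k. \<Psi> (fst x # w1 @ j # w2) (snd x # v1 @ k # v2))" by simp
    qed (use finI in auto)
    then show "slice (\<lambda>j k. \<Psi>' i (w1 @ j # w2) (v1 @ k # v2))"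
      by (simp add: \<Psi>'_def sum.cartesian_product case_prod_unfold)
  qed
  define r where "r = (\<lambda>i. SOME r. \<forall>w\<in>words I d. \<forall>v\<in>words I d. \<Psi>' i w v
      = (\<Sum>x\<in>words I d. r x * (\<Prod>p<d. L (x ! p) (w ! p) (v ! p))))"
  have r: "\<Psi>' i w v = (\<Sum>x\<in>words I d. r i x * (\<Prod>p<d. L (x ! p) (w ! p) (v ! p)))"
    if "w \<in> words I d" "v \<in> words I d" for i w v
    using someI_ex[OF ex[of i]] that unfolding r_def by blast
  have "\<Psi> w v = (\<Sum>x\<in>words I (Suc d). r (hd x) (tl x) * (\<Prod>p<Suc d. L (x ! p) (w ! p) (v ! p)))"
    if wv: "w \<in> words I (Suc d)" "v \<in> words I (Suc d)" for w v
  proof -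
    obtain j w' k v' where w: "w = j # w'" "j \<in> I" "w' \<in> words I d" and v: "v = k # v'" "k \<in> I" "v' \<in> words I d"
      using wv unfolding words_Suc by fast
    have "slice (\<lambda>j k. \<Psi> ([] @ j # w') ([] @ k # v'))"
      using w v by (intro Suc.prems) auto
    from slice_dual[OF this w(2) v(2)] have "\<Psi> w v = (\<Sum>i\<in>I. \<Psi>' i w' v' * L i j k)"
      by (simp add: w v \<Psi>'_def)
    then show ?thesis
      by (simp add: r w v sum_words_Suc prod.lessThan_Suc_shift sum_distrib_right
          sum_distrib_left mult_ac
          del: prod.lessThan_Suc)
  qed
  then show ?case by (intro exI[of _ "\<lambda>x. r (hd x) (tl x)"]) simp
qed

text \<open>Products of dual families are dual again, so pairing with the product of the functionals
  \<open>\<Lambda> (y ! p)\<close> extracts the coefficient \<open>r y\<close>.\<close>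

lemma tensor_zero_imp:
  assumes z: "\<And>w v. w \<in> words I d \<Longrightarrow> v \<in> words I d \<Longrightarrow> (\<Sum>x\<in>words I d. r x * (\<Prod>p<d. L (x ! p) (w ! p) (v ! p))) = 0"
    and y: "y \<in> words I d"
  shows "r y = 0"
proof -
  let ?W = "words I d"
  have "(\<Sum>w\<in>?W. \<Sum>v\<in>?W. \<Prod>p<d. \<Lambda> (y ! p) (w ! p) (v ! p) * L (x ! p) (w ! p) (v ! p)) = (if y = x then 1 else 0)"
    if x: "x \<in> ?W" for x
  proof -
    have "(\<Sum>w\<in>?W. \<Sum>v\<in>?W. \<Prod>p<d. \<Lambda> (y ! p) (w ! p) (v ! p) * L (x ! p) (w ! p) (v ! p))
      = (\<Sum>w\<in>?W. \<Prod>p<d. \<Sum>k\<in>I. \<Lambda> (y ! p) (w ! p) k * L (x ! p) (w ! p) k)"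
      using sum_words_prod[of "\<lambda>p k. \<Lambda> (y ! p) (_ ! p) k * L (x ! p) (_ ! p) k" d I]
      by (intro sum.cong refl) (rule sum_words_prod)
    also have "\<dots> = (\<Prod>p<d. \<Sum>j\<in>I. \<Sum>k\<in>I. \<Lambda> (y ! p) j k * L (x ! p) j k)" by (rule sum_words_prod)
    also have "\<dots> = (\<Prod>p<d. if y ! p = x ! p then 1 else 0)"
      using x y by (intro prod.cong refl dual) (auto simp: words_nth)
    finally show ?thesis using x y by (simp add: prod_delta_words words_length)
  qed
  note one = this
  have "0 = (\<Sum>w\<in>?W. \<Sum>v\<in>?W. (\<Prod>p<d. \<Lambda> (y ! p) (w ! p) (v ! p)) * (\<Sum>x\<in>?W. r x * (\<Prod>p<d. L (x ! p) (w ! p) (v ! p))))"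
    using z by simp
  also have "\<dots> = (\<Sum>w\<in>?W. \<Sum>v\<in>?W. \<Sum>x\<in>?W. r x * (\<Prod>p<d. \<Lambda> (y ! p) (w ! p) (v ! p) * L (x ! p) (w ! p) (v ! p)))"
    by (simp add: sum_distrib_left prod.distrib mult.left_commute)
  also have "\<dots> = (\<Sum>w\<in>?W. \<Sum>x\<in>?W. \<Sum>v\<in>?W. r x * (\<Prod>p<d. \<Lambda> (y ! p) (w ! p) (v ! p) * L (x ! p) (w ! p) (v ! p)))"
    by (intro sum.cong refl sum.swap)
  also have "\<dots> = (\<Sum>x\<in>?W. \<Sum>w\<in>?W. \<Sum>v\<in>?W. r x * (\<Prod>p<d. \<Lambda> (y ! p) (w ! p) (v ! p) * L (x ! p) (w ! p) (v ! p)))"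
    by (rule sum.swap)
  also have "\<dots> = (\<Sum>x\<in>?W. r x * (if y = x then 1 else 0))"
    by (intro sum.cong refl) (simp only: sum_distrib_left[symmetric] one)
  also have "\<dots> = r y"
    using y finite_words[OF finI] by (simp add: if_distrib[of "\<lambda>c. _ * c"] sum.delta cong: if_cong)
  finally show ?thesis by simp
qed

end

section \<open>Koszul signs as exponents in the field with two elements\<close>

section \<open>Signs\<close>

text \<open>Parities are treated as elements of a field; rewriting sums and products to bit
  operations would take them out of reach of the ring lemmas.\<close>

declare add_bit_eq_xor [simp del] mult_bit_eq_and [simp del]

lemma bit_sign_0 [simp]: "bit_sign 0 = 1" by (simp add: bit_sign_def)

lemma bit_sign_add: "bit_sign (p + q) = (bit_sign p * bit_sign q :: 'k::comm_ring_1)"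
  by (cases p; cases q) (auto simp: bit_sign_def)

lemma bit_sign_square [simp]: "bit_sign p * bit_sign p = (1 :: 'k::comm_ring_1)"
  by (simp flip: bit_sign_add)

lemma bit_add_self [simp]: "p + p = (0 :: bit)"
  by (cases p) auto

lemma bit_mult_eq_1_iff [simp]: "p * q = (1 :: bit) \<longleftrightarrow> p = 1 \<and> q = 1"
  by (cases p) auto

lemma sum_list_replicate_0 [simp]: "sum_list (replicate n (0 :: bit)) = 0"
  by (induction n) auto

definition texp :: "bit list \<Rightarrow> bit list \<Rightarrow> bit" where
  "texp ps qs = (\<Sum>k<length ps. \<Sum>l<k. ps ! k * qs ! l)"

lemma tensor_sign_texp: "tensor_sign ps qs = bit_sign (texp ps qs)"
  by (simp add: tensor_sign_def texp_def)

lemma texp_Nil [simp]: "texp [] qs = 0" by (simp add: texp_def)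

lemma texp_Cons: "texp (p # ps) (q # qs) = texp ps qs + sum_list ps * q"
proof -
  have "texp (p # ps) (q # qs) = (\<Sum>k<length ps. ps ! k * q + (\<Sum>l<k. ps ! k * qs ! l))"
    by (simp add: texp_def sum.lessThan_Suc_shift del: sum.lessThan_Suc)
  also have "\<dots> = texp ps qs + (\<Sum>k<length ps. ps ! k) * q"
    by (simp add: sum.distrib texp_def sum_distrib_right add.commute)
  finally show ?thesis by (simp add: sum_list_sum_nth atLeast0LessThan)
qed

lemma texp_append:
  "length ps1 = length qs1 \<Longrightarrow> texp (ps1 @ ps2) (qs1 @ qs2) = texp ps1 qs1 + texp ps2 qs2 + sum_list ps2 * sum_list qs1"
  by (induction ps1 qs1 rule: list_induct2) (auto simp: texp_Cons algebra_simps)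

lemma texp_map2_add_left:
  "length ps = length qs \<Longrightarrow> length qs = length rs \<Longrightarrow> texp (map2 (+) ps qs) rs = texp ps rs + texp qs rs"
  by (simp add: texp_def sum.distrib[symmetric] distrib_right)

lemma texp_map2_add_right:
  "length ps = length qs \<Longrightarrow> length qs = length rs \<Longrightarrow> texp ps (map2 (+) qs rs) = texp ps qs + texp ps rs"
  by (simp add: texp_def sum.distrib[symmetric] distrib_left)

lemma texp_replicate_0_right [simp]: "length ps = n \<Longrightarrow> texp ps (replicate n 0) = 0"
  by (simp add: texp_def)

lemma texp_replicate_0_left [simp]: "texp (replicate n 0) ps = 0"
  by (simp add: texp_def)

lemma texp_single:
  assumes "length ps1 = n" "length ps2 = m"
  shows "texp (ps1 @ p # ps2) (replicate n 0 @ q # replicate m 0) = sum_list ps2 * q"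
  using assms by (simp add: texp_append texp_Cons)

definition pairs :: "nat \<Rightarrow> (nat \<times> nat) set" where
  "pairs d = {(a, b). a < b \<and> b < d}"

lemma finite_pairs [simp]: "finite (pairs d)"
  by (rule finite_subset[of _ "{..<d} \<times> {..<d}"]) (auto simp: pairs_def)

lemma texp_pairs: "length ps = d \<Longrightarrow> texp ps qs = (\<Sum>(a, b)\<in>pairs d. ps ! b * qs ! a)"
proof -
  assume d: "length ps = d"
  have "texp ps qs = (\<Sum>(b, a)\<in>(SIGMA b:{..<d}. {..<b}). ps ! b * qs ! a)"
    unfolding texp_def d by (subst sum.Sigma) auto
  also have "\<dots> = (\<Sum>(a, b)\<in>pairs d. ps ! b * qs ! a)"
    by (rule sum.reindex_bij_witness[where i = "\<lambda>(a, b). (b, a)" and j = "\<lambda>(b, a). (a, b)"])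
      (auto simp: pairs_def)
  finally show ?thesis .
qed

text \<open>The permutation may send an increasing pair to a decreasing one, which is then reversed;
  symmetry of \<open>g\<close> makes this invisible, so the sum ranges over unordered pairs.\<close>

lemma sum_pairs_permute:
  assumes \<tau>: "\<tau> permutes {..<d}" and sym: "\<And>a b. a \<noteq> b \<Longrightarrow> g a b = g b a"
  shows "(\<Sum>(a, b)\<in>pairs d. g (\<tau> a) (\<tau> b)) = (\<Sum>(a, b)\<in>pairs d. g a b)"
proof -
  let ?i = "inv_into UNIV \<tau>"
  have [simp]: "\<tau> x < d \<longleftrightarrow> x < d" "?i x < d \<longleftrightarrow> x < d" for x
    using permutes_in_image[OF \<tau>] permutes_in_image[OF permutes_inv[OF \<tau>]] by auto
  have [simp]: "\<tau> (?i x) = x" "?i (\<tau> x) = x" for x by (simp_all add: permutes_inverses[OF \<tau>])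
  have ne: "\<tau> a = \<tau> b \<longleftrightarrow> a = b" "?i a = ?i b \<longleftrightarrow> a = b" for a b
    using permutes_inj[OF \<tau>] permutes_inj[OF permutes_inv[OF \<tau>]] by (auto simp: inj_eq)
  show ?thesis
    by (rule sum.reindex_bij_witness[where
          j = "\<lambda>(a, b). if \<tau> a < \<tau> b then (\<tau> a, \<tau> b) else (\<tau> b, \<tau> a)" and
          i = "\<lambda>(a, b). if ?i a < ?i b then (?i a, ?i b) else (?i b, ?i a)"])
      (auto simp: pairs_def ne not_less le_less sym split: if_splits)
qed

text \<open>The exponent of the Koszul sign as a function of the parities after the permutation: the
  sum runs over the inversions of \<open>\<sigma>\<close> itself, whereas \<open>perm_sign\<close>
  counts inversions of the inverse among the parities before it.\<close>

definition psgn :: "nat \<Rightarrow> (nat \<Rightarrow> nat) \<Rightarrow> bit list \<Rightarrow> bit" where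
  "psgn d \<sigma> qs = (\<Sum>(a, b)\<in>pairs d. if \<sigma> b < \<sigma> a then qs ! a * qs ! b else 0)"

lemma permute_list_inverse [simp]:
  assumes "\<sigma> permutes {..<length w}"
  shows "permute_list \<sigma> (permute_list (inv_into UNIV \<sigma>) w) = w"
    and "permute_list (inv_into UNIV \<sigma>) (permute_list \<sigma> w) = w"
  using assms permutes_inv[OF assms]
  by (auto simp: permute_list_compose[symmetric] permutes_inv_o)

text \<open>Substituting \<open>\<sigma> a\<close> and \<open>\<sigma> b\<close> for the two
  positions turns inversions of the inverse into inversions of \<open>\<sigma>\<close>. The
  condition \<open>(a < b) = (\<sigma> a < \<sigma> b)\<close> is symmetric in \<open>a\<close> and
  \<open>b\<close>, which makes the reindexing of unordered pairs applicable.\<close>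

lemma perm_sign_psgn:
  fixes \<sigma> :: "nat \<Rightarrow> nat"
  assumes \<sigma>: "\<sigma> permutes {..<d}" and l: "length ps = d"
  shows "perm_sign \<sigma> ps = (bit_sign (psgn d \<sigma> (permute_list \<sigma> ps)) :: 'k::comm_ring_1)"
proof -
  let ?i = "inv_into UNIV \<sigma>"
  have \<sigma>': "\<sigma> permutes {..<length ps}" using \<sigma> l by simp
  define Q where "Q = {(k, l). k < l \<and> l < d \<and> ?i k > ?i l \<and> ps ! k = 1 \<and> ps ! l = 1}"
  have Q: "Q \<subseteq> pairs d" by (auto simp: Q_def pairs_def)
  have "perm_sign \<sigma> ps = (bit_sign (\<Sum>x\<in>Q. 1) :: 'k)"
  proof -
    have "finite Q" using Q finite_pairs finite_subset by blast
    then have "bit_sign (\<Sum>x\<in>Q. 1) = (-1 :: 'k) ^ card Q"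
      by (induction Q rule: finite_induct) (auto simp: bit_sign_add, simp add: bit_sign_def)
    then show ?thesis by (simp add: perm_sign_def Q_def l)
  qed
  also have "(\<Sum>x\<in>Q. 1 :: bit) = (\<Sum>(k, l)\<in>pairs d. if ?i l < ?i k then ps ! k * ps ! l else 0)"
  proof -
    have "(\<Sum>(k, l)\<in>pairs d. if ?i l < ?i k then ps ! k * ps ! l else 0)
        = (\<Sum>x\<in>Q. (case x of (k, l) \<Rightarrow> if ?i l < ?i k then ps ! k * ps ! l else 0))"
      using Q finite_pairs by (intro sum.mono_neutral_right) (auto simp: Q_def pairs_def split: if_splits)
    also have "\<dots> = (\<Sum>x\<in>Q. 1)" by (intro sum.cong) (auto simp: Q_def)
    finally show ?thesis by simp
  qed
  also have "\<dots> = (\<Sum>(a, b)\<in>pairs d. (\<lambda>a b. if (a < b) = (\<sigma> a < \<sigma> b) then 0 else ps ! \<sigma> a * ps ! \<sigma> b) (?i a) (?i b))"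
    using permutes_inj[OF permutes_inv[OF \<sigma>]]
    by (intro sum.cong refl) (auto simp: pairs_def permutes_inverses[OF \<sigma>] inj_eq linorder_neq_iff)
  also have "\<dots> = (\<Sum>(a, b)\<in>pairs d. if (a < b) = (\<sigma> a < \<sigma> b) then 0 else ps ! \<sigma> a * ps ! \<sigma> b)"
    using permutes_inj[OF \<sigma>]
    by (subst sum_pairs_permute[OF permutes_inv[OF \<sigma>]]) (auto simp: inj_eq linorder_neq_iff not_less)
  also have "\<dots> = psgn d \<sigma> (permute_list \<sigma> ps)"
    unfolding psgn_def using permutes_inj[OF \<sigma>]
    by (intro sum.cong refl) (auto simp: pairs_def permute_list_nth[OF \<sigma>'] l inj_eq linorder_neq_iff)
  finally show ?thesis .
qed

text \<open>A pair is reversed by the composition iff exactly one of the two steps reverses it, so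
  the exponents add up modulo 2. This cocycle identity makes the signed permutation of coordinates
  an action.\<close>

lemma psgn_comp:
  assumes \<sigma>: "\<sigma> permutes {..<d}" and \<tau>: "\<tau> permutes {..<d}" and l: "length qs = d"
  shows "psgn d (\<sigma> \<circ> \<tau>) qs = psgn d \<tau> qs + psgn d \<sigma> (permute_list (inv_into UNIV \<tau>) qs)"
proof -
  let ?i = "inv_into UNIV \<tau>"
  have i: "?i permutes {..<length qs}" using permutes_inv[OF \<tau>] l by simp
  have inj: "\<sigma> a = \<sigma> b \<longleftrightarrow> a = b" "\<tau> a = \<tau> b \<longleftrightarrow> a = b" for a b
    using permutes_inj[OF \<sigma>] permutes_inj[OF \<tau>] by (auto simp: inj_eq)
  have "psgn d \<sigma> (permute_list ?i qs)
      = (\<Sum>(a, b)\<in>pairs d. (\<lambda>a b. if (\<tau> a < \<tau> b) = (\<sigma> (\<tau> a) < \<sigma> (\<tau> b)) then 0 else qs ! a * qs ! b) (?i a) (?i b))"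
    unfolding psgn_def
    by (intro sum.cong refl)
      (auto simp: pairs_def permute_list_nth[OF i] l permutes_inverses[OF \<tau>] inj linorder_neq_iff)
  also have "\<dots> = (\<Sum>(a, b)\<in>pairs d. if (\<tau> a < \<tau> b) = (\<sigma> (\<tau> a) < \<sigma> (\<tau> b)) then 0 else qs ! a * qs ! b)"
    by (subst sum_pairs_permute[OF permutes_inv[OF \<tau>]]) (auto simp: inj linorder_neq_iff not_less)
  finally have e: "psgn d \<sigma> (permute_list ?i qs) = \<dots>" .
  show ?thesis
    unfolding e psgn_def[of d \<tau>] psgn_def[of d "\<sigma> \<circ> \<tau>"] sum.distrib[symmetric]
    by (intro sum.cong refl) (auto simp: pairs_def inj linorder_neq_iff)
qed

text \<open>This balance of signs makes the permutation action multiplicative: the word of sums is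
  the parity word of a product. The identity holds for every pair of positions separately.\<close>

lemma psgn_texp:
  assumes \<sigma>: "\<sigma> permutes {..<d}" and l: "length ps = d" "length qs = d"
  shows "psgn d \<sigma> (map2 (+) ps qs) + texp (permute_list (inv_into UNIV \<sigma>) ps) (permute_list (inv_into UNIV \<sigma>) qs)
    = texp ps qs + psgn d \<sigma> ps + psgn d \<sigma> qs"
proof -
  let ?i = "inv_into UNIV \<sigma>"
  have i: "?i permutes {..<length ps}" "?i permutes {..<length qs}" using permutes_inv[OF \<sigma>] l by simp_all
  have inj: "\<sigma> a = \<sigma> b \<longleftrightarrow> a = b" for a b using permutes_inj[OF \<sigma>] by (auto simp: inj_eq)
  have "texp (permute_list ?i ps) (permute_list ?i qs)
      = (\<Sum>(a, b)\<in>pairs d. (\<lambda>a b. if \<sigma> a < \<sigma> b then ps ! b * qs ! a else ps ! a * qs ! b) (?i a) (?i b))"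
    unfolding texp_pairs[of "permute_list ?i ps" d, simplified, OF l(1)]
    by (intro sum.cong refl)
      (auto simp: pairs_def permute_list_nth[OF i(1)] permute_list_nth[OF i(2)] l permutes_inverses[OF \<sigma>])
  also have "\<dots> = (\<Sum>(a, b)\<in>pairs d. if \<sigma> a < \<sigma> b then ps ! b * qs ! a else ps ! a * qs ! b)"
    by (subst sum_pairs_permute[OF permutes_inv[OF \<sigma>]]) (auto simp: inj not_less le_less)
  finally have e: "texp (permute_list ?i ps) (permute_list ?i qs) = \<dots>" .
  \<comment> \<open>For a pair kept in order both sides are \<open>ps ! b * qs ! a\<close>. For a
    reversed pair the product is expanded, and one of its mixed terms cancels against
    \<open>ps ! a * qs ! b\<close> modulo 2.\<close>
  have "(if \<sigma> b < \<sigma> a then (ps ! a + qs ! a) * (ps ! b + qs ! b) else 0)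
      + (if \<sigma> a < \<sigma> b then ps ! b * qs ! a else ps ! a * qs ! b)
    = ps ! b * qs ! a + (if \<sigma> b < \<sigma> a then ps ! a * ps ! b else 0) + (if \<sigma> b < \<sigma> a then qs ! a * qs ! b else 0)"
    if "a < b" for a b
  proof -
    have "\<sigma> a \<noteq> \<sigma> b" using that inj by simp
    then consider "\<sigma> a < \<sigma> b" | "\<sigma> b < \<sigma> a" by linarith
    then show ?thesis
      by cases (cases "ps ! a"; cases "ps ! b"; cases "qs ! a"; cases "qs ! b"; simp)+
  qed
  note key = this
  show ?thesis
    unfolding e psgn_def texp_pairs[OF l(1)] sum.distrib[symmetric]
  proof (rule sum.cong[OF refl])
    fix x assume "x \<in> pairs d"
    then obtain a b where x: "x = (a, b)" "a < b" "b < d" by (auto simp: pairs_def)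
    then have "map2 (+) ps qs ! a = ps ! a + qs ! a" "map2 (+) ps qs ! b = ps ! b + qs ! b" using l by simp_all
    then show "(case x of (a, b) \<Rightarrow> if \<sigma> b < \<sigma> a then map2 (+) ps qs ! a * map2 (+) ps qs ! b else 0)
        + (case x of (a, b) \<Rightarrow> if \<sigma> a < \<sigma> b then ps ! b * qs ! a else ps ! a * qs ! b)
      = (case x of (a, b) \<Rightarrow> ps ! b * qs ! a) + (case x of (a, b) \<Rightarrow> if \<sigma> b < \<sigma> a then ps ! a * ps ! b else 0)
        + (case x of (a, b) \<Rightarrow> if \<sigma> b < \<sigma> a then qs ! a * qs ! b else 0)"
      using key[OF x(2)] unfolding x(1) by (simp only: prod.case)
  qed
qed

lemma psgn_id [simp]: "psgn d id qs = 0"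
  unfolding psgn_def by (intro sum.neutral) (auto simp: pairs_def)

section \<open>Tensor powers as functions on words, with signed product and signed
  permutations\<close>

section \<open>Tensor powers in coordinates\<close>

lemma sum_fun_apply: "(\<Sum>a\<in>J. f a) x = (\<Sum>a\<in>J. f a x)"
  by (induction J rule: infinite_finite_induct) auto

text \<open>
  Structure constants of a superalgebra with the finite homogeneous basis \<open>(e\<^sub>i)\<close>:
  \<open>e\<^sub>j e\<^sub>k = \<Sum>\<^sub>i c i j k e\<^sub>i\<close> and \<open>1 = \<Sum>\<^sub>i o1 i e\<^sub>i\<close>.
\<close>

locale graded_consts =
  fixes I :: "'i set" and par :: "'i \<Rightarrow> bit" and c :: "'i \<Rightarrow> 'i \<Rightarrow> 'i \<Rightarrow> 'k::comm_ring_1"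
    and o1 :: "'i \<Rightarrow> 'k" and d :: nat
  assumes finI: "finite I"
    and par_c: "i \<in> I \<Longrightarrow> j \<in> I \<Longrightarrow> k \<in> I \<Longrightarrow> c i j k \<noteq> 0 \<Longrightarrow> par i = par j + par k"
    and c_assoc: "i \<in> I \<Longrightarrow> j \<in> I \<Longrightarrow> k \<in> I \<Longrightarrow> m \<in> I \<Longrightarrow>
      (\<Sum>l\<in>I. c m l k * c l i j) = (\<Sum>l\<in>I. c m i l * c l j k)"
    and c_one_l: "i \<in> I \<Longrightarrow> j \<in> I \<Longrightarrow> (\<Sum>l\<in>I. c i l j * o1 l) = (if i = j then 1 else 0)"
    and c_one_r: "i \<in> I \<Longrightarrow> j \<in> I \<Longrightarrow> (\<Sum>l\<in>I. c i j l * o1 l) = (if i = j then 1 else 0)"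
    and par_o1: "i \<in> I \<Longrightarrow> o1 i \<noteq> 0 \<Longrightarrow> par i = 0"
begin

abbreviation "W \<equiv> words I d"
abbreviation "pars w \<equiv> map par w"
abbreviation sg :: "'i list \<Rightarrow> 'i list \<Rightarrow> 'k" where "sg x y \<equiv> bit_sign (texp (pars x) (pars y))"

definition cw :: "'i list \<Rightarrow> 'i list \<Rightarrow> 'i list \<Rightarrow> 'k" where
  "cw w x y = (\<Prod>p<d. c (w ! p) (x ! p) (y ! p))"

definition conv :: "('i list \<Rightarrow> 'k) \<Rightarrow> ('i list \<Rightarrow> 'k) \<Rightarrow> 'i list \<Rightarrow> 'k" (infixl \<open>\<star>\<close> 70) where
  "conv f g = (\<lambda>w. if w \<in> W then \<Sum>x\<in>W. \<Sum>y\<in>W. sg x y * cw w x y * (f x * g y) else 0)"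

text \<open>Vanishing off \<open>W\<close> lets a coordinate function and its tensor determine each
  other, so that equality of tensors is equality of functions.\<close>

definition TC :: "('i list \<Rightarrow> 'k) set" where
  "TC = {f. \<forall>w. w \<notin> W \<longrightarrow> f w = 0}"

definition tens :: "('i \<Rightarrow> 'k) list \<Rightarrow> 'i list \<Rightarrow> 'k" where
  "tens zs = (\<lambda>w. if w \<in> W then \<Prod>p<d. (zs ! p) (w ! p) else 0)"

definition T1 :: "'i list \<Rightarrow> 'k" where "T1 = tens (replicate d o1)"

definition scal :: "'k \<Rightarrow> ('i list \<Rightarrow> 'k) \<Rightarrow> 'i list \<Rightarrow> 'k" where "scal a f = (\<lambda>w. a * f w)"

text \<open>Coordinates move against tensors: the value at \<open>v\<close> is taken from the word
  that \<open>\<sigma>\<close> carries to \<open>v\<close>, and the sign is read off the parities of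
  \<open>v\<close>, that is, after the permutation.\<close>

definition actf :: "(nat \<Rightarrow> nat) \<Rightarrow> ('i list \<Rightarrow> 'k) \<Rightarrow> 'i list \<Rightarrow> 'k" where
  "actf \<sigma> f = (\<lambda>v. if v \<in> W then bit_sign (psgn d \<sigma> (pars v)) * f (permute_list (inv_into UNIV \<sigma>) v) else 0)"

lemma finW: "finite W" using finite_words[OF finI] .

lemma W_length: "w \<in> W \<Longrightarrow> length w = d" by (simp add: words_def)

lemma W_nth: "w \<in> W \<Longrightarrow> p < d \<Longrightarrow> w ! p \<in> I" by (auto simp: words_def)

lemma TC_out: "f \<in> TC \<Longrightarrow> w \<notin> W \<Longrightarrow> f w = 0" by (simp add: TC_def)

lemma TC_eqI: "f \<in> TC \<Longrightarrow> g \<in> TC \<Longrightarrow> (\<And>w. w \<in> W \<Longrightarrow> f w = g w) \<Longrightarrow> f = g"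
  by (rule ext) (metis TC_out)

lemma conv_TC [simp]: "f \<star> g \<in> TC" by (simp add: TC_def conv_def)
lemma tens_TC [simp]: "tens zs \<in> TC" by (simp add: TC_def tens_def)
lemma actf_TC [simp]: "actf \<sigma> f \<in> TC" by (simp add: TC_def actf_def)

lemma cw_pars:
  assumes "cw w x y \<noteq> 0" "w \<in> W" "x \<in> W" "y \<in> W"
  shows "pars w = map2 (+) (pars x) (pars y)"
proof -
  have "c (w ! p) (x ! p) (y ! p) \<noteq> 0" if "p < d" for p
    using assms(1) that unfolding cw_def by (metis prod_zero finite_lessThan lessThan_iff)
  then have "par (w ! p) = par (x ! p) + par (y ! p)" if "p < d" for p
    using assms that by (intro par_c) (auto simp: W_nth)
  then show ?thesis using assms by (intro nth_equalityI) (auto simp: W_length)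
qed

lemma cw_assoc:
  assumes "w \<in> W" "x \<in> W" "y \<in> W" "z \<in> W"
  shows "(\<Sum>t\<in>W. cw w t z * cw t x y) = (\<Sum>t\<in>W. cw w x t * cw t y z)"
proof -
  have "(\<Sum>t\<in>W. cw w t z * cw t x y) = (\<Prod>p<d. \<Sum>l\<in>I. c (w ! p) l (z ! p) * c l (x ! p) (y ! p))"
    unfolding cw_def prod.distrib[symmetric] by (rule sum_words_prod)
  also have "\<dots> = (\<Prod>p<d. \<Sum>l\<in>I. c (w ! p) (x ! p) l * c l (y ! p) (z ! p))"
    using assms by (intro prod.cong refl c_assoc) (auto simp: W_nth)
  also have "\<dots> = (\<Sum>t\<in>W. cw w x t * cw t y z)"
    unfolding cw_def prod.distrib[symmetric] by (rule sum_words_prod[symmetric])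
  finally show ?thesis .
qed

lemma sum4_rotate:
  fixes g :: "'a \<Rightarrow> 'b \<Rightarrow> 'c \<Rightarrow> 'd \<Rightarrow> 'e::comm_monoid_add"
  shows "(\<Sum>a\<in>A. \<Sum>b\<in>B. \<Sum>c\<in>C. \<Sum>d\<in>D. g a b c d) = (\<Sum>c\<in>C. \<Sum>d\<in>D. \<Sum>b\<in>B. \<Sum>a\<in>A. g a b c d)"
proof -
  have "(\<Sum>a\<in>A. \<Sum>b\<in>B. \<Sum>c\<in>C. \<Sum>d\<in>D. g a b c d) = (\<Sum>a\<in>A. \<Sum>c\<in>C. \<Sum>b\<in>B. \<Sum>d\<in>D. g a b c d)"
    by (rule sum.cong[OF refl], rule sum.swap)
  also have "\<dots> = (\<Sum>c\<in>C. \<Sum>a\<in>A. \<Sum>b\<in>B. \<Sum>d\<in>D. g a b c d)" by (rule sum.swap)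
  also have "\<dots> = (\<Sum>c\<in>C. \<Sum>a\<in>A. \<Sum>d\<in>D. \<Sum>b\<in>B. g a b c d)"
    by (rule sum.cong[OF refl], rule sum.cong[OF refl], rule sum.swap)
  also have "\<dots> = (\<Sum>c\<in>C. \<Sum>d\<in>D. \<Sum>a\<in>A. \<Sum>b\<in>B. g a b c d)"
    by (rule sum.cong[OF refl], rule sum.swap)
  also have "\<dots> = (\<Sum>c\<in>C. \<Sum>d\<in>D. \<Sum>b\<in>B. \<Sum>a\<in>A. g a b c d)"
    by (rule sum.cong[OF refl], rule sum.cong[OF refl], rule sum.swap)
  finally show ?thesis .
qed

text \<open>An intermediate word with nonzero structure constant has the sum of the parities of its
  factors, so both bracketings carry the sign \<open>sg x y * sg x z * sg y z\<close>. What remains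
  is associativity of the unsigned constants, which holds letter by letter.\<close>

lemma conv_assoc: "f \<star> g \<star> h = f \<star> (g \<star> h)"
proof (rule TC_eqI)
  fix w assume w: "w \<in> W"
  let ?s = "\<lambda>x y z. sg x y * sg x z * sg y z"
  have l: "(\<Sum>t\<in>W. sg t z * cw w t z * (sg x y * cw t x y)) = ?s x y z * (\<Sum>t\<in>W. cw w t z * cw t x y)"
    if "x \<in> W" "y \<in> W" "z \<in> W" for x y z
    unfolding sum_distrib_left
  proof (intro sum.cong refl)
    fix t assume t: "t \<in> W"
    show "sg t z * cw w t z * (sg x y * cw t x y) = ?s x y z * (cw w t z * cw t x y)"
    proof (cases "cw t x y = 0")
      case False
      then show ?thesis using cw_pars[OF False t] that
        by (simp add: texp_map2_add_left W_length bit_sign_add mult_ac)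
    qed simp
  qed
  have r: "(\<Sum>t\<in>W. sg x t * cw w x t * (sg y z * cw t y z)) = ?s x y z * (\<Sum>t\<in>W. cw w x t * cw t y z)"
    if "x \<in> W" "y \<in> W" "z \<in> W" for x y z
    unfolding sum_distrib_left
  proof (intro sum.cong refl)
    fix t assume t: "t \<in> W"
    show "sg x t * cw w x t * (sg y z * cw t y z) = ?s x y z * (cw w x t * cw t y z)"
    proof (cases "cw t y z = 0")
      case False
      then show ?thesis using cw_pars[OF False t] that
        by (simp add: texp_map2_add_right W_length bit_sign_add mult_ac)
    qed simp
  qed
  have "(f \<star> g \<star> h) w = (\<Sum>t\<in>W. \<Sum>z\<in>W. \<Sum>x\<in>W. \<Sum>y\<in>W. sg t z * cw w t z * (sg x y * cw t x y) * (f x * g y * h z))"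
    using w by (simp add: conv_def sum_distrib_left sum_distrib_right mult_ac)
  also have "\<dots> = (\<Sum>x\<in>W. \<Sum>y\<in>W. \<Sum>z\<in>W. \<Sum>t\<in>W. sg t z * cw w t z * (sg x y * cw t x y) * (f x * g y * h z))"
    by (rule sum4_rotate)
  also have "\<dots> = (\<Sum>x\<in>W. \<Sum>y\<in>W. \<Sum>z\<in>W. \<Sum>t\<in>W. sg x t * cw w x t * (sg y z * cw t y z) * (f x * g y * h z))"
  proof (rule sum.cong[OF refl], rule sum.cong[OF refl], rule sum.cong[OF refl])
    fix x y z assume "x \<in> W" "y \<in> W" "z \<in> W"
    then show "(\<Sum>t\<in>W. sg t z * cw w t z * (sg x y * cw t x y) * (f x * g y * h z))
        = (\<Sum>t\<in>W. sg x t * cw w x t * (sg y z * cw t y z) * (f x * g y * h z))"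
      unfolding sum_distrib_right[symmetric] using w by (simp add: l r cw_assoc)
  qed
  also have "\<dots> = (\<Sum>x\<in>W. \<Sum>t\<in>W. \<Sum>y\<in>W. \<Sum>z\<in>W. sg x t * cw w x t * (sg y z * cw t y z) * (f x * g y * h z))"
    (is "(\<Sum>x\<in>W. \<Sum>y\<in>W. \<Sum>z\<in>W. \<Sum>t\<in>W. ?F x y z t) = _")
  proof (rule sum.cong[OF refl])
    fix x
    have "(\<Sum>y\<in>W. \<Sum>z\<in>W. \<Sum>t\<in>W. ?F x y z t) = (\<Sum>y\<in>W. \<Sum>t\<in>W. \<Sum>z\<in>W. ?F x y z t)"
      by (rule sum.cong[OF refl], rule sum.swap)
    also have "\<dots> = (\<Sum>t\<in>W. \<Sum>y\<in>W. \<Sum>z\<in>W. ?F x y z t)" by (rule sum.swap)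
    finally show "(\<Sum>y\<in>W. \<Sum>z\<in>W. \<Sum>t\<in>W. ?F x y z t) = (\<Sum>t\<in>W. \<Sum>y\<in>W. \<Sum>z\<in>W. ?F x y z t)" .
  qed
  also have "\<dots> = (f \<star> (g \<star> h)) w"
    using w by (simp add: conv_def sum_distrib_left sum_distrib_right mult_ac)
  finally show "(f \<star> g \<star> h) w = (f \<star> (g \<star> h)) w" .
qed simp_all

lemma conv_add_l: "(f + g) \<star> h = f \<star> h + g \<star> h"
  by (rule ext) (simp add: conv_def distrib_left distrib_right sum.distrib)

lemma conv_add_r: "h \<star> (f + g) = h \<star> f + h \<star> g"
  by (rule ext) (simp add: conv_def distrib_left distrib_right sum.distrib)

lemma conv_scal_l: "scal a f \<star> g = scal a (f \<star> g)"
  by (rule ext) (simp add: conv_def scal_def sum_distrib_left mult_ac)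

lemma conv_scal_r: "f \<star> scal a g = scal a (f \<star> g)"
  by (rule ext) (simp add: conv_def scal_def sum_distrib_left mult_ac)

text \<open>The matrix of right multiplication by \<open>y\<close>: the entry is the coefficient at
  the \<open>i\<close>-th basis element of the \<open>j\<close>-th one times \<open>y\<close>.
  Products of such entries over the positions describe right multiplication by pure tensors.\<close>

definition R :: "('i \<Rightarrow> 'k) \<Rightarrow> 'i \<Rightarrow> 'i \<Rightarrow> 'k" where
  "R y i j = (\<Sum>k\<in>I. c i j k * y k)"

definition homog :: "bit \<Rightarrow> ('i \<Rightarrow> 'k) \<Rightarrow> bool" where
  "homog q y \<longleftrightarrow> (\<forall>i\<in>I. y i \<noteq> 0 \<longrightarrow> par i = q)"

definition lmul :: "('i \<Rightarrow> 'k) \<Rightarrow> ('i \<Rightarrow> 'k) \<Rightarrow> 'i \<Rightarrow> 'k" where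
  "lmul x y = (\<lambda>i. if i \<in> I then \<Sum>j\<in>I. R y i j * x j else 0)"

lemma homog_o1: "homog 0 o1" using par_o1 by (auto simp: homog_def)

lemma R_o1: "i \<in> I \<Longrightarrow> j \<in> I \<Longrightarrow> R o1 i j = (if i = j then 1 else 0)"
  by (simp add: R_def c_one_r)

lemma R_par: "homog q y \<Longrightarrow> i \<in> I \<Longrightarrow> j \<in> I \<Longrightarrow> R y i j \<noteq> 0 \<Longrightarrow> par i = par j + q"
proof -
  assume a: "homog q y" "i \<in> I" "j \<in> I" "R y i j \<noteq> 0"
  then obtain k where k: "k \<in> I" "c i j k * y k \<noteq> 0" unfolding R_def by (metis (no_types, lifting) sum.neutral)
  then have "c i j k \<noteq> 0" "y k \<noteq> 0" by auto
  then show "par i = par j + q" using par_c[of i j k] a k by (auto simp: homog_def)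
qed

text \<open>A pure tensor of homogeneous letters is supported on words with parities
  \<open>qs\<close>, so the interchange sign depends on the left word only and the remaining sum
  factors over the positions.\<close>

lemma conv_tens:
  assumes "w \<in> W" and l: "length qs = d" and h: "\<And>p. p < d \<Longrightarrow> homog (qs ! p) (ys ! p)"
  shows "(f \<star> tens ys) w = (\<Sum>x\<in>W. bit_sign (texp (pars x) qs) * (\<Prod>p<d. R (ys ! p) (w ! p) (x ! p)) * f x)"
proof -
  have "(\<Sum>y\<in>W. sg x y * cw w x y * (f x * tens ys y))
    = bit_sign (texp (pars x) qs) * (\<Prod>p<d. R (ys ! p) (w ! p) (x ! p)) * f x" if x: "x \<in> W" for x
  proof -
    have s: "sg x y * tens ys y = bit_sign (texp (pars x) qs) * tens ys y" if y: "y \<in> W" for y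
    proof (cases "tens ys y = 0")
      case False
      then have "(ys ! p) (y ! p) \<noteq> 0" if "p < d" for p
        using that y unfolding tens_def by (metis finite_lessThan lessThan_iff prod_zero)
      then have "pars y = qs"
        using h y l by (intro nth_equalityI) (auto simp: W_length homog_def W_nth)
      then show ?thesis by simp
    qed simp
    have "(\<Sum>y\<in>W. sg x y * cw w x y * (f x * tens ys y))
      = (\<Sum>y\<in>W. bit_sign (texp (pars x) qs) * f x * (\<Prod>p<d. c (w ! p) (x ! p) (y ! p) * (ys ! p) (y ! p)))"
    proof (intro sum.cong refl)
      fix y assume y: "y \<in> W"
      have "sg x y * cw w x y * (f x * tens ys y) = cw w x y * f x * (sg x y * tens ys y)" by (simp add: mult_ac)
      also have "\<dots> = bit_sign (texp (pars x) qs) * f x * (cw w x y * tens ys y)"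
        unfolding s[OF y] by (simp add: mult_ac)
      finally show "sg x y * cw w x y * (f x * tens ys y)
          = bit_sign (texp (pars x) qs) * f x * (\<Prod>p<d. c (w ! p) (x ! p) (y ! p) * (ys ! p) (y ! p))"
        using y by (simp add: tens_def cw_def prod.distrib)
    qed
    also have "\<dots> = bit_sign (texp (pars x) qs) * f x * (\<Prod>p<d. R (ys ! p) (w ! p) (x ! p))"
      unfolding sum_distrib_left[symmetric] R_def by (subst sum_words_prod) (rule refl)
    finally show ?thesis by (simp add: mult_ac)
  qed
  then show ?thesis using assms(1) by (simp add: conv_def)
qed

lemma tens_conv_tens:
  assumes l: "length xs = d" "length ys = d" "length ps = d" "length qs = d"
    and hx: "\<And>p. p < d \<Longrightarrow> homog (ps ! p) (xs ! p)" and hy: "\<And>p. p < d \<Longrightarrow> homog (qs ! p) (ys ! p)"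
  shows "tens xs \<star> tens ys = scal (bit_sign (texp ps qs)) (tens (map2 lmul xs ys))"
proof (rule TC_eqI)
  fix w assume w: "w \<in> W"
  have s: "bit_sign (texp (pars x) qs) * tens xs x = bit_sign (texp ps qs) * tens xs x" if x: "x \<in> W" for x
  proof (cases "tens xs x = 0")
    case False
    then have "(xs ! p) (x ! p) \<noteq> 0" if "p < d" for p
      using that x unfolding tens_def by (metis finite_lessThan lessThan_iff prod_zero)
    then have "pars x = ps"
      using hx x l by (intro nth_equalityI) (auto simp: W_length homog_def W_nth)
    then show ?thesis by simp
  qed simp
  have "(tens xs \<star> tens ys) w = (\<Sum>x\<in>W. bit_sign (texp (pars x) qs) * (\<Prod>p<d. R (ys ! p) (w ! p) (x ! p)) * tens xs x)"
    by (rule conv_tens[OF w l(4) hy])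
  also have "\<dots> = (\<Sum>x\<in>W. bit_sign (texp ps qs) * (\<Prod>p<d. R (ys ! p) (w ! p) (x ! p) * (xs ! p) (x ! p)))"
  proof (intro sum.cong refl)
    fix x assume x: "x \<in> W"
    have "bit_sign (texp (pars x) qs) * (\<Prod>p<d. R (ys ! p) (w ! p) (x ! p)) * tens xs x
        = (\<Prod>p<d. R (ys ! p) (w ! p) (x ! p)) * (bit_sign (texp (pars x) qs) * tens xs x)" by simp
    then show "bit_sign (texp (pars x) qs) * (\<Prod>p<d. R (ys ! p) (w ! p) (x ! p)) * tens xs x
        = bit_sign (texp ps qs) * (\<Prod>p<d. R (ys ! p) (w ! p) (x ! p) * (xs ! p) (x ! p))"
      unfolding s[OF x] using x by (simp add: tens_def prod.distrib mult_ac)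
  qed
  also have "\<dots> = bit_sign (texp ps qs) * (\<Prod>p<d. \<Sum>j\<in>I. R (ys ! p) (w ! p) j * (xs ! p) j)"
    unfolding sum_distrib_left[symmetric] by (subst sum_words_prod) (rule refl)
  also have "\<dots> = scal (bit_sign (texp ps qs)) (tens (map2 lmul xs ys)) w"
    using w l by (simp add: tens_def lmul_def W_nth scal_def)
  finally show "(tens xs \<star> tens ys) w = scal (bit_sign (texp ps qs)) (tens (map2 lmul xs ys)) w" .
qed (auto simp: TC_def scal_def tens_def conv_def)

lemma scal_1 [simp]: "scal 1 g = g" by (simp add: scal_def)

lemma tens_conv_even:
  assumes "length xs = d" "length ys = d"
    and "\<And>p. p < d \<Longrightarrow> homog 0 (xs ! p)" "\<And>p. p < d \<Longrightarrow> homog 0 (ys ! p)"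
  shows "tens xs \<star> tens ys = tens (map2 lmul xs ys)"
  using tens_conv_tens[OF assms(1,2), of "replicate d 0" "replicate d 0"] assms(3,4) by simp

lemma conv_T1: "f \<in> TC \<Longrightarrow> f \<star> T1 = f"
proof (rule TC_eqI)
  fix w assume w: "w \<in> W" 
  have "(f \<star> T1) w = (\<Sum>x\<in>W. (\<Prod>p<d. if w ! p = x ! p then 1 else 0) * f x)"
    unfolding T1_def using w
    by (subst conv_tens[where qs = "replicate d 0"])
      (auto intro!: sum.cong prod.cong simp: homog_o1 W_length R_o1 W_nth)
  also have "\<dots> = (\<Sum>x\<in>W. if w = x then f x else 0)"
    using w by (intro sum.cong refl) (simp add: prod_delta_words W_length)
  finally show "(f \<star> T1) w = f w" using w finW by simp
qed simp_all

lemma T1_conv: "f \<in> TC \<Longrightarrow> T1 \<star> f = f"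
proof (rule TC_eqI)
  fix w assume w: "w \<in> W"
  have "(T1 \<star> f) w = (\<Sum>x\<in>W. \<Sum>y\<in>W. cw w x y * T1 x * f y)"
  proof -
    have "sg x y * cw w x y * (T1 x * f y) = cw w x y * T1 x * f y" if x: "x \<in> W" for x y
    proof (cases "T1 x = 0")
      case False
      have "T1 x = (\<Prod>p<d. o1 (x ! p))" using x by (simp add: T1_def tens_def)
      then have "o1 (x ! p) \<noteq> 0" if "p < d" for p
        using that False prod_zero[of "{..<d}" "\<lambda>p. o1 (x ! p)"] by auto
      then have "pars x = replicate d 0"
        using x by (intro nth_equalityI) (auto simp: W_length par_o1 W_nth)
      then show ?thesis by simp
    qed simp
    then show ?thesis using w by (simp add: conv_def)
  qed
  also have "\<dots> = (\<Sum>y\<in>W. \<Sum>x\<in>W. cw w x y * T1 x * f y)" by (rule sum.swap)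
  also have "\<dots> = (\<Sum>y\<in>W. if w = y then f y else 0)"
  proof (intro sum.cong refl)
    fix y assume y: "y \<in> W"
    have "(\<Sum>x\<in>W. cw w x y * T1 x) = (\<Sum>x\<in>W. \<Prod>p<d. c (w ! p) (x ! p) (y ! p) * o1 (x ! p))"
      by (intro sum.cong refl) (simp add: cw_def T1_def tens_def prod.distrib)
    also have "\<dots> = (\<Prod>p<d. if w ! p = y ! p then 1 else 0)"
      using w y by (subst sum_words_prod) (auto intro!: prod.cong c_one_l simp: W_nth)
    also have "\<dots> = (if w = y then 1 else 0)" using w y by (simp add: prod_delta_words W_length)
    finally show "(\<Sum>x\<in>W. cw w x y * T1 x * f y) = (if w = y then f y else 0)"
      by (simp add: sum_distrib_right[symmetric])
  qed
  finally show "(T1 \<star> f) w = f w" using w finW by simp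
qed simp_all

lemma calg_TC: "calg TC (\<star>) T1 scal"
proof
  show "0 \<in> TC" by (simp add: TC_def)
qed (auto simp: conv_assoc conv_add_l conv_add_r conv_scal_l conv_scal_r T1_conv conv_T1,
    auto simp: TC_def T1_def tens_def scal_def)

lemma permute_W: "\<sigma> permutes {..<d} \<Longrightarrow> w \<in> W \<Longrightarrow> permute_list \<sigma> w \<in> W"
  by (simp add: words_def)

lemma permute_inv_W: "\<sigma> permutes {..<d} \<Longrightarrow> w \<in> W \<Longrightarrow> permute_list (inv_into UNIV \<sigma>) w \<in> W"
  using permute_W[OF permutes_inv] .

lemma cw_permute:
  assumes \<sigma>: "\<sigma> permutes {..<d}" and w: "w \<in> W" "x \<in> W" "y \<in> W"
  shows "cw (permute_list \<sigma> w) (permute_list \<sigma> x) (permute_list \<sigma> y) = cw w x y"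
proof -
  have "cw (permute_list \<sigma> w) (permute_list \<sigma> x) (permute_list \<sigma> y)
      = (\<Prod>p<d. c (w ! \<sigma> p) (x ! \<sigma> p) (y ! \<sigma> p))"
    unfolding cw_def using w \<sigma> by (intro prod.cong refl) (simp add: permute_list_nth W_length)
  also have "\<dots> = cw w x y"
    unfolding cw_def using prod.permute[OF \<sigma>, of "\<lambda>p. c (w ! p) (x ! p) (y ! p)"] by simp
  finally show ?thesis .
qed

text \<open>Both summation words are reindexed by the permutation. The unsigned structure constants
  do not change, and where they are nonzero the parities add up, so \<open>psgn_texp\<close>
  balances the signs.\<close>

lemma actf_conv:
  assumes \<sigma>: "\<sigma> permutes {..<d}"
  shows "actf \<sigma> (f \<star> g) = actf \<sigma> f \<star> actf \<sigma> g"
proof (rule TC_eqI)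
  fix v assume v: "v \<in> W"
  let ?i = "permute_list (inv_into UNIV \<sigma>)"
  have bij: "bij_betw ?i W W"
  proof (rule bij_betw_byWitness[where f' = "permute_list \<sigma>"])
    show "?i ` W \<subseteq> W" using permute_inv_W[OF \<sigma>] by blast
    show "permute_list \<sigma> ` W \<subseteq> W" using permute_W[OF \<sigma>] by blast
  qed (use \<sigma> in \<open>auto simp: W_length\<close>)
  have r: "(\<Sum>x\<in>W. F x) = (\<Sum>x\<in>W. F (?i x))" for F :: "'i list \<Rightarrow> 'k"
    using sum.reindex_bij_betw[OF bij, of F] by simp
  have "actf \<sigma> (f \<star> g) v = (\<Sum>x\<in>W. \<Sum>y\<in>W. bit_sign (psgn d \<sigma> (pars v)) * (sg x y * cw (?i v) x y * (f x * g y)))"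
    using v permute_inv_W[OF \<sigma> v] by (simp add: actf_def conv_def sum_distrib_left)
  also have "\<dots> = (\<Sum>x\<in>W. \<Sum>y\<in>W. bit_sign (psgn d \<sigma> (pars v)) * (sg (?i x) (?i y) * cw (?i v) (?i x) (?i y) * (f (?i x) * g (?i y))))"
    by (subst r, rule sum.cong[OF refl], rule r)
  also have "\<dots> = (\<Sum>x\<in>W. \<Sum>y\<in>W. sg x y * cw v x y * (actf \<sigma> f x * actf \<sigma> g y))"
  proof (intro sum.cong refl)
    fix x y assume x: "x \<in> W" and y: "y \<in> W"
    have cwi: "cw (?i v) (?i x) (?i y) = cw v x y"
      using cw_permute[OF permutes_inv[OF \<sigma>]] v x y by simp
    show "bit_sign (psgn d \<sigma> (pars v)) * (sg (?i x) (?i y) * cw (?i v) (?i x) (?i y) * (f (?i x) * g (?i y)))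
        = sg x y * cw v x y * (actf \<sigma> f x * actf \<sigma> g y)"
    proof (cases "cw v x y = 0")
      case False
      have i: "inv_into UNIV \<sigma> permutes {..<length x}" "inv_into UNIV \<sigma> permutes {..<length y}"
        using permutes_inv[OF \<sigma>] x y by (simp_all add: W_length)
      have "psgn d \<sigma> (pars v) + texp (pars (?i x)) (pars (?i y))
          = texp (pars x) (pars y) + psgn d \<sigma> (pars x) + psgn d \<sigma> (pars y)"
        using psgn_texp[OF \<sigma>, of "pars x" "pars y"] cw_pars[OF False v x y] x y
        by (simp add: W_length permute_list_map[OF i(1)] permute_list_map[OF i(2)])
      then have "bit_sign (psgn d \<sigma> (pars v)) * sg (?i x) (?i y)
          = (sg x y * bit_sign (psgn d \<sigma> (pars x)) * bit_sign (psgn d \<sigma> (pars y)) :: 'k)"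
        by (simp flip: bit_sign_add)
      then show ?thesis unfolding cwi using x y by (simp add: actf_def mult_ac)
    qed (simp add: cwi)
  qed
  finally show "actf \<sigma> (f \<star> g) v = (actf \<sigma> f \<star> actf \<sigma> g) v" using v by (simp add: conv_def)
qed simp_all

lemma actf_comp:
  assumes \<sigma>: "\<sigma> permutes {..<d}" and \<tau>: "\<tau> permutes {..<d}"
  shows "actf (\<sigma> \<circ> \<tau>) f = actf \<tau> (actf \<sigma> f)"
proof (rule TC_eqI)
  fix v assume v: "v \<in> W"
  have i: "inv_into UNIV \<tau> permutes {..<length v}" using permutes_inv[OF \<tau>] v by (simp add: W_length)
  have i': "inv_into UNIV \<sigma> permutes {..<length v}" using permutes_inv[OF \<sigma>] v by (simp add: W_length)
  have "inv_into UNIV (\<sigma> \<circ> \<tau>) = inv_into UNIV \<tau> \<circ> inv_into UNIV \<sigma>"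
    using \<sigma> \<tau> by (intro o_inv_distrib) (auto simp: permutes_bij)
  then show "actf (\<sigma> \<circ> \<tau>) f v = actf \<tau> (actf \<sigma> f) v"
    using v permute_inv_W[OF \<tau> v] psgn_comp[OF \<sigma> \<tau>, of "pars v"]
    by (simp add: actf_def permute_list_compose[OF i'] W_length bit_sign_add permute_list_map[OF i] mult_ac)
qed simp_all

lemma actf_tens:
  assumes \<sigma>: "\<sigma> permutes {..<d}" and l: "length zs = d" "length ps = d"
    and h: "\<And>p. p < d \<Longrightarrow> homog (ps ! p) (zs ! p)"
  shows "actf \<sigma> (tens zs) = scal (perm_sign \<sigma> ps) (tens (permute_list \<sigma> zs))"
proof (rule TC_eqI)
  fix v assume v: "v \<in> W"
  let ?i = "inv_into UNIV \<sigma>"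
  have i: "?i permutes {..<length v}" using permutes_inv[OF \<sigma>] v by (simp add: W_length)
  have "tens zs (permute_list ?i v) = (\<Prod>p<d. (zs ! p) (v ! ?i p))"
    using permute_inv_W[OF \<sigma> v] v by (simp add: tens_def permute_list_nth[OF i] W_length)
  also have "\<dots> = (\<Prod>p<d. (zs ! \<sigma> p) (v ! p))"
    by (subst prod.permute[OF \<sigma>]) (simp add: comp_def permutes_inverses[OF \<sigma>])
  finally have e: "tens zs (permute_list ?i v) = (\<Prod>p<d. (zs ! \<sigma> p) (v ! p))" .
  have "bit_sign (psgn d \<sigma> (pars v)) * tens zs (permute_list ?i v) = perm_sign \<sigma> ps * tens zs (permute_list ?i v)"
  proof (cases "tens zs (permute_list ?i v) = 0")
    case False
    then have nz: "(zs ! \<sigma> p) (v ! p) \<noteq> 0" if "p < d" for p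
      using that e by (metis (no_types, lifting) finite_lessThan lessThan_iff prod_zero)
    have "par (v ! p) = ps ! \<sigma> p" if "p < d" for p
      using nz[OF that] h[of "\<sigma> p"] permutes_in_image[OF \<sigma>, of p] that v by (auto simp: homog_def W_nth)
    then have "pars v = permute_list \<sigma> ps"
      using v \<sigma> l by (intro nth_equalityI) (auto simp: W_length permute_list_nth)
    then show ?thesis by (simp add: perm_sign_psgn[OF \<sigma> l(2)])
  qed simp
  then have "actf \<sigma> (tens zs) v = perm_sign \<sigma> ps * tens zs (permute_list ?i v)" using v by (simp add: actf_def)
  also have "\<dots> = scal (perm_sign \<sigma> ps) (tens (permute_list \<sigma> zs)) v"
    unfolding e using v \<sigma> l by (simp add: tens_def permute_list_nth scal_def)
  finally show "actf \<sigma> (tens zs) v = scal (perm_sign \<sigma> ps) (tens (permute_list \<sigma> zs)) v" .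
qed (auto simp: TC_def scal_def tens_def actf_def)

lemma actf_tens_even:
  assumes \<sigma>: "\<sigma> permutes {..<d}" and l: "length zs = d" and h: "\<And>p. p < d \<Longrightarrow> homog 0 (zs ! p)"
  shows "actf \<sigma> (tens zs) = tens (permute_list \<sigma> zs)"
proof -
  have "{(k, l). k < l \<and> l < d \<and> inv_into UNIV \<sigma> k > inv_into UNIV \<sigma> l \<and>
     replicate d (0::bit) ! k = 1 \<and> replicate d (0::bit) ! l = 1} = {}" by auto
  then have "perm_sign \<sigma> (replicate d 0) = (1 :: 'k)" by (simp only: perm_sign_def length_replicate) simp
  then show ?thesis using actf_tens[OF \<sigma> l, of "replicate d 0"] h by simp
qed

lemma actf_T1: "\<sigma> permutes {..<d} \<Longrightarrow> actf \<sigma> T1 = T1"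
proof -
  assume \<sigma>: "\<sigma> permutes {..<d}"
  have "permute_list \<sigma> (replicate d o1) = replicate d o1"
    using \<sigma> permutes_in_image[OF \<sigma>] by (intro nth_equalityI) (auto simp: permute_list_nth)
  then show ?thesis unfolding T1_def using \<sigma> by (subst actf_tens_even) (auto simp: homog_o1)
qed

lemma calg_act_TC: "calg_act TC (\<star>) T1 scal d actf"
proof -
  interpret calg TC "(\<star>)" T1 scal by (rule calg_TC)
  show ?thesis
  proof
    fix f assume "f \<in> TC"
    then show "actf id f = f"
      by (intro TC_eqI) (simp, assumption, simp add: actf_def)
  qed (auto simp: actf_conv actf_comp actf_T1, auto simp: actf_def scal_def fun_eq_iff distrib_left mult.left_commute)
qed

end

text \<open>\<open>slice_crit\<close> is surjectivity in the double centralizer property of one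
  letter, stated for matrices: \<open>z\<close> factors through the left ideal of \<open>f\<close>
  and commutes with right multiplication by the corner. Only homogeneous \<open>y\<close> are
  tested, because those have a definite sign when placed in one tensor position. Equations between
  letters are required on \<open>I\<close> only, as letters are arbitrary functions outside.\<close>

locale dc_consts = graded_consts I par c o1 d + dual_functionals I "\<lambda>i j k. \<Sum>t\<in>I. c j i t * graded_consts.R I c f t k" \<Lambda>
  for I :: "'i set" and par :: "'i \<Rightarrow> bit" and c :: "'i \<Rightarrow> 'i \<Rightarrow> 'i \<Rightarrow> 'k::idom"
    and o1 :: "'i \<Rightarrow> 'k" and d :: nat and f :: "'i \<Rightarrow> 'k" and \<Lambda> +
  assumes f_homog: "homog 0 f" and f_idem: "i \<in> I \<Longrightarrow> lmul f f i = f i"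
    and slice_crit: "(\<And>j k. j \<in> I \<Longrightarrow> k \<in> I \<Longrightarrow> (\<Sum>l\<in>I. z j l * R f l k) = z j k) \<Longrightarrow>
      (\<And>q y j k. homog q y \<Longrightarrow> (\<And>i. i \<in> I \<Longrightarrow> lmul f y i = y i) \<Longrightarrow> (\<And>i. i \<in> I \<Longrightarrow> lmul y f i = y i) \<Longrightarrow>
        j \<in> I \<Longrightarrow> k \<in> I \<Longrightarrow> (\<Sum>l\<in>I. z j l * R y l k) = (\<Sum>l\<in>I. R y j l * z l k)) \<Longrightarrow> slice z"
begin

sublocale TC: calg TC "(\<star>)" T1 scal by (rule calg_TC)

abbreviation "FF \<equiv> tens (replicate d f)"

lemma tens_cong:
  "(\<And>p i. p < d \<Longrightarrow> i \<in> I \<Longrightarrow> (xs ! p) i = (ys ! p) i) \<Longrightarrow> tens xs = tens ys"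
  by (auto simp: tens_def fun_eq_iff W_nth intro!: prod.cong)

lemma lmul_o1: "i \<in> I \<Longrightarrow> lmul g o1 i = g i"
  using finI by (simp add: lmul_def R_o1 if_distrib[of "\<lambda>c. c * _"] sum.delta' cong: if_cong)

lemma o1_lmul: "i \<in> I \<Longrightarrow> lmul o1 g i = g i"
proof -
  assume i: "i \<in> I"
  then have "lmul o1 g i = (\<Sum>j\<in>I. \<Sum>k\<in>I. c i j k * o1 j * g k)"
    by (simp add: lmul_def R_def sum_distrib_left mult_ac)
  also have "\<dots> = (\<Sum>k\<in>I. \<Sum>j\<in>I. c i j k * o1 j * g k)" by (rule sum.swap)
  also have "\<dots> = (\<Sum>k\<in>I. if i = k then g k else 0)"
    using i by (intro sum.cong refl) (simp add: c_one_l sum_distrib_right[symmetric])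
  finally show ?thesis using i finI by simp
qed

lemma FF_idem: "FF \<star> FF = FF"
  by (subst tens_conv_even) (auto simp: f_homog f_idem intro!: tens_cong)

definition delta :: "'i list \<Rightarrow> 'i list \<Rightarrow> 'k" where "delta v = (\<lambda>w. if w = v then 1 else 0)"

lemma delta_TC [simp]: "v \<in> W \<Longrightarrow> delta v \<in> TC" by (auto simp: delta_def TC_def)

lemma delta_expand: "g \<in> TC \<Longrightarrow> g = (\<Sum>v\<in>W. scal (g v) (delta v))"
  by (rule ext) (auto simp: sum_fun_apply scal_def delta_def finW TC_out if_distrib[of "\<lambda>c. _ * c"] sum.delta' cong: if_cong)

text \<open>The parity word of the left factor is the sum of those of the output \<open>w\<close>
  and the input \<open>v\<close>. This is therefore the interchange sign of the left factor with
  \<open>v\<close>, expressed through \<open>w\<close> and \<open>v\<close> alone.\<close>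

definition sgn2 :: "'i list \<Rightarrow> 'i list \<Rightarrow> 'k" where
  "sgn2 w v = bit_sign (texp (map2 (+) (pars w) (pars v)) (pars v))"

abbreviation "L \<equiv> \<lambda>i j k. \<Sum>t\<in>I. c j i t * R f t k"

text \<open>
  After the twist by \<open>sgn2\<close>, which does not depend on the left factor, left multiplication becomes
  an unsigned tensor product of left multiplications.
\<close>

lemma left_mult:
  assumes w: "w \<in> W" and v: "v \<in> W"
  shows "(s \<star> (delta v \<star> FF)) w = sgn2 w v * (\<Sum>x\<in>W. s x * (\<Prod>p<d. L (x ! p) (w ! p) (v ! p)))"
proof -
  have dF: "(delta v \<star> FF) t = (\<Prod>p<d. R f (t ! p) (v ! p))" if t: "t \<in> W" for t
  proof -
    have "(delta v \<star> FF) t = (\<Sum>x\<in>W. if x = v then \<Prod>p<d. R f (t ! p) (v ! p) else 0)"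
      using t by (subst conv_tens[where qs = "replicate d 0"])
        (auto intro!: sum.cong simp: f_homog delta_def W_length)
    then show ?thesis using v finW by simp
  qed
  have "(s \<star> (delta v \<star> FF)) w = (\<Sum>x\<in>W. \<Sum>t\<in>W. sg x t * cw w x t * (s x * (\<Prod>p<d. R f (t ! p) (v ! p))))"
    using w by (simp add: conv_def[of s] dF)
  also have "\<dots> = (\<Sum>x\<in>W. \<Sum>t\<in>W. sgn2 w v * s x * (\<Prod>p<d. c (w ! p) (x ! p) (t ! p) * R f (t ! p) (v ! p)))"
  proof (rule sum.cong[OF refl], rule sum.cong[OF refl])
    fix x t assume x: "x \<in> W" and t: "t \<in> W"
    let ?r = "\<Prod>p<d. R f (t ! p) (v ! p)"
    have "sg x t * (cw w x t * ?r) = sgn2 w v * (cw w x t * ?r)"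
    proof (cases "cw w x t * ?r = 0")
      case False
      then have "R f (t ! p) (v ! p) \<noteq> 0" if "p < d" for p
        using that prod_zero[of "{..<d}" "\<lambda>p. R f (t ! p) (v ! p)"] by auto
      then have "par (t ! p) = par (v ! p)" if "p < d" for p
        using R_par[OF f_homog, of "t ! p" "v ! p"] that t v by (simp add: W_nth)
      then have tv: "pars t = pars v" using t v by (intro nth_equalityI) (auto simp: W_length)
      have "pars w = map2 (+) (pars x) (pars v)" using cw_pars[of w x t] False w x t tv by simp
      then have "map2 (+) (pars w) (pars v) = pars x"
        using x v by (intro nth_equalityI) (auto simp: W_length add.assoc)
      then show ?thesis by (simp add: sgn2_def tv)
    next
      case True
      then show ?thesis unfolding True by simp
    qed
    moreover have "sg x t * cw w x t * (s x * ?r) = s x * (sg x t * (cw w x t * ?r))" by (simp add: mult_ac)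
    ultimately show "sg x t * cw w x t * (s x * ?r)
        = sgn2 w v * s x * (\<Prod>p<d. c (w ! p) (x ! p) (t ! p) * R f (t ! p) (v ! p))"
      by (simp add: cw_def prod.distrib mult_ac)
  qed
  also have "\<dots> = (\<Sum>x\<in>W. sgn2 w v * s x * (\<Prod>p<d. L (x ! p) (w ! p) (v ! p)))"
    unfolding sum_distrib_left[symmetric] by (subst sum_words_prod) (rule refl)
  finally show ?thesis by (simp add: sum_distrib_left mult.assoc)
qed

definition at_pos :: "nat \<Rightarrow> ('i \<Rightarrow> 'k) \<Rightarrow> ('i \<Rightarrow> 'k) \<Rightarrow> nat \<Rightarrow> ('i \<Rightarrow> 'k) list" where
  "at_pos m z y n = replicate m z @ y # replicate n z"

lemma at_pos_nth: "p < Suc (m + n) \<Longrightarrow> at_pos m z y n ! p = (if p = m then y else z)"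
  by (auto simp: at_pos_def nth_append nth_Cons split: nat.split)

lemma qs_nth: "p < Suc (m + n) \<Longrightarrow> (replicate m 0 @ q # replicate n 0) ! p = (if p = m then q else (0::bit))"
  by (auto simp: nth_append nth_Cons split: nat.split)

lemma eq_take_drop: "n < length x \<Longrightarrow> take n x = w1 \<Longrightarrow> drop (Suc n) x = w2 \<Longrightarrow> x = w1 @ x ! n # w2"
  using id_take_nth_drop[of n x] by blast

text \<open>The condition fixes every letter of \<open>x\<close> except the one in position
  \<open>length w1\<close>, which remains as the summation index.\<close>

lemma sum_collapse:
  assumes d: "d = Suc (length w1 + length w2)" and w: "w1 @ w2 \<in> words I (d - 1)"
  shows "(\<Sum>x\<in>W. if take (length w1) x = w1 \<and> drop (Suc (length w1)) x = w2 then G x else 0)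
    = (\<Sum>j\<in>I. G (w1 @ j # w2))"
proof -
  have "(\<Sum>x\<in>W. if take (length w1) x = w1 \<and> drop (Suc (length w1)) x = w2 then G x else 0)
      = (\<Sum>x\<in>(\<lambda>j. w1 @ j # w2) ` I. if take (length w1) x = w1 \<and> drop (Suc (length w1)) x = w2 then G x else 0)"
  proof (rule sum.mono_neutral_right[OF finW])
    show "(\<lambda>j. w1 @ j # w2) ` I \<subseteq> W" using w d by (auto simp: words_def)
    show "\<forall>x\<in>W - (\<lambda>j. w1 @ j # w2) ` I.
       (if take (length w1) x = w1 \<and> drop (Suc (length w1)) x = w2 then G x else 0) = 0"
    proof
      fix x assume x: "x \<in> W - (\<lambda>j. w1 @ j # w2) ` I"
      have lx: "length x = d" using x by (simp add: W_length)
      have "x ! length w1 \<in> I" using x d by (intro W_nth) simp_all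
      moreover have "length w1 < length x" using lx d by simp
      ultimately have "\<not> (take (length w1) x = w1 \<and> drop (Suc (length w1)) x = w2)"
        using x eq_take_drop[of "length w1" x w1 w2] by blast
      then show "(if take (length w1) x = w1 \<and> drop (Suc (length w1)) x = w2 then G x else 0) = 0"
        by auto
    qed
  qed
  also have "\<dots> = (\<Sum>j\<in>I. G (w1 @ j # w2))"
    by (subst sum.reindex) (auto simp: inj_on_def)
  finally show ?thesis .
qed

text \<open>Right multiplication by the unit has the identity matrix, so each position other than
  that of \<open>y\<close> forces equal letters.\<close>

lemma prod_at_pos:
  assumes d: "d = Suc (length w1 + length w2)" and w: "w1 @ j # w2 \<in> W" and x: "x \<in> W"
  shows "(\<Prod>p<d. R (at_pos (length w1) o1 y (length w2) ! p) ((w1 @ j # w2) ! p) (x ! p))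
      = (if take (length w1) x = w1 \<and> drop (Suc (length w1)) x = w2 then R y j (x ! length w1) else 0)" (is ?A)
    and "(\<Prod>p<d. R (at_pos (length w1) o1 y (length w2) ! p) (x ! p) ((w1 @ j # w2) ! p))
      = (if take (length w1) x = w1 \<and> drop (Suc (length w1)) x = w2 then R y (x ! length w1) j else 0)" (is ?B)
proof -
  let ?n = "length w1" and ?w = "w1 @ j # w2"
  have lx: "length x = d" using x by (simp add: W_length)
  have eq: "take ?n x = w1 \<and> drop (Suc ?n) x = w2 \<longleftrightarrow> (\<forall>p<d. p \<noteq> ?n \<longrightarrow> ?w ! p = x ! p)"
  proof
    assume a: "take ?n x = w1 \<and> drop (Suc ?n) x = w2"
    have xe: "x = w1 @ x ! ?n # w2" using a lx d by (intro eq_take_drop) simp_all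
    show "\<forall>p<d. p \<noteq> ?n \<longrightarrow> ?w ! p = x ! p"
      by (subst xe) (auto simp: nth_append nth_Cons split: nat.split)
  next
    assume a: "\<forall>p<d. p \<noteq> ?n \<longrightarrow> ?w ! p = x ! p"
    have "take ?n x ! p = w1 ! p" if "p < ?n" for p
      using a[rule_format, of p] that d by (simp add: nth_append)
    moreover have "drop (Suc ?n) x ! p = w2 ! p" if "p < length w2" for p
      using a[rule_format, of "Suc ?n + p"] that d lx by (simp add: nth_append)
    ultimately show "take ?n x = w1 \<and> drop (Suc ?n) x = w2"
      using lx d by (auto intro!: nth_equalityI)
  qed
  have wn: "?w ! ?n = j" by simp
  have key: "(\<Prod>p<d. if p = ?n then r else if ?w ! p = x ! p then 1 else 0) =
      (if take ?n x = w1 \<and> drop (Suc ?n) x = w2 then r else (0::'k))" for r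
  proof (cases "\<forall>p<d. p \<noteq> ?n \<longrightarrow> ?w ! p = x ! p")
    case True
    then have "(\<Prod>p<d. if p = ?n then r else if ?w ! p = x ! p then 1 else 0) = (\<Prod>p<d. if p = ?n then r else 1)"
      by (intro prod.cong) auto
    also have "\<dots> = r" using d by (simp add: prod.delta)
    finally show ?thesis using True eq by simp
  next
    case False
    then obtain p where p: "p < d" "p \<noteq> ?n" "?w ! p \<noteq> x ! p" by blast
    then have "(\<Prod>p<d. if p = ?n then r else if ?w ! p = x ! p then 1 else 0) = 0"
      by (intro prod_zero) auto
    moreover have nc: "\<not> (take ?n x = w1 \<and> drop (Suc ?n) x = w2)" using False eq by blast
    ultimately show ?thesis unfolding if_not_P[OF nc] by blast
  qed
  have "R (at_pos ?n o1 y (length w2) ! p) (?w ! p) (x ! p) =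
      (if p = ?n then R y j (x ! ?n) else if ?w ! p = x ! p then 1 else 0)"
    "R (at_pos ?n o1 y (length w2) ! p) (x ! p) (?w ! p) =
      (if p = ?n then R y (x ! ?n) j else if ?w ! p = x ! p then 1 else 0)" if "p < d" for p
    using that d at_pos_nth[of p ?n "length w2" o1 y] W_nth[OF w that] W_nth[OF x that] R_o1 by auto
  then show ?A ?B unfolding key[symmetric] by simp_all
qed

text \<open>The element \<open>y\<close> crosses the letters of the left factor that stand to the
  right of its position, whence the exponent \<open>sum_list (pars w2) * q\<close>; the letters
  before it are not crossed.\<close>

lemma conv_at_pos:
  assumes d: "d = Suc (length w1 + length w2)" and w: "w1 @ w2 \<in> words I (d - 1)" and j: "j \<in> I"
    and y: "homog q y"
  shows "(g \<star> tens (at_pos (length w1) o1 y (length w2))) (w1 @ j # w2)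
    = bit_sign (sum_list (pars w2) * q) * (\<Sum>l\<in>I. R y j l * g (w1 @ l # w2))" (is ?A)
    and "t \<in> W \<Longrightarrow> (delta (w1 @ j # w2) \<star> tens (at_pos (length w1) o1 y (length w2))) t
    = (if take (length w1) t = w1 \<and> drop (Suc (length w1)) t = w2
       then bit_sign (sum_list (pars w2) * q) * R y (t ! length w1) j else 0)"
proof -
  let ?qs = "replicate (length w1) 0 @ q # replicate (length w2) 0"
  let ?ys = "at_pos (length w1) o1 y (length w2)"
  have wW: "w1 @ j # w2 \<in> W" using w d j by (auto simp: words_def)
  have h: "homog (?qs ! p) (?ys ! p)" if "p < d" for p
    using that d qs_nth[of p "length w1" "length w2" q] at_pos_nth[of p "length w1" "length w2" o1 y] y homog_o1
    by auto
  have s: "texp (pars (w1 @ l # w2)) ?qs = sum_list (pars w2) * q" for l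
    using texp_single[of "pars w1" "length w1" "pars w2" "length w2" "par l" q] by simp
  have lq: "length ?qs = d" using d by simp
  have "(g \<star> tens ?ys) (w1 @ j # w2)
      = (\<Sum>x\<in>W. if take (length w1) x = w1 \<and> drop (Suc (length w1)) x = w2
           then bit_sign (texp (pars x) ?qs) * R y j (x ! length w1) * g x else 0)"
    by (subst conv_tens[OF wW lq]) (auto intro!: sum.cong h simp: prod_at_pos(1)[OF d wW])
  also have "\<dots> = (\<Sum>l\<in>I. bit_sign (texp (pars (w1 @ l # w2)) ?qs) * R y j l * g (w1 @ l # w2))"
    by (subst sum_collapse[OF d w]) simp
  finally show ?A unfolding s by (simp add: sum_distrib_left mult.assoc)
  show "(delta (w1 @ j # w2) \<star> tens ?ys) t
    = (if take (length w1) t = w1 \<and> drop (Suc (length w1)) t = w2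
       then bit_sign (sum_list (pars w2) * q) * R y (t ! length w1) j else 0)" if t: "t \<in> W"
  proof -
    have "(delta (w1 @ j # w2) \<star> tens ?ys) t = (\<Sum>x\<in>W. if x = w1 @ j # w2 then
       bit_sign (texp (pars x) ?qs) * (\<Prod>p<d. R (?ys ! p) (t ! p) (x ! p)) else 0)"
      by (subst conv_tens[OF t lq]) (auto intro!: sum.cong h simp: delta_def)
    also have "\<dots> = bit_sign (texp (pars (w1 @ j # w2)) ?qs) * (\<Prod>p<d. R (?ys ! p) (t ! p) ((w1 @ j # w2) ! p))"
      using wW finW by simp
    finally show ?thesis unfolding s prod_at_pos(2)[OF d wW t] by simp
  qed
qed

text \<open>Evaluated at basis words, an endomorphism becomes a matrix \<open>\<Psi>\<close>. Its
  commutation with the tensors that have \<open>y\<close> in one position and units elsewhere is,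
  after the twist by \<open>sgn2\<close>, what \<open>slice_crit\<close> asks for in that
  position.\<close>

theorem dci_tensor: "dci TC (\<star>) FF"
proof (rule dciI)
  show "FF \<in> TC" "FF \<star> FF = FF" by (simp_all add: FF_idem)
next
  fix s assume s: "s \<in> TC" and z: "\<And>x. x \<in> TC \<Longrightarrow> s \<star> (x \<star> FF) = 0"
  have "s w = 0" if w: "w \<in> W" for w
  proof (rule tensor_zero_imp[OF _ w])
    fix w v assume wv: "w \<in> W" "v \<in> W"
    have "sgn2 w v * (\<Sum>x\<in>W. s x * (\<Prod>p<d. L (x ! p) (w ! p) (v ! p))) = 0"
      using left_mult[OF wv, of s] z[of "delta v"] wv by simp
    \<comment> \<open>The twist squares to 1, so multiplying by it once more removes it.\<close>
    then have "sgn2 w v * sgn2 w v * (\<Sum>x\<in>W. s x * (\<Prod>p<d. L (x ! p) (w ! p) (v ! p))) = 0"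
      by (simp add: mult.assoc)
    then show "(\<Sum>x\<in>W. s x * (\<Prod>p<d. L (x ! p) (w ! p) (v ! p))) = 0"
      by (simp add: sgn2_def)
  qed
  then show "s = 0" using s by (intro TC_eqI[OF s TC.zero_closed]) simp
next
  fix \<phi>
  assume \<phi>1: "\<And>x. x \<in> TC \<Longrightarrow> x \<star> FF = x \<Longrightarrow> \<phi> x \<in> TC \<and> \<phi> x \<star> FF = \<phi> x"
    and \<phi>2: "\<And>x y. x \<in> TC \<Longrightarrow> y \<in> TC \<Longrightarrow> x \<star> FF = x \<Longrightarrow> y \<star> FF = y \<Longrightarrow> \<phi> (x + y) = \<phi> x + \<phi> y"
    and \<phi>3: "\<And>x c. x \<in> TC \<Longrightarrow> c \<in> TC \<Longrightarrow> x \<star> FF = x \<Longrightarrow> FF \<star> c = c \<Longrightarrow> c \<star> FF = c \<Longrightarrow>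
               \<phi> (x \<star> c) = \<phi> x \<star> c"
  \<comment> \<open>Precomposition with right multiplication by \<open>FF\<close> extends
    \<open>\<phi>\<close> to all of \<open>TC\<close>, so that it can be evaluated at single basis
    words.\<close>
  define \<Phi> where "\<Phi> x = \<phi> (x \<star> FF)" for x
  have xFF: "x \<star> FF \<star> FF = x \<star> FF" for x by (simp add: conv_assoc FF_idem)
  have \<Phi>TC: "\<Phi> x \<in> TC" "\<Phi> x \<star> FF = \<Phi> x" for x using \<phi>1[of "x \<star> FF"] by (auto simp: \<Phi>_def xFF)
  have \<Phi>add: "\<Phi> (x + y) = \<Phi> x + \<Phi> y" for x y
    unfolding \<Phi>_def conv_add_l by (intro \<phi>2) (auto simp: xFF)
  have \<Phi>0: "\<Phi> 0 = 0" using \<Phi>add[of 0 0] by simp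
  have \<Phi>sum: "\<Phi> (sum g J) = (\<Sum>j\<in>J. \<Phi> (g j))" for g :: "'i list \<Rightarrow> 'i list \<Rightarrow> 'k" and J
    by (induction J rule: infinite_finite_induct)
      (simp_all only: \<Phi>0 \<Phi>add sum.infinite sum.empty sum.insert simp_thms)
  \<comment> \<open>Scalars reach \<open>\<phi>\<close> as right multiplication by the corner
    element \<open>scal a FF\<close>.\<close>
  have \<Phi>scal: "\<Phi> (scal a x) = scal a (\<Phi> x)" for a x
  proof -
    have aT: "scal a FF \<in> TC" by (rule TC.sm_closed) simp
    have "\<Phi> (scal a x) = \<phi> (x \<star> FF \<star> scal a FF)"
      by (simp add: \<Phi>_def conv_scal_l conv_scal_r xFF)
    also have "\<dots> = \<phi> (x \<star> FF) \<star> scal a FF"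
      using aT by (intro \<phi>3) (auto simp: xFF conv_scal_l conv_scal_r FF_idem)
    finally show ?thesis using \<Phi>TC[of x] by (simp add: conv_scal_r \<Phi>_def)
  qed
  define \<Psi> where "\<Psi> w v = \<Phi> (delta v) w" for w v
  have \<Phi>\<Psi>: "\<Phi> x w = (\<Sum>v\<in>W. x v * \<Psi> w v)" if "x \<in> TC" for x w
    by (subst delta_expand[OF that]) (simp add: \<Phi>sum \<Phi>scal sum_fun_apply \<Psi>_def, simp add: scal_def)
  \<comment> \<open>A tensor with units around \<open>y\<close> is in general outside the corner.
    Multiplying it by \<open>FF\<close> on either side gives the same tensor \<open>?Z\<close> with
    \<open>f\<close> around \<open>y\<close>, which is in the corner, so \<open>\<phi>3\<close>
    applies to it.\<close>
  have comm: "\<Phi> (x \<star> tens (at_pos m o1 y n)) = \<Phi> x \<star> tens (at_pos m o1 y n)"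
    if d: "d = Suc (m + n)" and y: "homog q y" "\<And>i. i \<in> I \<Longrightarrow> lmul f y i = y i" "\<And>i. i \<in> I \<Longrightarrow> lmul y f i = y i"
    for x q y m n
  proof -
    let ?Y = "tens (at_pos m o1 y n)" and ?Z = "tens (at_pos m f y n)"
    let ?qs = "replicate m 0 @ q # replicate n 0"
    have h1: "homog (?qs ! p) (at_pos m o1 y n ! p)" "homog (?qs ! p) (at_pos m f y n ! p)" if "p < d" for p
      using that d qs_nth[of p m n q] at_pos_nth[of p m n] y homog_o1 f_homog by auto
    have lm: "length (at_pos m a y n) = d" "length ?qs = d" for a using d by (simp_all add: at_pos_def)
    have fo: "lmul f o1 i = f i" "lmul o1 f i = f i" if "i \<in> I" for i
      using that lmul_o1 o1_lmul by auto
    have ny: "at_pos m a b n ! p = (if p = m then b else a)" if "p < d" for a b p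
      using that d by (simp add: at_pos_nth)
    have "FF \<star> ?Y = tens (map2 lmul (replicate d f) (at_pos m o1 y n))"
      using tens_conv_tens[of "replicate d f" "at_pos m o1 y n" "replicate d 0" ?qs] lm h1 f_homog by simp
    also have "\<dots> = ?Z" by (rule tens_cong) (use fo y ny lm in auto)
    finally have FY: "FF \<star> ?Y = ?Z" .
    have "?Y \<star> FF = tens (map2 lmul (at_pos m o1 y n) (replicate d f))"
      using tens_conv_tens[of "at_pos m o1 y n" "replicate d f" ?qs "replicate d 0"] lm h1 f_homog by simp
    also have "\<dots> = ?Z" by (rule tens_cong) (use fo y ny lm in auto)
    finally have YF: "?Y \<star> FF = ?Z" .
    have FZ: "FF \<star> ?Z = ?Z" and ZF: "?Z \<star> FF = ?Z"
      using FY YF by (metis conv_assoc FF_idem)+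
    have "\<Phi> (x \<star> ?Y) = \<phi> (x \<star> FF \<star> ?Z)" by (simp add: \<Phi>_def conv_assoc YF FZ)
    also have "\<dots> = \<phi> (x \<star> FF) \<star> ?Z" by (intro \<phi>3) (auto simp: xFF FZ ZF)
    also have "\<dots> = \<Phi> x \<star> FF \<star> ?Y" by (simp add: conv_assoc FY \<Phi>_def)
    finally show ?thesis by (simp add: \<Phi>TC)
  qed
  have YfF: "tens (at_pos m o1 f n) \<star> FF = FF" if "d = Suc (m + n)" for m n
  proof -
    have ny: "at_pos m o1 f n ! p = (if p = m then f else o1)" if "p < d" for p
      using that \<open>d = Suc (m + n)\<close> by (simp add: at_pos_nth)
    have lm: "length (at_pos m o1 f n) = d" using that by (simp add: at_pos_def)
    have "tens (at_pos m o1 f n) \<star> FF = tens (map2 lmul (at_pos m o1 f n) (replicate d f))"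
      by (rule tens_conv_even) (use lm f_homog ny homog_o1 in auto)
    also have "\<dots> = FF" by (rule tens_cong) (use f_idem o1_lmul ny lm in auto)
    finally show ?thesis .
  qed
  have "\<exists>r. \<forall>w\<in>W. \<forall>v\<in>W. sgn2 w v * \<Psi> w v = (\<Sum>x\<in>W. r x * (\<Prod>p<d. L (x ! p) (w ! p) (v ! p)))"
  proof (rule slices_imp_tensor)
    fix w1 w2 v1 v2
    assume w: "w1 @ w2 \<in> words I (d - 1)" and v: "v1 @ v2 \<in> words I (d - 1)"
      and l: "length w1 = length v1" and d0: "0 < d"
    have l2: "length w2 = length v2" using w v l by (auto simp: words_def)
    have d: "d = Suc (length v1 + length v2)" "d = Suc (length w1 + length w2)"
      using w v l d0 by (auto simp: words_def)
    have wW: "w1 @ j # w2 \<in> W" "v1 @ j # v2 \<in> W" if "j \<in> I" for j using w v d that by (auto simp: words_def)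
    \<comment> \<open>\<open>\<beta>\<close> sums the parities of \<open>w2\<close> and
      \<open>v2\<close>, \<open>\<alpha>\<close> those of \<open>v1\<close>; \<open>E\<close> is the
      part of the twist exponent that is independent of the letters \<open>j\<close> and
      \<open>k\<close> in the distinguished position.\<close>
    define \<beta> where "\<beta> = sum_list (pars w2) + sum_list (pars v2)"
    define \<alpha> where "\<alpha> = sum_list (pars v1)"
    define E where "E = texp (map2 (+) (pars w1) (pars v1)) (pars v1) + texp (map2 (+) (pars w2) (pars v2)) (pars v2) + \<beta> * \<alpha>"
    have S: "sum_list (map2 (+) (pars w2) (pars v2)) = \<beta>"
      using l2 unfolding \<beta>_def by (induction w2 v2 rule: list_induct2) (auto simp: algebra_simps)
    have sg2: "sgn2 (w1 @ j # w2) (v1 @ k # v2) = bit_sign (E + \<beta> * par k + (par j + par k) * \<alpha>)" for j k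
      using l by (simp add: sgn2_def texp_append texp_Cons S E_def \<alpha>_def algebra_simps)
    let ?P = "\<lambda>j k. \<Psi> (w1 @ j # w2) (v1 @ k # v2)"
    \<comment> \<open>Commutation in coordinates. The signs on the two sides differ: one comes from
      crossing \<open>v2\<close> in the input, the other from crossing \<open>w2\<close> in the
      output.\<close>
    have C: "bit_sign (sum_list (pars v2) * q) * (\<Sum>t\<in>I. R y t k * ?P j t) =
        bit_sign (sum_list (pars w2) * q) * (\<Sum>t\<in>I. R y j t * ?P t k)"
      if y: "homog q y" "\<And>i. i \<in> I \<Longrightarrow> lmul f y i = y i" "\<And>i. i \<in> I \<Longrightarrow> lmul y f i = y i"
        and jk: "j \<in> I" "k \<in> I" for q y j k
    proof -
      have "\<Phi> (delta (v1 @ k # v2) \<star> tens (at_pos (length v1) o1 y (length v2))) (w1 @ j # w2)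
        = (\<Sum>t\<in>W. if take (length v1) t = v1 \<and> drop (Suc (length v1)) t = v2
              then bit_sign (sum_list (pars v2) * q) * R y (t ! length v1) k * \<Psi> (w1 @ j # w2) t else 0)"
        by (subst \<Phi>\<Psi>) (auto intro!: sum.cong simp: conv_at_pos(2)[OF d(1) v jk(2) y(1)])
      also have "\<dots> = (\<Sum>t\<in>I. bit_sign (sum_list (pars v2) * q) * R y t k * ?P j t)"
        by (subst sum_collapse[OF d(1) v]) simp
      finally have "\<Phi> (delta (v1 @ k # v2) \<star> tens (at_pos (length v1) o1 y (length v2))) (w1 @ j # w2) = \<dots>" .
      moreover have "(\<Phi> (delta (v1 @ k # v2)) \<star> tens (at_pos (length v1) o1 y (length v2))) (w1 @ j # w2)
        = bit_sign (sum_list (pars w2) * q) * (\<Sum>t\<in>I. R y j t * ?P t k)"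
        unfolding l[symmetric] l2[symmetric] by (subst conv_at_pos(1)[OF d(2) w jk(1) y(1)]) (simp add: \<Psi>_def)
      ultimately show ?thesis
        using comm[OF d(1) y, of "delta (v1 @ k # v2)"] by (simp add: sum_distrib_left mult.assoc)
    qed
    show "slice (\<lambda>j k. sgn2 (w1 @ j # w2) (v1 @ k # v2) * ?P j k)"
    proof (rule slice_crit)
      fix j k assume jk: "j \<in> I" "k \<in> I"
      have "\<Phi> (delta (v1 @ k # v2) \<star> tens (at_pos (length v1) o1 f (length v2))) = \<Phi> (delta (v1 @ k # v2))"
        unfolding \<Phi>_def by (simp add: conv_assoc YfF d(1)[symmetric] YfF[OF d(1)])
      then have "\<Phi> (delta (v1 @ k # v2) \<star> tens (at_pos (length v1) o1 f (length v2))) (w1 @ j # w2) = ?P j k"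
        by (simp add: \<Psi>_def)
      moreover have "\<Phi> (delta (v1 @ k # v2) \<star> tens (at_pos (length v1) o1 f (length v2))) (w1 @ j # w2)
        = (\<Sum>t\<in>W. if take (length v1) t = v1 \<and> drop (Suc (length v1)) t = v2
              then R f (t ! length v1) k * \<Psi> (w1 @ j # w2) t else 0)"
        by (subst \<Phi>\<Psi>) (auto intro!: sum.cong simp: conv_at_pos(2)[OF d(1) v jk(2) f_homog])
      moreover have "\<dots> = (\<Sum>t\<in>I. R f t k * ?P j t)"
        by (subst sum_collapse[OF d(1) v]) simp
      ultimately have e: "?P j k = (\<Sum>t\<in>I. R f t k * ?P j t)" by simp
      have "sgn2 (w1 @ j # w2) (v1 @ t # v2) * ?P j t * R f t k
          = sgn2 (w1 @ j # w2) (v1 @ k # v2) * (R f t k * ?P j t)" if "t \<in> I" for t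
        using R_par[OF f_homog that jk(2)] by (cases "R f t k = 0") (auto simp: sg2)
      then have "(\<Sum>t\<in>I. sgn2 (w1 @ j # w2) (v1 @ t # v2) * ?P j t * R f t k)
          = sgn2 (w1 @ j # w2) (v1 @ k # v2) * (\<Sum>t\<in>I. R f t k * ?P j t)"
        unfolding sum_distrib_left by (rule sum.cong[OF refl])
      then show "(\<Sum>t\<in>I. sgn2 (w1 @ j # w2) (v1 @ t # v2) * ?P j t * R f t k)
          = sgn2 (w1 @ j # w2) (v1 @ k # v2) * ?P j k"
        unfolding e[symmetric] .
    next
      fix q y j k
      assume y: "homog q y" "\<And>i. i \<in> I \<Longrightarrow> lmul f y i = y i" "\<And>i. i \<in> I \<Longrightarrow> lmul y f i = y i"
        and jk: "j \<in> I" "k \<in> I"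
      \<comment> \<open>On each side the twist is constant along the nonzero entries. The two
        constants differ by \<open>bit_sign (\<beta> * q)\<close>, which is exactly the discrepancy
        of the signs in \<open>C\<close>, so the twisted matrix commutes without sign.\<close>
      let ?s = "bit_sign (E + \<beta> * par k + (par j + par k + q) * \<alpha>) :: 'k"
      have 1: "sgn2 (w1 @ j # w2) (v1 @ t # v2) * ?P j t * R y t k = ?s * bit_sign (\<beta> * q) * (R y t k * ?P j t)"
        if "t \<in> I" for t
        using R_par[OF y(1) that jk(2)] by (cases "R y t k = 0") (auto simp: sg2 algebra_simps bit_sign_add)
      have 2: "R y j t * (sgn2 (w1 @ t # w2) (v1 @ k # v2) * ?P t k) = ?s * (R y j t * ?P t k)" if "t \<in> I" for t
      proof (cases "R y j t = 0")
        case False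
        then have "par j = par t + q" using R_par[OF y(1) jk(1) that] by simp
        then have "par t = par j + q" by (simp add: add.assoc)
        then show ?thesis by (simp add: sg2 algebra_simps)
      qed simp
      have "bit_sign (\<beta> * q) * (\<Sum>t\<in>I. R y t k * ?P j t)
          = bit_sign (sum_list (pars w2) * q) * (bit_sign (sum_list (pars v2) * q) * (\<Sum>t\<in>I. R y t k * ?P j t))"
        by (simp add: \<beta>_def distrib_right bit_sign_add mult.assoc)
      also have "\<dots> = (\<Sum>t\<in>I. R y j t * ?P t k)"
      proof -
        have "b * (b' * S) = S'" if "b' * S = b * S'" "b * b = 1" for b b' S S' :: 'k
          using that by (simp flip: mult.assoc)
        then show ?thesis using C[OF y jk] by simp
      qed
      finally have "?s * bit_sign (\<beta> * q) * (\<Sum>t\<in>I. R y t k * ?P j t) = ?s * (\<Sum>t\<in>I. R y j t * ?P t k)"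
        by (simp add: mult.assoc)
      moreover have "(\<Sum>t\<in>I. sgn2 (w1 @ j # w2) (v1 @ t # v2) * ?P j t * R y t k)
          = ?s * bit_sign (\<beta> * q) * (\<Sum>t\<in>I. R y t k * ?P j t)"
        unfolding sum_distrib_left by (rule sum.cong[OF refl 1])
      moreover have "(\<Sum>t\<in>I. R y j t * (sgn2 (w1 @ t # w2) (v1 @ k # v2) * ?P t k))
          = ?s * (\<Sum>t\<in>I. R y j t * ?P t k)"
        unfolding sum_distrib_left by (rule sum.cong[OF refl 2])
      ultimately show "(\<Sum>t\<in>I. sgn2 (w1 @ j # w2) (v1 @ t # v2) * ?P j t * R y t k)
          = (\<Sum>t\<in>I. R y j t * (sgn2 (w1 @ t # w2) (v1 @ k # v2) * ?P t k))" by simp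
    qed
  qed
  then obtain r where r: "\<And>w v. w \<in> W \<Longrightarrow> v \<in> W \<Longrightarrow>
      sgn2 w v * \<Psi> w v = (\<Sum>x\<in>W. r x * (\<Prod>p<d. L (x ! p) (w ! p) (v ! p)))" by blast
  define s where "s w = (if w \<in> W then r w else 0)" for w
  have sT: "s \<in> TC" by (simp add: s_def TC_def)
  have "\<phi> x = s \<star> x" if x: "x \<in> TC" "x \<star> FF = x" for x
  proof (rule TC_eqI)
    show "\<phi> x \<in> TC" using \<phi>1 x by simp
    fix w assume w: "w \<in> W"
    have "\<Psi> w v = (s \<star> (delta v \<star> FF)) w" if v: "v \<in> W" for v
    proof -
      have "\<Psi> w v = sgn2 w v * (sgn2 w v * \<Psi> w v)" by (simp add: sgn2_def mult.assoc[symmetric])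
      then show ?thesis unfolding r[OF w v] left_mult[OF w v] by (simp add: s_def)
    qed
    then have "\<phi> x w = (\<Sum>v\<in>W. x v * (s \<star> (delta v \<star> FF)) w)"
      using \<Phi>\<Psi>[OF x(1), of w] x by (simp add: \<Phi>_def)
    also have "\<dots> = (s \<star> ((\<Sum>v\<in>W. scal (x v) (delta v)) \<star> FF)) w"
    proof -
      have sc: "scal (x v) (delta v) \<in> TC" if "v \<in> W" for v using that by (intro TC.sm_closed) simp
      have "s \<star> ((\<Sum>v\<in>W. scal (x v) (delta v)) \<star> FF) = (\<Sum>v\<in>W. scal (x v) (s \<star> (delta v \<star> FF)))"
        using sc sT by (simp add: TC.sum_l TC.sum_r TC.sm_closed conv_scal_l conv_scal_r)
      then show ?thesis by (simp add: sum_fun_apply) (simp add: scal_def)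
    qed
    also have "\<dots> = (s \<star> x) w" using delta_expand[OF x(1)] x(2) by simp
    finally show "\<phi> x w = (s \<star> x) w" .
  qed simp
  then show "\<exists>s\<in>TC. \<forall>x\<in>TC. x \<star> FF = x \<longrightarrow> \<phi> x = s \<star> x" using sT by blast
qed

end

text \<open>\<open>finsum\<close> needs an abelian monoid, and the record is one because its laws
  hold for the images under the injective \<open>h\<close>.\<close>

lemma (in calg) faithful_rep_finsum:
  assumes rep: "faithful_rep S h C (\<star>) u sm" and "finite J" and "\<And>j. j \<in> J \<Longrightarrow> g j \<in> carrier S"
  shows "finsum S g J \<in> carrier S" and "h (finsum S g J) = (\<Sum>j\<in>J. h (g j))"
proof -
  note Q = faithful_repD[OF rep]
  have inj: "x \<in> carrier S \<Longrightarrow> y \<in> carrier S \<Longrightarrow> h x = h y \<Longrightarrow> x = y" for x y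
    using Q(11) by (auto simp: bij_betw_def inj_on_def)
  interpret S: abelian_monoid S
    by (rule abelian_monoidI) (auto intro!: inj simp: Q(1-8) algebra_simps)
  have "finsum S g J \<in> carrier S \<and> h (finsum S g J) = (\<Sum>j\<in>J. h (g j))"
    using assms(2,3)
  proof (induction J rule: finite_induct)
    case (insert j J)
    then have "finsum S g (insert j J) = g j \<oplus>\<^bsub>S\<^esub> finsum S g J" by (intro S.finsum_insert) auto
    then show ?case using insert by (auto simp: Q(1,8))
  qed (simp add: Q(5,6))
  then show "finsum S g J \<in> carrier S" "h (finsum S g J) = (\<Sum>j\<in>J. h (g j))" by auto
qed

section \<open>Linear extension from the generators of a free module\<close>

section \<open>Free modules on finitely supported functions\<close>

lemma lookup_free_smult [simp]: "Poly_Mapping.lookup (free_smult c p) x = c * Poly_Mapping.lookup p x"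
  by (simp add: free_smult_def Poly_Mapping.map.rep_eq when_def)

lemma module_free_smult: "Modules.module (free_smult :: 'r::comm_ring_1 \<Rightarrow> ('x \<Rightarrow>\<^sub>0 'r) \<Rightarrow> _)"
  by unfold_locales (auto intro!: poly_mapping_eqI simp: lookup_add algebra_simps)

interpretation free: Modules.module "free_smult :: 'r::comm_ring_1 \<Rightarrow> ('x \<Rightarrow>\<^sub>0 'r) \<Rightarrow> _"
  by (rule module_free_smult)

lemma free_smult_single [simp]: "free_smult c (Poly_Mapping.single x a) = Poly_Mapping.single x (c * a)"
  by (intro poly_mapping_eqI) (simp add: lookup_single when_def)

lemma keys_free_smult: "Poly_Mapping.keys (free_smult c p) \<subseteq> Poly_Mapping.keys p"
  by (auto simp: in_keys_iff)

lemma lookup_sum_poly: "Poly_Mapping.lookup (sum g J) x = (\<Sum>j\<in>J. Poly_Mapping.lookup (g j) x)"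
  by (induction J rule: infinite_finite_induct) (auto simp: lookup_add)

lemma keys_sum_subset: "(\<And>j. j \<in> J \<Longrightarrow> Poly_Mapping.keys (g j) \<subseteq> Y) \<Longrightarrow> Poly_Mapping.keys (sum g J) \<subseteq> Y"
proof (induction J rule: infinite_finite_induct)
  case (insert j J)
  then have "Poly_Mapping.keys (g j) \<union> Poly_Mapping.keys (sum g J) \<subseteq> Y" by simp
  then show ?case using keys_add[of "g j" "sum g J"] insert.hyps by (metis order_trans sum.insert)
qed auto

lemma keys_free_extend:
  "(\<And>x. x \<in> Poly_Mapping.keys p \<Longrightarrow> Poly_Mapping.keys (g x) \<subseteq> Y) \<Longrightarrow> Poly_Mapping.keys (free_extend g p) \<subseteq> Y"
  unfolding free_extend_def by (intro keys_sum_subset order_trans[OF keys_free_smult])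

definition lin :: "('x \<Rightarrow> 'r) \<Rightarrow> ('x \<Rightarrow>\<^sub>0 'r) \<Rightarrow> 'r::comm_ring_1" where
  "lin h p = (\<Sum>x\<in>Poly_Mapping.keys p. Poly_Mapping.lookup p x * h x)"

lemma lin_superset: "finite Y \<Longrightarrow> Poly_Mapping.keys p \<subseteq> Y \<Longrightarrow> lin h p = (\<Sum>x\<in>Y. Poly_Mapping.lookup p x * h x)"
  unfolding lin_def by (intro sum.mono_neutral_left) (auto simp: in_keys_iff)

lemma lin_add: "lin h (p + q) = lin h p + lin h q"
proof -
  let ?Y = "Poly_Mapping.keys p \<union> Poly_Mapping.keys q"
  have "lin h (p + q) = (\<Sum>x\<in>?Y. Poly_Mapping.lookup (p + q) x * h x)"
    using keys_add[of p q] by (intro lin_superset) auto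
  also have "\<dots> = lin h p + lin h q"
    by (subst (1 2) lin_superset[of ?Y]) (auto simp: lookup_add distrib_right sum.distrib)
  finally show ?thesis .
qed

lemma lin_smult: "lin h (free_smult c p) = c * lin h p"
  by (subst lin_superset[of "Poly_Mapping.keys p"]) (auto simp: keys_free_smult lin_def sum_distrib_left mult.assoc)

lemma lin_zero [simp]: "lin h 0 = 0" by (simp add: lin_def)

lemma lin_single [simp]: "lin h (Poly_Mapping.single x a) = a * h x"
  by (subst lin_superset[of "{x}"]) auto

lemma lin_diff: "lin h (p - q) = lin h p - lin h q"
  using lin_add[of h "p - q" q] by simp

lemma lin_sum: "lin h (sum g J) = (\<Sum>j\<in>J. lin h (g j))"
  by (induction J rule: infinite_finite_induct) (auto simp: lin_add)

lemma poly_mapping_expand: "p = (\<Sum>x\<in>Poly_Mapping.keys p. Poly_Mapping.single x (Poly_Mapping.lookup p x))"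
proof (rule poly_mapping_eqI)
  fix y
  show "Poly_Mapping.lookup p y = Poly_Mapping.lookup (\<Sum>x\<in>Poly_Mapping.keys p. Poly_Mapping.single x (Poly_Mapping.lookup p x)) y"
    by (cases "y \<in> Poly_Mapping.keys p")
      (auto simp: lookup_sum_poly lookup_single when_def sum.delta in_keys_iff cong: if_cong)
qed

section \<open>Identification of the quotient construction of tensor powers with coordinate
  functions\<close>

section \<open>Coordinates on tensor powers\<close>

text \<open>A superalgebra with a finite homogeneous basis \<open>el\<close> and coordinates
  \<open>co\<close>. The parts \<open>G\<close> are described through coordinates, so taking a
  homogeneous component means restricting coordinates to letters of one parity.\<close>

locale graded_alg =
  fixes M :: "('k::comm_ring_1, 'm) module" and G :: "bit \<Rightarrow> 'm set" and I :: "'i set"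
    and par :: "'i \<Rightarrow> bit" and el :: "'i \<Rightarrow> 'm" and co :: "'i \<Rightarrow> 'm \<Rightarrow> 'k" and d :: nat
  assumes finI: "finite I"
    and M_add: "x \<in> carrier M \<Longrightarrow> y \<in> carrier M \<Longrightarrow> x \<oplus>\<^bsub>M\<^esub> y \<in> carrier M"
    and M_mult: "x \<in> carrier M \<Longrightarrow> y \<in> carrier M \<Longrightarrow> x \<otimes>\<^bsub>M\<^esub> y \<in> carrier M"
    and M_smult: "x \<in> carrier M \<Longrightarrow> a \<odot>\<^bsub>M\<^esub> x \<in> carrier M"
    and M_one: "\<one>\<^bsub>M\<^esub> \<in> carrier M"
    and M_assoc: "x \<in> carrier M \<Longrightarrow> y \<in> carrier M \<Longrightarrow> z \<in> carrier M \<Longrightarrow>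
      (x \<otimes>\<^bsub>M\<^esub> y) \<otimes>\<^bsub>M\<^esub> z = x \<otimes>\<^bsub>M\<^esub> (y \<otimes>\<^bsub>M\<^esub> z)"
    and M_one_l: "x \<in> carrier M \<Longrightarrow> \<one>\<^bsub>M\<^esub> \<otimes>\<^bsub>M\<^esub> x = x"
    and M_one_r: "x \<in> carrier M \<Longrightarrow> x \<otimes>\<^bsub>M\<^esub> \<one>\<^bsub>M\<^esub> = x"
    and el_M: "i \<in> I \<Longrightarrow> el i \<in> carrier M"
    and co_el: "i \<in> I \<Longrightarrow> j \<in> I \<Longrightarrow> co i (el j) = (if i = j then 1 else 0)"
    and co_add: "i \<in> I \<Longrightarrow> x \<in> carrier M \<Longrightarrow> y \<in> carrier M \<Longrightarrow> co i (x \<oplus>\<^bsub>M\<^esub> y) = co i x + co i y"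
    and co_smult: "i \<in> I \<Longrightarrow> x \<in> carrier M \<Longrightarrow> co i (a \<odot>\<^bsub>M\<^esub> x) = a * co i x"
    and co_eq: "x \<in> carrier M \<Longrightarrow> y \<in> carrier M \<Longrightarrow> (\<And>i. i \<in> I \<Longrightarrow> co i x = co i y) \<Longrightarrow> x = y"
    and co_ex: "\<exists>x\<in>carrier M. \<forall>i\<in>I. co i x = b i"
    and co_mult: "i \<in> I \<Longrightarrow> x \<in> carrier M \<Longrightarrow> y \<in> carrier M \<Longrightarrow>
      co i (x \<otimes>\<^bsub>M\<^esub> y) = (\<Sum>j\<in>I. \<Sum>k\<in>I. co i (el j \<otimes>\<^bsub>M\<^esub> el k) * (co j x * co k y))"
    and G_iff: "x \<in> G p \<longleftrightarrow> x \<in> carrier M \<and> (\<forall>i\<in>I. co i x \<noteq> 0 \<longrightarrow> par i = p)"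
    and par_mult: "i \<in> I \<Longrightarrow> j \<in> I \<Longrightarrow> k \<in> I \<Longrightarrow> co i (el j \<otimes>\<^bsub>M\<^esub> el k) \<noteq> 0 \<Longrightarrow> par i = par j + par k"
    and par_one: "i \<in> I \<Longrightarrow> co i \<one>\<^bsub>M\<^esub> \<noteq> 0 \<Longrightarrow> par i = 0"
begin

abbreviation "c \<equiv> \<lambda>i j k. co i (el j \<otimes>\<^bsub>M\<^esub> el k)"
abbreviation "o1 \<equiv> \<lambda>i. co i \<one>\<^bsub>M\<^esub>"

sublocale graded_consts I par c o1 d
proof
  show "finite I" by (rule finI)
next
  fix i j k m assume a: "i \<in> I" "j \<in> I" "k \<in> I" "m \<in> I"
  have "(\<Sum>l\<in>I. c m l k * c l i j) = co m ((el i \<otimes>\<^bsub>M\<^esub> el j) \<otimes>\<^bsub>M\<^esub> el k)"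
    using a finI by (subst co_mult) (auto simp: M_mult el_M co_el if_distrib[of "\<lambda>c. _ * c"] sum.delta cong: if_cong)
  also have "\<dots> = co m (el i \<otimes>\<^bsub>M\<^esub> (el j \<otimes>\<^bsub>M\<^esub> el k))" using a by (simp add: M_assoc el_M)
  also have "\<dots> = (\<Sum>j'\<in>I. \<Sum>l\<in>I. if j' = i then c m i l * c l j k else 0)"
    using a by (subst co_mult) (auto simp: M_mult el_M co_el intro!: sum.cong)
  also have "\<dots> = (\<Sum>l\<in>I. c m i l * c l j k)"
  proof -
    have "(\<Sum>j'\<in>I. \<Sum>l\<in>I. if j' = i then c m i l * c l j k else 0)
        = (\<Sum>j'\<in>I. if j' = i then \<Sum>l\<in>I. c m i l * c l j k else 0)"
      by (intro sum.cong refl) simp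
    then show ?thesis using a finI by simp
  qed
  finally show "(\<Sum>l\<in>I. c m l k * c l i j) = (\<Sum>l\<in>I. c m i l * c l j k)" .
next
  fix i j assume a: "i \<in> I" "j \<in> I"
  have "(\<Sum>l\<in>I. c i l j * o1 l) = co i (\<one>\<^bsub>M\<^esub> \<otimes>\<^bsub>M\<^esub> el j)"
    using a finI by (subst co_mult) (auto simp: M_one el_M co_el if_distrib[of "\<lambda>c. _ * c"] sum.delta cong: if_cong)
  then show "(\<Sum>l\<in>I. c i l j * o1 l) = (if i = j then 1 else 0)" using a by (simp add: M_one_l el_M co_el)
  have "(\<Sum>l\<in>I. c i j l * o1 l) = (\<Sum>j'\<in>I. if j' = j then \<Sum>l\<in>I. c i j' l * o1 l else 0)"
    using a finI by simp
  also have "\<dots> = (\<Sum>j'\<in>I. \<Sum>l\<in>I. c i j' l * (co j' (el j) * o1 l))"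
    using a by (intro sum.cong refl) (auto simp: co_el)
  also have "\<dots> = co i (el j \<otimes>\<^bsub>M\<^esub> \<one>\<^bsub>M\<^esub>)"
    using a by (subst co_mult) (auto simp: M_one el_M)
  finally show "(\<Sum>l\<in>I. c i j l * o1 l) = (if i = j then 1 else 0)" using a by (simp add: M_one_r el_M co_el)
qed (use par_mult par_one in auto)

notation conv (infixl \<open>\<star>\<close> 70)

abbreviation cs :: "'m \<Rightarrow> 'i \<Rightarrow> 'k" where "cs x \<equiv> \<lambda>i. co i x"

abbreviation tw :: "'m list \<Rightarrow> 'i list \<Rightarrow> 'k" where "tw w \<equiv> tens (map cs w)"

lemma lmul_cs: "x \<in> carrier M \<Longrightarrow> y \<in> carrier M \<Longrightarrow> i \<in> I \<Longrightarrow> lmul (cs x) (cs y) i = co i (x \<otimes>\<^bsub>M\<^esub> y)"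
  by (simp add: lmul_def R_def co_mult sum_distrib_left mult_ac)

lemma tens_eqI:
  "(\<And>p i. p < d \<Longrightarrow> i \<in> I \<Longrightarrow> (xs ! p) i = (ys ! p) i) \<Longrightarrow> tens xs = tens ys"
  by (auto simp: tens_def fun_eq_iff W_nth intro!: prod.cong)

lemma hcomp_props:
  assumes x: "x \<in> carrier M"
  shows "hcomp M G p x \<in> carrier M" and "i \<in> I \<Longrightarrow> co i (hcomp M G p x) = (if par i = p then co i x else 0)"
proof -
  obtain y where y: "y \<in> carrier M" "\<And>i. i \<in> I \<Longrightarrow> co i y = (if par i = p then co i x else 0)"
    using co_ex[of "\<lambda>i. if par i = p then co i x else 0"] by auto
  obtain z where z: "z \<in> carrier M" "\<And>i. i \<in> I \<Longrightarrow> co i z = (if par i = p then 0 else co i x)"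
    using co_ex[of "\<lambda>i. if par i = p then 0 else co i x"] by auto
  have pp: "q = p + 1 \<longleftrightarrow> q \<noteq> p" for q by (cases p; cases q) auto
  have yG: "y \<in> G p" and zG: "z \<in> G (p + 1)" using y z by (auto simp: G_iff pp)
  have xyz: "x = y \<oplus>\<^bsub>M\<^esub> z" using x y z by (intro co_eq) (auto simp: M_add co_add)
  have "hcomp M G p x = y"
    unfolding hcomp_def
  proof (rule the_equality)
    fix y' assume "y' \<in> G p \<and> (\<exists>z\<in>G (p + 1). x = y' \<oplus>\<^bsub>M\<^esub> z)"
    then obtain z' where "y' \<in> G p" "z' \<in> G (p + 1)" "x = y' \<oplus>\<^bsub>M\<^esub> z'" by blast
    then show "y' = y" using y by (intro co_eq) (auto simp: G_iff pp co_add)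
  qed (use yG zG xyz in blast)
  then show "hcomp M G p x \<in> carrier M" "i \<in> I \<Longrightarrow> co i (hcomp M G p x) = (if par i = p then co i x else 0)"
    using y by auto
qed

lemma hcomps_nth: "length ps = d \<Longrightarrow> length w = d \<Longrightarrow> p < d \<Longrightarrow> hcomps M G ps w ! p = hcomp M G (ps ! p) (w ! p)"
  by (simp add: hcomps_def)

lemma length_hcomps: "length ps = d \<Longrightarrow> length w = d \<Longrightarrow> length (hcomps M G ps w) = d"
  by (simp add: hcomps_def)

lemma hcomps_carrier: "ps \<in> words UNIV d \<Longrightarrow> w \<in> words (carrier M) d \<Longrightarrow> hcomps M G ps w \<in> words (carrier M) d"
  by (rule wordsI) (auto simp: length_hcomps words_length hcomps_nth words_nth hcomp_props)

lemma homog_hcomps: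
  "ps \<in> words UNIV d \<Longrightarrow> w \<in> words (carrier M) d \<Longrightarrow> p < d \<Longrightarrow> homog (ps ! p) (cs (hcomps M G ps w ! p))"
  by (auto simp: homog_def hcomps_nth words_length hcomp_props words_nth split: if_splits)

lemma finite_UNIV_bit: "finite (UNIV :: bit set)"
  by (rule finite_subset[of _ "{0, 1}"]) auto

text \<open>Each letter is the sum of its two homogeneous components; multiplying out gives one
  summand for every word of parities.\<close>

lemma tw_hcomps:
  assumes w: "w \<in> words (carrier M) d"
  shows "tw w = (\<Sum>ps\<in>words UNIV d. tw (hcomps M G ps w))"
proof (rule ext)
  fix v
  show "tw w v = (\<Sum>ps\<in>words UNIV d. tw (hcomps M G ps w)) v"
  proof (cases "v \<in> W")
    case True
    have "(\<Sum>ps\<in>words UNIV d. tw (hcomps M G ps w)) v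
        = (\<Sum>ps\<in>words UNIV d. \<Prod>p<d. if par (v ! p) = ps ! p then co (v ! p) (w ! p) else 0)"
      unfolding sum_fun_apply using w True
      by (intro sum.cong refl) (auto simp: tens_def hcomps_nth length_hcomps words_length hcomp_props words_nth intro!: prod.cong)
    also have "\<dots> = (\<Prod>p<d. \<Sum>q\<in>UNIV. if par (v ! p) = q then co (v ! p) (w ! p) else 0)"
      by (rule sum_words_prod)
    also have "\<dots> = tw w v" using True w by (simp add: tens_def words_length sum.delta finite_UNIV_bit)
    finally show ?thesis by simp
  qed (simp add: sum_fun_apply tens_def)
qed

lemma tw_conv:
  assumes v: "v \<in> words (carrier M) d" and w: "w \<in> words (carrier M) d"
  shows "tw v \<star> tw w = (\<Sum>ps\<in>words UNIV d. \<Sum>qs\<in>words UNIV d.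
      scal (tensor_sign ps qs) (tw (map2 (monoid.mult M) (hcomps M G ps v) (hcomps M G qs w))))"
proof -
  interpret TC: calg TC "(\<star>)" T1 scal by (rule calg_TC)
  have "tw v \<star> tw w = (\<Sum>ps\<in>words UNIV d. \<Sum>qs\<in>words UNIV d. tw (hcomps M G ps v) \<star> tw (hcomps M G qs w))"
    by (subst tw_hcomps[OF v], subst tw_hcomps[OF w]) (simp add: TC.sum_l TC.sum_r TC.sum_closed, rule sum.swap)
  also have "\<dots> = (\<Sum>ps\<in>words UNIV d. \<Sum>qs\<in>words UNIV d.
      scal (tensor_sign ps qs) (tw (map2 (monoid.mult M) (hcomps M G ps v) (hcomps M G qs w))))"
  proof (intro sum.cong refl)
    fix ps qs :: "bit list" assume ps: "ps \<in> words UNIV d" and qs: "qs \<in> words UNIV d"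
    note hc = hcomps_carrier[OF ps v] hcomps_carrier[OF qs w]
    have "tw (hcomps M G ps v) \<star> tw (hcomps M G qs w)
        = scal (bit_sign (texp ps qs)) (tens (map2 lmul (map cs (hcomps M G ps v)) (map cs (hcomps M G qs w))))"
      using hc ps qs v w homog_hcomps by (intro tens_conv_tens) (auto simp: words_length)
    also have "tens (map2 lmul (map cs (hcomps M G ps v)) (map cs (hcomps M G qs w)))
        = tw (map2 (monoid.mult M) (hcomps M G ps v) (hcomps M G qs w))"
      using hc by (intro tens_eqI) (simp add: words_length words_nth lmul_cs)
    finally show "tw (hcomps M G ps v) \<star> tw (hcomps M G qs w)
      = scal (tensor_sign ps qs) (tw (map2 (monoid.mult M) (hcomps M G ps v) (hcomps M G qs w)))"
      by (simp add: tensor_sign_texp)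
  qed
  finally show ?thesis .
qed

lemma tw_act:
  assumes \<sigma>: "\<sigma> permutes {..<d}" and w: "w \<in> words (carrier M) d"
  shows "actf \<sigma> (tw w) = (\<Sum>ps\<in>words UNIV d. scal (perm_sign \<sigma> ps) (tw (permute_list \<sigma> (hcomps M G ps w))))"
proof -
  interpret A: calg_act TC "(\<star>)" T1 scal d actf by (rule calg_act_TC)
  have "actf \<sigma> (tw w) = (\<Sum>ps\<in>words UNIV d. actf \<sigma> (tw (hcomps M G ps w)))"
    by (subst tw_hcomps[OF w]) (simp add: A.act_sum[OF \<sigma>])
  also have "\<dots> = (\<Sum>ps\<in>words UNIV d. scal (perm_sign \<sigma> ps) (tw (permute_list \<sigma> (hcomps M G ps w))))"
  proof (intro sum.cong refl)
    fix ps :: "bit list" assume ps: "ps \<in> words UNIV d"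
    have l: "length (hcomps M G ps w) = d" using ps w by (simp add: length_hcomps words_length)
    then have \<sigma>': "\<sigma> permutes {..<length (hcomps M G ps w)}" using \<sigma> by simp
    show "actf \<sigma> (tw (hcomps M G ps w)) = scal (perm_sign \<sigma> ps) (tw (permute_list \<sigma> (hcomps M G ps w)))"
      unfolding permute_list_map[OF \<sigma>', symmetric] using l ps w homog_hcomps
      by (intro actf_tens[OF \<sigma>]) (auto simp: words_length)
  qed
  finally show ?thesis .
qed

text \<open>Linear extension of the coordinates of words to the free module. Its kernel is
  \<open>Rel\<close> and its image is \<open>TC\<close>, so it realizes the quotient map.\<close>

definition \<Theta> :: "('m list \<Rightarrow>\<^sub>0 'k) \<Rightarrow> 'i list \<Rightarrow> 'k" where
  "\<Theta> p = (\<lambda>v. lin (\<lambda>w. tw w v) p)"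

abbreviation "Fw \<equiv> free_words M G d"

lemma Fw_simps: "carrier Fw = {p. Poly_Mapping.keys p \<subseteq> words (carrier M) d}"
  "monoid.mult Fw = free_extend2 (word_mult M G d)" "\<one>\<^bsub>Fw\<^esub> = Poly_Mapping.single (replicate d \<one>\<^bsub>M\<^esub>) 1"
  "add Fw = (+)" "Module.module.smult Fw = free_smult"
  by (simp_all add: free_words_def)

lemma \<Theta>_TC [simp]: "\<Theta> p \<in> TC"
  by (auto simp: \<Theta>_def TC_def lin_def tens_def)

lemma \<Theta>_add: "\<Theta> (p + q) = \<Theta> p + \<Theta> q" by (rule ext) (simp add: \<Theta>_def lin_add)

lemma \<Theta>_diff: "\<Theta> (p - q) = \<Theta> p - \<Theta> q" by (rule ext) (simp add: \<Theta>_def lin_diff)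

lemma \<Theta>_smult: "\<Theta> (free_smult a p) = scal a (\<Theta> p)" by (rule ext) (simp add: \<Theta>_def lin_smult scal_def)

lemma \<Theta>_single: "\<Theta> (Poly_Mapping.single w a) = scal a (tw w)" by (rule ext) (simp add: \<Theta>_def scal_def)

lemma \<Theta>_sum: "\<Theta> (sum g J) = (\<Sum>j\<in>J. \<Theta> (g j))" by (rule ext) (simp add: \<Theta>_def lin_sum sum_fun_apply)

lemma \<Theta>_free_extend: "\<Theta> (free_extend g p) = (\<Sum>w\<in>Poly_Mapping.keys p. scal (Poly_Mapping.lookup p w) (\<Theta> (g w)))"
  unfolding free_extend_def by (simp add: \<Theta>_sum \<Theta>_smult)

lemma \<Theta>_expand: "\<Theta> p = (\<Sum>w\<in>Poly_Mapping.keys p. scal (Poly_Mapping.lookup p w) (tw w))"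
  by (rule ext) (simp add: \<Theta>_def lin_def sum_fun_apply scal_def)

lemma \<Theta>_mult:
  assumes p: "p \<in> carrier Fw" and q: "q \<in> carrier Fw"
  shows "\<Theta> (p \<otimes>\<^bsub>Fw\<^esub> q) = \<Theta> p \<star> \<Theta> q"
proof -
  interpret TC: calg TC "(\<star>)" T1 scal by (rule calg_TC)
  have st: "scal a (tw w) \<in> TC" for a w by (rule TC.sm_closed) simp
  have "\<Theta> (p \<otimes>\<^bsub>Fw\<^esub> q) = (\<Sum>v\<in>Poly_Mapping.keys p. \<Sum>w\<in>Poly_Mapping.keys q.
      scal (Poly_Mapping.lookup p v * Poly_Mapping.lookup q w) (\<Theta> (word_mult M G d v w)))"
    unfolding Fw_simps free_extend2_def \<Theta>_free_extend
    by (intro sum.cong refl, rule ext) (simp add: scal_def sum_fun_apply sum_distrib_left mult.assoc)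
  also have "\<dots> = (\<Sum>v\<in>Poly_Mapping.keys p. \<Sum>w\<in>Poly_Mapping.keys q.
      scal (Poly_Mapping.lookup p v * Poly_Mapping.lookup q w) (tw v \<star> tw w))"
  proof (rule sum.cong[OF refl], rule sum.cong[OF refl])
    fix v w assume "v \<in> Poly_Mapping.keys p" "w \<in> Poly_Mapping.keys q"
    then have vw: "v \<in> words (carrier M) d" "w \<in> words (carrier M) d" using p q by (auto simp: Fw_simps)
    show "scal (Poly_Mapping.lookup p v * Poly_Mapping.lookup q w) (\<Theta> (word_mult M G d v w))
        = scal (Poly_Mapping.lookup p v * Poly_Mapping.lookup q w) (tw v \<star> tw w)"
      unfolding tw_conv[OF vw] by (simp add: word_mult_def \<Theta>_sum \<Theta>_single)
  qed
  also have "\<dots> = (\<Sum>v\<in>Poly_Mapping.keys p. \<Sum>w\<in>Poly_Mapping.keys q.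
      scal (Poly_Mapping.lookup p v) (tw v) \<star> scal (Poly_Mapping.lookup q w) (tw w))"
    by (simp add: conv_scal_l conv_scal_r) (simp add: scal_def mult_ac)
  also have "\<dots> = \<Theta> p \<star> \<Theta> q"
    unfolding \<Theta>_expand by (simp add: TC.sum_l TC.sum_r TC.sum_closed st, rule sum.swap)
  finally show ?thesis .
qed

lemma \<Theta>_act:
  assumes \<sigma>: "\<sigma> permutes {..<d}" and p: "p \<in> carrier Fw"
  shows "\<Theta> (free_extend (word_act M G d \<sigma>) p) = actf \<sigma> (\<Theta> p)"
proof -
  interpret A: calg_act TC "(\<star>)" T1 scal d actf by (rule calg_act_TC)
  have st: "scal a (tw w) \<in> TC" for a w by (rule A.sm_closed) simp
  have "actf \<sigma> (\<Theta> p) = (\<Sum>w\<in>Poly_Mapping.keys p. scal (Poly_Mapping.lookup p w) (actf \<sigma> (tw w)))"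
    unfolding \<Theta>_expand by (simp add: A.act_sum[OF \<sigma>] st A.act_sm[OF \<sigma>])
  also have "\<dots> = \<Theta> (free_extend (word_act M G d \<sigma>) p)"
    unfolding \<Theta>_free_extend
  proof (intro sum.cong refl)
    fix w assume "w \<in> Poly_Mapping.keys p"
    then have "w \<in> words (carrier M) d" using p by (auto simp: Fw_simps)
    then show "scal (Poly_Mapping.lookup p w) (actf \<sigma> (tw w)) = scal (Poly_Mapping.lookup p w) (\<Theta> (word_act M G d \<sigma> w))"
      by (simp add: tw_act[OF \<sigma>] word_act_def \<Theta>_sum \<Theta>_single)
  qed
  finally show ?thesis by simp
qed

lemma Fw_mult_closed: "p \<in> carrier Fw \<Longrightarrow> q \<in> carrier Fw \<Longrightarrow> p \<otimes>\<^bsub>Fw\<^esub> q \<in> carrier Fw"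
  unfolding Fw_simps free_extend2_def word_mult_def mem_Collect_eq
proof (intro keys_free_extend keys_sum_subset)
  fix v w and ps qs :: "bit list"
  assume a: "Poly_Mapping.keys p \<subseteq> words (carrier M) d" "Poly_Mapping.keys q \<subseteq> words (carrier M) d"
    and b: "v \<in> Poly_Mapping.keys p" "w \<in> Poly_Mapping.keys q" "ps \<in> words UNIV d" "qs \<in> words UNIV d"
  have "v \<in> words (carrier M) d" "w \<in> words (carrier M) d" using a b by auto
  note hc = hcomps_carrier[OF b(3) this(1)] hcomps_carrier[OF b(4) this(2)]
  have "map2 (monoid.mult M) (hcomps M G ps v) (hcomps M G qs w) \<in> words (carrier M) d"
    using hc by (intro wordsI) (auto simp: words_length words_nth M_mult)
  then show "Poly_Mapping.keys (Poly_Mapping.single (map2 (monoid.mult M) (hcomps M G ps v) (hcomps M G qs w)) (tensor_sign ps qs))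
      \<subseteq> words (carrier M) d"
    by (auto split: if_splits)
qed

lemma Fw_act_closed: "\<sigma> permutes {..<d} \<Longrightarrow> p \<in> carrier Fw \<Longrightarrow> free_extend (word_act M G d \<sigma>) p \<in> carrier Fw"
  unfolding Fw_simps word_act_def mem_Collect_eq
proof (intro keys_free_extend keys_sum_subset)
  fix w and ps :: "bit list"
  assume a: "Poly_Mapping.keys p \<subseteq> words (carrier M) d" "\<sigma> permutes {..<d}"
    and b: "w \<in> Poly_Mapping.keys p" "ps \<in> words UNIV d"
  have "w \<in> words (carrier M) d" using a b by auto
  note hc = hcomps_carrier[OF b(2) this]
  then have "permute_list \<sigma> (hcomps M G ps w) \<in> words (carrier M) d"
    using a(2) by (auto simp: words_def)
  then show "Poly_Mapping.keys (Poly_Mapping.single (permute_list \<sigma> (hcomps M G ps w)) (perm_sign \<sigma> ps))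
      \<subseteq> words (carrier M) d"
    by (auto split: if_splits)
qed

subsection \<open>The kernel of the coordinate map\<close>

abbreviation "Rel \<equiv> tensor_rels M d"

lemma Rel_add:
  "u @ [x \<oplus>\<^bsub>M\<^esub> y] @ v \<in> words UNIV d \<Longrightarrow> u @ [x] @ v \<in> words (carrier M) d \<Longrightarrow> y \<in> carrier M \<Longrightarrow>
   Poly_Mapping.single (u @ [x \<oplus>\<^bsub>M\<^esub> y] @ v) 1 - Poly_Mapping.single (u @ [x] @ v) 1 - Poly_Mapping.single (u @ [y] @ v) 1 \<in> Rel"
  unfolding tensor_rels_def by (intro free.span_base UnI1) blast

lemma Rel_smult:
  "u @ [x] @ v \<in> words (carrier M) d \<Longrightarrow>
   Poly_Mapping.single (u @ [a \<odot>\<^bsub>M\<^esub> x] @ v) 1 - Poly_Mapping.single (u @ [x] @ v) a \<in> Rel"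
  unfolding tensor_rels_def by (intro free.span_base UnI2) blast

lemma subspace_Rel: "free.subspace Rel" unfolding tensor_rels_def by (rule free.subspace_span)

lemma subspace_ker: "free.subspace {p \<in> carrier Fw. \<Theta> p = 0}"
proof (rule free.subspaceI)
  show "0 \<in> {p \<in> carrier Fw. \<Theta> p = 0}" by (simp add: Fw_simps \<Theta>_def fun_eq_iff)
next
  fix p q assume "p \<in> {p \<in> carrier Fw. \<Theta> p = 0}" "q \<in> {p \<in> carrier Fw. \<Theta> p = 0}"
  then show "p + q \<in> {p \<in> carrier Fw. \<Theta> p = 0}" using keys_add[of p q] by (auto simp: Fw_simps \<Theta>_add)
next
  fix a p assume "p \<in> {p \<in> carrier Fw. \<Theta> p = 0}"
  then show "free_smult a p \<in> {p \<in> carrier Fw. \<Theta> p = 0}"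
    using keys_free_smult[of a p] by (auto simp: Fw_simps \<Theta>_smult, simp add: scal_def fun_eq_iff)
qed

lemma Fw_diff: "p \<in> carrier Fw \<Longrightarrow> q \<in> carrier Fw \<Longrightarrow> p - q \<in> carrier Fw"
  using keys_diff[of p q] by (auto simp: Fw_simps)

lemma Fw_single: "w \<in> words (carrier M) d \<Longrightarrow> Poly_Mapping.single w a \<in> carrier Fw"
  by (simp add: Fw_simps)

text \<open>The placeholder \<open>undefined\<close> occupies the position that the product leaves
  out, so the second factor visibly does not depend on \<open>x\<close>; linearity in one letter can
  then be read off.\<close>

lemma tw_split:
  assumes "u @ [x] @ v \<in> words (carrier M) d" "w \<in> W"
  shows "tw (u @ [x] @ v) w = co (w ! length u) x * (\<Prod>p\<in>{..<d} - {length u}. co (w ! p) ((u @ [undefined] @ v) ! p))"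
proof -
  have n: "length u < d" using assms(1) by (auto simp: words_def)
  have "tw (u @ [x] @ v) w = (\<Prod>p<d. co (w ! p) ((u @ [x] @ v) ! p))"
  proof -
    have "map cs (u @ [x] @ v) ! p = cs ((u @ [x] @ v) ! p)" if "p < d" for p
      using words_length[OF assms(1)] that by (intro nth_map) simp
    then show ?thesis using assms(2) by (simp add: tens_def del: map_append append_Cons append_Nil)
  qed
  also have "\<dots> = co (w ! length u) ((u @ [x] @ v) ! length u) * (\<Prod>p\<in>{..<d} - {length u}. co (w ! p) ((u @ [x] @ v) ! p))"
    using n by (subst prod.remove[of _ "length u"]) auto
  also have "(\<Prod>p\<in>{..<d} - {length u}. co (w ! p) ((u @ [x] @ v) ! p))
      = (\<Prod>p\<in>{..<d} - {length u}. co (w ! p) ((u @ [undefined] @ v) ! p))"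
    by (intro prod.cong refl) (auto simp: nth_append nth_Cons split: nat.split)
  finally show ?thesis by simp
qed

lemma Rel_subset_ker: "Rel \<subseteq> {p \<in> carrier Fw. \<Theta> p = 0}"
  unfolding tensor_rels_def
proof (rule free.span_minimal[OF _ subspace_ker], safe)
  fix u x y v assume w: "u @ [x] @ v \<in> words (carrier M) d" and y: "y \<in> carrier M"
  have x: "x \<in> carrier M" using w by (auto simp: words_def)
  have w': "u @ [y] @ v \<in> words (carrier M) d" "u @ [x \<oplus>\<^bsub>M\<^esub> y] @ v \<in> words (carrier M) d"
    using w y by (auto simp: words_def M_add)
  let ?p = "Poly_Mapping.single (u @ [x \<oplus>\<^bsub>M\<^esub> y] @ v) 1 - Poly_Mapping.single (u @ [x] @ v) 1 - Poly_Mapping.single (u @ [y] @ v) (1::'k)"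
  show "?p \<in> carrier Fw" by (intro Fw_diff Fw_single w w')
  show "\<Theta> ?p = 0"
  proof (rule TC_eqI)
    fix t assume t: "t \<in> W"
    have "t ! length u \<in> I" using t w by (intro W_nth) (auto simp: words_def)
    then show "\<Theta> ?p t = 0 t"
      using x y unfolding \<Theta>_diff \<Theta>_single scal_1 minus_apply tw_split[OF w t] tw_split[OF w'(1) t] tw_split[OF w'(2) t]
      by (simp add: co_add algebra_simps)
  qed (rule \<Theta>_TC, simp add: TC_def)
next
  fix u a x v assume w: "u @ [x] @ v \<in> words (carrier M) d"
  have x: "x \<in> carrier M" using w by (auto simp: words_def)
  have w': "u @ [a \<odot>\<^bsub>M\<^esub> x] @ v \<in> words (carrier M) d" using w by (auto simp: words_def M_smult)
  let ?p = "Poly_Mapping.single (u @ [a \<odot>\<^bsub>M\<^esub> x] @ v) 1 - Poly_Mapping.single (u @ [x] @ v) a"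
  show "?p \<in> carrier Fw" by (intro Fw_diff Fw_single w w')
  show "\<Theta> ?p = 0"
  proof (rule TC_eqI)
    fix t assume t: "t \<in> W"
    have "t ! length u \<in> I" using t w by (intro W_nth) (auto simp: words_def)
    then show "\<Theta> ?p t = 0 t"
      using x unfolding \<Theta>_diff \<Theta>_single scal_def minus_apply tw_split[OF w t] tw_split[OF w' t]
      by (simp add: co_smult algebra_simps)
  qed (rule \<Theta>_TC, simp add: TC_def)
qed

text \<open>Induction on a set \<open>J\<close> supporting the coordinates of \<open>x\<close>: the
  additive relation splits off one basis component, and the scalar relation pulls out its
  coefficient.\<close>

lemma single_letter_Rel:
  assumes w: "u @ [x] @ v \<in> words (carrier M) d"
  shows "Poly_Mapping.single (u @ [x] @ v) 1 - (\<Sum>i\<in>I. Poly_Mapping.single (u @ [el i] @ v) (co i x)) \<in> Rel"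
proof -
  have uv: "set u \<subseteq> carrier M" "set v \<subseteq> carrier M" "length u + length v + 1 = d" using w by (auto simp: words_def)
  have W': "u @ [y] @ v \<in> words (carrier M) d" if "y \<in> carrier M" for y using uv that by (simp add: words_def)
  have "Poly_Mapping.single (u @ [x] @ v) 1 - (\<Sum>i\<in>J. Poly_Mapping.single (u @ [el i] @ v) (co i x)) \<in> Rel"
    if "J \<subseteq> I" "x \<in> carrier M" "\<forall>i\<in>I - J. co i x = 0" for J x
    using finite_subset[OF that(1) finI] that
  proof (induction J arbitrary: x rule: finite_induct)
    case empty
    \<comment> \<open>An element with all coordinates zero equals its own multiple by 0, and the
      scalar relation for this multiple disposes of the word.\<close>
    then have "x = 0 \<odot>\<^bsub>M\<^esub> x" by (intro co_eq) (auto simp: M_smult co_smult)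
    then show ?case using Rel_smult[OF W'[OF empty.prems(2)], of 0] by simp
  next
    case (insert j J)
    have j: "j \<in> I" using insert by auto
    obtain x' where x': "x' \<in> carrier M" "\<And>i. i \<in> I \<Longrightarrow> co i x' = (if i = j then 0 else co i x)"
      using co_ex[of "\<lambda>i. if i = j then 0 else co i x"] by auto
    let ?s = "\<lambda>y. Poly_Mapping.single (u @ [y] @ v) (1::'k)"
    have xe: "x = x' \<oplus>\<^bsub>M\<^esub> (co j x \<odot>\<^bsub>M\<^esub> el j)"
      using insert.prems j x' by (intro co_eq) (auto simp: M_add M_smult co_add co_smult el_M co_el)
    have 1: "?s x - ?s x' - ?s (co j x \<odot>\<^bsub>M\<^esub> el j) \<in> Rel"
      by (subst xe, rule Rel_add) (use x' j W' uv in \<open>auto simp: M_smult el_M words_def\<close>)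
    have 2: "?s (co j x \<odot>\<^bsub>M\<^esub> el j) - Poly_Mapping.single (u @ [el j] @ v) (co j x) \<in> Rel"
      by (rule Rel_smult) (use j W' el_M in auto)
    have "?s x' - (\<Sum>i\<in>J. Poly_Mapping.single (u @ [el i] @ v) (co i x')) \<in> Rel"
      using insert x' by (intro insert.IH) auto
    moreover have "(\<Sum>i\<in>J. Poly_Mapping.single (u @ [el i] @ v) (co i x')) = (\<Sum>i\<in>J. Poly_Mapping.single (u @ [el i] @ v) (co i x))"
      using insert x' by (intro sum.cong refl) auto
    ultimately have 3: "?s x' - (\<Sum>i\<in>J. Poly_Mapping.single (u @ [el i] @ v) (co i x)) \<in> Rel" by simp
    have "?s x - (\<Sum>i\<in>insert j J. Poly_Mapping.single (u @ [el i] @ v) (co i x))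
      = (?s x - ?s x' - ?s (co j x \<odot>\<^bsub>M\<^esub> el j)) + (?s (co j x \<odot>\<^bsub>M\<^esub> el j) - Poly_Mapping.single (u @ [el j] @ v) (co j x))
        + (?s x' - (\<Sum>i\<in>J. Poly_Mapping.single (u @ [el i] @ v) (co i x)))"
      using insert.hyps by simp
    also have "\<dots> \<in> Rel" by (intro free.subspace_add[OF subspace_Rel] 1 2 3)
    finally show ?case .
  qed
  from this[of I x] show ?thesis using w by (auto simp: words_def)
qed

text \<open>Letters are expanded from the left; the prefix \<open>u\<close> records the positions
  already replaced by basis elements.\<close>

lemma word_Rel:
  assumes "u \<in> words I (d - length w)" "length w \<le> d" "set w \<subseteq> carrier M"
  shows "Poly_Mapping.single (map el u @ w) 1
    - (\<Sum>v\<in>words I (length w). Poly_Mapping.single (map el (u @ v)) (\<Prod>p<length w. co (v ! p) (w ! p))) \<in> Rel"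
  using assms
proof (induction w arbitrary: u)
  case Nil
  then show ?case using free.subspace_0[OF subspace_Rel] by simp
next
  case (Cons x w)
  let ?S = "\<lambda>u. (\<Sum>v\<in>words I (length w). Poly_Mapping.single (map el (u @ v)) (\<Prod>p<length w. co (v ! p) (w ! p)))"
  have elu: "el ` set u \<subseteq> carrier M" using Cons.prems by (auto simp: words_def el_M)
  have 1: "Poly_Mapping.single (map el u @ [x] @ w) 1 - (\<Sum>i\<in>I. Poly_Mapping.single (map el u @ [el i] @ w) (co i x)) \<in> Rel"
    using Cons.prems elu by (intro single_letter_Rel) (auto simp: words_def)
  have 2: "Poly_Mapping.single (map el (u @ [i]) @ w) 1 - ?S (u @ [i]) \<in> Rel" if "i \<in> I" for i
    using Cons.prems that by (intro Cons.IH) (auto simp: words_def)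
  have 3: "(\<Sum>i\<in>I. free_smult (co i x) (Poly_Mapping.single (map el (u @ [i]) @ w) 1 - ?S (u @ [i]))) \<in> Rel"
    by (intro free.subspace_sum[OF subspace_Rel] free.subspace_scale[OF subspace_Rel] 2)
  have "(\<Sum>v\<in>words I (length (x # w)). Poly_Mapping.single (map el (u @ v)) (\<Prod>p<length (x # w). co (v ! p) ((x # w) ! p)))
      = (\<Sum>i\<in>I. free_smult (co i x) (?S (u @ [i])))"
    by (simp add: sum_words_Suc prod.lessThan_Suc_shift free.scale_sum_right del: prod.lessThan_Suc)
  then have "Poly_Mapping.single (map el u @ (x # w)) 1
    - (\<Sum>v\<in>words I (length (x # w)). Poly_Mapping.single (map el (u @ v)) (\<Prod>p<length (x # w). co (v ! p) ((x # w) ! p)))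
    = (Poly_Mapping.single (map el u @ [x] @ w) 1 - (\<Sum>i\<in>I. Poly_Mapping.single (map el u @ [el i] @ w) (co i x)))
     + (\<Sum>i\<in>I. free_smult (co i x) (Poly_Mapping.single (map el (u @ [i]) @ w) 1 - ?S (u @ [i])))"
    by (simp add: free.scale_right_diff_distrib sum_subtractf)
  also have "\<dots> \<in> Rel" by (intro free.subspace_add[OF subspace_Rel] 1 3)
  finally show ?case .
qed

text \<open>Modulo the relations \<open>p\<close> is the combination of basis words with
  coefficients \<open>\<Theta> p\<close>, so it is itself a relation once these vanish.\<close>

lemma Rel_eq_ker: "Rel = {p \<in> carrier Fw. \<Theta> p = 0}"
proof (rule equalityI[OF Rel_subset_ker], safe)
  fix p assume p: "p \<in> carrier Fw" "\<Theta> p = 0"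
  let ?K = "Poly_Mapping.keys p" and ?l = "Poly_Mapping.lookup p"
  have 1: "Poly_Mapping.single w 1 - (\<Sum>v\<in>W. Poly_Mapping.single (map el v) (tw w v)) \<in> Rel" if "w \<in> ?K" for w
  proof -
    have w: "w \<in> words (carrier M) d" using that p by (auto simp: Fw_simps)
    have "(\<Sum>v\<in>W. Poly_Mapping.single (map el v) (tw w v))
        = (\<Sum>v\<in>W. Poly_Mapping.single (map el v) (\<Prod>p<d. co (v ! p) (w ! p)))"
      using w by (intro sum.cong refl) (simp add: tens_def words_length)
    then show ?thesis using word_Rel[of "[]" w] w by (auto simp: words_def)
  qed
  have "(\<Sum>w\<in>?K. free_smult (?l w) (\<Sum>v\<in>W. Poly_Mapping.single (map el v) (tw w v)))
      = (\<Sum>w\<in>?K. \<Sum>v\<in>W. Poly_Mapping.single (map el v) (?l w * tw w v))"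
    by (simp add: free.scale_sum_right)
  also have "\<dots> = (\<Sum>v\<in>W. \<Sum>w\<in>?K. Poly_Mapping.single (map el v) (?l w * tw w v))" by (rule sum.swap)
  also have "\<dots> = (\<Sum>v\<in>W. Poly_Mapping.single (map el v) (\<Theta> p v))"
  proof (intro sum.cong refl)
    fix v
    show "(\<Sum>w\<in>?K. Poly_Mapping.single (map el v) (?l w * tw w v)) = Poly_Mapping.single (map el v) (\<Theta> p v)"
      unfolding \<Theta>_def lin_def
      by (rule poly_mapping_eqI) (simp add: lookup_sum_poly lookup_single when_def)
  qed
  also have "\<dots> = 0" using p by simp
  finally have z: "(\<Sum>w\<in>?K. free_smult (?l w) (\<Sum>v\<in>W. Poly_Mapping.single (map el v) (tw w v))) = 0" .
  have "p = (\<Sum>w\<in>?K. free_smult (?l w) (Poly_Mapping.single w 1))"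
    using poly_mapping_expand[of p] by simp
  then have "p = (\<Sum>w\<in>?K. free_smult (?l w) (Poly_Mapping.single w 1 - (\<Sum>v\<in>W. Poly_Mapping.single (map el v) (tw w v))))"
    using z by (simp add: free.scale_right_diff_distrib sum_subtractf)
  also have "\<dots> \<in> Rel"
    by (intro free.subspace_sum[OF subspace_Rel] free.subspace_scale[OF subspace_Rel] 1)
  finally show "p \<in> Rel" .
qed

lemma image_\<Theta>: "\<Theta> ` carrier Fw = TC"
proof (intro equalityI subsetI)
  fix g assume g: "g \<in> TC"
  let ?p = "\<Sum>v\<in>W. Poly_Mapping.single (map el v) (g v)"
  have elW: "map el v \<in> words (carrier M) d" if "v \<in> W" for v using that el_M by (auto simp: words_def)
  have p: "?p \<in> carrier Fw"
    unfolding Fw_simps mem_Collect_eq using elW by (intro keys_sum_subset) (auto split: if_splits)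
  have "tw (map el v) w = (if w = v then 1 else 0)" if "v \<in> W" "w \<in> W" for v w
  proof -
    have "tw (map el v) w = (\<Prod>p<d. if w ! p = v ! p then 1 else 0)"
      using that by (auto simp: tens_def W_length co_el W_nth intro!: prod.cong)
    then show ?thesis using that by (simp add: prod_delta_words W_length)
  qed
  then have "\<Theta> ?p w = g w" if "w \<in> W" for w
    using that finW unfolding \<Theta>_sum \<Theta>_single sum_fun_apply scal_def
    by (simp add: if_distrib[of "\<lambda>c. _ * c"] sum.delta cong: if_cong)
  then have "\<Theta> ?p = g" by (intro TC_eqI[OF _ g]) auto
  then show "g \<in> \<Theta> ` carrier Fw" using p by (intro image_eqI[OF sym])
qed auto

definition coords :: "('m list \<Rightarrow>\<^sub>0 'k) set \<Rightarrow> 'i list \<Rightarrow> 'k" where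
  "coords U = \<Theta> (SOME p. p \<in> U)"

lemma
  shows faithful_rep_tensor_power: "faithful_rep (tensor_power M G d) coords TC (\<star>) T1 scal"
    and coords_coset: "p \<in> carrier Fw \<Longrightarrow> coords (Rel +>\<^bsub>Fw\<^esub> p) = \<Theta> p"
    and Rel_coset: "p \<in> carrier Fw \<Longrightarrow> Rel +>\<^bsub>Fw\<^esub> p = {q \<in> carrier Fw. \<Theta> q = \<Theta> p}"
    and carrier_tensor_power: "carrier (tensor_power M G d) = (\<lambda>p. Rel +>\<^bsub>Fw\<^esub> p) ` carrier Fw"
proof -
  have one: "\<one>\<^bsub>Fw\<^esub> \<in> carrier Fw" "\<Theta> \<one>\<^bsub>Fw\<^esub> = T1"
  proof -
    have r: "replicate d \<one>\<^bsub>M\<^esub> \<in> words (carrier M) d" using M_one by (auto simp: words_def)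
    show "\<one>\<^bsub>Fw\<^esub> \<in> carrier Fw" using Fw_single[OF r, of 1] by (simp add: Fw_simps)
    show "\<Theta> \<one>\<^bsub>Fw\<^esub> = T1" by (simp add: Fw_simps \<Theta>_single T1_def)
  qed
  have smc: "a \<odot>\<^bsub>Fw\<^esub> p \<in> carrier Fw" if "p \<in> carrier Fw" for a p
    using that keys_free_smult[of a p] by (auto simp: Fw_simps)
  note Q = faithful_rep_quot_alg[of Fw \<Theta> T1 "(\<star>)" scal Rel,
      OF Fw_simps(4) Fw_diff one Fw_mult_closed smc \<Theta>_add \<Theta>_mult _ Rel_eq_ker, simplified]
  have sm: "\<Theta> (a \<odot>\<^bsub>Fw\<^esub> p) = scal a (\<Theta> p)" for a p by (simp add: Fw_simps \<Theta>_smult)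
  have c: "coords = (\<lambda>U. \<Theta> (SOME p. p \<in> U))" by (simp add: fun_eq_iff coords_def)
  show "faithful_rep (tensor_power M G d) coords TC (\<star>) T1 scal"
    using Q(1)[OF sm] unfolding image_\<Theta> tensor_power_def c .
  show "coords (Rel +>\<^bsub>Fw\<^esub> p) = \<Theta> p" if "p \<in> carrier Fw" unfolding c by (rule Q(2)[OF sm that])
  show "Rel +>\<^bsub>Fw\<^esub> p = {q \<in> carrier Fw. \<Theta> q = \<Theta> p}" if "p \<in> carrier Fw" by (rule Q(3)[OF sm that])
  show "carrier (tensor_power M G d) = (\<lambda>p. Rel +>\<^bsub>Fw\<^esub> p) ` carrier Fw"
    unfolding tensor_power_def by (rule Q(4)[OF sm])
qed

lemma pure_tensor_props:
  assumes w: "w \<in> words (carrier M) d"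
  shows "pure_tensor M G w \<in> carrier (tensor_power M G d)" and "coords (pure_tensor M G w) = tw w"
proof -
  have p: "Poly_Mapping.single w 1 \<in> carrier Fw" by (rule Fw_single[OF w])
  have e: "pure_tensor M G w = Rel +>\<^bsub>Fw\<^esub> Poly_Mapping.single w 1" using w by (simp add: pure_tensor_def words_length)
  show "pure_tensor M G w \<in> carrier (tensor_power M G d)" unfolding e carrier_tensor_power using p by blast
  show "coords (pure_tensor M G w) = tw w" unfolding e coords_coset[OF p] by (simp add: \<Theta>_single)
qed

text \<open>The action is a union over representatives. It is a single coset because the coordinates
  of a permuted representative are determined by the coordinates of the representative.\<close>

lemma tensor_act_props:
  assumes \<sigma>: "\<sigma> permutes {..<d}" and U: "U \<in> carrier (tensor_power M G d)"
  shows "tensor_act M G d \<sigma> U \<in> carrier (tensor_power M G d)"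
    and "coords (tensor_act M G d \<sigma> U) = actf \<sigma> (coords U)"
proof -
  obtain p where p: "U = Rel +>\<^bsub>Fw\<^esub> p" "p \<in> carrier Fw" using U unfolding carrier_tensor_power by blast
  let ?e = "free_extend (word_act M G d \<sigma>)"
  have "Rel +>\<^bsub>Fw\<^esub> ?e u = Rel +>\<^bsub>Fw\<^esub> ?e p" if "u \<in> U" for u
  proof -
    have "u \<in> carrier Fw" "\<Theta> u = \<Theta> p" using that p by (auto simp: Rel_coset)
    then show ?thesis using p(2) by (simp add: Rel_coset Fw_act_closed[OF \<sigma>] \<Theta>_act[OF \<sigma>])
  qed
  moreover have "p \<in> U" using p by (simp add: Rel_coset)
  ultimately have e: "tensor_act M G d \<sigma> U = Rel +>\<^bsub>Fw\<^esub> ?e p" unfolding tensor_act_def by blast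
  show "tensor_act M G d \<sigma> U \<in> carrier (tensor_power M G d)"
    unfolding e carrier_tensor_power using p Fw_act_closed[OF \<sigma>] by blast
  show "coords (tensor_act M G d \<sigma> U) = actf \<sigma> (coords U)"
  proof -
    have "coords (tensor_act M G d \<sigma> U) = \<Theta> (?e p)" unfolding e by (rule coords_coset[OF Fw_act_closed[OF \<sigma> p(2)]])
    then show ?thesis unfolding \<Theta>_act[OF \<sigma> p(2)] unfolding p(1) coords_coset[OF p(2)] .
  qed
qed

abbreviation "Inv \<equiv> calg_act.invs TC d actf"

lemma carrier_tensor_invariants:
  "carrier (tensor_invariants M G d) = {U \<in> carrier (tensor_power M G d). coords U \<in> Inv}"
proof -
  interpret A: calg_act TC "(\<star>)" T1 scal d actf by (rule calg_act_TC)
  note Q = faithful_repD[OF faithful_rep_tensor_power]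
  have "tensor_act M G d \<sigma> U = U \<longleftrightarrow> actf \<sigma> (coords U) = coords U"
    if "U \<in> carrier (tensor_power M G d)" "\<sigma> permutes {..<d}" for U \<sigma>
    using tensor_act_props[OF that(2,1)] Q(11) that(1) unfolding bij_betw_def inj_on_def by metis
  then show ?thesis unfolding tensor_invariants_def A.invs_def using Q(12) by auto
qed

lemma faithful_rep_tensor_invariants:
  "faithful_rep (tensor_invariants M G d) coords Inv (\<star>) T1 scal"
proof -
  interpret A: calg_act TC "(\<star>)" T1 scal d actf by (rule calg_act_TC)
  interpret I: calg Inv "(\<star>)" T1 scal by (rule A.calg_invs)
  note Q = faithful_repD[OF faithful_rep_tensor_power]
  have ops: "monoid.mult (tensor_invariants M G d) = monoid.mult (tensor_power M G d)"
    "add (tensor_invariants M G d) = add (tensor_power M G d)"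
    "\<one>\<^bsub>tensor_invariants M G d\<^esub> = \<one>\<^bsub>tensor_power M G d\<^esub>"
    "\<zero>\<^bsub>tensor_invariants M G d\<^esub> = \<zero>\<^bsub>tensor_power M G d\<^esub>"
    "Module.module.smult (tensor_invariants M G d) = Module.module.smult (tensor_power M G d)"
    by (simp_all add: tensor_invariants_def)
  show ?thesis
  proof (rule faithful_repI)
    show "bij_betw coords (carrier (tensor_invariants M G d)) Inv"
      unfolding bij_betw_def
    proof
      show "inj_on coords (carrier (tensor_invariants M G d))"
        proof (rule inj_on_subset)
        show "inj_on coords (carrier (tensor_power M G d))" using Q(11) by (rule bij_betw_imp_inj_on)
        show "carrier (tensor_invariants M G d) \<subseteq> carrier (tensor_power M G d)"
          unfolding carrier_tensor_invariants by blast
      qed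
      have "x \<in> coords ` carrier (tensor_invariants M G d)" if x: "x \<in> Inv" for x
      proof -
        have "x \<in> coords ` carrier (tensor_power M G d)"
          unfolding bij_betw_imp_surj_on[OF Q(11)] by (rule A.invs_C[OF x])
        then obtain U where "x = coords U" "U \<in> carrier (tensor_power M G d)" by (rule imageE)
        then show ?thesis using x by (intro image_eqI[of _ _ U]) (simp_all add: carrier_tensor_invariants)
      qed
      then show "coords ` carrier (tensor_invariants M G d) = Inv" by (auto simp: carrier_tensor_invariants)
    qed
  next
    fix x assume "x \<in> carrier (tensor_invariants M G d)"
    then have x: "x \<in> carrier (tensor_power M G d)" "coords x \<in> Inv" by (simp_all add: carrier_tensor_invariants)
    fix a
    show "a \<odot>\<^bsub>tensor_invariants M G d\<^esub> x \<in> carrier (tensor_invariants M G d)"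
      "coords (a \<odot>\<^bsub>tensor_invariants M G d\<^esub> x) = scal a (coords x)"
      unfolding ops carrier_tensor_invariants using x(2) by (simp_all add: Q(3,10)[OF x(1)] I.sm_closed)
    fix y assume "y \<in> carrier (tensor_invariants M G d)"
    then have y: "y \<in> carrier (tensor_power M G d)" "coords y \<in> Inv" by (simp_all add: carrier_tensor_invariants)
    show "x \<oplus>\<^bsub>tensor_invariants M G d\<^esub> y \<in> carrier (tensor_invariants M G d)"
      "x \<otimes>\<^bsub>tensor_invariants M G d\<^esub> y \<in> carrier (tensor_invariants M G d)"
      "coords (x \<oplus>\<^bsub>tensor_invariants M G d\<^esub> y) = coords x + coords y"
      "coords (x \<otimes>\<^bsub>tensor_invariants M G d\<^esub> y) = coords x \<star> coords y"
      unfolding ops carrier_tensor_invariants mem_Collect_eq Q(8)[OF x(1) y(1)] Q(9)[OF x(1) y(1)]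
      using Q(1)[OF x(1) y(1)] Q(2)[OF x(1) y(1)] I.add_closed[OF x(2) y(2)] I.mul_closed[OF x(2) y(2)]
      by blast+
  next
    show "\<one>\<^bsub>tensor_invariants M G d\<^esub> \<in> carrier (tensor_invariants M G d)"
      "\<zero>\<^bsub>tensor_invariants M G d\<^esub> \<in> carrier (tensor_invariants M G d)"
      "coords \<zero>\<^bsub>tensor_invariants M G d\<^esub> = 0" "coords \<one>\<^bsub>tensor_invariants M G d\<^esub> = T1"
      unfolding ops carrier_tensor_invariants mem_Collect_eq Q(6) Q(7)
      using Q(4) Q(5) I.zero_closed I.one_closed by blast+
  qed
qed

end

section \<open>The double centralizer property of a single letter and its passage to tensors\<close>

section \<open>From letters to tensors\<close>

context graded_consts
begin

definition LC :: "('i \<Rightarrow> 'k) set" where "LC = {x. \<forall>i. i \<notin> I \<longrightarrow> x i = 0}"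

text \<open>The unit coordinates \<open>o1\<close> are unspecified off \<open>I\<close>; truncation
  makes the unit an element of \<open>LC\<close>.\<close>

definition lone :: "'i \<Rightarrow> 'k" where "lone = (\<lambda>i. if i \<in> I then o1 i else 0)"

definition lscal :: "'k \<Rightarrow> ('i \<Rightarrow> 'k) \<Rightarrow> 'i \<Rightarrow> 'k" where "lscal a x = (\<lambda>i. a * x i)"

lemma LC_eqI: "x \<in> LC \<Longrightarrow> y \<in> LC \<Longrightarrow> (\<And>i. i \<in> I \<Longrightarrow> x i = y i) \<Longrightarrow> x = y"
  by (rule ext) (metis (mono_tags, lifting) LC_def mem_Collect_eq)

lemma lmul_LC [simp]: "lmul x y \<in> LC" by (simp add: LC_def lmul_def)

lemma lmul_expand: "i \<in> I \<Longrightarrow> lmul x y i = (\<Sum>j\<in>I. \<Sum>k\<in>I. c i j k * (x j * y k))"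
  by (simp add: lmul_def R_def sum_distrib_left mult_ac)

lemma lmul_assoc: "lmul (lmul x y) z = lmul x (lmul y z)"
proof (rule LC_eqI)
  fix m assume m: "m \<in> I"
  have "lmul (lmul x y) z m = (\<Sum>l\<in>I. \<Sum>k\<in>I. \<Sum>i\<in>I. \<Sum>j\<in>I. c m l k * c l i j * (x i * y j * z k))"
    using m by (simp add: lmul_expand sum_distrib_left sum_distrib_right mult_ac)
  also have "\<dots> = (\<Sum>i\<in>I. \<Sum>j\<in>I. \<Sum>k\<in>I. \<Sum>l\<in>I. c m l k * c l i j * (x i * y j * z k))"
    by (rule sum4_rotate)
  also have "\<dots> = (\<Sum>i\<in>I. \<Sum>j\<in>I. \<Sum>k\<in>I. \<Sum>l\<in>I. c m i l * c l j k * (x i * y j * z k))"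
  proof (rule sum.cong[OF refl], rule sum.cong[OF refl], rule sum.cong[OF refl])
    fix i j k assume "i \<in> I" "j \<in> I" "k \<in> I"
    then show "(\<Sum>l\<in>I. c m l k * c l i j * (x i * y j * z k)) = (\<Sum>l\<in>I. c m i l * c l j k * (x i * y j * z k))"
      unfolding sum_distrib_right[symmetric] using m by (simp add: c_assoc)
  qed
  also have "\<dots> = (\<Sum>i\<in>I. \<Sum>l\<in>I. \<Sum>j\<in>I. \<Sum>k\<in>I. c m i l * c l j k * (x i * y j * z k))"
    (is "(\<Sum>x\<in>I. \<Sum>y\<in>I. \<Sum>z\<in>I. \<Sum>t\<in>I. ?F x y z t) = _")
  proof (rule sum.cong[OF refl])
    fix x
    have "(\<Sum>y\<in>I. \<Sum>z\<in>I. \<Sum>t\<in>I. ?F x y z t) = (\<Sum>y\<in>I. \<Sum>t\<in>I. \<Sum>z\<in>I. ?F x y z t)"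
      by (rule sum.cong[OF refl], rule sum.swap)
    also have "\<dots> = (\<Sum>t\<in>I. \<Sum>y\<in>I. \<Sum>z\<in>I. ?F x y z t)" by (rule sum.swap)
    finally show "(\<Sum>y\<in>I. \<Sum>z\<in>I. \<Sum>t\<in>I. ?F x y z t) = (\<Sum>t\<in>I. \<Sum>y\<in>I. \<Sum>z\<in>I. ?F x y z t)" .
  qed
  also have "\<dots> = lmul x (lmul y z) m"
    using m by (simp add: lmul_expand sum_distrib_left sum_distrib_right mult_ac)
  finally show "lmul (lmul x y) z m = lmul x (lmul y z) m" .
qed simp_all

lemma lmul_add_l: "lmul (x + y) z = lmul x z + lmul y z"
  by (rule ext) (simp add: lmul_def distrib_left sum.distrib)

lemma lmul_add_r: "lmul z (x + y) = lmul z x + lmul z y"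
  by (rule ext) (simp add: lmul_def R_def distrib_left distrib_right sum.distrib)

lemma lmul_scal_l: "lmul (lscal a x) y = lscal a (lmul x y)"
  by (rule ext) (simp add: lmul_def lscal_def sum_distrib_left mult_ac)

lemma lmul_scal_r: "lmul x (lscal a y) = lscal a (lmul x y)"
  by (rule ext) (simp add: lmul_def R_def lscal_def sum_distrib_left sum_distrib_right mult_ac)

lemma lmul_lone: "x \<in> LC \<Longrightarrow> lmul x lone = x"
proof (rule LC_eqI)
  fix i assume i: "i \<in> I"
  have "R lone i j = R o1 i j" for j by (simp add: R_def lone_def)
  then show "lmul x lone i = x i"
    using i finI by (simp add: lmul_def R_o1 if_distrib[of "\<lambda>c. c * _"] sum.delta' cong: if_cong)
qed simp_all

lemma lone_lmul: "x \<in> LC \<Longrightarrow> lmul lone x = x"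
proof (rule LC_eqI)
  fix i assume i: "i \<in> I"
  have "lmul lone x i = (\<Sum>j\<in>I. \<Sum>k\<in>I. c i j k * o1 j * x k)"
    using i by (simp add: lmul_expand lone_def mult_ac)
  also have "\<dots> = (\<Sum>k\<in>I. \<Sum>j\<in>I. c i j k * o1 j * x k)" by (rule sum.swap)
  also have "\<dots> = (\<Sum>k\<in>I. if i = k then x k else 0)"
    using i by (intro sum.cong refl) (simp add: c_one_l sum_distrib_right[symmetric])
  finally show "lmul lone x i = x i" using i finI by simp
qed simp_all

lemma calg_LC: "calg LC lmul lone lscal"
proof
  show "0 \<in> LC" by (simp add: LC_def)
qed (auto simp: lmul_assoc lmul_add_l lmul_add_r lmul_scal_l lmul_scal_r lone_lmul lmul_lone,
    auto simp: LC_def lone_def lscal_def)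

lemma lmul_homog: "homog p x \<Longrightarrow> homog q y \<Longrightarrow> homog (p + q) (lmul x y)"
  unfolding homog_def
proof (intro ballI impI)
  fix i assume h: "\<forall>i\<in>I. x i \<noteq> 0 \<longrightarrow> par i = p" "\<forall>i\<in>I. y i \<noteq> 0 \<longrightarrow> par i = q"
    and i: "i \<in> I" "lmul x y i \<noteq> 0"
  then obtain j where j: "j \<in> I" "(\<Sum>k\<in>I. c i j k * (x j * y k)) \<noteq> 0"
    unfolding lmul_expand[OF i(1)] by (metis (no_types, lifting) sum.neutral)
  then obtain k where k: "k \<in> I" "c i j k * (x j * y k) \<noteq> 0" by (metis (no_types, lifting) sum.neutral)
  then have "c i j k \<noteq> 0" "x j \<noteq> 0" "y k \<noteq> 0" by auto
  then show "par i = p + q" using par_c[OF i(1) j(1) k(1)] h j k by simp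
qed

end

locale dc_letter = graded_consts I par c o1 d
  for I :: "'i set" and par :: "'i \<Rightarrow> bit" and c :: "'i \<Rightarrow> 'i \<Rightarrow> 'i \<Rightarrow> 'k::idom"
    and o1 :: "'i \<Rightarrow> 'k" and d :: nat +
  fixes f :: "'i \<Rightarrow> 'k"
  assumes pid: "principal_domain (ring_of_type_algebra :: 'k ring)"
    and f_hom: "homog 0 f" and f_dci: "dci LC lmul f"
begin

interpretation LC: calg LC lmul lone lscal by (rule calg_LC)

lemma f_LC: "f \<in> LC" and f_idem': "lmul f f = f"
  using f_dci by (auto simp: dci_def)

definition ldelta :: "'i \<Rightarrow> 'i \<Rightarrow> 'k" where "ldelta k = (\<lambda>i. if i = k then 1 else 0)"

lemma ldelta_LC [simp]: "k \<in> I \<Longrightarrow> ldelta k \<in> LC" by (auto simp: ldelta_def LC_def)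

lemma lmul_ldelta: "i \<in> I \<Longrightarrow> k \<in> I \<Longrightarrow> lmul (ldelta k) y i = R y i k"
  using finI by (simp add: lmul_def ldelta_def if_distrib[of "\<lambda>c. _ * c"] sum.delta cong: if_cong)

lemma ldelta_expand: "x \<in> LC \<Longrightarrow> x = (\<Sum>k\<in>I. lscal (x k) (ldelta k))"
  by (rule ext) (auto simp: sum_fun_apply lscal_def ldelta_def finI LC_def if_distrib[of "\<lambda>c. _ * c"] sum.delta' cong: if_cong)

abbreviation "L \<equiv> \<lambda>i j k. \<Sum>t\<in>I. c j i t * R f t k"

text \<open>This identifies the matrices \<open>L i\<close>: they describe left multiplication by
  the basis elements on the left ideal of \<open>f\<close>.\<close>

lemma lmul_L: "j \<in> I \<Longrightarrow> k \<in> I \<Longrightarrow> lmul s (lmul (ldelta k) f) j = (\<Sum>i\<in>I. s i * L i j k)"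
proof -
  assume jk: "j \<in> I" "k \<in> I"
  have "lmul s (lmul (ldelta k) f) j = (\<Sum>i\<in>I. \<Sum>t\<in>I. c j i t * (s i * R f t k))"
    using jk by (simp add: lmul_expand[of j s] lmul_ldelta)
  then show ?thesis by (simp add: sum_distrib_left mult_ac)
qed

lemma L_zero_imp:
  assumes "\<And>j k. j \<in> I \<Longrightarrow> k \<in> I \<Longrightarrow> (\<Sum>i\<in>I. a i * L i j k) = 0" "i \<in> I"
  shows "a i = 0"
proof -
  define s where "s i = (if i \<in> I then a i else 0)" for i
  have s: "s \<in> LC" by (simp add: s_def LC_def)
  have z: "lmul s (lmul (ldelta k) f) = 0" if k: "k \<in> I" for k
  proof (rule LC_eqI)
    fix j assume j: "j \<in> I"
    show "lmul s (lmul (ldelta k) f) j = 0 j"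
      using assms(1)[OF j k] lmul_L[OF j k, of s] by (simp add: s_def)
  qed (simp_all add: LC.zero_closed)
  have "s = 0"
  proof (rule dci_inj[OF f_dci s])
    fix x assume x: "x \<in> LC"
    have "lmul s (lmul x f) = (\<Sum>k\<in>I. lscal (x k) (lmul s (lmul (ldelta k) f)))"
      using s f_LC by (subst ldelta_expand[OF x]) (simp add: LC.sum_l LC.sum_r LC.sm_closed lmul_scal_l lmul_scal_r)
    also have "\<dots> = 0" by (intro sum.neutral) (auto simp: z lscal_def fun_eq_iff)
    finally show "lmul s (lmul x f) = 0" .
  qed
  then have "s i = 0" by simp
  then show ?thesis using assms(2) by (simp add: s_def)
qed

text \<open>The matrix \<open>z\<close> defines a map \<open>\<zeta>\<close> that restricts to an
  endomorphism of the left ideal of \<open>f\<close>, so the property of \<open>f\<close> yields the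
  left multiplier. A general corner element is split into even and odd part to meet the hypothesis
  on homogeneous ones.\<close>

lemma slice_crit':
  assumes z1: "\<And>j k. j \<in> I \<Longrightarrow> k \<in> I \<Longrightarrow> (\<Sum>l\<in>I. z j l * R f l k) = z j k"
    and z2: "\<And>q y j k. homog q y \<Longrightarrow> (\<And>i. i \<in> I \<Longrightarrow> lmul f y i = y i) \<Longrightarrow> (\<And>i. i \<in> I \<Longrightarrow> lmul y f i = y i) \<Longrightarrow>
        j \<in> I \<Longrightarrow> k \<in> I \<Longrightarrow> (\<Sum>l\<in>I. z j l * R y l k) = (\<Sum>l\<in>I. R y j l * z l k)"
  shows "\<exists>a. \<forall>j\<in>I. \<forall>k\<in>I. z j k = (\<Sum>i\<in>I. a i * L i j k)"
proof -
  define \<zeta> where "\<zeta> x = (\<lambda>j. if j \<in> I then \<Sum>k\<in>I. z j k * x k else 0)" for x :: "'i \<Rightarrow> 'k"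
  have \<zeta>LC [simp]: "\<zeta> x \<in> LC" for x by (simp add: \<zeta>_def LC_def)
  have \<zeta>add: "\<zeta> (x + y) = \<zeta> x + \<zeta> y" for x y
    by (rule ext) (simp add: \<zeta>_def distrib_left sum.distrib)
  have \<zeta>mul: "\<zeta> (lmul x y) j = (\<Sum>k\<in>I. (\<Sum>l\<in>I. z j l * R y l k) * x k)" if "j \<in> I" for x y j
  proof -
    have "\<zeta> (lmul x y) j = (\<Sum>l\<in>I. \<Sum>k\<in>I. z j l * R y l k * x k)"
      using that by (simp add: \<zeta>_def lmul_def sum_distrib_left mult.assoc)
    also have "\<dots> = (\<Sum>k\<in>I. \<Sum>l\<in>I. z j l * R y l k * x k)" by (rule sum.swap)
    finally show ?thesis by (simp add: sum_distrib_right)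
  qed
  have mul\<zeta>: "lmul (\<zeta> x) y j = (\<Sum>k\<in>I. (\<Sum>l\<in>I. R y j l * z l k) * x k)" if "j \<in> I" for x y j
  proof -
    have "lmul (\<zeta> x) y j = (\<Sum>l\<in>I. \<Sum>k\<in>I. R y j l * z l k * x k)"
      using that by (simp add: \<zeta>_def lmul_def sum_distrib_left mult.assoc)
    also have "\<dots> = (\<Sum>k\<in>I. \<Sum>l\<in>I. R y j l * z l k * x k)" by (rule sum.swap)
    finally show ?thesis by (simp add: sum_distrib_right)
  qed
  have hc: "\<zeta> (lmul x y) = lmul (\<zeta> x) y" if "homog q y" "lmul f y = y" "lmul y f = y" for q x y
    by (rule LC_eqI) (simp_all add: \<zeta>mul mul\<zeta> z2[OF that(1)] that)
  have \<zeta>f: "\<zeta> (lmul x f) = \<zeta> x" for x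
    by (rule LC_eqI) (simp_all add: \<zeta>mul z1, simp add: \<zeta>_def)
  have \<zeta>f': "lmul (\<zeta> x) f = \<zeta> x" for x
    using hc[OF f_hom f_idem' f_idem', of x] \<zeta>f by simp
  obtain s where s: "s \<in> LC" "\<And>x. x \<in> LC \<Longrightarrow> lmul x f = x \<Longrightarrow> \<zeta> x = lmul s x"
  proof (rule dci_surj[OF f_dci, of \<zeta>])
    fix x y assume x: "x \<in> LC" and y: "y \<in> LC" "lmul f y = y" "lmul y f = y"
    define y0 where "y0 i = (if par i = 0 then y i else 0)" for i
    define y1 where "y1 i = (if par i = 0 then 0 else y i)" for i
    have yy: "y = y0 + y1" by (rule ext) (simp add: y0_def y1_def)
    have LC01: "y0 \<in> LC" "y1 \<in> LC" using y by (auto simp: LC_def y0_def y1_def)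
    have h0: "homog 0 y0" and h1: "homog 1 y1" by (auto simp: homog_def y0_def y1_def)
    have l: "lmul f y0 + lmul f y1 = y0 + y1" "lmul y0 f + lmul y1 f = y0 + y1"
      using y by (simp_all add: yy lmul_add_l lmul_add_r)
    \<comment> \<open>Multiplication by the even \<open>f\<close> respects parity, so uniqueness of
      the decomposition puts both parts of \<open>y\<close> into the corner.\<close>
    have sep: "x0 = y0 \<and> x1 = y1" if "homog 0 x0" "homog 1 x1" "x0 + x1 = y0 + y1" "x0 \<in> LC" "x1 \<in> LC" for x0 x1
    proof -
      have "x0 i = y0 i \<and> x1 i = y1 i" if "i \<in> I" for i
      proof (cases "par i = 0")
        case True
        then have "x1 i = 0" "y1 i = 0" using \<open>homog 1 x1\<close> that by (auto simp: homog_def y1_def)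
        then show ?thesis using fun_cong[OF \<open>x0 + x1 = y0 + y1\<close>, of i] by simp
      next
        case False
        then have "x0 i = 0" "y0 i = 0" using \<open>homog 0 x0\<close> that by (auto simp: homog_def y0_def)
        then show ?thesis using fun_cong[OF \<open>x0 + x1 = y0 + y1\<close>, of i] by simp
      qed
      then show ?thesis using that LC01 by (auto intro!: LC_eqI)
    qed
    have "lmul f y0 = y0 \<and> lmul f y1 = y1" "lmul y0 f = y0 \<and> lmul y1 f = y1"
      using sep[OF _ _ l(1)] sep[OF _ _ l(2)] lmul_homog[OF f_hom h0] lmul_homog[OF f_hom h1]
        lmul_homog[OF h0 f_hom] lmul_homog[OF h1 f_hom] by simp_all
    then show "\<zeta> (lmul x y) = lmul (\<zeta> x) y"
      using hc[OF h0] hc[OF h1] by (simp add: yy lmul_add_r \<zeta>add)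
  qed (use that \<zeta>f' \<zeta>add in auto)
  have "z j k = (\<Sum>i\<in>I. s i * L i j k)" if jk: "j \<in> I" "k \<in> I" for j k
  proof -
    have "z j k = \<zeta> (ldelta k) j"
      using jk finI by (simp add: \<zeta>_def ldelta_def if_distrib[of "\<lambda>c. _ * c"] sum.delta cong: if_cong)
    also have "\<dots> = \<zeta> (lmul (ldelta k) f) j" by (simp add: \<zeta>f)
    also have "\<dots> = lmul s (lmul (ldelta k) f) j"
      using s(2)[of "lmul (ldelta k) f"] by (simp add: lmul_assoc f_idem')
    finally show ?thesis using jk by (simp add: lmul_L)
  qed
  then show ?thesis by blast
qed

text \<open>Independence of the matrices \<open>L i\<close> is injectivity in the double centralizer
  property. For saturation, a matrix \<open>z\<close> with \<open>b * z\<close> a left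
  multiplication satisfies the hypotheses of \<open>slice_crit'\<close> after cancelling
  \<open>b\<close>, because left multiplications commute with right ones; so \<open>z\<close> is a
  left multiplication too.\<close>

lemma ex_dc_consts: "\<exists>\<Lambda>. dc_consts I par c o1 f \<Lambda>"
proof -
  define v where "v i = (\<lambda>(j, k). L i j k)" for i
  obtain \<Lambda> where \<Lambda>: "\<And>i j. i \<in> I \<Longrightarrow> j \<in> I \<Longrightarrow> (\<Sum>e\<in>I \<times> I. \<Lambda> i e * v j e) = (if i = j then 1 else 0)"
  proof (rule saturated_dual_functionals[OF pid, of "I \<times> I" I v])
    show "finite (I \<times> I)" "finite I" using finI by auto
  next
    fix a assume z: "\<And>e. e \<in> I \<times> I \<Longrightarrow> (\<Sum>i\<in>I. a i * v i e) = 0"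
    show "\<forall>i\<in>I. a i = 0"
    proof
      fix i assume "i \<in> I"
      then show "a i = 0"
        by (rule L_zero_imp[rotated]) (use z[of "(_, _)"] in \<open>simp add: v_def\<close>)
    qed
  next
    fix z :: "'i \<times> 'i \<Rightarrow> 'k" and b a
    assume b: "b \<noteq> 0" and "\<And>e. e \<in> I \<times> I \<Longrightarrow> b * z e = (\<Sum>i\<in>I. a i * v i e)"
    then have bz: "b * z (j, k) = (\<Sum>i\<in>I. a i * L i j k)" if "j \<in> I" "k \<in> I" for j k
      using that by (simp add: v_def)
    define s where "s i = (if i \<in> I then a i else 0)" for i
    have sL: "s \<in> LC" by (simp add: s_def LC_def)
    have gL: "lscal a' (lmul x y) \<in> LC" for a' x y by (rule LC.sm_closed) simp
    have bs: "b * z (j, k) = lmul s (lmul (ldelta k) f) j" if "j \<in> I" "k \<in> I" for j k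
      using bz[OF that] lmul_L[OF that, of s] by (simp add: s_def)
    \<comment> \<open>Column \<open>k\<close> of \<open>b * z\<close> is \<open>s\<close> times the
      \<open>k\<close>-th basis element times \<open>f\<close>. Right multiplication by
      \<open>y\<close> before this map gives \<open>right\<close>, after it gives
      \<open>left\<close>.\<close>
    have right: "(\<Sum>l\<in>I. b * z (j, l) * R y l k) = lmul s (lmul (lmul (ldelta k) y) f) j"
      if jk: "j \<in> I" "k \<in> I" for j k y
    proof -
      have "lmul (ldelta k) y = (\<Sum>l\<in>I. lscal (R y l k) (ldelta l))"
        by (subst ldelta_expand) (auto intro!: sum.cong simp: lmul_ldelta jk)
      then have "lmul s (lmul (lmul (ldelta k) y) f) = (\<Sum>l\<in>I. lscal (R y l k) (lmul s (lmul (ldelta l) f)))"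
        using f_LC sL gL by (simp add: LC.sum_l LC.sum_r LC.sm_closed lmul_scal_l lmul_scal_r)
      then show ?thesis using jk by (simp add: sum_fun_apply bs) (simp add: lscal_def mult.commute)
    qed
    have left: "(\<Sum>l\<in>I. R y j l * (b * z (l, k))) = lmul (lmul s (lmul (ldelta k) f)) y j"
      if jk: "j \<in> I" "k \<in> I" for j k y
      using jk by (simp add: lmul_def[of _ y] bs)
    have "\<exists>a. \<forall>j\<in>I. \<forall>k\<in>I. z (j, k) = (\<Sum>i\<in>I. a i * L i j k)"
    proof (rule slice_crit')
      fix j k assume jk: "j \<in> I" "k \<in> I"
      have "b * (\<Sum>l\<in>I. z (j, l) * R f l k) = b * z (j, k)"
        using right[OF jk, of f] bs[OF jk] by (simp add: lmul_assoc f_idem' sum_distrib_left mult.assoc)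
      then show "(\<Sum>l\<in>I. z (j, l) * R f l k) = z (j, k)" using b by simp
    next
      fix q y j k
      assume y: "homog q y" "\<And>i. i \<in> I \<Longrightarrow> lmul f y i = y i" "\<And>i. i \<in> I \<Longrightarrow> lmul y f i = y i"
        and jk: "j \<in> I" "k \<in> I"
      \<comment> \<open>\<open>y\<close> satisfies the corner equations on \<open>I\<close> only, so
        \<open>lmul f y\<close> and \<open>lmul y f\<close> may be exchanged inside a product but
        need not equal \<open>y\<close> as functions.\<close>
      have c1: "lmul x f1 = lmul x f2" if "\<And>i. i \<in> I \<Longrightarrow> f1 i = f2 i" for x f1 f2
      proof -
        have r: "R f1 i j = R f2 i j" for i j by (simp add: R_def that)
        show ?thesis unfolding lmul_def r ..
      qed
      have "b * (\<Sum>l\<in>I. z (j, l) * R y l k) = lmul s (lmul (ldelta k) (lmul y f)) j"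
        using right[OF jk, of y] by (simp add: sum_distrib_left mult.assoc lmul_assoc)
      also have "lmul (ldelta k) (lmul y f) = lmul (ldelta k) (lmul f y)" by (rule c1) (simp add: y)
      also have "lmul s (lmul (ldelta k) (lmul f y)) j = b * (\<Sum>l\<in>I. R y j l * z (l, k))"
        using left[OF jk, of y] by (simp add: sum_distrib_left mult.left_commute lmul_assoc)
      finally show "(\<Sum>l\<in>I. z (j, l) * R y l k) = (\<Sum>l\<in>I. R y j l * z (l, k))" using b by simp
    qed
    then show "\<exists>b. \<forall>e\<in>I \<times> I. z e = (\<Sum>i\<in>I. b i * v i e)" by (auto simp: v_def)
  qed blast
  have "dual_functionals I L (\<lambda>i j k. \<Lambda> i (j, k))"
  proof
    fix i i' assume "i \<in> I" "i' \<in> I"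
    from \<Lambda>[OF this] show "(\<Sum>j\<in>I. \<Sum>k\<in>I. \<Lambda> i (j, k) * L i' j k) = (if i = i' then 1 else 0)"
      by (simp add: sum.cartesian_product v_def case_prod_unfold)
  qed (rule finI)
  then interpret D: dual_functionals I L "\<lambda>i j k. \<Lambda> i (j, k)" .
  have "dc_consts I par c o1 f (\<lambda>i j k. \<Lambda> i (j, k))"
  proof
    show "homog 0 f" by (rule f_hom)
    show "\<And>i. i \<in> I \<Longrightarrow> lmul f f i = f i" by (simp add: f_idem')
  qed (use slice_crit' in \<open>simp add: D.slice_def\<close>)
  then show ?thesis by blast
qed

theorem dci_tensor_letter: "dci TC (\<star>) (tens (replicate d f))"
proof -
  obtain \<Lambda> where "dc_consts I par c o1 f \<Lambda>" using ex_dc_consts by blast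
  then interpret D: dc_consts I par c o1 d f \<Lambda> .
  show ?thesis by (rule D.dci_tensor)
qed

end

section \<open>Passage from the coefficient algebra to matrices over it\<close>

section \<open>Matrices\<close>

text \<open>Matrices are functions of two indices, zero outside the square, since the abstract
  setting takes its addition from an abelian group type, and matrices of varying dimensions do not
  form one.\<close>

definition fmat :: "nat \<Rightarrow> (nat \<Rightarrow> nat \<Rightarrow> 'a::ring) set" where
  "fmat n = {g. \<forall>r s. \<not> (r < n \<and> s < n) \<longrightarrow> g r s = 0}"

definition fmul :: "nat \<Rightarrow> (nat \<Rightarrow> nat \<Rightarrow> 'a::ring) \<Rightarrow> (nat \<Rightarrow> nat \<Rightarrow> 'a) \<Rightarrow> nat \<Rightarrow> nat \<Rightarrow> 'a" where
  "fmul n g h = (\<lambda>r s. if r < n \<and> s < n then \<Sum>t<n. g r t * h t s else 0)"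

definition fdiag :: "nat \<Rightarrow> 'a::ring \<Rightarrow> nat \<Rightarrow> nat \<Rightarrow> 'a" where
  "fdiag n a = (\<lambda>r s. if r < n \<and> r = s then a else 0)"

definition funit :: "'a::ring \<Rightarrow> nat \<Rightarrow> nat \<Rightarrow> nat \<Rightarrow> nat \<Rightarrow> 'a" where
  "funit a i j = (\<lambda>r s. if r = i \<and> s = j then a else 0)"

lemma fmat_eqI: "g \<in> fmat n \<Longrightarrow> h \<in> fmat n \<Longrightarrow> (\<And>r s. r < n \<Longrightarrow> s < n \<Longrightarrow> g r s = h r s) \<Longrightarrow> g = h"
  by (intro ext) (metis (mono_tags, lifting) fmat_def mem_Collect_eq)

lemma fmul_fmat [simp]: "fmul n g h \<in> fmat n" by (simp add: fmat_def fmul_def)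

lemma funit_fmat [simp]: "i < n \<Longrightarrow> j < n \<Longrightarrow> funit a i j \<in> fmat n" by (simp add: fmat_def funit_def)

lemma fmul_funit: "i < n \<Longrightarrow> j < n \<Longrightarrow> k < n \<Longrightarrow> l < n \<Longrightarrow>
    fmul n (funit a i j) (funit b k l) = (if j = k then funit (a * b) i l else 0)"
  by (rule fmat_eqI[of _ n])
    (auto simp: fmat_def funit_def fmul_def if_distrib[of "\<lambda>c. c * _"] sum.delta cong: if_cong intro!: sum.neutral)

lemma fmul_funit_right:
  assumes "r < n" "s < n" "k < n"
  shows "fmul n g (funit a k l) r s = (if s = l then g r k * a else 0)"
proof -
  have "fmul n g (funit a k l) r s = (\<Sum>t<n. if t = k then (if s = l then g r k * a else 0) else 0)"
    unfolding fmul_def using assms by (simp only: conj_absorb simp_thms if_True)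
      (intro sum.cong refl, auto simp: funit_def)
  then show ?thesis using assms by simp
qed

lemma fmul_fdiag: "g \<in> fmat n \<Longrightarrow> fmul n g (fdiag n a) = (\<lambda>r s. g r s * a)"
  by (rule fmat_eqI[of _ n])
    (auto simp: fmat_def fdiag_def fmul_def if_distrib[of "\<lambda>c. _ * c"] sum.delta cong: if_cong)

lemma fdiag_fmul: "g \<in> fmat n \<Longrightarrow> fmul n (fdiag n a) g = (\<lambda>r s. a * g r s)"
  by (rule fmat_eqI[of _ n])
    (auto simp: fmat_def fdiag_def fmul_def if_distrib[of "\<lambda>c. c * _"] sum.delta cong: if_cong)

lemma fdiag_fmat [simp]: "fdiag n a \<in> fmat n" by (auto simp: fmat_def fdiag_def)

text \<open>The column with index 0 determines everything; it exists because \<open>n\<close> is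
  positive. Sending \<open>a\<close> to the entry \<open>(i, 0)\<close> of
  \<open>\<phi> (funit a j 0)\<close> is an endomorphism of the left ideal of \<open>e\<close>,
  hence left multiplication by some \<open>s' i j\<close>. The other columns are reached by
  multiplying with \<open>funit e 0 k\<close>, an element of the corner.\<close>

lemma dci_matrix:
  fixes e :: "'a::ring"
  assumes dci: "dci UNIV (*) e" and n: "0 < n"
  shows "dci (fmat n) (fmul n) (fdiag n e)"
proof (rule dciI)
  have ee: "e * e = e" using dci by (simp add: dci_def)
  show "fdiag n e \<in> fmat n" by simp
  show "fmul n (fdiag n e) (fdiag n e) = fdiag n e"
    by (subst fmul_fdiag) (simp, simp add: fdiag_def ee fun_eq_iff)
  have fixed: "fmul n x (fdiag n e) = x \<longleftrightarrow> (\<forall>r s. x r s * e = x r s)" if "x \<in> fmat n" for x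
    using that by (simp add: fmul_fdiag fun_eq_iff)
  have fixed': "fmul n (fdiag n e) x = x \<longleftrightarrow> (\<forall>r s. e * x r s = x r s)" if "x \<in> fmat n" for x
    using that by (simp add: fdiag_fmul fun_eq_iff)
  {
    fix s assume s: "s \<in> fmat n" and z: "\<And>x. x \<in> fmat n \<Longrightarrow> fmul n s (fmul n x (fdiag n e)) = 0"
    have "s i j = 0" if ij: "i < n" "j < n" for i j
    proof (rule dci_inj[OF dci])
      fix a
      have "fmul n s (fmul n (funit a j 0) (fdiag n e)) i 0 = 0" using z[of "funit a j 0"] ij n by simp
      moreover have "fmul n s (fmul n (funit a j 0) (fdiag n e)) i 0 = (\<Sum>t<n. if t = j then s i j * (a * e) else 0)"
      proof -
        have "fmul n (funit a j 0) (fdiag n e) = (\<lambda>r s. funit a j 0 r s * e)"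
          using ij n by (intro fmul_fdiag) simp
        then have "fmul n s (fmul n (funit a j 0) (fdiag n e)) i 0 = (\<Sum>t<n. s i t * (funit a j 0 t 0 * e))"
          using ij n by (simp add: fmul_def[of n s])
        also have "\<dots> = (\<Sum>t<n. if t = j then s i j * (a * e) else 0)"
          by (intro sum.cong refl) (auto simp: funit_def)
        finally show ?thesis .
      qed
      ultimately show "s i j * (a * e) = 0" using ij by simp
    qed simp
    then show "s = 0" by (intro fmat_eqI[OF s]) (auto simp: fmat_def)
  }
  fix \<phi>
  assume \<phi>1: "\<And>x. x \<in> fmat n \<Longrightarrow> fmul n x (fdiag n e) = x \<Longrightarrow> \<phi> x \<in> fmat n \<and> fmul n (\<phi> x) (fdiag n e) = \<phi> x"
    and \<phi>2: "\<And>x y. x \<in> fmat n \<Longrightarrow> y \<in> fmat n \<Longrightarrow> fmul n x (fdiag n e) = x \<Longrightarrow> fmul n y (fdiag n e) = y \<Longrightarrow> \<phi> (x + y) = \<phi> x + \<phi> y"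
    and \<phi>3: "\<And>x c. x \<in> fmat n \<Longrightarrow> c \<in> fmat n \<Longrightarrow> fmul n x (fdiag n e) = x \<Longrightarrow> fmul n (fdiag n e) c = c \<Longrightarrow>
        fmul n c (fdiag n e) = c \<Longrightarrow> \<phi> (fmul n x c) = fmul n (\<phi> x) c"
  have ue: "fmul n (funit a i j) (fdiag n e) = funit a i j" if "a * e = a" "i < n" "j < n" for a i j
    using that fixed[OF funit_fmat[OF that(2,3)]] by (simp add: funit_def)
  have eu: "fmul n (fdiag n e) (funit a i j) = funit a i j" if "e * a = a" "i < n" "j < n" for a i j
    using that fixed'[OF funit_fmat[OF that(2,3)]] by (simp add: funit_def)
  have "\<exists>s. \<forall>a. a * e = a \<longrightarrow> \<phi> (funit a j 0) i 0 = s * a" if ij: "i < n" "j < n" for i j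
  proof (rule dci_surj[OF dci, of "\<lambda>a. \<phi> (funit a j 0) i 0"])
    fix x assume x: "x * e = x"
    show "\<phi> (funit x j 0) i 0 \<in> UNIV \<and> \<phi> (funit x j 0) i 0 * e = \<phi> (funit x j 0) i 0"
    proof -
      have p: "\<phi> (funit x j 0) \<in> fmat n" "fmul n (\<phi> (funit x j 0)) (fdiag n e) = \<phi> (funit x j 0)"
        using \<phi>1[OF funit_fmat ue[OF x]] ij n by blast+
      then show ?thesis using fixed[OF p(1)] by blast
    qed
    fix y assume y: "y * e = y"
    have "funit (x + y) j 0 = funit x j 0 + funit y j 0" by (intro ext) (simp add: funit_def)
    then show "\<phi> (funit (x + y) j 0) i 0 = \<phi> (funit x j 0) i 0 + \<phi> (funit y j 0) i 0"
      using \<phi>2[OF funit_fmat funit_fmat ue[OF x] ue[OF y]] ij n by simp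
  next
    fix x c assume x: "x * e = x" and c: "e * c = c" "c * e = c"
    have "\<phi> (funit (x * c) j 0) = \<phi> (fmul n (funit x j 0) (funit c 0 0))"
      using ij n by (simp add: fmul_funit)
    also have "\<dots> = fmul n (\<phi> (funit x j 0)) (funit c 0 0)"
      using ij n x c by (intro \<phi>3) (auto simp: ue eu)
    finally show "\<phi> (funit (x * c) j 0) i 0 = \<phi> (funit x j 0) i 0 * c"
      using ij n by (simp add: fmul_funit_right)
  qed auto
  then obtain s' where s': "\<And>i j a. i < n \<Longrightarrow> j < n \<Longrightarrow> a * e = a \<Longrightarrow> \<phi> (funit a j 0) i 0 = s' i j * a"
    by metis
  define s where "s i j = (if i < n \<and> j < n then s' i j else 0)" for i j
  have s: "s \<in> fmat n" by (simp add: fmat_def s_def)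
  have \<phi>u: "\<phi> (funit a j k) i l = (if l = k then s i j * a else 0)" if "a * e = a" "i < n" "j < n" "k < n" "l < n" for a i j k l
  proof -
    have "\<phi> (funit a j k) = \<phi> (fmul n (funit a j 0) (funit e 0 k))"
      using that n by (simp add: fmul_funit)
    also have "\<dots> = fmul n (\<phi> (funit a j 0)) (funit e 0 k)"
      using that n by (intro \<phi>3) (auto simp: ue eu ee)
    finally show ?thesis using that n s' by (simp add: fmul_funit_right s_def mult.assoc)
  qed
  have \<phi>sum: "sum g J \<in> fmat n \<and> fmul n (sum g J) (fdiag n e) = sum g J \<and> \<phi> (sum g J) = (\<Sum>t\<in>J. \<phi> (g t))"
    if "finite J" "\<And>t. t \<in> J \<Longrightarrow> g t \<in> fmat n \<and> fmul n (g t) (fdiag n e) = g t"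
    for J and g :: "nat \<times> nat \<Rightarrow> nat \<Rightarrow> nat \<Rightarrow> 'a"
    using that
  proof (induction J rule: finite_induct)
    case empty
    have z: "(0::nat \<Rightarrow> nat \<Rightarrow> 'a) \<in> fmat n" "fmul n 0 (fdiag n e) = 0" by (auto simp: fmat_def fmul_def fun_eq_iff)
    then have "\<phi> 0 = 0" using \<phi>2[of 0 0] by simp
    then show ?case unfolding sum.empty using z by blast
  next
    case (insert t J)
    then have t: "g t \<in> fmat n" "fmul n (g t) (fdiag n e) = g t"
      and J: "sum g J \<in> fmat n" "fmul n (sum g J) (fdiag n e) = sum g J" "\<phi> (sum g J) = (\<Sum>t\<in>J. \<phi> (g t))" by auto
    have a: "g t + sum g J \<in> fmat n" using t(1) J(1) by (auto simp: fmat_def)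
    have "fmul n (g t + sum g J) (fdiag n e) = g t + sum g J"
      unfolding fixed[OF a] using t(2) J(2) unfolding fixed[OF t(1)] fixed[OF J(1)] by (simp add: distrib_right)
    moreover have "\<phi> (g t + sum g J) = \<phi> (g t) + \<phi> (sum g J)" using t J by (intro \<phi>2)
    ultimately show ?case unfolding sum.insert[OF insert.hyps] J(3)[symmetric] using a by blast
  qed
  have "\<phi> x = fmul n s x" if x: "x \<in> fmat n" "fmul n x (fdiag n e) = x" for x
  proof (rule fmat_eqI)
    show "\<phi> x \<in> fmat n" using \<phi>1[OF x] by simp
    fix i l assume il: "i < n" "l < n"
    have xe: "x r t * e = x r t" for r t using x fixed by blast
    have xs: "x = (\<Sum>(j, k)\<in>{..<n} \<times> {..<n}. funit (x j k) j k)"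
    proof (rule fmat_eqI[OF x(1)])
      show "(\<Sum>(j, k)\<in>{..<n} \<times> {..<n}. funit (x j k) j k) \<in> fmat n"
        using \<phi>sum[of "{..<n} \<times> {..<n}" "\<lambda>(j, k). funit (x j k) j k"] ue xe by auto
      fix r t assume rt: "r < n" "t < n"
      have "(\<Sum>(j, k)\<in>{..<n} \<times> {..<n}. funit (x j k) j k) r t
          = (\<Sum>p\<in>{..<n} \<times> {..<n}. if p = (r, t) then x r t else 0)"
        unfolding sum_fun_apply by (intro sum.cong refl) (auto simp: funit_def split: if_splits)
      then show "x r t = (\<Sum>(j, k)\<in>{..<n} \<times> {..<n}. funit (x j k) j k) r t" using rt by simp
    qed
    have "\<phi> x = (\<Sum>(j, k)\<in>{..<n} \<times> {..<n}. \<phi> (funit (x j k) j k))"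
      by (subst xs) (use \<phi>sum[of "{..<n} \<times> {..<n}" "\<lambda>(j, k). funit (x j k) j k"] ue xe in \<open>auto simp: case_prod_unfold\<close>)
    then have "\<phi> x i l = (\<Sum>(j, k)\<in>{..<n} \<times> {..<n}. if l = k then s i j * x j k else 0)"
      unfolding sum_fun_apply using il by (auto simp: \<phi>u xe case_prod_unfold sum_fun_apply intro!: sum.cong)
    also have "\<dots> = (\<Sum>j<n. s i j * x j l)"
      using il by (simp add: sum.cartesian_product[symmetric])
    finally show "\<phi> x i l = fmul n s x i l" using il by (simp add: fmul_def)
  qed simp
  then show "\<exists>s\<in>fmat n. \<forall>x\<in>fmat n. fmul n x (fdiag n e) = x \<longrightarrow> \<phi> x = fmul n s x" using s by blast
qed

section \<open>Extension of scalars to the field of fractions and clearing of denominators\<close>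

section \<open>Scalar extension to the field of fractions\<close>

abbreviation fr :: "'k::idom \<Rightarrow> 'k fract" where "fr a \<equiv> Fract a 1"

lemma fr_add: "fr (a + b) = fr a + fr b" by (simp add: add_fract)
lemma fr_mult: "fr (a * b) = fr a * fr b" by simp
lemma fr_0: "fr 0 = 0" by (simp add: Zero_fract_def)
lemma fr_1: "fr 1 = 1" by (simp add: One_fract_def)
lemma fr_eq_0_iff: "fr a = 0 \<longleftrightarrow> a = 0" by (simp add: Zero_fract_def eq_fract)
lemma fr_eq_iff: "fr a = fr b \<longleftrightarrow> a = b" by (simp add: eq_fract)
lemma fr_sum: "fr (sum g J) = (\<Sum>j\<in>J. fr (g j))"
  by (induction J rule: infinite_finite_induct) (simp_all add: fr_0 fr_add del: add_fract)

lemma fract_cases_fr: obtains a b where "b \<noteq> 0" "x = fr a * Fract 1 b"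
  by (cases x) simp

lemma fr_inverse: "b \<noteq> 0 \<Longrightarrow> fr b * Fract 1 b = 1"
  by (simp add: One_fract_def eq_fract)

definition linK :: "('x \<Rightarrow> 'k::idom fract) \<Rightarrow> ('x \<Rightarrow>\<^sub>0 'k) \<Rightarrow> 'k fract" where
  "linK h p = (\<Sum>x\<in>Poly_Mapping.keys p. fr (Poly_Mapping.lookup p x) * h x)"

lemma linK_superset: "finite Y \<Longrightarrow> Poly_Mapping.keys p \<subseteq> Y \<Longrightarrow> linK h p = (\<Sum>x\<in>Y. fr (Poly_Mapping.lookup p x) * h x)"
  unfolding linK_def by (intro sum.mono_neutral_left) (auto simp: in_keys_iff fr_0)

lemma linK_add: "linK h (p + q) = linK h p + linK h q"
proof -
  let ?Y = "Poly_Mapping.keys p \<union> Poly_Mapping.keys q"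
  have "linK h (p + q) = (\<Sum>x\<in>?Y. fr (Poly_Mapping.lookup (p + q) x) * h x)"
    using keys_add[of p q] by (intro linK_superset) auto
  also have "\<dots> = linK h p + linK h q"
    by (subst (1 2) linK_superset[of ?Y]) (auto simp: lookup_add fr_add distrib_right sum.distrib simp del: add_fract)
  finally show ?thesis .
qed

lemma linK_smult: "linK h (free_smult c p) = fr c * linK h p"
  by (subst linK_superset[of "Poly_Mapping.keys p"])
    (auto simp: keys_free_smult linK_def sum_distrib_left mult.assoc fr_mult simp del: mult_fract)

lemma linK_zero [simp]: "linK h 0 = 0" by (simp add: linK_def)

lemma linK_single [simp]: "linK h (Poly_Mapping.single x a) = fr a * h x"
  by (subst linK_superset[of "{x}"]) auto

lemma linK_diff: "linK h (p - q) = linK h p - linK h q"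
  using linK_add[of h "p - q" q] by simp

lemma linK_sum: "linK h (sum g J) = (\<Sum>j\<in>J. linK h (g j))"
  by (induction J rule: infinite_finite_induct) (auto simp: linK_add)

lemma linK_free_extend: "linK h (free_extend g p) = linK (\<lambda>x. linK h (g x)) p"
  unfolding free_extend_def linK_sum linK_smult by (simp add: linK_def)

definition scalK :: "'k::idom fract \<Rightarrow> ('w \<Rightarrow> 'k fract) \<Rightarrow> 'w \<Rightarrow> 'k fract" where
  "scalK a z = (\<lambda>v. a * z v)"

lemma scalK_simps:
  "scalK a (scalK b z) = scalK (a * b) z" "scalK 1 z = z" "scalK a (z + z') = scalK a z + scalK a z'"
  "scalK (a + b) z = scalK a z + scalK b z" "scalK a 0 = 0" "scalK 0 z = 0"
  by (auto simp: scalK_def fun_eq_iff algebra_simps)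

text \<open>The scalar extension is realized inside an algebra \<open>D\<close> of functions with
  values in the field of fractions, into which \<open>\<iota>\<close> embeds \<open>S\<close>.
  Injectivity of \<open>\<iota>\<close> encodes that \<open>S\<close> is torsion-free.\<close>

locale ext_setting = D: calg D mulD uD scalK
  for D :: "('w \<Rightarrow> 'k::idom fract) set" and mulD (infixl \<open>\<star>\<close> 70) and uD +
  fixes S :: "('k, 's) module" and \<iota> :: "'s \<Rightarrow> 'w \<Rightarrow> 'k fract"
  assumes S_add: "x \<in> carrier S \<Longrightarrow> y \<in> carrier S \<Longrightarrow> x \<oplus>\<^bsub>S\<^esub> y \<in> carrier S"
    and S_mult: "x \<in> carrier S \<Longrightarrow> y \<in> carrier S \<Longrightarrow> x \<otimes>\<^bsub>S\<^esub> y \<in> carrier S"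
    and S_smult: "x \<in> carrier S \<Longrightarrow> a \<odot>\<^bsub>S\<^esub> x \<in> carrier S"
    and S_one: "\<one>\<^bsub>S\<^esub> \<in> carrier S" and S_zero: "\<zero>\<^bsub>S\<^esub> \<in> carrier S"
    and \<iota>_D: "x \<in> carrier S \<Longrightarrow> \<iota> x \<in> D"
    and \<iota>_add: "x \<in> carrier S \<Longrightarrow> y \<in> carrier S \<Longrightarrow> \<iota> (x \<oplus>\<^bsub>S\<^esub> y) = \<iota> x + \<iota> y"
    and \<iota>_mult: "x \<in> carrier S \<Longrightarrow> y \<in> carrier S \<Longrightarrow> \<iota> (x \<otimes>\<^bsub>S\<^esub> y) = \<iota> x \<star> \<iota> y"
    and \<iota>_smult: "x \<in> carrier S \<Longrightarrow> \<iota> (a \<odot>\<^bsub>S\<^esub> x) = scalK (fr a) (\<iota> x)"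
    and \<iota>_one: "\<iota> \<one>\<^bsub>S\<^esub> = uD" and \<iota>_zero: "\<iota> \<zero>\<^bsub>S\<^esub> = 0"
    and \<iota>_inj: "x \<in> carrier S \<Longrightarrow> y \<in> carrier S \<Longrightarrow> \<iota> x = \<iota> y \<Longrightarrow> x = y"
begin

text \<open>The span of the image of \<open>S\<close> over the field: with common denominators, each
  of its elements is an element of that image divided by a scalar.\<close>

definition E :: "('w \<Rightarrow> 'k fract) set" where
  "E = {z \<in> D. \<exists>c s. c \<noteq> 0 \<and> s \<in> carrier S \<and> scalK (fr c) z = \<iota> s}"

lemma calg_E: "calg E (\<star>) uD scalK"
proof
  have in_E: "z \<in> E" if "z \<in> D" "c \<noteq> 0" "s \<in> carrier S" "scalK (fr c) z = \<iota> s" for z c s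
    using that unfolding E_def by blast
  show "0 \<in> E" by (rule in_E[of _ 1 "\<zero>\<^bsub>S\<^esub>"]) (auto simp: D.zero_closed S_zero \<iota>_zero scalK_simps)
  show "uD \<in> E" by (rule in_E[of _ 1 "\<one>\<^bsub>S\<^esub>"]) (auto simp: D.one_closed S_one \<iota>_one scalK_simps fr_1)
  fix x assume "x \<in> E"
  then obtain c s where x: "x \<in> D" "c \<noteq> 0" "s \<in> carrier S" "scalK (fr c) x = \<iota> s" by (auto simp: E_def)
  show "scalK a x \<in> E" for a
  proof -
    obtain p q where a: "q \<noteq> 0" "a = fr p * Fract 1 q" by (rule fract_cases_fr)
    have "fr (q * c) * a = fr p * fr c" using a fr_inverse[OF a(1)] by (simp add: eq_fract)
    then have "scalK (fr (q * c)) (scalK a x) = \<iota> (p \<odot>\<^bsub>S\<^esub> s)"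
      using x by (simp add: \<iota>_smult flip: x(4)) (simp add: scalK_simps)
    then show ?thesis using a x by (intro in_E[of _ "q * c" "p \<odot>\<^bsub>S\<^esub> s"]) (auto simp: D.sm_closed S_smult)
  qed
  from this[of "- 1"] show "- x \<in> E" by (simp add: scalK_def fun_Compl_def)
  fix y assume "y \<in> E"
  then obtain c' s' where y: "y \<in> D" "c' \<noteq> 0" "s' \<in> carrier S" "scalK (fr c') y = \<iota> s'" by (auto simp: E_def)
  have "scalK (fr (c * c')) (x + y) = \<iota> (c' \<odot>\<^bsub>S\<^esub> s \<oplus>\<^bsub>S\<^esub> c \<odot>\<^bsub>S\<^esub> s')"
    using x(3) y(3) by (simp add: \<iota>_add \<iota>_smult S_smult flip: x(4) y(4)) (simp add: scalK_simps mult.commute)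
  then show "x + y \<in> E"
    using x y by (intro in_E[of _ "c * c'"]) (auto simp: D.add_closed S_smult S_add)
  have "scalK (fr (c * c')) (x \<star> y) = \<iota> (s \<otimes>\<^bsub>S\<^esub> s')"
    using x y by (simp add: \<iota>_mult D.sm_l D.sm_r D.sm_closed flip: x(4) y(4)) (simp add: scalK_simps mult.commute)
  then show "x \<star> y \<in> E"
    using x y by (intro in_E[of _ "c * c'"]) (auto simp: D.mul_closed S_mult)
qed (auto simp: E_def D.assoc D.distl D.distr D.one_l D.one_r D.sm_l D.sm_r)

definition \<Theta> :: "('s \<times> 'k fract \<Rightarrow>\<^sub>0 'k) \<Rightarrow> 'w \<Rightarrow> 'k fract" where
  "\<Theta> p = (\<lambda>v. linK (\<lambda>(s, x). x * \<iota> s v) p)"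

lemma \<Theta>_add: "\<Theta> (p + q) = \<Theta> p + \<Theta> q" by (rule ext) (simp add: \<Theta>_def linK_add)
lemma \<Theta>_diff: "\<Theta> (p - q) = \<Theta> p - \<Theta> q" by (rule ext) (simp add: \<Theta>_def linK_diff)
lemma \<Theta>_smult: "\<Theta> (free_smult a p) = scalK (fr a) (\<Theta> p)" by (rule ext) (simp add: \<Theta>_def linK_smult scalK_def)
lemma \<Theta>_single: "\<Theta> (Poly_Mapping.single (s, x) a) = scalK (fr a * x) (\<iota> s)"
  by (rule ext) (simp add: \<Theta>_def scalK_def mult.assoc)

lemma ext_free_simps: "carrier (ext_free S) = {p. Poly_Mapping.keys p \<subseteq> carrier S \<times> UNIV}"
  "monoid.mult (ext_free S) = free_extend2 (\<lambda>(s, x) (t, y). Poly_Mapping.single (s \<otimes>\<^bsub>S\<^esub> t, x * y) 1)"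
  "\<one>\<^bsub>ext_free S\<^esub> = Poly_Mapping.single (\<one>\<^bsub>S\<^esub>, 1) 1"
  "add (ext_free S) = (+)"
  "Module.module.smult (ext_free S) = (\<lambda>c. free_extend (\<lambda>(s, x). Poly_Mapping.single (s, c * x) 1))"
  by (simp_all add: ext_free_def)

abbreviation "Rel \<equiv> ext_rels S"
abbreviation "sing \<equiv> (\<lambda>s x. Poly_Mapping.single (s, x) (1::'k))"

lemma subspace_Rel: "free.subspace Rel" unfolding ext_rels_def by (rule free.subspace_span)

lemma Rel1: "s \<in> carrier S \<Longrightarrow> t \<in> carrier S \<Longrightarrow> sing (s \<oplus>\<^bsub>S\<^esub> t) x - sing s x - sing t x \<in> Rel"
  unfolding ext_rels_def by (intro free.span_base UnI1) blast
lemma Rel3: "s \<in> carrier S \<Longrightarrow> sing (a \<odot>\<^bsub>S\<^esub> s) x - Poly_Mapping.single (s, x) a \<in> Rel"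
  unfolding ext_rels_def by (intro free.span_base) blast
lemma Rel4: "s \<in> carrier S \<Longrightarrow> sing s (fr a * x) - Poly_Mapping.single (s, x) a \<in> Rel"
  unfolding ext_rels_def by (intro free.span_base UnI2) blast

lemma ext_diff: "p \<in> carrier (ext_free S) \<Longrightarrow> q \<in> carrier (ext_free S) \<Longrightarrow> p - q \<in> carrier (ext_free S)"
  using keys_diff[of p q] unfolding ext_free_simps by blast

lemma ext_single: "s \<in> carrier S \<Longrightarrow> Poly_Mapping.single (s, x) a \<in> carrier (ext_free S)"
  by (simp add: ext_free_simps)

lemma Rel_subset_ker: "Rel \<subseteq> {p \<in> carrier (ext_free S). \<Theta> p = 0}"
proof -
  have sub: "free.subspace {p \<in> carrier (ext_free S). \<Theta> p = 0}"
  proof (rule free.subspaceI)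
    show "0 \<in> {p \<in> carrier (ext_free S). \<Theta> p = 0}" by (simp add: ext_free_simps \<Theta>_def fun_eq_iff)
  next
    fix p q assume "p \<in> {p \<in> carrier (ext_free S). \<Theta> p = 0}" "q \<in> {p \<in> carrier (ext_free S). \<Theta> p = 0}"
    then show "p + q \<in> {p \<in> carrier (ext_free S). \<Theta> p = 0}"
      using keys_add[of p q] unfolding ext_free_simps by (auto simp: \<Theta>_add)
  next
    fix a p assume "p \<in> {p \<in> carrier (ext_free S). \<Theta> p = 0}"
    then show "free_smult a p \<in> {p \<in> carrier (ext_free S). \<Theta> p = 0}"
      using keys_free_smult[of a p] unfolding ext_free_simps by (auto simp: \<Theta>_smult scalK_simps)
  qed
  show ?thesis
    unfolding ext_rels_def
  proof (rule free.span_minimal[OF _ sub], safe, goal_cases)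
    case (1 p s t x)
    then show ?case by (intro ext_diff ext_single S_add)
  next
    case (2 p s t x)
    then show ?case by (simp add: \<Theta>_diff \<Theta>_single \<iota>_add scalK_simps)
  next
    case (3 p s x y)
    then show ?case by (intro ext_diff ext_single)
  next
    case (4 p s x y)
    then show ?case by (simp add: \<Theta>_diff \<Theta>_single scalK_simps distrib_left)
  next
    case (5 p a s x)
    then show ?case by (intro ext_diff ext_single S_smult)
  next
    case (6 p a s x)
    then show ?case by (simp add: \<Theta>_diff \<Theta>_single \<iota>_smult scalK_simps fr_1 mult.commute)
  next
    case (7 p a s x)
    then show ?case by (intro ext_diff ext_single)
  next
    case (8 p a s x)
    then show ?case by (simp add: \<Theta>_diff \<Theta>_single scalK_simps fr_1)
  qed
qed

lemma Rel_trans: "p - q \<in> Rel \<Longrightarrow> q - r \<in> Rel \<Longrightarrow> p - r \<in> Rel"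
  using free.subspace_add[OF subspace_Rel, of "p - q" "q - r"] by simp

lemma Rel_sym: "p - q \<in> Rel \<Longrightarrow> q - p \<in> Rel"
  using free.subspace_neg[OF subspace_Rel, of "p - q"] by simp

lemma Rel_plus: "p - q \<in> Rel \<Longrightarrow> p' - q' \<in> Rel \<Longrightarrow> (p + p') - (q + q') \<in> Rel"
  using free.subspace_add[OF subspace_Rel, of "p - q" "p' - q'"] by (simp add: algebra_simps)

lemma sing_scale:
  assumes s: "s \<in> carrier S" shows "sing s (fr a * x) - sing (a \<odot>\<^bsub>S\<^esub> s) x \<in> Rel"
  by (rule Rel_trans[OF Rel4[OF s] Rel_sym[OF Rel3[OF s]]])

text \<open>All summands are brought to the denominator \<open>q * b\<close>, their numerators are
  moved into \<open>S\<close>, and the sum is formed in the first factor.\<close>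

lemma common_denominator:
  assumes "p \<in> carrier (ext_free S)"
  shows "\<exists>s b. s \<in> carrier S \<and> b \<noteq> 0 \<and> p - sing s (Fract 1 b) \<in> Rel"
proof -
  have "\<exists>s b. s \<in> carrier S \<and> b \<noteq> 0 \<and>
      (\<Sum>x\<in>J. Poly_Mapping.single x (Poly_Mapping.lookup p x)) - sing s (Fract 1 b) \<in> Rel"
    if "finite J" "J \<subseteq> carrier S \<times> UNIV" for J
    using that
  proof (induction J rule: finite_induct)
    case empty
    have "sing (0 \<odot>\<^bsub>S\<^esub> \<zero>\<^bsub>S\<^esub>) (Fract 1 1) - 0 \<in> Rel"
      using Rel3[OF S_zero, of 0 "Fract 1 1"] by (simp only: single_zero)
    then have "0 - sing (0 \<odot>\<^bsub>S\<^esub> \<zero>\<^bsub>S\<^esub>) (Fract 1 1) \<in> Rel" by (rule Rel_sym)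
    then show ?case using S_smult[OF S_zero, of 0] by (intro exI[of _ "0 \<odot>\<^bsub>S\<^esub> \<zero>\<^bsub>S\<^esub>"] exI[of _ 1]) simp
  next
    case (insert t J)
    obtain s x where t: "t = (s, x)" "s \<in> carrier S" using insert.prems by auto
    obtain s' b where s': "s' \<in> carrier S" "b \<noteq> 0"
      "(\<Sum>x\<in>J. Poly_Mapping.single x (Poly_Mapping.lookup p x)) - sing s' (Fract 1 b) \<in> Rel"
      using insert by auto
    obtain a q where x: "q \<noteq> 0" "x = fr a * Fract 1 q" by (rule fract_cases_fr)
    let ?l = "Poly_Mapping.lookup p t" and ?z = "Fract 1 (q * b)"
    have "fr ?l * x = fr (?l * a * b) * ?z" "Fract 1 b = fr q * ?z"
      using x s' by (simp_all add: eq_fract)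
    then have "Poly_Mapping.single t ?l - sing ((?l * a * b) \<odot>\<^bsub>S\<^esub> s) ?z \<in> Rel"
      and 2: "sing s' (Fract 1 b) - sing (q \<odot>\<^bsub>S\<^esub> s') ?z \<in> Rel"
      using Rel_trans[OF Rel_sym[OF Rel4[OF t(2), of ?l x]] ] sing_scale[OF t(2), of "?l * a * b" ?z]
        sing_scale[OF s'(1), of q ?z] by (simp_all add: t(1))
    then have 3: "(Poly_Mapping.single t ?l + (\<Sum>x\<in>J. Poly_Mapping.single x (Poly_Mapping.lookup p x)))
        - (sing ((?l * a * b) \<odot>\<^bsub>S\<^esub> s) ?z + sing (q \<odot>\<^bsub>S\<^esub> s') ?z) \<in> Rel"
      using Rel_plus Rel_trans[OF s'(3) 2] by blast
    have "(sing ((?l * a * b) \<odot>\<^bsub>S\<^esub> s) ?z + sing (q \<odot>\<^bsub>S\<^esub> s') ?z) - sing ((?l * a * b) \<odot>\<^bsub>S\<^esub> s \<oplus>\<^bsub>S\<^esub> q \<odot>\<^bsub>S\<^esub> s') ?z \<in> Rel"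
      using Rel_sym[of "sing ((?l * a * b) \<odot>\<^bsub>S\<^esub> s \<oplus>\<^bsub>S\<^esub> q \<odot>\<^bsub>S\<^esub> s') ?z"] Rel1[OF S_smult[OF t(2)] S_smult[OF s'(1)]]
      by (simp add: diff_diff_eq)
    from Rel_trans[OF 3 this] show ?case
      using insert.hyps x s' t
      by (intro exI[of _ "(?l * a * b) \<odot>\<^bsub>S\<^esub> s \<oplus>\<^bsub>S\<^esub> q \<odot>\<^bsub>S\<^esub> s'"] exI[of _ "q * b"]) (simp add: S_add S_smult)
  qed
  from this[of "Poly_Mapping.keys p"] show ?thesis
    using assms poly_mapping_expand[of p] by (simp add: ext_free_simps)
qed

text \<open>Modulo relations there is only one generator \<open>(s, 1/b)\<close>. If its image
  vanishes, so does \<open>\<iota> s\<close>; injectivity then gives that \<open>s\<close> equals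
  its multiple by 0, and the generator is a relation.\<close>

lemma Rel_eq_ker: "Rel = {p \<in> carrier (ext_free S). \<Theta> p = 0}"
proof (rule equalityI[OF Rel_subset_ker], safe)
  fix p assume p: "p \<in> carrier (ext_free S)" "\<Theta> p = 0"
  obtain s b where s: "s \<in> carrier S" "b \<noteq> 0" "p - sing s (Fract 1 b) \<in> Rel"
    using common_denominator[OF p(1)] by blast
  then have "\<Theta> (p - sing s (Fract 1 b)) = 0" using Rel_subset_ker by blast
  then have "scalK (Fract 1 b) (\<iota> s) = 0" using p by (simp add: \<Theta>_diff \<Theta>_single fr_1)
  then have "scalK (fr b * Fract 1 b) (\<iota> s) = 0" by (metis scalK_simps(1,5))
  then have "\<iota> s = 0" using fr_inverse[OF s(2)] by (simp only: scalK_simps)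
  then have "s = 0 \<odot>\<^bsub>S\<^esub> s" using s by (intro \<iota>_inj) (auto simp: S_smult \<iota>_smult scalK_simps)
  then have "sing s (Fract 1 b) \<in> Rel" using Rel3[OF s(1), of 0] by simp
  from free.subspace_add[OF subspace_Rel s(3) this] show "p \<in> Rel" by simp
qed

lemma image_\<Theta>: "\<Theta> ` carrier (ext_free S) = E"
proof (intro equalityI subsetI)
  fix z assume "z \<in> \<Theta> ` carrier (ext_free S)"
  then obtain p where p: "p \<in> carrier (ext_free S)" "z = \<Theta> p" by blast
  obtain s b where s: "s \<in> carrier S" "b \<noteq> 0" "p - sing s (Fract 1 b) \<in> Rel"
    using common_denominator[OF p(1)] by blast
  then have "\<Theta> (p - sing s (Fract 1 b)) = 0" using Rel_subset_ker by blast
  then have z: "z = scalK (Fract 1 b) (\<iota> s)" using p by (simp add: \<Theta>_diff \<Theta>_single fr_1)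
  then have "scalK (fr b) z = \<iota> s" using fr_inverse[OF s(2)] by (simp only: scalK_simps)
  then show "z \<in> E" unfolding E_def using s D.sm_closed[OF \<iota>_D[OF s(1)]] z by auto
next
  fix z assume "z \<in> E"
  then obtain c s where z: "c \<noteq> 0" "s \<in> carrier S" "scalK (fr c) z = \<iota> s" by (auto simp: E_def)
  have "\<Theta> (sing s (Fract 1 c)) = scalK (Fract 1 c) (scalK (fr c) z)" using z by (simp add: \<Theta>_single fr_1)
  also have "\<dots> = z" using fr_inverse[OF z(1)] by (simp only: scalK_simps mult.commute)
  finally show "z \<in> \<Theta> ` carrier (ext_free S)" using ext_single[OF z(2)] by (intro image_eqI[OF sym])
qed

lemma \<Theta>_D: "p \<in> carrier (ext_free S) \<Longrightarrow> \<Theta> p \<in> D"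
  using image_\<Theta> unfolding E_def by blast

lemma \<Theta>_expand: "\<Theta> p = (\<Sum>t\<in>Poly_Mapping.keys p. scalK (fr (Poly_Mapping.lookup p t) * snd t) (\<iota> (fst t)))"
  by (rule ext) (simp add: \<Theta>_def linK_def sum_fun_apply scalK_def case_prod_unfold mult.assoc)

lemma \<Theta>_mult:
  assumes p: "p \<in> carrier (ext_free S)" and q: "q \<in> carrier (ext_free S)"
  shows "\<Theta> (p \<otimes>\<^bsub>ext_free S\<^esub> q) = \<Theta> p \<star> \<Theta> q"
proof -
  have kp: "fst t \<in> carrier S" if "t \<in> Poly_Mapping.keys p" for t using that p by (auto simp: ext_free_simps)
  have kq: "fst t \<in> carrier S" if "t \<in> Poly_Mapping.keys q" for t using that q by (auto simp: ext_free_simps)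
  have fe: "\<Theta> (free_extend g r) = (\<Sum>t\<in>Poly_Mapping.keys r. scalK (fr (Poly_Mapping.lookup r t)) (\<Theta> (g t)))"
    for g and r :: "'s \<times> 'k fract \<Rightarrow>\<^sub>0 'k"
    by (rule ext) (simp add: \<Theta>_def linK_free_extend, simp add: linK_def sum_fun_apply scalK_def)
  have "\<Theta> (p \<otimes>\<^bsub>ext_free S\<^esub> q) = (\<Sum>t\<in>Poly_Mapping.keys p. \<Sum>t'\<in>Poly_Mapping.keys q.
      scalK (fr (Poly_Mapping.lookup p t)) (scalK (fr (Poly_Mapping.lookup q t')) (scalK (snd t * snd t') (\<iota> (fst t \<otimes>\<^bsub>S\<^esub> fst t')))))"
    unfolding ext_free_simps free_extend2_def fe case_prod_unfold \<Theta>_single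
    by (rule ext) (simp add: sum_fun_apply scalK_def sum_distrib_left fr_1)
  also have "\<dots> = (\<Sum>t\<in>Poly_Mapping.keys p. \<Sum>t'\<in>Poly_Mapping.keys q.
      scalK (fr (Poly_Mapping.lookup p t) * snd t) (\<iota> (fst t)) \<star> scalK (fr (Poly_Mapping.lookup q t') * snd t') (\<iota> (fst t')))"
  proof (rule sum.cong[OF refl], rule sum.cong[OF refl])
    fix t t' assume "t \<in> Poly_Mapping.keys p" "t' \<in> Poly_Mapping.keys q"
    then have "fst t \<in> carrier S" "fst t' \<in> carrier S" using kp kq by auto
    then show "scalK (fr (Poly_Mapping.lookup p t)) (scalK (fr (Poly_Mapping.lookup q t')) (scalK (snd t * snd t') (\<iota> (fst t \<otimes>\<^bsub>S\<^esub> fst t'))))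
      = scalK (fr (Poly_Mapping.lookup p t) * snd t) (\<iota> (fst t)) \<star> scalK (fr (Poly_Mapping.lookup q t') * snd t') (\<iota> (fst t'))"
      by (simp add: \<iota>_mult D.sm_l D.sm_r D.sm_closed \<iota>_D) (simp add: scalK_simps mult_ac)
  qed
  also have "\<dots> = (\<Sum>t\<in>Poly_Mapping.keys p. scalK (fr (Poly_Mapping.lookup p t) * snd t) (\<iota> (fst t)) \<star> \<Theta> q)"
    unfolding \<Theta>_expand[of q] using kp kq by (intro sum.cong refl D.sum_r[symmetric] D.sm_closed \<iota>_D)
  also have "\<dots> = \<Theta> p \<star> \<Theta> q"
    unfolding \<Theta>_expand[of p] using kp by (intro D.sum_l[symmetric] D.sm_closed \<iota>_D \<Theta>_D q)
  finally show ?thesis .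
qed

lemma \<Theta>_ext_smult: "\<Theta> (c \<odot>\<^bsub>ext_free S\<^esub> p) = scalK c (\<Theta> p)"
  unfolding ext_free_simps \<Theta>_def linK_free_extend case_prod_unfold
  by (rule ext) (simp add: linK_def scalK_def sum_distrib_left fr_1 mult_ac)

definition ecoords :: "('s \<times> 'k fract \<Rightarrow>\<^sub>0 'k) set \<Rightarrow> 'w \<Rightarrow> 'k fract" where
  "ecoords U = \<Theta> (SOME p. p \<in> U)"

lemma
  shows faithful_rep_scalar_ext: "faithful_rep (scalar_ext S) ecoords E (\<star>) uD scalK"
    and ecoords_coset: "p \<in> carrier (ext_free S) \<Longrightarrow> ecoords (Rel +>\<^bsub>ext_free S\<^esub> p) = \<Theta> p"
    and ext_coset: "p \<in> carrier (ext_free S) \<Longrightarrow> Rel +>\<^bsub>ext_free S\<^esub> p = {q \<in> carrier (ext_free S). \<Theta> q = \<Theta> p}"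
    and carrier_scalar_ext: "carrier (scalar_ext S) = (\<lambda>p. Rel +>\<^bsub>ext_free S\<^esub> p) ` carrier (ext_free S)"
proof -
  have one: "\<one>\<^bsub>ext_free S\<^esub> \<in> carrier (ext_free S)" "\<Theta> \<one>\<^bsub>ext_free S\<^esub> = uD"
    using ext_single[OF S_one, of 1 1] by (simp_all add: ext_free_simps(3) \<Theta>_single \<iota>_one fr_1 scalK_simps)
  have mc: "p \<otimes>\<^bsub>ext_free S\<^esub> q \<in> carrier (ext_free S)"
    if "p \<in> carrier (ext_free S)" "q \<in> carrier (ext_free S)" for p q
    using that unfolding ext_free_simps free_extend2_def mem_Collect_eq
    by (intro keys_free_extend) (force simp: S_mult split: prod.split)
  have sc: "c \<odot>\<^bsub>ext_free S\<^esub> p \<in> carrier (ext_free S)" if "p \<in> carrier (ext_free S)" for c p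
    using that unfolding ext_free_simps mem_Collect_eq
    by (intro keys_free_extend) (force split: prod.split)
  have c: "ecoords = (\<lambda>U. \<Theta> (SOME p. p \<in> U))" by (simp add: fun_eq_iff ecoords_def)
  note Q = faithful_rep_quot_alg[of "ext_free S" \<Theta> uD "(\<star>)" scalK Rel,
      OF ext_free_simps(4) ext_diff one mc sc \<Theta>_add \<Theta>_mult \<Theta>_ext_smult Rel_eq_ker, simplified]
  show "faithful_rep (scalar_ext S) ecoords E (\<star>) uD scalK"
    using Q(1) unfolding image_\<Theta> scalar_ext_def c .
  show "ecoords (Rel +>\<^bsub>ext_free S\<^esub> p) = \<Theta> p" if "p \<in> carrier (ext_free S)" unfolding c by (rule Q(2)[OF that])
  show "Rel +>\<^bsub>ext_free S\<^esub> p = {q \<in> carrier (ext_free S). \<Theta> q = \<Theta> p}" if "p \<in> carrier (ext_free S)" by (rule Q(3)[OF that])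
  show "carrier (scalar_ext S) = (\<lambda>p. Rel +>\<^bsub>ext_free S\<^esub> p) ` carrier (ext_free S)"
    unfolding scalar_ext_def by (rule Q(4))
qed

lemma ext_tensor_props:
  assumes "s \<in> carrier S"
  shows "ext_tensor S s x \<in> carrier (scalar_ext S)" and "ecoords (ext_tensor S s x) = scalK x (\<iota> s)"
  using ext_single[OF assms, of x 1]
  by (auto simp: ext_tensor_def carrier_scalar_ext ecoords_coset \<Theta>_single fr_1)

text \<open>
  Denominators of \<open>\<phi>\<close> on the finite spanning set \<open>V\<close> are bounded, so a multiple of \<open>\<phi>\<close> restricts to
  the original algebra.
\<close>

lemma dci_E:
  assumes C: "calg C mul u sm" and h: "faithful_rep S h C mul u sm" and dci: "dci C mul (h f)"
    and f: "f \<in> carrier S" and V: "finite V" "V \<subseteq> carrier S"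
    and span: "\<And>s. s \<in> carrier S \<Longrightarrow> \<exists>a. \<iota> s = (\<Sum>v\<in>V. scalK (fr (a v)) (\<iota> v))"
  shows "dci E (\<star>) (\<iota> f)"
proof -
  interpret E: calg E "(\<star>)" uD scalK by (rule calg_E)
  note Q = faithful_repD[OF h]
  \<comment> \<open>\<open>h\<close> and \<open>\<iota>\<close> are both injective on
    \<open>S\<close>, so equations may be passed from one representation to the other.\<close>
  have h_iff: "h x = h y \<longleftrightarrow> \<iota> x = \<iota> y" if "x \<in> carrier S" "y \<in> carrier S" for x y
    using that Q(11) \<iota>_inj by (auto simp: bij_betw_def inj_on_def)
  have \<iota>E: "\<iota> s \<in> E" if "s \<in> carrier S" for s
    unfolding E_def using that \<iota>_D[OF that]
    by (intro CollectI conjI exI[of _ "1 :: 'k"] exI[of _ s]) (simp_all add: fr_1 scalK_simps)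
  have "h (f \<otimes>\<^bsub>S\<^esub> f) = h f" using dci by (simp add: Q(9)[OF f f] dci_def)
  then have ftof: "\<iota> f \<star> \<iota> f = \<iota> f" using h_iff[OF S_mult[OF f f] f] \<iota>_mult[OF f f] by simp
  have E_D: "z \<in> D" if "z \<in> E" for z using that by (simp add: E_def)
  have frac: "z = scalK (Fract 1 c) (\<iota> s)" if "c \<noteq> 0" "scalK (fr c) z = \<iota> s" for z c s
    using fr_inverse[OF that(1)] unfolding that(2)[symmetric] by (simp only: scalK_simps mult.commute)
  show ?thesis
  proof (rule dciI)
    show "\<iota> f \<in> E" "\<iota> f \<star> \<iota> f = \<iota> f" by (simp_all add: \<iota>E f ftof)
  next
    fix z assume z: "z \<in> E" and k: "\<And>x. x \<in> E \<Longrightarrow> z \<star> (x \<star> \<iota> f) = 0"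
    obtain c s where c: "c \<noteq> 0" "s \<in> carrier S" "scalK (fr c) z = \<iota> s" using z by (auto simp: E_def)
    have "h s = 0"
    proof (rule dci_inj[OF dci Q(12)[OF c(2)]])
      fix x assume "x \<in> C"
      then obtain t where t: "t \<in> carrier S" "x = h t" using Q(11) by (auto simp: bij_betw_def)
      have "\<iota> (s \<otimes>\<^bsub>S\<^esub> (t \<otimes>\<^bsub>S\<^esub> f)) = scalK (fr c) (z \<star> (\<iota> t \<star> \<iota> f))"
        using c t f z by (simp add: \<iota>_mult S_mult D.sm_l D.mul_closed \<iota>_D E_D flip: c(3))
      also have "\<dots> = \<iota> \<zero>\<^bsub>S\<^esub>" using k[OF \<iota>E[OF t(1)]] by (simp add: scalK_simps \<iota>_zero)
      finally have "h (s \<otimes>\<^bsub>S\<^esub> (t \<otimes>\<^bsub>S\<^esub> f)) = h \<zero>\<^bsub>S\<^esub>" using c t f by (simp add: h_iff S_mult S_zero)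
      then show "mul (h s) (mul x (h f)) = 0" using c t f Q by simp
    qed
    then have "\<iota> s = 0" using h_iff[OF c(2) S_zero] Q(6) \<iota>_zero by simp
    then show "z = 0" using frac[OF c(1,3)] by (simp add: scalK_simps)
  next
    fix \<phi>
    assume \<phi>1: "\<And>x. x \<in> E \<Longrightarrow> x \<star> \<iota> f = x \<Longrightarrow> \<phi> x \<in> E \<and> \<phi> x \<star> \<iota> f = \<phi> x"
      and \<phi>2: "\<And>x y. x \<in> E \<Longrightarrow> y \<in> E \<Longrightarrow> x \<star> \<iota> f = x \<Longrightarrow> y \<star> \<iota> f = y \<Longrightarrow> \<phi> (x + y) = \<phi> x + \<phi> y"
      and \<phi>3: "\<And>x c. x \<in> E \<Longrightarrow> c \<in> E \<Longrightarrow> x \<star> \<iota> f = x \<Longrightarrow> \<iota> f \<star> c = c \<Longrightarrow> c \<star> \<iota> f = c \<Longrightarrow>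
         \<phi> (x \<star> c) = \<phi> x \<star> c"
    have \<phi>s: "\<phi> (scalK a x) = scalK a (\<phi> x)" if x: "x \<in> E" "x \<star> \<iota> f = x" for a x
    proof -
      have "\<phi> (x \<star> scalK a (\<iota> f)) = \<phi> x \<star> scalK a (\<iota> f)"
        using x f by (intro \<phi>3) (auto simp: E.sm_closed \<iota>E E.sm_l E.sm_r ftof)
      then show ?thesis using x \<phi>1[OF x] f by (simp add: E.sm_r \<iota>E)
    qed
    have fx: "x \<star> \<iota> f \<in> E" "x \<star> \<iota> f \<star> \<iota> f = x \<star> \<iota> f" if "x \<in> E" for x
      using that f by (simp_all add: E.mul_closed \<iota>E E.assoc ftof)
    \<comment> \<open>The product of the denominators needed at the single elements of
      \<open>V\<close> serves for all of them.\<close>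
    have "\<exists>c. c \<noteq> 0 \<and> (\<forall>v\<in>V. \<exists>t\<in>carrier S. scalK (fr c) (\<phi> (\<iota> v \<star> \<iota> f)) = \<iota> t)"
      using V
    proof (induction V rule: finite_induct)
      case (insert v V)
      then obtain c where c: "c \<noteq> 0" "\<And>v. v \<in> V \<Longrightarrow> \<exists>t\<in>carrier S. scalK (fr c) (\<phi> (\<iota> v \<star> \<iota> f)) = \<iota> t" by auto
      have "\<phi> (\<iota> v \<star> \<iota> f) \<in> E" using \<phi>1[OF fx[OF \<iota>E]] insert.prems by auto
      then obtain c' t' where c': "c' \<noteq> 0" "t' \<in> carrier S" "scalK (fr c') (\<phi> (\<iota> v \<star> \<iota> f)) = \<iota> t'" by (auto simp: E_def)
      have "\<exists>t\<in>carrier S. scalK (fr (c * c')) (\<phi> (\<iota> v' \<star> \<iota> f)) = \<iota> t" if v': "v' \<in> insert v V" for v'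
      proof (cases "v' = v")
        case True
        have "scalK (fr (c * c')) (\<phi> (\<iota> v \<star> \<iota> f)) = \<iota> (c \<odot>\<^bsub>S\<^esub> t')"
          using c' by (simp add: \<iota>_smult flip: c'(3)) (simp add: scalK_simps)
        then show ?thesis using True c' S_smult by blast
      next
        case False
        then obtain t where t: "t \<in> carrier S" "scalK (fr c) (\<phi> (\<iota> v' \<star> \<iota> f)) = \<iota> t" using c v' by blast
        have "scalK (fr (c * c')) (\<phi> (\<iota> v' \<star> \<iota> f)) = \<iota> (c' \<odot>\<^bsub>S\<^esub> t)"
          using t by (simp add: \<iota>_smult flip: t(2)) (simp add: scalK_simps mult.commute)
        then show ?thesis using t S_smult by blast
      qed
      then show ?case using c(1) c'(1) by (intro exI[of _ "c * c'"]) simp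
    qed (auto intro: exI[of _ 1])
    then obtain c where c: "c \<noteq> 0" "\<And>v. v \<in> V \<Longrightarrow> \<exists>t\<in>carrier S. scalK (fr c) (\<phi> (\<iota> v \<star> \<iota> f)) = \<iota> t" by blast
    have \<phi>sum: "\<phi> (\<Sum>v\<in>J. scalK (b v) (\<iota> v \<star> \<iota> f)) = (\<Sum>v\<in>J. scalK (b v) (\<phi> (\<iota> v \<star> \<iota> f)))
        \<and> (\<Sum>v\<in>J. scalK (b v) (\<iota> v \<star> \<iota> f)) \<in> E \<and> (\<Sum>v\<in>J. scalK (b v) (\<iota> v \<star> \<iota> f)) \<star> \<iota> f = (\<Sum>v\<in>J. scalK (b v) (\<iota> v \<star> \<iota> f))"
      if "finite J" "J \<subseteq> carrier S" for J and b :: "'s \<Rightarrow> 'k fract"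
      using that
    proof (induction J rule: finite_induct)
      case empty
      have "\<phi> 0 = \<phi> 0 + \<phi> 0" using \<phi>2[of 0 0] E.zero_closed by (simp add: E.zero_l \<iota>E f)
      then have "\<phi> 0 = 0" by simp
      then show ?case unfolding sum.empty using E.zero_closed E.zero_l[OF \<iota>E[OF f]] by blast
    next
      case (insert v J)
      have v: "\<iota> v \<in> E" using insert.prems \<iota>E by auto
      have sv: "scalK (b v) (\<iota> v \<star> \<iota> f) \<in> E" "scalK (b v) (\<iota> v \<star> \<iota> f) \<star> \<iota> f = scalK (b v) (\<iota> v \<star> \<iota> f)"
        using fx[OF v] by (simp_all add: E.sm_closed E.sm_l \<iota>E f)
      have IH: "\<phi> (\<Sum>v\<in>J. scalK (b v) (\<iota> v \<star> \<iota> f)) = (\<Sum>v\<in>J. scalK (b v) (\<phi> (\<iota> v \<star> \<iota> f)))"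
        "(\<Sum>v\<in>J. scalK (b v) (\<iota> v \<star> \<iota> f)) \<in> E"
        "(\<Sum>v\<in>J. scalK (b v) (\<iota> v \<star> \<iota> f)) \<star> \<iota> f = (\<Sum>v\<in>J. scalK (b v) (\<iota> v \<star> \<iota> f))"
        using insert by auto
      let ?s = "scalK (b v) (\<iota> v \<star> \<iota> f)" and ?R = "\<Sum>v\<in>J. scalK (b v) (\<iota> v \<star> \<iota> f)"
      have 1: "\<phi> (?s + ?R) = scalK (b v) (\<phi> (\<iota> v \<star> \<iota> f)) + (\<Sum>v\<in>J. scalK (b v) (\<phi> (\<iota> v \<star> \<iota> f)))"
        unfolding \<phi>2[OF sv(1) IH(2) sv(2) IH(3)] IH(1) \<phi>s[OF fx[OF v]] ..
      have 2: "(?s + ?R) \<star> \<iota> f = ?s + ?R"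
        unfolding E.distl[OF sv(1) IH(2) \<iota>E[OF f]] sv(2) IH(3) ..
      show ?case
        unfolding sum.insert[OF insert.hyps]
        using 1 2 E.add_closed[OF sv(1) IH(2)] by blast
    qed
    have cont: "\<exists>t\<in>carrier S. scalK (fr c) (\<phi> (\<iota> s \<star> \<iota> f)) = \<iota> t" if s: "s \<in> carrier S" for s
    proof -
      obtain a where a: "\<iota> s = (\<Sum>v\<in>V. scalK (fr (a v)) (\<iota> v))" using span[OF s] by blast
      have e0: "\<iota> s \<star> \<iota> f = (\<Sum>v\<in>V. scalK (fr (a v)) (\<iota> v \<star> \<iota> f))"
        unfolding a using V f by (subst E.sum_l) (auto simp: E.sm_closed \<iota>E E.sm_l subset_iff intro!: sum.cong)
      have e: "scalK (fr c) (\<phi> (\<iota> s \<star> \<iota> f)) = (\<Sum>v\<in>V. scalK (fr (a v)) (scalK (fr c) (\<phi> (\<iota> v \<star> \<iota> f))))"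
        unfolding e0 using \<phi>sum[OF V, of "\<lambda>v. fr (a v)", THEN conjunct1]
        by (simp only: fun_eq_iff) (simp add: sum_fun_apply scalK_def sum_distrib_left mult.left_commute)
      have "\<exists>t\<in>carrier S. (\<Sum>v\<in>J. scalK (fr (a v)) (scalK (fr c) (\<phi> (\<iota> v \<star> \<iota> f)))) = \<iota> t" if "finite J" "J \<subseteq> V" for J
        using that
      proof (induction J rule: finite_induct)
        case (insert v J)
        then obtain t where t: "t \<in> carrier S" "(\<Sum>v\<in>J. scalK (fr (a v)) (scalK (fr c) (\<phi> (\<iota> v \<star> \<iota> f)))) = \<iota> t" by auto
        obtain t' where t': "t' \<in> carrier S" "scalK (fr c) (\<phi> (\<iota> v \<star> \<iota> f)) = \<iota> t'" using c insert.prems by blast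
        show ?case
          unfolding sum.insert[OF insert.hyps] t(2) t'(2)
          using t t' by (intro bexI[of _ "a v \<odot>\<^bsub>S\<^esub> t' \<oplus>\<^bsub>S\<^esub> t"]) (simp_all add: \<iota>_add \<iota>_smult S_smult S_add)
      qed (use S_zero \<iota>_zero in \<open>auto intro!: bexI[of _ "\<zero>\<^bsub>S\<^esub>"]\<close>)
      then show ?thesis unfolding e using V by blast
    qed
    \<comment> \<open>\<open>\<psi>\<close> is \<open>c\<close> times \<open>\<phi>\<close>, read on
      the side of \<open>C\<close>. The choice is unambiguous because \<open>h\<close> and
      \<open>\<iota>\<close> are injective.\<close>
    define \<psi> where "\<psi> x = (SOME y. \<exists>s t. s \<in> carrier S \<and> t \<in> carrier S \<and> x = h s \<and> y = h t \<and>
        scalK (fr c) (\<phi> (\<iota> s \<star> \<iota> f)) = \<iota> t)" for x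
    have \<psi>: "\<exists>t\<in>carrier S. \<psi> (h s) = h t \<and> scalK (fr c) (\<phi> (\<iota> s \<star> \<iota> f)) = \<iota> t" if s: "s \<in> carrier S" for s
    proof -
      obtain t where "t \<in> carrier S" "scalK (fr c) (\<phi> (\<iota> s \<star> \<iota> f)) = \<iota> t" using cont[OF s] by blast
      then have "\<exists>y s' t. s' \<in> carrier S \<and> t \<in> carrier S \<and> h s = h s' \<and> y = h t \<and>
        scalK (fr c) (\<phi> (\<iota> s' \<star> \<iota> f)) = \<iota> t" using s by blast
      from someI_ex[OF this] obtain s' t where st: "s' \<in> carrier S" "t \<in> carrier S" "h s = h s'" "\<psi> (h s) = h t"
        "scalK (fr c) (\<phi> (\<iota> s' \<star> \<iota> f)) = \<iota> t" unfolding \<psi>_def by blast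
      then have "\<iota> s = \<iota> s'" using h_iff[OF s st(1)] by simp
      then show ?thesis using st by auto
    qed
    have hx: "\<exists>s\<in>carrier S. x = h s \<and> \<iota> s \<star> \<iota> f = \<iota> s" if "x \<in> C" "mul x (h f) = x" for x
    proof -
      have "x \<in> h ` carrier S" using Q(11) that(1) by (simp add: bij_betw_def)
      then obtain s where s: "s \<in> carrier S" "x = h s" by blast
      have "h (s \<otimes>\<^bsub>S\<^esub> f) = h s" using that s f Q(9) by simp
      then show ?thesis using h_iff[OF S_mult[OF s(1) f] s(1)] s f \<iota>_mult by auto
    qed
    obtain r where r: "r \<in> C" "\<And>x. x \<in> C \<Longrightarrow> mul x (h f) = x \<Longrightarrow> \<psi> x = mul r x"
    proof (rule dci_surj[OF dci, of \<psi>])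
      fix x assume x: "x \<in> C" "mul x (h f) = x"
      obtain s where s: "s \<in> carrier S" "x = h s" "\<iota> s \<star> \<iota> f = \<iota> s" using hx[OF x] by blast
      obtain t where t: "t \<in> carrier S" "\<psi> x = h t" "scalK (fr c) (\<phi> (\<iota> s)) = \<iota> t"
        using \<psi>[OF s(1)] s by auto
      have "\<iota> t \<star> \<iota> f = \<iota> t"
        using \<phi>1[OF \<iota>E[OF s(1)] s(3)] f by (simp add: E.sm_l \<iota>E flip: t(3))
      then have "h (t \<otimes>\<^bsub>S\<^esub> f) = h t" using t f by (simp add: h_iff S_mult \<iota>_mult)
      then show "\<psi> x \<in> C \<and> mul (\<psi> x) (h f) = \<psi> x" using t f Q by simp
    next
      fix x y assume x: "x \<in> C" "mul x (h f) = x" and y: "y \<in> C" "mul y (h f) = y"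
      obtain s where s: "s \<in> carrier S" "x = h s" "\<iota> s \<star> \<iota> f = \<iota> s" using hx[OF x] by blast
      obtain t where t: "t \<in> carrier S" "\<psi> x = h t" "scalK (fr c) (\<phi> (\<iota> s)) = \<iota> t"
        using \<psi>[OF s(1)] s by auto
      obtain s' where s': "s' \<in> carrier S" "y = h s'" "\<iota> s' \<star> \<iota> f = \<iota> s'" using hx[OF y] by blast
      obtain t' where t': "t' \<in> carrier S" "\<psi> y = h t'" "scalK (fr c) (\<phi> (\<iota> s')) = \<iota> t'"
        using \<psi>[OF s'(1)] s' by auto
      have i: "\<iota> (s \<oplus>\<^bsub>S\<^esub> s') \<star> \<iota> f = \<iota> (s \<oplus>\<^bsub>S\<^esub> s')" using s s' f by (simp add: \<iota>_add E.distl \<iota>E)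
      obtain t'' where t'': "t'' \<in> carrier S" "\<psi> (x + y) = h t''" "scalK (fr c) (\<phi> (\<iota> (s \<oplus>\<^bsub>S\<^esub> s'))) = \<iota> t''"
        using \<psi>[OF S_add[OF s(1) s'(1)]] s s' i Q(8) by auto
      have "\<iota> t'' = \<iota> (t \<oplus>\<^bsub>S\<^esub> t')"
        using s s' t(1) t'(1) \<phi>2[OF \<iota>E[OF s(1)] \<iota>E[OF s'(1)]]
        by (simp add: \<iota>_add scalK_simps flip: t(3) t'(3) t''(3))
      then show "\<psi> (x + y) = \<psi> x + \<psi> y"
        using t t' t'' Q(8) h_iff[OF t''(1) S_add[OF t(1) t'(1)]] by simp
    next
      fix x y assume x: "x \<in> C" "mul x (h f) = x" and y: "y \<in> C" "mul (h f) y = y" "mul y (h f) = y"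
      obtain s where s: "s \<in> carrier S" "x = h s" "\<iota> s \<star> \<iota> f = \<iota> s" using hx[OF x] by blast
      obtain t where t: "t \<in> carrier S" "\<psi> x = h t" "scalK (fr c) (\<phi> (\<iota> s)) = \<iota> t"
        using \<psi>[OF s(1)] s by auto
      obtain s' where s': "s' \<in> carrier S" "y = h s'" "\<iota> s' \<star> \<iota> f = \<iota> s'" using hx[OF y(1,3)] by blast
      have fy: "\<iota> f \<star> \<iota> s' = \<iota> s'"
        using y(2) s' f h_iff[OF S_mult[OF f s'(1)] s'(1)] by (simp add: \<iota>_mult Q(9))
      have i: "\<iota> (s \<otimes>\<^bsub>S\<^esub> s') \<star> \<iota> f = \<iota> (s \<otimes>\<^bsub>S\<^esub> s')" using s s' f by (simp add: \<iota>_mult E.assoc \<iota>E)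
      obtain t'' where t'': "t'' \<in> carrier S" "\<psi> (mul x y) = h t''" "scalK (fr c) (\<phi> (\<iota> (s \<otimes>\<^bsub>S\<^esub> s'))) = \<iota> t''"
        using \<psi>[OF S_mult[OF s(1) s'(1)]] s s' i Q(9) by auto
      have "\<iota> t'' = \<iota> (t \<otimes>\<^bsub>S\<^esub> s')"
        using s s' t(1) fy \<phi>3[OF \<iota>E[OF s(1)] \<iota>E[OF s'(1)]] \<phi>1[OF \<iota>E[OF s(1)]]
        by (simp add: \<iota>_mult E.sm_l \<iota>E flip: t(3) t''(3))
      then show "\<psi> (mul x y) = mul (\<psi> x) y"
        using t s' t'' Q(9) h_iff[OF t''(1) S_mult[OF t(1) s'(1)]] by simp
    qed (use that in blast)
    obtain \<rho> where \<rho>: "\<rho> \<in> carrier S" "r = h \<rho>" using Q(11) r(1) by (auto simp: bij_betw_def)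
    \<comment> \<open>Since \<open>\<psi>\<close> is left multiplication by \<open>h \<rho>\<close>,
      the map \<open>\<phi>\<close> is that by \<open>\<iota> \<rho>\<close> divided by
      \<open>c\<close>; a general \<open>z\<close> is reached through a multiple that comes from
      \<open>S\<close>.\<close>
    have "\<phi> z = scalK (Fract 1 c) (\<iota> \<rho>) \<star> z" if z: "z \<in> E" "z \<star> \<iota> f = z" for z
    proof -
      obtain b s where s: "b \<noteq> 0" "s \<in> carrier S" "scalK (fr b) z = \<iota> s" using z by (auto simp: E_def)
      have sf: "\<iota> s \<star> \<iota> f = \<iota> s" using z f by (simp add: E.sm_l \<iota>E flip: s(3))
      then have "h (s \<otimes>\<^bsub>S\<^esub> f) = h s" using s f by (simp add: h_iff S_mult \<iota>_mult)
      then have "mul (h s) (h f) = h s" using s f Q(9) by simp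
      then have "\<psi> (h s) = mul r (h s)" using r(2) Q(12)[OF s(2)] by blast
      then have "\<psi> (h s) = h (\<rho> \<otimes>\<^bsub>S\<^esub> s)" using \<rho> s Q(9) by simp
      moreover obtain t where t: "t \<in> carrier S" "\<psi> (h s) = h t" "scalK (fr c) (\<phi> (\<iota> s)) = \<iota> t"
        using \<psi>[OF s(2)] unfolding sf by blast
      ultimately have "\<iota> t = \<iota> (\<rho> \<otimes>\<^bsub>S\<^esub> s)" using h_iff[OF t(1) S_mult[OF \<rho>(1) s(2)]] by simp
      then have "scalK (fr c) (\<phi> (\<iota> s)) = \<iota> \<rho> \<star> \<iota> s" using t(3) \<iota>_mult[OF \<rho>(1) s(2)] by simp
      then have "scalK (fr c) (\<phi> (scalK (fr b) z)) = \<iota> \<rho> \<star> scalK (fr b) z" unfolding s(3) .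
      then have "scalK (fr c) (scalK (fr b) (\<phi> z)) = scalK (fr b) (\<iota> \<rho> \<star> z)"
        using \<phi>s[OF z] z \<rho> by (simp add: E.sm_r \<iota>E)
      then have "scalK (Fract 1 b * Fract 1 c) (scalK (fr c) (scalK (fr b) (\<phi> z)))
          = scalK (Fract 1 b * Fract 1 c) (scalK (fr b) (\<iota> \<rho> \<star> z))" by simp
      moreover have "Fract 1 b * Fract 1 c * fr c * fr b = 1" "Fract 1 b * Fract 1 c * fr b = Fract 1 c"
        using s c by (simp_all add: One_fract_def eq_fract)
      ultimately have "\<phi> z = scalK (Fract 1 c) (\<iota> \<rho> \<star> z)"
        unfolding scalK_simps mult.assoc[symmetric] by (simp only: scalK_simps)
      then show ?thesis using z \<rho> by (simp add: E.sm_l \<iota>E)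
    qed
    then show "\<exists>s\<in>E. \<forall>x\<in>E. x \<star> \<iota> f = x \<longrightarrow> \<phi> x = s \<star> x"
      using \<rho> by (intro bexI[of _ "scalK (Fract 1 c) (\<iota> \<rho>)"]) (auto simp: E.sm_closed \<iota>E)
  qed
qed

end

section \<open>Orbit counting and divisibility of orbit sums\<close>

section \<open>Counting by orbits\<close>

text \<open>Composition with a fixed \<open>\<rho>\<close> maps the stabilizer of \<open>z\<close>
  bijectively to the permutations carrying \<open>z\<close> to \<open>\<beta> \<rho> z\<close>, so
  all fibres over the orbit have the same size. The order of composition is that of a right
  action.\<close>

lemma card_orbit_stabilizer:
  fixes \<beta> :: "(nat \<Rightarrow> nat) \<Rightarrow> 'z \<Rightarrow> 'z"
  assumes H: "finite H" and comp: "\<And>\<sigma> \<tau>. \<sigma> \<in> H \<Longrightarrow> \<tau> \<in> H \<Longrightarrow> \<sigma> \<circ> \<tau> \<in> H"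
    and bij: "\<And>\<sigma>. \<sigma> \<in> H \<Longrightarrow> bij \<sigma>" and inv: "\<And>\<sigma>. \<sigma> \<in> H \<Longrightarrow> inv_into UNIV \<sigma> \<in> H"
    and act: "\<And>\<sigma> \<tau>. \<sigma> \<in> H \<Longrightarrow> \<tau> \<in> H \<Longrightarrow> \<beta> (\<sigma> \<circ> \<tau>) z = \<beta> \<tau> (\<beta> \<sigma> z)" and id: "\<beta> id z = z"
  shows "card H = card ((\<lambda>\<sigma>. \<beta> \<sigma> z) ` H) * card {\<sigma> \<in> H. \<beta> \<sigma> z = z}"
proof -
  have "card {\<sigma> \<in> H. \<beta> \<sigma> z = y} = card {\<sigma> \<in> H. \<beta> \<sigma> z = z}" if y: "y \<in> (\<lambda>\<sigma>. \<beta> \<sigma> z) ` H" for y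
  proof -
    obtain \<rho> where \<rho>: "\<rho> \<in> H" "y = \<beta> \<rho> z" using y by blast
    note [simp] = bij_is_inj[OF bij[OF \<rho>(1)]] bij_is_surj[OF bij[OF \<rho>(1)]]
    have io: "inv_into UNIV \<rho> \<circ> \<rho> = id" "\<rho> \<circ> inv_into UNIV \<rho> = id" by (simp_all flip: surj_iff)
    have "bij_betw (\<lambda>\<tau>. \<tau> \<circ> \<rho>) {\<sigma> \<in> H. \<beta> \<sigma> z = z} {\<sigma> \<in> H. \<beta> \<sigma> z = y}"
    proof (rule bij_betw_byWitness[where f' = "\<lambda>\<tau>. \<tau> \<circ> inv_into UNIV \<rho>"])
      show "(\<lambda>\<tau>. \<tau> \<circ> \<rho>) ` {\<sigma> \<in> H. \<beta> \<sigma> z = z} \<subseteq> {\<sigma> \<in> H. \<beta> \<sigma> z = y}"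
        using \<rho> by (auto simp: comp act)
      have "\<beta> (\<sigma> \<circ> inv_into UNIV \<rho>) z = z" if "\<sigma> \<in> H" "\<beta> \<sigma> z = y" for \<sigma>
      proof -
        have "\<beta> (\<sigma> \<circ> inv_into UNIV \<rho>) z = \<beta> (inv_into UNIV \<rho>) (\<beta> \<rho> z)"
          using that \<rho> inv by (simp add: act)
        also have "\<dots> = \<beta> (\<rho> \<circ> inv_into UNIV \<rho>) z" using \<rho> inv by (simp add: act)
        finally show ?thesis using io id by simp
      qed
      then show "(\<lambda>\<tau>. \<tau> \<circ> inv_into UNIV \<rho>) ` {\<sigma> \<in> H. \<beta> \<sigma> z = y} \<subseteq> {\<sigma> \<in> H. \<beta> \<sigma> z = z}"
        using \<rho> inv comp by auto
    qed (use io in \<open>auto simp: comp_assoc\<close>)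
    then show ?thesis using bij_betw_same_card by force
  qed
  then have "(\<Sum>y\<in>(\<lambda>\<sigma>. \<beta> \<sigma> z) ` H. card {\<sigma> \<in> H. \<beta> \<sigma> z = y}) = card ((\<lambda>\<sigma>. \<beta> \<sigma> z) ` H) * card {\<sigma> \<in> H. \<beta> \<sigma> z = z}"
    by simp
  moreover have "(\<Sum>y\<in>(\<lambda>\<sigma>. \<beta> \<sigma> z) ` H. card {\<sigma> \<in> H. \<beta> \<sigma> z = y}) = card H"
    using card_eq_sum[of H] sum.image_gen[OF H, of "\<lambda>_. 1::nat" "\<lambda>\<sigma>. \<beta> \<sigma> z"] by simp
  ultimately show ?thesis by simp
qed

text \<open>Orbits are removed one at a time. The sum over the orbit of \<open>z\<close> is its
  length times \<open>g z\<close>, the order of the stabilizer divides \<open>g z\<close>, and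
  length times stabilizer order is \<open>card H\<close>.\<close>

lemma card_group_dvd_sum:
  fixes \<beta> :: "(nat \<Rightarrow> nat) \<Rightarrow> 'z \<Rightarrow> 'z" and g :: "'z \<Rightarrow> 'k::comm_ring_1"
  assumes H: "finite H" and comp: "\<And>\<sigma> \<tau>. \<sigma> \<in> H \<Longrightarrow> \<tau> \<in> H \<Longrightarrow> \<sigma> \<circ> \<tau> \<in> H" and idH: "id \<in> H"
    and bij: "\<And>\<sigma>. \<sigma> \<in> H \<Longrightarrow> bij \<sigma>" and inv: "\<And>\<sigma>. \<sigma> \<in> H \<Longrightarrow> inv_into UNIV \<sigma> \<in> H"
    and Z: "finite Z" "\<And>\<sigma> z. \<sigma> \<in> H \<Longrightarrow> z \<in> Z \<Longrightarrow> \<beta> \<sigma> z \<in> Z"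
    and act: "\<And>\<sigma> \<tau> z. z \<in> Z \<Longrightarrow> \<sigma> \<in> H \<Longrightarrow> \<tau> \<in> H \<Longrightarrow> \<beta> (\<sigma> \<circ> \<tau>) z = \<beta> \<tau> (\<beta> \<sigma> z)"
    and id: "\<And>z. z \<in> Z \<Longrightarrow> \<beta> id z = z"
    and g: "\<And>\<sigma> z. z \<in> Z \<Longrightarrow> \<sigma> \<in> H \<Longrightarrow> g (\<beta> \<sigma> z) = g z"
    and dvd: "\<And>z. z \<in> Z \<Longrightarrow> of_nat (card {\<sigma> \<in> H. \<beta> \<sigma> z = z}) dvd g z"
  shows "of_nat (card H) dvd (\<Sum>z\<in>Z. g z)"
  using Z act id g dvd
proof (induction "card Z" arbitrary: Z rule: less_induct)
  case less
  note Z = less.prems(1,2) and act = less.prems(3) and id = less.prems(4) and g = less.prems(5) and dvd = less.prems(6)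
  show ?case
  proof (cases "Z = {}")
    case False
    then obtain z where z: "z \<in> Z" by blast
    define orb where "orb = (\<lambda>\<sigma>. \<beta> \<sigma> z) ` H"
    have orb: "orb \<subseteq> Z" "z \<in> orb" using Z z idH id[OF z] unfolding orb_def by (auto intro: image_eqI[of _ _ id])
    have "of_nat (card H) dvd (\<Sum>z\<in>Z - orb. g z)"
    proof (rule less.hyps)
      show "card (Z - orb) < card Z" using orb z Z by (intro psubset_card_mono) auto
      show "finite (Z - orb)" using Z by simp
      fix \<sigma> y assume \<sigma>: "\<sigma> \<in> H" and y: "y \<in> Z - orb"
      have "\<beta> \<sigma> y \<notin> orb"
      proof
        assume "\<beta> \<sigma> y \<in> orb"
        then obtain \<rho> where \<rho>: "\<rho> \<in> H" "\<beta> \<sigma> y = \<beta> \<rho> z" unfolding orb_def by blast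
        note [simp] = bij_is_surj[OF bij[OF \<sigma>]]
        have "\<sigma> \<circ> inv_into UNIV \<sigma> = id" by (simp flip: surj_iff)
        then have "y = \<beta> (\<sigma> \<circ> inv_into UNIV \<sigma>) y" using id y by simp
        also have "\<dots> = \<beta> (inv_into UNIV \<sigma>) (\<beta> \<rho> z)" using \<sigma> inv y \<rho> by (simp add: act)
        also have "\<dots> = \<beta> (\<rho> \<circ> inv_into UNIV \<sigma>) z" using \<rho> inv[OF \<sigma>] z by (simp add: act)
        finally show False using y \<rho>(1) inv[OF \<sigma>] comp unfolding orb_def by blast
      qed
      then show "\<beta> \<sigma> y \<in> Z - orb" using Z(2) \<sigma> y by blast
    qed (use act id g dvd in auto)
    moreover have "of_nat (card H) dvd (\<Sum>y\<in>orb. g y)"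
    proof -
      have "(\<Sum>y\<in>orb. g y) = (\<Sum>y\<in>orb. g z)" using g z by (intro sum.cong) (auto simp: orb_def)
      then have "(\<Sum>y\<in>orb. g y) = of_nat (card orb) * g z" by simp
      moreover have "card H = card orb * card {\<sigma> \<in> H. \<beta> \<sigma> z = z}"
        unfolding orb_def using H comp bij inv act[OF z] id[OF z] by (rule card_orbit_stabilizer)
      ultimately show ?thesis using dvd[OF z] by (simp add: mult_dvd_mono)
    qed
    moreover have "(\<Sum>z\<in>Z. g z) = (\<Sum>z\<in>Z - orb. g z) + (\<Sum>y\<in>orb. g y)"
      using Z orb by (intro sum.subset_diff) auto
    ultimately show ?thesis by simp
  qed simp
qed

lemma zip_eq_iff:
  assumes "length a = m" "length b = m" "length a' = m" "length b' = m"
  shows "zip a b = zip a' b' \<longleftrightarrow> a = a' \<and> b = b'"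
  using assms by (metis map_fst_zip map_snd_zip)

lemma permute_list_zip3:
  assumes "length a = m" "length b = m" "length c = m" "\<sigma> permutes {..<m}"
  shows "permute_list \<sigma> (zip a (zip b c)) = zip a (zip b c) \<longleftrightarrow>
    permute_list \<sigma> a = a \<and> permute_list \<sigma> b = b \<and> permute_list \<sigma> c = c"
  using assms by (simp add: permute_list_zip[of _ "{..<m}"] zip_eq_iff[of _ m])

definition cnt :: "'x list \<Rightarrow> 'x \<Rightarrow> nat" where
  "cnt w y = card {k. k < length w \<and> w ! k = y}"

lemma cnt_notin: "y \<notin> set w \<Longrightarrow> cnt w y = 0"
  by (auto simp: cnt_def in_set_conv_nth)

lemma count_mset_cnt: "count (mset w) y = cnt w y"
  by (simp add: cnt_def count_mset count_list_eq_length_filter length_filter_conv_card eq_commute[of y])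

definition lstab :: "'x list \<Rightarrow> (nat \<Rightarrow> nat) set" where
  "lstab w = {\<sigma>. \<sigma> permutes {..<length w} \<and> permute_list \<sigma> w = w}"

lemma lstab_group:
  shows "finite (lstab w)" "\<sigma> \<in> lstab w \<Longrightarrow> \<tau> \<in> lstab w \<Longrightarrow> \<sigma> \<circ> \<tau> \<in> lstab w" "id \<in> lstab w"
    "\<sigma> \<in> lstab w \<Longrightarrow> bij \<sigma>" "\<sigma> \<in> lstab w \<Longrightarrow> inv_into UNIV \<sigma> \<in> lstab w"
proof -
  show "finite (lstab w)"
    by (rule finite_subset[OF _ finite_permutations[of "{..<length w}"]]) (auto simp: lstab_def)
  show "\<sigma> \<in> lstab w \<Longrightarrow> \<tau> \<in> lstab w \<Longrightarrow> \<sigma> \<circ> \<tau> \<in> lstab w"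
    by (simp add: lstab_def permutes_compose permute_list_compose)
  show "id \<in> lstab w" by (simp add: lstab_def permutes_id)
  show "\<sigma> \<in> lstab w \<Longrightarrow> bij \<sigma>" by (auto simp: lstab_def permutes_bij)
  show "\<sigma> \<in> lstab w \<Longrightarrow> inv_into UNIV \<sigma> \<in> lstab w"
    using permute_list_inverse(2)[of \<sigma> w] by (simp add: lstab_def permutes_inv)
qed

text \<open>The permutations of positions carry \<open>w\<close> to all rearrangements of its
  multiset. Comparing the size of this orbit with the multinomial formula leaves the product of
  factorials as the order of the stabilizer.\<close>

lemma card_lstab: "card (lstab w) = (\<Prod>y\<in>set w. fact (cnt w y))"
proof -
  let ?H = "{\<sigma>. \<sigma> permutes {..<length w}}"
  have orb: "(\<lambda>\<sigma>. permute_list \<sigma> w) ` ?H = permutations_of_multiset (mset w)"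
  proof (intro equalityI subsetI)
    fix v assume "v \<in> permutations_of_multiset (mset w)"
    then have "mset v = mset w" by (simp add: permutations_of_multiset_def)
    from mset_eq_permutation[OF this] obtain \<sigma> where "\<sigma> permutes {..<length w}" "permute_list \<sigma> w = v" .
    then show "v \<in> (\<lambda>\<sigma>. permute_list \<sigma> w) ` ?H" by blast
  qed (auto simp: permutations_of_multiset_def)
  have "card ?H = card ((\<lambda>\<sigma>. permute_list \<sigma> w) ` ?H) * card {\<sigma> \<in> ?H. permute_list \<sigma> w = w}"
  proof (rule card_orbit_stabilizer)
    fix \<sigma> \<tau> assume "\<sigma> \<in> ?H" "\<tau> \<in> ?H"
    then show "permute_list (\<sigma> \<circ> \<tau>) w = permute_list \<tau> (permute_list \<sigma> w)" "\<sigma> \<circ> \<tau> \<in> ?H"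
      "bij \<sigma>" "inv_into UNIV \<sigma> \<in> ?H"
      by (simp_all add: permutes_compose permutes_bij permutes_inv permute_list_compose del: comp_apply)
  qed (simp_all add: finite_permutations)
  moreover have "card ?H = fact (length w)" by (simp add: card_permutations)
  moreover have "{\<sigma> \<in> ?H. permute_list \<sigma> w = w} = lstab w" by (auto simp: lstab_def)
  ultimately have "fact (length w) = card (permutations_of_multiset (mset w)) * card (lstab w)"
    unfolding orb by simp
  moreover have "card (permutations_of_multiset (mset w)) * (\<Prod>y\<in>set w. fact (cnt w y)) = fact (length w)"
    using card_permutations_of_multiset_aux[of "mset w"] by (simp add: count_mset_cnt)
  moreover have "card (permutations_of_multiset (mset w)) > 0"
    using calculation(2) by (metis fact_gt_zero gr0I mult_zero_left)
  ultimately show ?thesis by (metis mult_left_cancel neq0_conv)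
qed

lemma prod_fact_dvd_fact_sum: "finite Y \<Longrightarrow> (\<Prod>y\<in>Y. fact (f y) :: nat) dvd fact (\<Sum>y\<in>Y. f y)"
proof (induction Y rule: finite_induct)
  case (insert y Y)
  have "(\<Prod>y\<in>insert y Y. fact (f y) :: nat) dvd fact (f y) * fact (\<Sum>y\<in>Y. f y)"
    using insert by (simp add: mult_dvd_mono)
  also have "\<dots> dvd fact (f y + (\<Sum>y\<in>Y. f y))" by (rule fact_fact_dvd_fact)
  finally show ?case using insert by simp
qed simp

text \<open>The letters in \<open>Y\<close> split at most \<open>m\<close> positions into disjoint
  classes, and multinomial coefficients are integers.\<close>

lemma prod_fact_cnt_dvd:
  assumes "finite Y" "card {k. k < length w \<and> w ! k \<in> Y} \<le> m"
  shows "(\<Prod>y\<in>Y. fact (cnt w y) :: nat) dvd fact m"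
proof -
  have "(\<Sum>y\<in>Y. cnt w y) = card (\<Union>y\<in>Y. {k. k < length w \<and> w ! k = y})"
    unfolding cnt_def using assms(1) by (subst card_UN_disjoint) auto
  also have "(\<Union>y\<in>Y. {k. k < length w \<and> w ! k = y}) = {k. k < length w \<and> w ! k \<in> Y}" by blast
  finally have "(\<Sum>y\<in>Y. cnt w y) \<le> m" using assms(2) by simp
  then have "fact (\<Sum>y\<in>Y. cnt w y) dvd (fact m :: nat)" by (rule fact_dvd)
  then show ?thesis using prod_fact_dvd_fact_sum[OF assms(1), of "cnt w"] dvd_trans by blast
qed

section \<open>The spanned subalgebra in coordinates: divisibility by factorials\<close>

section \<open>The subalgebra of divisible coordinates\<close>

text \<open>Every inversion contains a moved position, and the parity there is zero.\<close>

lemma psgn_fixed: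
  assumes "length qs = d" "\<And>p. p < d \<Longrightarrow> \<sigma> p \<noteq> p \<Longrightarrow> qs ! p = 0"
  shows "psgn d \<sigma> qs = 0"
  unfolding psgn_def
proof (rule sum.neutral, rule ballI)
  fix x assume "x \<in> pairs d"
  then obtain a b where x: "x = (a, b)" "a < b" "b < d" by (auto simp: pairs_def)
  have "qs ! a * qs ! b = 0" if "\<sigma> b < \<sigma> a"
  proof (cases "\<sigma> a = a")
    case True
    then have "\<sigma> b \<noteq> b" using that x by simp
    then show ?thesis using assms(2)[of b] x by simp
  next
    case False
    then show ?thesis using assms(2)[of a] x by simp
  qed
  then show "(case x of (a, b) \<Rightarrow> if \<sigma> b < \<sigma> a then qs ! a * qs ! b else 0) = 0"
    by (simp only: x prod.case if_cancel split: if_split) simp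
qed

text \<open>The inversions are \<open>(k, l)\<close> together with \<open>(k, m)\<close> and
  \<open>(m, l)\<close> for \<open>m\<close> strictly between; the last two kinds contribute equally
  and cancel modulo 2.\<close>

lemma psgn_transpose:
  assumes kl: "k < l" "l < d" and q: "length qs = d" "qs ! k = 1" "qs ! l = 1"
  shows "psgn d (Transposition.transpose k l) qs = 1"
proof -
  let ?\<sigma> = "Transposition.transpose k l"
  let ?P = "insert (k, l) ((\<lambda>m. (k, m)) ` {k<..<l} \<union> (\<lambda>m. (m, l)) ` {k<..<l})"
  have "psgn d ?\<sigma> qs = (\<Sum>(a, b)\<in>?P. qs ! a * qs ! b)"
  proof -
    have "psgn d ?\<sigma> qs = (\<Sum>x\<in>?P. case x of (a, b) \<Rightarrow> if ?\<sigma> b < ?\<sigma> a then qs ! a * qs ! b else 0)"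
      unfolding psgn_def
    proof (rule sum.mono_neutral_right)
      show "?P \<subseteq> pairs d" using kl by (auto simp: pairs_def)
      show "\<forall>x\<in>pairs d - ?P. (case x of (a, b) \<Rightarrow> if ?\<sigma> b < ?\<sigma> a then qs ! a * qs ! b else 0) = 0"
        using kl by (auto simp: pairs_def Transposition.transpose_def image_iff split: if_splits)
    qed simp
    also have "\<dots> = (\<Sum>(a, b)\<in>?P. qs ! a * qs ! b)"
      using kl by (intro sum.cong refl) (auto simp: Transposition.transpose_def split: if_splits)
    finally show ?thesis .
  qed
  also have "\<dots> = 1 + (\<Sum>(a, b)\<in>(\<lambda>m. (k, m)) ` {k<..<l} \<union> (\<lambda>m. (m, l)) ` {k<..<l}. qs ! a * qs ! b)"
    using q by (subst sum.insert) auto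
  also have "(\<Sum>(a, b)\<in>(\<lambda>m. (k, m)) ` {k<..<l} \<union> (\<lambda>m. (m, l)) ` {k<..<l}. qs ! a * qs ! b)
      = (\<Sum>m\<in>{k<..<l}. qs ! m) + (\<Sum>m\<in>{k<..<l}. qs ! m)"
    using q by (subst sum.union_disjoint) (auto simp: sum.reindex inj_on_def)
  finally show ?thesis by simp
qed

text \<open>\<open>Ia\<close> and \<open>Ic\<close> index the letters with entries in the bases of
  \<open>\<aa>\<close> and of its complement. \<open>Ia_closed\<close> and \<open>o1_Ic\<close>
  express that \<open>\<aa>\<close> is closed under products and contains 1. Characteristic 0 allows
  2 to be cancelled and keeps the factorials nonzero.\<close>

locale div_consts = graded_consts I par c o1 d
  for I :: "'i set" and par :: "'i \<Rightarrow> bit" and c :: "'i \<Rightarrow> 'i \<Rightarrow> 'i \<Rightarrow> 'k::{idom,ring_char_0}"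
    and o1 :: "'i \<Rightarrow> 'k" and d :: nat +
  fixes Ia Ic :: "'i set"
  assumes Ic_even: "i \<in> Ic \<Longrightarrow> i \<in> I \<and> par i = 0"
    and even_cases: "i \<in> I \<Longrightarrow> par i = 0 \<Longrightarrow> i \<in> Ia \<or> i \<in> Ic"
    and Ia_closed: "i \<in> Ic \<Longrightarrow> j \<in> Ia \<Longrightarrow> k \<in> Ia \<Longrightarrow> c i j k = 0"
    and o1_Ic: "i \<in> Ic \<Longrightarrow> o1 i = 0"
begin

sublocale A: calg_act TC "(\<star>)" T1 scal d actf by (rule calg_act_TC)

text \<open>Odd letters occur at most once. For encoded triples this is the condition in
  \<open>Tri\<close>.\<close>

definition good :: "'i list \<Rightarrow> bool" where
  "good t \<longleftrightarrow> (\<forall>k<d. \<forall>l<d. k \<noteq> l \<and> t ! k = t ! l \<longrightarrow> par (t ! k) = 0)"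

definition dl :: "'i list \<Rightarrow> 'i list \<Rightarrow> 'k" where "dl t = (\<lambda>w. if w = t then 1 else 0)"

definition cosets :: "'i list \<Rightarrow> (nat \<Rightarrow> nat) set set" where
  "cosets t = (\<lambda>\<sigma>. (\<lambda>\<tau>. \<tau> \<circ> \<sigma>) ` lstab t) ` {\<sigma>. \<sigma> permutes {..<d}}"

definition xi :: "'i list \<Rightarrow> 'i list \<Rightarrow> 'k" where
  "xi t = (\<Sum>C\<in>cosets t. actf (SOME \<sigma>. \<sigma> \<in> C) (dl t))"

definition fc :: "'i list \<Rightarrow> nat" where "fc w = (\<Prod>i\<in>Ic. fact (cnt w i))"

lemma finIc: "finite Ic" using finI Ic_even by (auto intro: finite_subset)

lemma inv_apply: "z \<in> A.invs \<Longrightarrow> \<sigma> permutes {..<d} \<Longrightarrow> v \<in> W \<Longrightarrow>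
    z v = bit_sign (psgn d \<sigma> (pars v)) * z (permute_list (inv_into UNIV \<sigma>) v)"
  using A.invs_act[of z \<sigma>] by (metis actf_def)

lemma inv_apply': "z \<in> A.invs \<Longrightarrow> \<sigma> permutes {..<d} \<Longrightarrow> v \<in> W \<Longrightarrow>
    z (permute_list \<sigma> v) = bit_sign (psgn d \<sigma> (pars (permute_list \<sigma> v))) * z v"
  using inv_apply[of z \<sigma> "permute_list \<sigma> v"] permute_W[of \<sigma> v] permute_list_inverse(2)[of \<sigma> v]
  by (simp add: W_length)

lemma actf_dl:
  assumes "\<sigma> permutes {..<d}" "t \<in> W"
  shows "actf \<sigma> (dl t) v = (if v = permute_list \<sigma> t then bit_sign (psgn d \<sigma> (pars v)) else 0)"
proof -
  have "permute_list (inv_into UNIV \<sigma>) v = t \<longleftrightarrow> v = permute_list \<sigma> t" if "v \<in> W"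
    using permute_list_inverse[of \<sigma> v] permute_list_inverse[of \<sigma> t] assms that by (auto simp: W_length)
  then show ?thesis using permute_W[OF assms] by (auto simp: actf_def dl_def)
qed

text \<open>The stabilizer exchanges equal letters only, and repeated letters of a good word are
  even, so no odd position is moved.\<close>

lemma good_stab_sign:
  assumes t: "t \<in> W" "good t" and \<sigma>: "\<sigma> \<in> lstab t"
  shows "psgn d \<sigma> (pars t) = 0"
proof (rule psgn_fixed)
  have s: "\<sigma> permutes {..<d}" "permute_list \<sigma> t = t" using \<sigma> t by (auto simp: lstab_def W_length)
  fix p assume p: "p < d" "\<sigma> p \<noteq> p"
  have "t ! \<sigma> p = t ! p" "\<sigma> p < d"
    using s p t permute_list_nth[of \<sigma> t p] permutes_in_image[OF s(1), of p] by (auto simp: W_length)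
  then have "par (t ! p) = 0" using t(2) p unfolding good_def by metis
  then show "pars t ! p = 0" using p t by (simp add: W_length)
qed (use t in \<open>simp add: W_length\<close>)

text \<open>At a rearrangement of \<open>t\<close> exactly one coset of the stabilizer contributes,
  and its sign is independent of the representative because the stabilizer of a good word acts
  without sign. At other words nothing contributes.\<close>

lemma xi_apply:
  assumes t: "t \<in> W" "good t"
  shows "\<sigma> permutes {..<d} \<Longrightarrow> xi t (permute_list \<sigma> t) = bit_sign (psgn d \<sigma> (pars (permute_list \<sigma> t)))"
    and "(\<And>\<sigma>. \<sigma> permutes {..<d} \<Longrightarrow> v \<noteq> permute_list \<sigma> t) \<Longrightarrow> xi t v = 0"
proof -
  have cC: "\<exists>\<sigma>. \<sigma> permutes {..<d} \<and> C = (\<lambda>\<tau>. \<tau> \<circ> \<sigma>) ` lstab t" if "C \<in> cosets t" for C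
    using that unfolding cosets_def by blast
  have rep: "(SOME \<sigma>. \<sigma> \<in> C) \<in> C" if "C \<in> cosets t" for C
    using cC[OF that] lstab_group(3) by (metis imageI someI)
  have perm: "\<sigma> permutes {..<d}" if "C \<in> cosets t" "\<sigma> \<in> C" for C \<sigma>
    using cC[OF that(1)] that(2) t by (auto simp: lstab_def W_length intro: permutes_compose)
  have same: "permute_list \<rho> t = permute_list \<sigma> t"
    if \<sigma>: "\<sigma> permutes {..<d}" and \<rho>: "\<rho> \<in> (\<lambda>\<tau>. \<tau> \<circ> \<sigma>) ` lstab t" for \<rho> \<sigma>
  proof -
    obtain \<tau> where "\<rho> = \<tau> \<circ> \<sigma>" "\<tau> \<in> lstab t" using \<rho> by blast
    then show ?thesis using permute_list_compose[of \<sigma> t \<tau>] \<sigma> t by (simp add: lstab_def W_length)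
  qed
  have finC: "finite (cosets t)" unfolding cosets_def by (simp add: finite_permutations)
  have val: "xi t v = (\<Sum>C\<in>cosets t. actf (SOME \<sigma>. \<sigma> \<in> C) (dl t) v)" for v
    unfolding xi_def by (rule sum_fun_apply)
  show "xi t v = 0" if "\<And>\<sigma>. \<sigma> permutes {..<d} \<Longrightarrow> v \<noteq> permute_list \<sigma> t"
    unfolding val using that perm[OF _ rep] t by (intro sum.neutral) (simp add: actf_dl)
  show "xi t (permute_list \<sigma> t) = bit_sign (psgn d \<sigma> (pars (permute_list \<sigma> t)))" if \<sigma>: "\<sigma> permutes {..<d}"
  proof -
  let ?D = "(\<lambda>\<tau>. \<tau> \<circ> \<sigma>) ` lstab t" and ?v = "permute_list \<sigma> t"
  have D: "?D \<in> cosets t" using \<sigma> unfolding cosets_def by blast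
  have z: "actf (SOME \<sigma>. \<sigma> \<in> C) (dl t) ?v = 0" if C: "C \<in> cosets t" "C \<noteq> ?D" for C
  proof -
    obtain \<rho> where \<rho>: "\<rho> permutes {..<d}" "C = (\<lambda>\<tau>. \<tau> \<circ> \<rho>) ` lstab t" using cC[OF C(1)] by blast
    have "?v \<noteq> permute_list \<rho> t"
    proof
      assume e: "?v = permute_list \<rho> t"
      \<comment> \<open>Equal rearrangements differ by the stabilizer element \<open>?k\<close>,
        which forces the two cosets to coincide.\<close>
      let ?k = "\<rho> \<circ> inv_into UNIV \<sigma>"
      have i: "inv_into UNIV \<sigma> permutes {..<length t}" using \<sigma> t by (simp add: permutes_inv W_length)
      have "permute_list ?k t = t"
        using permute_list_compose[OF i, of \<rho>] permute_list_inverse(2)[of \<sigma> t] \<sigma> t e by (simp add: W_length)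
      then have k: "?k \<in> lstab t" using \<rho> i t by (simp add: lstab_def permutes_compose W_length)
      have rk: "\<rho> = ?k \<circ> \<sigma>" by (simp add: fun_eq_iff permutes_inverses[OF \<sigma>])
      have "C = ?D"
      proof (intro equalityI subsetI)
        fix \<pi> assume "\<pi> \<in> C"
        then obtain \<tau> where "\<tau> \<in> lstab t" "\<pi> = \<tau> \<circ> \<rho>" using \<rho> by blast
        then have "\<pi> = (\<tau> \<circ> ?k) \<circ> \<sigma>" "\<tau> \<circ> ?k \<in> lstab t" using rk k lstab_group(2) by (auto simp: comp_assoc)
        then show "\<pi> \<in> ?D" by blast
      next
        fix \<pi> assume "\<pi> \<in> ?D"
        then obtain \<tau> where \<tau>: "\<tau> \<in> lstab t" "\<pi> = \<tau> \<circ> \<sigma>" by blast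
        have bk: "bij ?k" using lstab_group(4)[OF k] .
        have "\<sigma> = inv_into UNIV ?k \<circ> \<rho>"
          using rk bij_is_inj[OF bk] by (metis comp_assoc id_comp inv_o_cancel)
        then have "\<pi> = (\<tau> \<circ> inv_into UNIV ?k) \<circ> \<rho>" using \<tau> by (simp add: comp_assoc)
        moreover have "\<tau> \<circ> inv_into UNIV ?k \<in> lstab t" using \<tau> k lstab_group(2,5) by blast
        ultimately show "\<pi> \<in> C" using \<rho> by blast
      qed
      then show False using C by simp
    qed
    then show ?thesis using same[OF \<rho>(1)] rep[OF C(1)] \<rho> perm[OF C(1) rep[OF C(1)]] t by (simp add: actf_dl)
  qed
  have "xi t ?v = (\<Sum>C\<in>cosets t. if C = ?D then actf (SOME \<sigma>. \<sigma> \<in> ?D) (dl t) ?v else 0)"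
    unfolding val using z by (intro sum.cong) auto
  also have "\<dots> = actf (SOME \<sigma>. \<sigma> \<in> ?D) (dl t) ?v" using D finC by simp
  also have "\<dots> = bit_sign (psgn d \<sigma> (pars ?v))"
  proof -
    obtain \<tau> where \<tau>: "\<tau> \<in> lstab t" "(SOME \<sigma>. \<sigma> \<in> ?D) = \<tau> \<circ> \<sigma>" using rep[OF D] by blast
    have \<tau>p: "\<tau> permutes {..<d}" using \<tau> t by (simp add: lstab_def W_length)
    have "actf (\<tau> \<circ> \<sigma>) (dl t) = actf \<sigma> (actf \<tau> (dl t))" by (rule actf_comp[OF \<tau>p \<sigma>])
    also have "actf \<tau> (dl t) = dl t"
    proof (rule ext)
      fix v
      have "permute_list \<tau> t = t" using \<tau> by (simp add: lstab_def)
      then show "actf \<tau> (dl t) v = dl t v"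
        unfolding actf_dl[OF \<tau>p t(1)] using good_stab_sign[OF t \<tau>(1)] by (auto simp: dl_def)
    qed
    finally have "actf (\<tau> \<circ> \<sigma>) (dl t) = actf \<sigma> (dl t)" .
    then show ?thesis unfolding \<tau>(2) using actf_dl[OF \<sigma> t(1), of ?v] by simp
  qed
  finally show "xi t ?v = bit_sign (psgn d \<sigma> (pars ?v))" .
  qed
qed

text \<open>By the cocycle identity \<open>psgn_comp\<close> the values at the rearrangements of
  \<open>t\<close> transform into each other with the right signs.\<close>

lemma xi_invs:
  assumes t: "t \<in> W" "good t" shows "xi t \<in> A.invs"
proof -
  have TC: "xi t \<in> TC"
    unfolding TC_def
  proof safe
    fix w assume "w \<notin> W"
    then show "xi t w = 0" using permute_W t by (intro xi_apply(2)[OF t]) auto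
  qed
  have "actf \<tau> (xi t) = xi t" if \<tau>: "\<tau> permutes {..<d}" for \<tau>
  proof (rule TC_eqI[OF actf_TC TC])
    fix v assume v: "v \<in> W"
    let ?i = "inv_into UNIV \<tau>" let ?u = "permute_list ?i v"
    have e: "actf \<tau> (xi t) v = bit_sign (psgn d \<tau> (pars v)) * xi t ?u" using v by (simp add: actf_def)
    have vu: "v = permute_list \<tau> ?u" using \<tau> v by (simp add: W_length)
    show "actf \<tau> (xi t) v = xi t v"
    proof (cases "\<exists>\<rho>. \<rho> permutes {..<d} \<and> ?u = permute_list \<rho> t")
      case True
      then obtain \<rho> where \<rho>: "\<rho> permutes {..<d}" "?u = permute_list \<rho> t" by blast
      have v': "v = permute_list (\<rho> \<circ> \<tau>) t"
        using vu \<rho> \<tau> t permute_list_compose[of \<tau> t \<rho>] by (simp add: W_length)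
      have i: "?i permutes {..<length v}" using \<tau> v by (simp add: permutes_inv W_length)
      have "xi t v = bit_sign (psgn d (\<rho> \<circ> \<tau>) (pars v))"
        using xi_apply(1)[OF t permutes_compose[OF \<tau> \<rho>(1)]] v' by simp
      also have "\<dots> = bit_sign (psgn d \<tau> (pars v)) * bit_sign (psgn d \<rho> (pars ?u))"
        using psgn_comp[OF \<rho>(1) \<tau>, of "pars v"] v by (simp add: W_length bit_sign_add permute_list_map[OF i])
      also have "bit_sign (psgn d \<rho> (pars ?u)) = xi t ?u" using xi_apply(1)[OF t \<rho>(1)] \<rho> by simp
      finally show ?thesis using e by simp
    next
      case False
      have "v \<noteq> permute_list \<rho> t" if "\<rho> permutes {..<d}" for \<rho>
      proof
        assume "v = permute_list \<rho> t"
        then have "?u = permute_list (\<rho> \<circ> ?i) t"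
          using permute_list_compose[of ?i t \<rho>] \<tau> t by (simp add: permutes_inv W_length)
        then show False using False that \<tau> by (blast intro: permutes_compose permutes_inv)
      qed
      then show ?thesis using e xi_apply(2)[OF t] False by simp
    qed
  qed
  then show ?thesis using TC by (simp add: A.invs_def)
qed

text \<open>Two equal odd letters are exchanged by a transposition that fixes \<open>t\<close> and
  acts with sign -1, so \<open>2 * z t = 0\<close>.\<close>

lemma invs_not_good:
  assumes z: "z \<in> A.invs" and t: "t \<in> W" "\<not> good t" shows "z t = 0"
proof -
  obtain k l where kl: "k < l" "l < d" "t ! k = t ! l" "par (t ! k) = 1"
  proof -
    obtain k l where "k < d" "l < d" "k \<noteq> l" "t ! k = t ! l" "par (t ! k) \<noteq> 0"
      using t unfolding good_def by blast
    then show thesis using that[of k l] that[of l k] by (cases "k < l") auto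
  qed
  let ?\<sigma> = "Transposition.transpose k l"
  have \<sigma>: "?\<sigma> permutes {..<d}" using kl by (intro permutes_swap_id) auto
  have "permute_list ?\<sigma> t = t"
    using \<sigma> t kl by (intro nth_equalityI) (auto simp: permute_list_nth W_length Transposition.transpose_def)
  then have "z t = bit_sign (psgn d ?\<sigma> (pars t)) * z t" using inv_apply'[OF z \<sigma> t(1)] by simp
  also have "psgn d ?\<sigma> (pars t) = 1" using kl t by (intro psgn_transpose) (auto simp: W_length)
  finally have "2 * z t = 0" by (simp add: bit_sign_def)
  then show ?thesis by simp
qed

text \<open>An invariant is determined on a whole orbit by one value, so a multiple of
  \<open>xi t\<close> removes the orbit of \<open>t\<close>, and the number of nonzero coordinates
  drops. The weight is left general: factorial weights describe the subalgebra, the constant weight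
  1 gives a spanning set of all invariants.\<close>

lemma invs_span:
  assumes z: "z \<in> A.invs" and wt: "\<And>w. w \<in> W \<Longrightarrow> wt w dvd z w"
    and wt_perm: "\<And>\<sigma> w. \<sigma> permutes {..<d} \<Longrightarrow> w \<in> W \<Longrightarrow> wt (permute_list \<sigma> w) = wt w"
  shows "\<exists>a. z = (\<Sum>t\<in>{t \<in> W. good t}. scal (a t) (scal (wt t) (xi t)))"
  using z wt
proof (induction "card {w \<in> W. z w \<noteq> 0}" arbitrary: z rule: less_induct)
  case less
  show ?case
  proof (cases "\<exists>t\<in>W. z t \<noteq> 0")
    case False
    then have "z = 0" using less.prems(1) A.invs_C by (intro TC_eqI) (auto simp: A.zero_closed)
    then show ?thesis by (intro exI[of _ "\<lambda>_. 0"]) (simp add: fun_eq_iff sum_fun_apply scal_def)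
  next
    case True
    then obtain t where t: "t \<in> W" "z t \<noteq> 0" by blast
    then have gt: "good t" using invs_not_good[OF less.prems(1)] by blast
    obtain b where b: "z t = wt t * b" using less.prems(2)[OF t(1)] by (rule dvdE)
    interpret V: calg A.invs "(\<star>)" T1 scal by (rule A.calg_invs)
    \<comment> \<open>The multiple of the weighted \<open>xi t\<close> with value \<open>z t\<close>
      at \<open>t\<close>; by invariance it agrees with \<open>z\<close> on the whole orbit of
      \<open>t\<close>, and it is zero elsewhere.\<close>
    define y where "y = scal b (scal (wt t) (xi t))"
    have y: "y \<in> A.invs" unfolding y_def by (intro V.sm_closed xi_invs[OF t(1) gt])
    have yv: "y v = z v" if "\<sigma> permutes {..<d}" "v = permute_list \<sigma> t" for v \<sigma>
      using that xi_apply(1)[OF t(1) gt that(1)] inv_apply'[OF less.prems(1) that(1) t(1)] b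
      by (simp add: y_def scal_def)
    have y0: "y v = 0" if "\<And>\<sigma>. \<sigma> permutes {..<d} \<Longrightarrow> v \<noteq> permute_list \<sigma> t" for v
      using xi_apply(2)[OF t(1) gt that] by (simp add: y_def scal_def)
    have yz: "(z - y) v = z v \<or> (z - y) v = 0" for v using yv y0 by (cases "\<exists>\<sigma>. \<sigma> permutes {..<d} \<and> v = permute_list \<sigma> t") auto
    have "\<exists>a. z - y = (\<Sum>t\<in>{t \<in> W. good t}. scal (a t) (scal (wt t) (xi t)))"
    proof (rule less.hyps)
      have "(z - y) t = 0" using yv[OF permutes_id, of t] by simp
      then have "{w \<in> W. (z - y) w \<noteq> 0} \<subset> {w \<in> W. z w \<noteq> 0}" using t yz by fastforce
      then show "card {w \<in> W. (z - y) w \<noteq> 0} < card {w \<in> W. z w \<noteq> 0}" using finW by (intro psubset_card_mono) auto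
      show "z - y \<in> A.invs" using less.prems(1) y by (rule V.diff_closed)
      fix w assume "w \<in> W"
      then show "wt w dvd (z - y) w" using less.prems(2)[of w] yz[of w] by auto
    qed
    then obtain a where a: "z - y = (\<Sum>t\<in>{t \<in> W. good t}. scal (a t) (scal (wt t) (xi t)))" by blast
    have "z = (\<Sum>s\<in>{t \<in> W. good t}. scal (a s + (if s = t then b else 0)) (scal (wt s) (xi s)))"
    proof (rule ext)
      fix v
      have "z v = (\<Sum>s\<in>{t \<in> W. good t}. scal (a s) (scal (wt s) (xi s))) v + y v"
        using fun_cong[OF a, of v] by (simp add: diff_eq_eq)
      also have "y v = (\<Sum>s\<in>{t \<in> W. good t}. if s = t then y v else 0)" using t gt finW by simp
      also have "(\<Sum>s\<in>{t \<in> W. good t}. scal (a s) (scal (wt s) (xi s))) v + \<dots>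
          = (\<Sum>s\<in>{t \<in> W. good t}. scal (a s + (if s = t then b else 0)) (scal (wt s) (xi s))) v"
        unfolding sum_fun_apply sum.distrib[symmetric]
        by (intro sum.cong refl) (auto simp: scal_def y_def distrib_right)
      finally show "z v = (\<Sum>s\<in>{t \<in> W. good t}. scal (a s + (if s = t then b else 0)) (scal (wt s) (xi s))) v" .
    qed
    then show ?thesis by (rule exI[of _ "\<lambda>s. a s + (if s = t then b else 0)"])
  qed
qed

text \<open>The coordinate form of the algebra spanned by the \<open>\<eta>\<close> elements;
  closure under multiplication becomes a statement about divisibility.\<close>

definition TT :: "('i list \<Rightarrow> 'k) set" where
  "TT = {z \<in> A.invs. \<forall>w\<in>W. of_nat (fc w) dvd z w}"

lemma cnt_permute: "\<sigma> permutes {..<length w} \<Longrightarrow> cnt (permute_list \<sigma> w) y = cnt w y"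
  by (simp flip: count_mset_cnt)

lemma fc_permute: "\<sigma> permutes {..<d} \<Longrightarrow> w \<in> W \<Longrightarrow> fc (permute_list \<sigma> w) = fc w"
  by (simp add: fc_def cnt_permute W_length)

text \<open>Nonzero coordinates of \<open>xi t\<close> sit at rearrangements of \<open>t\<close>,
  which have the same factorial weight as \<open>t\<close>.\<close>

lemma eta_TT: "t \<in> W \<Longrightarrow> good t \<Longrightarrow> scal (of_nat (fc t)) (xi t) \<in> TT"
proof -
  assume t: "t \<in> W" "good t"
  interpret V: calg A.invs "(\<star>)" T1 scal by (rule A.calg_invs)
  have "of_nat (fc t) * xi t w = 0 \<or> fc w = fc t" for w
    using fc_permute[OF _ t(1)] xi_apply(2)[OF t, of w] by fastforce
  then have "of_nat (fc w) dvd of_nat (fc t) * xi t w" for w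
    by (metis dvd_0_right dvd_triv_left)
  then show "scal (of_nat (fc t)) (xi t) \<in> TT"
    by (simp add: TT_def V.sm_closed xi_invs[OF t]) (simp add: scal_def)
qed

text \<open>The unit has coordinate zero at every word with a letter in \<open>Ic\<close>, and all
  other words have weight 1.\<close>

lemma T1_TT: "T1 \<in> TT"
proof -
  have "of_nat (fc w) dvd T1 w" if w: "w \<in> W" for w
  proof (cases "\<exists>p<d. w ! p \<in> Ic")
    case True
    then obtain p where "p < d" "w ! p \<in> Ic" by blast
    then have "T1 w = 0" using w by (auto simp: T1_def tens_def o1_Ic intro!: prod_zero bexI[of _ p])
    then show ?thesis by simp
  next
    case False
    then have "cnt w i = 0" if "i \<in> Ic" for i using that w by (auto simp: cnt_def W_length)
    then show ?thesis by (simp add: fc_def)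
  qed
  moreover have "T1 \<in> A.invs" by (auto simp: A.invs_def A.one_closed actf_T1)
  ultimately show ?thesis by (simp add: TT_def)
qed

text \<open>
  The positions carrying letters outside \<open>Ic\<close> are marked, so that the stabilizer of the marked word
  permutes only equal letters of \<open>Ic\<close>.
\<close>

definition mark :: "'i list \<Rightarrow> ('i \<times> nat) list" where
  "mark w = map (\<lambda>p. (w ! p, if w ! p \<in> Ic then 0 else Suc p)) [0..<length w]"

lemma length_mark [simp]: "length (mark w) = length w" by (simp add: mark_def)

lemma nth_mark: "p < length w \<Longrightarrow> mark w ! p = (w ! p, if w ! p \<in> Ic then 0 else Suc p)"
  by (simp add: mark_def)

lemma lstab_mark:
  assumes "\<sigma> \<in> lstab (mark w)" "p < length w"
  shows "w ! \<sigma> p = w ! p" and "w ! p \<notin> Ic \<Longrightarrow> \<sigma> p = p"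
proof -
  have \<sigma>: "\<sigma> permutes {..<length w}" "permute_list \<sigma> (mark w) = mark w" using assms by (auto simp: lstab_def)
  then have "mark w ! \<sigma> p = mark w ! p" using assms permute_list_nth[of \<sigma> "mark w" p] by simp
  moreover have "\<sigma> p < length w" using permutes_in_image[OF \<sigma>(1), of p] assms by simp
  ultimately show "w ! \<sigma> p = w ! p" "w ! p \<notin> Ic \<Longrightarrow> \<sigma> p = p" using assms by (auto simp: nth_mark split: if_splits)
qed

text \<open>The marks \<open>Suc p\<close> are pairwise different and never 0, so letters outside
  \<open>Ic\<close> have multiplicity at most one in the marked word and contribute the factor
  1.\<close>

lemma card_lstab_mark: "w \<in> W \<Longrightarrow> card (lstab (mark w)) = fc w"
proof -
  assume w: "w \<in> W"
  let ?m = "mark w"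
  have c0: "cnt ?m (i, 0) = cnt w i" if "i \<in> Ic" for i
    unfolding cnt_def using that by (intro arg_cong[where f = card]) (auto simp: nth_mark)
  have c1: "fact (cnt ?m y) = (1::nat)" if y: "y \<in> set ?m - (\<lambda>i. (i, 0)) ` Ic" for y
  proof -
    obtain p where p: "p < length w" "y = ?m ! p" using y by (auto simp: in_set_conv_nth)
    have "{k. k < length ?m \<and> ?m ! k = y} \<subseteq> {p}" using y p by (auto simp: nth_mark split: if_splits)
    then have "cnt ?m y \<le> 1" unfolding cnt_def using card_mono[of "{p}"] by force
    then show ?thesis by (auto simp: le_Suc_eq)
  qed
  have "card (lstab ?m) = (\<Prod>y\<in>set ?m. fact (cnt ?m y))" by (rule card_lstab)
  also have "\<dots> = (\<Prod>y\<in>set ?m \<union> (\<lambda>i. (i, 0)) ` Ic. fact (cnt ?m y))"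
    using finIc by (intro prod.mono_neutral_left) (auto simp: cnt_notin)
  also have "\<dots> = (\<Prod>y\<in>(\<lambda>i. (i, 0)) ` Ic. fact (cnt ?m y))"
    using finIc c1 by (intro prod.mono_neutral_right) auto
  also have "\<dots> = fc w" unfolding fc_def by (subst prod.reindex) (auto simp: inj_on_def c0)
  finally show ?thesis .
qed

text \<open>The order is a product of factorials of multiplicities of triples. Triples with the
  \<open>x\<close>-letter in \<open>Ic\<close> refine the multiplicities in \<open>x\<close>; those
  with only the \<open>y\<close>-letter in \<open>Ic\<close>, as opposed to the
  \<open>x\<close>-letter, refine the ones in \<open>y\<close>. Any other triple occurs once: if its
  \<open>w\<close>-letter is outside \<open>Ic\<close>, the mark is unique; otherwise the
  \<open>x\<close>- and \<open>y\<close>-letters have equal parity, cannot both be even by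
  \<open>Ia_closed\<close>, and an odd letter occurs only once in the good word
  \<open>x\<close>.\<close>

lemma lstab_zip_dvd:
  assumes w: "w \<in> W" and x: "x \<in> W" "good x" and y: "y \<in> W" and cw: "cw w x y \<noteq> 0"
  shows "card (lstab (zip (mark w) (zip x y))) dvd fc x * fc y"
proof -
  let ?z = "zip (mark w) (zip x y)"
  have l: "length ?z = d" "length w = d" "length x = d" "length y = d" using w x y by (simp_all add: W_length)
  have zn: "?z ! p = (mark w ! p, x ! p, y ! p)" if "p < d" for p using that l by simp
  define Q1 where "Q1 = {q \<in> set ?z. fst (snd q) \<in> Ic}"
  define Q2 where "Q2 = {q \<in> set ?z. fst (snd q) \<notin> Ic \<and> snd (snd q) \<in> Ic}"
  have 3: "fact (cnt ?z q) = (1::nat)" if q: "q \<in> set ?z - (Q1 \<union> Q2)" for q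
  proof -
    obtain p where p: "p < d" "q = ?z ! p" using q l by (auto simp: in_set_conv_nth)
    have nI: "x ! p \<notin> Ic" "y ! p \<notin> Ic" using q p zn[OF p(1)] by (auto simp: Q1_def Q2_def)
    have "k = p" if k: "k < d" "?z ! k = q" for k
    proof (cases "w ! p \<in> Ic")
      case False
      then show ?thesis using k p zn l by (auto simp: nth_mark split: if_splits)
    next
      case True
      have cn: "c (w ! p) (x ! p) (y ! p) \<noteq> 0" using cw p unfolding cw_def by (metis finite_lessThan lessThan_iff prod_zero)
      have xyI: "x ! p \<in> I" "y ! p \<in> I" "w ! p \<in> I" using x y w p by (auto simp: W_nth)
      have "par (x ! p) = par (y ! p)" using par_c[OF xyI(3,1,2) cn] Ic_even[OF True] by (cases "par (x ! p)"; cases "par (y ! p)") auto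
      then have e: "par (y ! p) = 0" if "par (x ! p) = 0" using that by simp
      have "par (x ! p) \<noteq> 0"
      proof
        assume 0: "par (x ! p) = 0"
        then have "x ! p \<in> Ia" "y ! p \<in> Ia" using even_cases[OF xyI(1)] even_cases[OF xyI(2)] nI e by blast+
        then show False using Ia_closed[OF True] cn by blast
      qed
      moreover have "x ! k = x ! p" using k p zn by auto
      ultimately show ?thesis using x(2) k(1) p(1) unfolding good_def by metis
    qed
    then have "{k. k < length ?z \<and> ?z ! k = q} \<subseteq> {p}" using l by auto
    then have "cnt ?z q \<le> 1" unfolding cnt_def using card_mono[of "{p}"] by force
    then show ?thesis by (auto simp: le_Suc_eq)
  qed
  have 1: "(\<Prod>q\<in>Q1. fact (cnt ?z q)) dvd fc x"
  proof -
    have "(\<Prod>q\<in>Q1. fact (cnt ?z q) :: nat) = (\<Prod>i\<in>Ic. \<Prod>q\<in>{q \<in> Q1. fst (snd q) = i}. fact (cnt ?z q))"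
      using finIc by (intro prod.group[symmetric]) (auto simp: Q1_def)
    also have "\<dots> dvd (\<Prod>i\<in>Ic. fact (cnt x i))"
    proof (rule prod_dvd_prod, rule prod_fact_cnt_dvd)
      fix i assume "i \<in> Ic"
      show "finite {q \<in> Q1. fst (snd q) = i}" by (simp add: Q1_def)
      have "{k. k < length ?z \<and> ?z ! k \<in> {q \<in> Q1. fst (snd q) = i}} \<subseteq> {k. k < length x \<and> x ! k = i}"
        using l by auto
      then show "card {k. k < length ?z \<and> ?z ! k \<in> {q \<in> Q1. fst (snd q) = i}} \<le> cnt x i"
        unfolding cnt_def by (intro card_mono) auto
    qed
    finally show ?thesis by (simp add: fc_def)
  qed
  have 2: "(\<Prod>q\<in>Q2. fact (cnt ?z q)) dvd fc y"
  proof -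
    have "(\<Prod>q\<in>Q2. fact (cnt ?z q) :: nat) = (\<Prod>i\<in>Ic. \<Prod>q\<in>{q \<in> Q2. snd (snd q) = i}. fact (cnt ?z q))"
      using finIc by (intro prod.group[symmetric]) (auto simp: Q2_def)
    also have "\<dots> dvd (\<Prod>i\<in>Ic. fact (cnt y i))"
    proof (rule prod_dvd_prod, rule prod_fact_cnt_dvd)
      fix i assume "i \<in> Ic"
      show "finite {q \<in> Q2. snd (snd q) = i}" by (simp add: Q2_def)
      have "{k. k < length ?z \<and> ?z ! k \<in> {q \<in> Q2. snd (snd q) = i}} \<subseteq> {k. k < length y \<and> y ! k = i}"
        using l by auto
      then show "card {k. k < length ?z \<and> ?z ! k \<in> {q \<in> Q2. snd (snd q) = i}} \<le> cnt y i"
        unfolding cnt_def by (intro card_mono) auto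
    qed
    finally show ?thesis by (simp add: fc_def)
  qed
  have "card (lstab ?z) = (\<Prod>q\<in>set ?z. fact (cnt ?z q))" by (rule card_lstab)
  also have "\<dots> = (\<Prod>q\<in>Q1 \<union> Q2. fact (cnt ?z q))"
    using 3 by (intro prod.mono_neutral_right) (auto simp: Q1_def Q2_def)
  also have "\<dots> = (\<Prod>q\<in>Q1. fact (cnt ?z q)) * (\<Prod>q\<in>Q2. fact (cnt ?z q))"
    by (intro prod.union_disjoint) (auto simp: Q1_def Q2_def)
  finally show ?thesis using mult_dvd_mono[OF 1 2] by simp
qed

text \<open>
  The coordinate of \<open>f \<star> g\<close> at \<open>w\<close> is a sum over pairs \<open>(x, y)\<close> on which the stabilizer of the
  marked word acts.  That group has order \<open>fc w\<close>, and the stabilizer of a pair has order dividing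
  \<open>fc x * fc y\<close>, hence dividing the summand; so every orbit sum is divisible by \<open>fc w\<close>.
\<close>

lemma conv_TT:
  assumes f: "f \<in> TT" and g: "g \<in> TT" shows "f \<star> g \<in> TT"
proof -
  interpret V: calg A.invs "(\<star>)" T1 scal by (rule A.calg_invs)
  have fi: "f \<in> A.invs" and gi: "g \<in> A.invs" using f g by (auto simp: TT_def)
  have "of_nat (fc w) dvd (f \<star> g) w" if w: "w \<in> W" for w
  proof -
    define F where "F = (\<lambda>(x, y). sg x y * cw w x y * (f x * g y))"
    let ?H = "lstab (mark w)"
    define \<beta> where "\<beta> \<sigma> = (\<lambda>(x :: 'i list, y :: 'i list). (permute_list \<sigma> x, permute_list \<sigma> y))" for \<sigma>
    have Hp: "\<sigma> permutes {..<d}" if "\<sigma> \<in> ?H" for \<sigma> using that w by (simp add: lstab_def W_length)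
    have Hw: "permute_list \<sigma> w = w" if "\<sigma> \<in> ?H" for \<sigma>
      using Hp[OF that] lstab_mark(1)[OF that] w by (intro nth_equalityI) (auto simp: permute_list_nth W_length)
    \<comment> \<open>The group moves only positions with letters of \<open>Ic\<close>, which are
      even, so it fixes \<open>w\<close> without sign.\<close>
    have Hs: "psgn d \<sigma> (pars w) = 0" if \<sigma>: "\<sigma> \<in> ?H" for \<sigma>
    proof (rule psgn_fixed)
      fix p assume "p < d" "\<sigma> p \<noteq> p"
      then show "pars w ! p = 0"
        using lstab_mark(2)[OF \<sigma>, of p] w Ic_even by (auto simp: W_length)
    qed (use w in \<open>simp add: W_length\<close>)
    have "of_nat (card ?H) dvd (\<Sum>z\<in>W \<times> W. F z)"
    proof (rule card_group_dvd_sum[where \<beta> = \<beta>])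
      fix \<sigma> z assume \<sigma>: "\<sigma> \<in> ?H" and z: "z \<in> W \<times> W"
      show "\<beta> \<sigma> z \<in> W \<times> W" using z Hp[OF \<sigma>] by (auto simp: \<beta>_def permute_W)
      obtain x y where xy: "z = (x, y)" "x \<in> W" "y \<in> W" using z by blast
      let ?x = "permute_list \<sigma> x" and ?y = "permute_list \<sigma> y"
      have W': "?x \<in> W" "?y \<in> W" using xy Hp[OF \<sigma>] by (auto simp: permute_W)
      have c1: "cw w ?x ?y = cw w x y" using cw_permute[OF Hp[OF \<sigma>] w xy(2,3)] Hw[OF \<sigma>] by simp
      show "F (\<beta> \<sigma> z) = F z"
      proof (cases "cw w x y = 0")
        case False
        have i: "inv_into UNIV \<sigma> permutes {..<length ?x}" "inv_into UNIV \<sigma> permutes {..<length ?y}"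
          using Hp[OF \<sigma>] xy by (auto simp: permutes_inv W_length)
        have "map2 (+) (pars ?x) (pars ?y) = pars w" using cw_pars[of w ?x ?y] False c1 w W' by simp
        then have "texp (pars x) (pars y) = texp (pars ?x) (pars ?y) + psgn d \<sigma> (pars ?x) + psgn d \<sigma> (pars ?y)"
          using psgn_texp[OF Hp[OF \<sigma>], of "pars ?x" "pars ?y"] Hs[OF \<sigma>] xy Hp[OF \<sigma>]
          by (simp add: W_length permute_list_map[OF i(1)] permute_list_map[OF i(2)])
        then have "sg x y = sg ?x ?y * (bit_sign (psgn d \<sigma> (pars ?x)) * bit_sign (psgn d \<sigma> (pars ?y)))"
          by (simp add: bit_sign_add mult.assoc)
        then show ?thesis
          using inv_apply'[OF fi Hp[OF \<sigma>] xy(2)] inv_apply'[OF gi Hp[OF \<sigma>] xy(3)] c1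
          by (simp add: F_def \<beta>_def xy(1) mult_ac)
      qed (simp add: F_def \<beta>_def xy(1) c1)
    next
      fix z assume z: "z \<in> W \<times> W"
      obtain x y where xy: "z = (x, y)" "x \<in> W" "y \<in> W" using z by blast
      show "of_nat (card {\<sigma> \<in> ?H. \<beta> \<sigma> z = z}) dvd F z"
      proof (cases "cw w x y = 0 \<or> f x = 0")
        case False
        \<comment> \<open>A nonzero coordinate of an invariant sits at a good word; this is what
          makes the bound on the stabilizer of the pair available.\<close>
        then have gx: "good x" using invs_not_good[OF fi xy(2)] by blast
        have "{\<sigma> \<in> ?H. \<beta> \<sigma> z = z} = lstab (zip (mark w) (zip x y))"
        proof -
          have "permute_list \<sigma> (zip (mark w) (zip x y)) = zip (mark w) (zip x y) \<longleftrightarrow>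
              permute_list \<sigma> (mark w) = mark w \<and> permute_list \<sigma> x = x \<and> permute_list \<sigma> y = y"
            if "\<sigma> permutes {..<d}" for \<sigma>
            using w xy that by (intro permute_list_zip3[of _ d]) (auto simp: W_length)
          then show ?thesis using w xy by (auto simp: lstab_def \<beta>_def W_length)
        qed
        then have "card {\<sigma> \<in> ?H. \<beta> \<sigma> z = z} dvd fc x * fc y"
          using lstab_zip_dvd[OF w xy(2) gx xy(3)] False by simp
        then have "of_nat (card {\<sigma> \<in> ?H. \<beta> \<sigma> z = z}) dvd (of_nat (fc x * fc y) :: 'k)" by (elim dvdE) (simp only: of_nat_mult dvd_triv_left)
        also have "\<dots> dvd f x * g y" using f g xy unfolding TT_def of_nat_mult by (intro mult_dvd_mono) auto
        also have "\<dots> dvd F z" by (simp add: F_def xy(1))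
        finally show ?thesis .
      qed (auto simp: F_def xy(1))
    next
      show "finite (W \<times> W)" using finW by simp
    next
      fix \<sigma> \<tau> z assume "z \<in> W \<times> W" "\<sigma> \<in> ?H" "\<tau> \<in> ?H"
      then show "\<beta> (\<sigma> \<circ> \<tau>) z = \<beta> \<tau> (\<beta> \<sigma> z)"
        using Hp by (auto simp: \<beta>_def permute_list_compose W_length)
    qed (auto simp: lstab_group \<beta>_def)
    then show ?thesis using w by (simp add: card_lstab_mark conv_def F_def sum.cartesian_product)
  qed
  then show ?thesis using V.mul_closed[OF fi gi] by (simp add: TT_def)
qed

end

section \<open>Bases of the superalgebra and coordinates on matrices over it\<close>

section \<open>Matrix superalgebras\<close>

lemma (in Modules.module) independent_Un:
  assumes S: "independent S" and T: "independent T" and d: "span S \<inter> span T \<subseteq> {0}"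
  shows "independent (S \<union> T)"
  unfolding independent_explicit_module
proof (intro allI impI)
  fix t u v assume t: "finite t" "t \<subseteq> S \<union> T" "(\<Sum>v\<in>t. scale (u v) v) = 0" "v \<in> t"
  let ?s = "\<Sum>v\<in>t \<inter> S. scale (u v) v" and ?r = "\<Sum>v\<in>t - S. scale (u v) v"
  have s: "?s + ?r = 0" using t(1,3) by (metis sum.Int_Diff)
  have "?s \<in> span S" by (intro span_sum span_scale span_base) auto
  moreover have "?r \<in> span T" using t by (intro span_sum span_scale span_base) auto
  moreover have "?s = - ?r" using s by (simp add: eq_neg_iff_add_eq_0)
  ultimately have "?s = 0" "?r = 0" using d span_neg[of ?r T] by auto
  then show "u v = 0"
    using independentD[OF S, of "t \<inter> S" u v] independentD[OF T, of "t - S" u v] t by auto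
qed

text \<open>The finitely many basis elements occurring in the representations of the generators
  already span; by independence there are no others.\<close>

lemma (in Modules.module) finite_basis:
  assumes Y: "finite Y" "span Y = UNIV" and B: "independent B" "span B = UNIV"
  shows "finite B"
proof -
  define F where "F = (\<Union>y\<in>Y. {b. representation B y b \<noteq> 0})"
  have F: "finite F" "F \<subseteq> B" using Y by (auto simp: F_def finite_representation dest: representation_ne_zero)
  have "y \<in> span F" if "y \<in> Y" for y
  proof -
    have "(\<Sum>b | representation B y b \<noteq> 0. scale (representation B y b) b) \<in> span F"
      using that by (intro span_sum span_scale span_base) (auto simp: F_def)
    then show ?thesis using sum_nonzero_representation_eq[OF B(1), of y] B(2) by simp
  qed
  then have F': "span F = UNIV" using Y(2) span_minimal[of Y "span F"] by auto
  have "b \<in> F" if "b \<in> B" for b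
  proof -
    have "representation B b = representation F b" using B F F' by (intro representation_extend) auto
    then have "representation F b b = 1" using fun_cong[OF representation_basis[OF B(1) that], of b] by simp
    then have "representation F b b \<noteq> 0" by simp
    then show ?thesis by (rule representation_ne_zero)
  qed
  then have "B = F" using F(2) by blast
  then show ?thesis using F(1) by simp
qed

lemma (in Modules.module) span_iff_representation:
  assumes B: "independent B" "span B = UNIV" and S: "S \<subseteq> B"
  shows "y \<in> span S \<longleftrightarrow> (\<forall>b. representation B y b \<noteq> 0 \<longrightarrow> b \<in> S)"
proof
  assume "y \<in> span S"
  then have "representation B y = representation S y" using B S by (intro representation_extend) auto
  then show "\<forall>b. representation B y b \<noteq> 0 \<longrightarrow> b \<in> S" using representation_ne_zero[of S y] by auto
next
  assume h: "\<forall>b. representation B y b \<noteq> 0 \<longrightarrow> b \<in> S"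
  have "(\<Sum>b | representation B y b \<noteq> 0. scale (representation B y b) b) \<in> span S"
    using h by (intro span_sum span_scale span_base) auto
  then show "y \<in> span S" using sum_nonzero_representation_eq[OF B(1), of y] B(2) by simp
qed

lemma mult_mat_nth:
  assumes "x \<in> carrier_mat n n" "y \<in> carrier_mat n n" "r < n" "s < n"
  shows "(x * y) $$ (r, s) = (\<Sum>t<n. x $$ (r, t) * y $$ (t, s))"
  using assms by (simp add: scalar_prod_def atLeast0LessThan)

lemma \<xi>_unit_carrier [simp]: "\<xi>_unit n a r s \<in> carrier_mat n n" by (simp add: \<xi>_unit_def)

lemma \<xi>_unit_nth: "i < n \<Longrightarrow> j < n \<Longrightarrow> \<xi>_unit n a r s $$ (i, j) = (if i = r \<and> j = s then a else 0)"
  by (simp add: \<xi>_unit_def)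

lemma mult_\<xi>_unit:
  fixes a b :: "'a::ring"
  assumes "s < n" "r' < n"
  shows "\<xi>_unit n a r s * \<xi>_unit n b r' s' = (if s = r' then \<xi>_unit n (a * b) r s' else 0\<^sub>m n n)"
proof (rule eq_matI, goal_cases)
  case (1 i j)
  then have ij: "i < n" "j < n" by (auto simp: \<xi>_unit_def split: if_splits)
  have "(\<Sum>t<n. \<xi>_unit n a r s $$ (i, t) * \<xi>_unit n b r' s' $$ (t, j))
      = (\<Sum>t<n. if t = s then (if i = r \<and> s = r' \<and> j = s' then a * b else 0) else 0)"
    using ij by (intro sum.cong refl) (auto simp: \<xi>_unit_nth)
  then show ?case using ij assms by (subst mult_mat_nth[of _ n]) (auto simp: \<xi>_unit_nth)
qed (auto simp: \<xi>_unit_def)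

locale schur_basis = good_pair_basis scale A \<aa> \<cc> B\<^sub>\<aa> B\<^sub>\<cc> B\<^sub>1
  for scale :: "'k::{idom,ring_char_0} \<Rightarrow> 'a::{ring,monoid_mult} \<Rightarrow> 'a" (infixr \<open>*s\<close> 75)
    and A :: "bit \<Rightarrow> 'a set" and \<aa> \<cc> B\<^sub>\<aa> B\<^sub>\<cc> B\<^sub>1 :: "'a set" +
  fixes n d :: nat
  assumes rank: "finite_rank scale"
begin

definition B :: "'a set" where "B = B\<^sub>\<aa> \<union> B\<^sub>\<cc> \<union> B\<^sub>1"

lemma bases: "independent B\<^sub>\<aa>" "span B\<^sub>\<aa> = \<aa>" "independent B\<^sub>\<cc>" "span B\<^sub>\<cc> = \<cc>"
    "independent B\<^sub>1" "span B\<^sub>1 = A 1"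
  using basis_\<aa> basis_\<cc> basis_odd by (auto simp: is_basis_def)

lemma indep_even: "independent (B\<^sub>\<aa> \<union> B\<^sub>\<cc>)" by (intro independent_Un) (simp_all add: bases \<aa>_inter_\<cc>)

lemma span_even: "span (B\<^sub>\<aa> \<union> B\<^sub>\<cc>) = A 0"
proof
  show "span (B\<^sub>\<aa> \<union> B\<^sub>\<cc>) \<subseteq> A 0"
    using \<aa>_even \<cc>_even bases span_superset[of B\<^sub>\<aa>] span_superset[of B\<^sub>\<cc>] by (intro span_minimal subspace_A) auto
  show "A 0 \<subseteq> span (B\<^sub>\<aa> \<union> B\<^sub>\<cc>)"
  proof
    fix x assume "x \<in> A 0"
    then obtain y z where "y \<in> \<aa>" "z \<in> \<cc>" "x = y + z" using \<aa>_plus_\<cc> by blast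
    moreover have "\<aa> \<subseteq> span (B\<^sub>\<aa> \<union> B\<^sub>\<cc>)" "\<cc> \<subseteq> span (B\<^sub>\<aa> \<union> B\<^sub>\<cc>)"
      unfolding bases(2)[symmetric] bases(4)[symmetric] by (rule span_mono, simp)+
    ultimately show "x \<in> span (B\<^sub>\<aa> \<union> B\<^sub>\<cc>)" by (auto intro: span_add)
  qed
qed

lemma indep_B: "independent B"
  unfolding B_def by (intro independent_Un indep_even) (simp_all add: bases span_even A_inter)

lemma span_B: "span B = UNIV"
proof -
  have "x \<in> span B" for x
  proof -
    obtain y z where "y \<in> A 0" "z \<in> A 1" "x = y + z" using A_sum by blast
    moreover have "A 0 \<subseteq> span B" "A 1 \<subseteq> span B"
      unfolding span_even[symmetric] bases(6)[symmetric] by (rule span_mono, simp add: B_def)+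
    ultimately show ?thesis by (auto intro: span_add)
  qed
  then show ?thesis by blast
qed

lemma fin_B: "finite B"
  using rank finite_basis[OF _ _ indep_B span_B] by (auto simp: finite_rank_def is_basis_def)

lemma even_odd_disjoint: "(B\<^sub>\<aa> \<union> B\<^sub>\<cc>) \<inter> B\<^sub>1 = {}"
proof -
  have "x = 0" if "x \<in> B\<^sub>\<aa> \<union> B\<^sub>\<cc>" "x \<in> B\<^sub>1" for x
    using that A_inter span_base[of x "B\<^sub>\<aa> \<union> B\<^sub>\<cc>"] span_base[of x B\<^sub>1] by (auto simp: bases span_even)
  moreover have "0 \<notin> B\<^sub>1" using bases(5) dependent_zero by blast
  ultimately show ?thesis by blast
qed

lemma a_c_disjoint: "B\<^sub>\<aa> \<inter> B\<^sub>\<cc> = {}"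
proof -
  have "x = 0" if "x \<in> B\<^sub>\<aa>" "x \<in> B\<^sub>\<cc>" for x
    using that \<aa>_inter_\<cc> span_base[of x B\<^sub>\<aa>] span_base[of x B\<^sub>\<cc>] by (auto simp: bases)
  moreover have "0 \<notin> B\<^sub>\<cc>" using bases(3) dependent_zero by blast
  ultimately show ?thesis by blast
qed

definition rp :: "'a \<Rightarrow> 'a \<Rightarrow> 'k" where "rp = representation B"

definition bpar :: "'a \<Rightarrow> bit" where "bpar b = (if b \<in> B\<^sub>1 then 1 else 0)"

lemma rp_add: "rp (x + y) b = rp x b + rp y b"
  unfolding rp_def using span_B by (simp add: representation_add[OF indep_B])

lemma rp_scale: "rp (a *s x) b = a * rp x b"
  unfolding rp_def using span_B by (simp add: representation_scale[OF indep_B])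

lemma rp_zero [simp]: "rp 0 b = 0" using rp_add[of 0 0 b] by simp

lemma rp_sum: "rp (sum g J) b = (\<Sum>j\<in>J. rp (g j) b)"
  by (induction J rule: infinite_finite_induct) (auto simp: rp_add)

lemma rp_basis: "b \<in> B \<Longrightarrow> rp b b' = (if b' = b then 1 else 0)"
  unfolding rp_def by (simp add: representation_basis[OF indep_B])

lemma rp_expand: "(\<Sum>b\<in>B. rp x b *s b) = x"
  unfolding rp_def using span_B fin_B by (intro sum_representation_eq[OF indep_B]) auto

lemma rp_eqI: "(\<And>b. b \<in> B \<Longrightarrow> rp x b = rp y b) \<Longrightarrow> x = y"
  using rp_expand[of x] rp_expand[of y] by (metis (no_types, lifting) sum.cong)

lemma rp_combination: "b \<in> B \<Longrightarrow> rp (\<Sum>b'\<in>B. g b' *s b') b = g b"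
  using fin_B by (simp add: rp_sum rp_scale rp_basis if_distrib[of "\<lambda>c. _ * c"] sum.delta cong: if_cong)

lemma rp_mult: "rp (x * y) b = (\<Sum>b'\<in>B. \<Sum>b''\<in>B. rp (b' * b'') b * (rp x b' * rp y b''))"
proof -
  have "x * y = (\<Sum>b'\<in>B. \<Sum>b''\<in>B. rp y b'' *s rp x b' *s (b' * b''))"
  proof -
    have "x * y = (\<Sum>b'\<in>B. rp x b' *s b') * (\<Sum>b''\<in>B. rp y b'' *s b'')" by (simp only: rp_expand)
    also have "\<dots> = (\<Sum>b'\<in>B. \<Sum>b''\<in>B. (rp x b' *s b') * (rp y b'' *s b''))" by (rule sum_product)
    finally show ?thesis by (simp only: scale_mult_left[symmetric] scale_mult_right[symmetric])
  qed
  then show ?thesis by (simp add: rp_sum rp_scale mult_ac)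
qed

lemma A_iff: "y \<in> A p \<longleftrightarrow> (\<forall>b\<in>B. rp y b \<noteq> 0 \<longrightarrow> bpar b = p)"
proof -
  have ne: "rp y b \<noteq> 0 \<Longrightarrow> b \<in> B" for b unfolding rp_def by (rule representation_ne_zero)
  have 0: "y \<in> A 0 \<longleftrightarrow> (\<forall>b. rp y b \<noteq> 0 \<longrightarrow> b \<in> B\<^sub>\<aa> \<union> B\<^sub>\<cc>)"
    unfolding span_even[symmetric] rp_def by (intro span_iff_representation indep_B span_B) (auto simp: B_def)
  have 1: "y \<in> A 1 \<longleftrightarrow> (\<forall>b. rp y b \<noteq> 0 \<longrightarrow> b \<in> B\<^sub>1)"
    unfolding bases(6)[symmetric] rp_def by (intro span_iff_representation indep_B span_B) (auto simp: B_def)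
  show ?thesis
  proof (cases p)
    case zero
    then show ?thesis unfolding zero 0 using even_odd_disjoint ne by (auto simp: bpar_def B_def)
  next
    case one
    then show ?thesis unfolding one 1 using even_odd_disjoint ne by (auto simp: bpar_def B_def)
  qed
qed

lemma bpar_A: "b \<in> B \<Longrightarrow> b \<in> A (bpar b)"
  by (auto simp: A_iff rp_basis split: if_splits)

definition I :: "('a \<times> nat \<times> nat) set" where "I = B \<times> {..<n} \<times> {..<n}"

definition el :: "'a \<times> nat \<times> nat \<Rightarrow> 'a mat" where "el = (\<lambda>(b, r, s). \<xi>_unit n b r s)"

definition co :: "'a \<times> nat \<times> nat \<Rightarrow> 'a mat \<Rightarrow> 'k" where "co = (\<lambda>(b, r, s) m. rp (m $$ (r, s)) b)"

definition par :: "'a \<times> nat \<times> nat \<Rightarrow> bit" where "par = (\<lambda>(b, r, s). bpar b)"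

abbreviation "M \<equiv> mat_alg (*s) n"
abbreviation "G \<equiv> mat_gr A n"

lemma M_simps: "carrier M = carrier_mat n n" "monoid.mult M = (*)" "\<one>\<^bsub>M\<^esub> = 1\<^sub>m n" "\<zero>\<^bsub>M\<^esub> = 0\<^sub>m n n"
  "add M = (+)" "Module.module.smult M = (\<lambda>c. map_mat ((*s) c))"
  by (simp_all add: mat_alg_def)

lemma sum_I: "(\<Sum>j\<in>I. g j) = (\<Sum>b\<in>B. \<Sum>r<n. \<Sum>s<n. g (b, r, s))"
  by (simp add: I_def sum.cartesian_product)

lemma mat_gr_mult: "x \<in> G p \<Longrightarrow> y \<in> G q \<Longrightarrow> x * y \<in> G (p + q)"
proof -
  assume x: "x \<in> G p" and y: "y \<in> G q"
  have c: "x \<in> carrier_mat n n" "y \<in> carrier_mat n n" using x y by (auto simp: mat_gr_def)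
  have "(\<Sum>t<n. x $$ (i, t) * y $$ (t, j)) \<in> A (p + q)" if "i < n" "j < n" for i j
    using x y that by (intro subspace_sum[OF subspace_A] A_mult) (auto simp: mat_gr_def)
  then show ?thesis using c by (auto simp: mat_gr_def mult_mat_nth[OF c] simp del: index_mult_mat(1))
qed

lemma G_iff': "x \<in> G p \<longleftrightarrow> x \<in> carrier M \<and> (\<forall>i\<in>I. co i x \<noteq> 0 \<longrightarrow> par i = p)"
  by (auto simp: mat_gr_def M_simps A_iff I_def co_def par_def)

text \<open>In the sixfold sum a product of two matrix units survives only if the inner indices
  match, which leaves the usual sum over one inner index and the structure constants of the
  basis.\<close>

lemma co_mult':
  assumes i: "i \<in> I" and x: "x \<in> carrier_mat n n" and y: "y \<in> carrier_mat n n"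
  shows "co i (x * y) = (\<Sum>j\<in>I. \<Sum>k\<in>I. co i (el j * el k) * (co j x * co k y))"
proof -
  obtain b r s where i': "i = (b, r, s)" "b \<in> B" "r < n" "s < n" using i by (auto simp: I_def)
  have e: "co i (el (b', r', s') * el (b'', r'', s'')) = (if s'' = s then if r' = r then if r'' = s' then rp (b' * b'') b else 0 else 0 else 0)"
    if "s' < n" "r'' < n" for b' r' s' b'' r'' s''
    using that i' by (auto simp: el_def mult_\<xi>_unit co_def \<xi>_unit_nth)
  have "(\<Sum>j\<in>I. \<Sum>k\<in>I. co i (el j * el k) * (co j x * co k y))
      = (\<Sum>b'\<in>B. \<Sum>r'<n. \<Sum>s'<n. \<Sum>b''\<in>B. \<Sum>r''<n. \<Sum>s''<n.
          if s'' = s then if r' = r then if r'' = s' then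
            rp (b' * b'') b * (rp (x $$ (r', s')) b' * rp (y $$ (r'', s'')) b'') else 0 else 0 else 0)"
    unfolding sum_I
    by (intro sum.cong refl) (auto simp: e, auto simp: co_def)
  also have "\<dots> = (\<Sum>b'\<in>B. \<Sum>r'<n. if r' = r then (\<Sum>s'<n. \<Sum>b''\<in>B. 
            rp (b' * b'') b * (rp (x $$ (r', s')) b' * rp (y $$ (s', s)) b'')) else 0)"
    using i' by (intro sum.cong refl) (auto simp: sum.delta)
  also have "\<dots> = (\<Sum>b'\<in>B. \<Sum>s'<n. \<Sum>b''\<in>B. rp (b' * b'') b * (rp (x $$ (r, s')) b' * rp (y $$ (s', s)) b''))"
    using i' by (simp add: sum.delta)
  also have "\<dots> = (\<Sum>s'<n. \<Sum>b'\<in>B. \<Sum>b''\<in>B. rp (b' * b'') b * (rp (x $$ (r, s')) b' * rp (y $$ (s', s)) b''))"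
    by (rule sum.swap)
  also have "\<dots> = co i (x * y)"
    using i' by (simp add: co_def mult_mat_nth[OF x y] rp_sum rp_mult[of "_ $$ _"] del: index_mult_mat(1))
  finally show ?thesis by simp
qed

lemma mat_eqI: "x \<in> carrier_mat n n \<Longrightarrow> y \<in> carrier_mat n n \<Longrightarrow>
    (\<And>r s. r < n \<Longrightarrow> s < n \<Longrightarrow> x $$ (r, s) = y $$ (r, s)) \<Longrightarrow> x = y"
  by (rule eq_matI) auto

sublocale graded_alg M G I par el co d
proof (unfold_locales, goal_cases)
  case 1
  show ?case using fin_B by (simp add: I_def)
next
  case (6 x y z)
  note h = 6[unfolded M_simps]
  show ?case unfolding M_simps
  proof (rule mat_eqI)
    fix r s assume rs: "r < n" "s < n"
    have "(\<Sum>t<n. (\<Sum>u<n. x $$ (r, u) * y $$ (u, t)) * z $$ (t, s)) = (\<Sum>t<n. \<Sum>u<n. x $$ (r, u) * (y $$ (u, t) * z $$ (t, s)))"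
      by (simp add: sum_distrib_right mult.assoc)
    also have "\<dots> = (\<Sum>u<n. \<Sum>t<n. x $$ (r, u) * (y $$ (u, t) * z $$ (t, s)))" by (rule sum.swap)
    finally show "(x * y * z) $$ (r, s) = (x * (y * z)) $$ (r, s)"
      using rs h by (simp add: mult_mat_nth[of _ n] sum_distrib_left mult_carrier_mat[of _ n n _ n] del: index_mult_mat(1))
  qed (use h in auto)
next
  case (7 x)
  then show ?case unfolding M_simps
    by (intro mat_eqI) (auto simp: mult_mat_nth[of _ n] if_distrib[of "\<lambda>c. c * _"] sum.delta' simp del: index_mult_mat(1) cong: if_cong)
next
  case (8 x)
  then show ?case unfolding M_simps
    by (intro mat_eqI) (auto simp: mult_mat_nth[of _ n] if_distrib[of "\<lambda>c. _ * c"] sum.delta simp del: index_mult_mat(1) cong: if_cong)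
next
  case (10 i j)
  then show ?case by (auto simp: I_def co_def el_def \<xi>_unit_nth rp_basis split: if_splits)
next
  case (13 x y)
  have "x $$ (r, s) = y $$ (r, s)" if "r < n" "s < n" for r s
    using 13(3)[of "(_, r, s)"] that by (intro rp_eqI) (auto simp: I_def co_def)
  then show ?case using 13(1,2) by (intro mat_eqI) (auto simp: M_simps)
next
  case (14 b)
  show ?case
    by (intro bexI[of _ "mat n n (\<lambda>(r, s). \<Sum>b'\<in>B. b (b', r, s) *s b')"])
      (auto simp: M_simps I_def co_def rp_combination)
next
  case (15 i x y)
  then show ?case unfolding M_simps by (rule co_mult')
next
  case (16 x p)
  show ?case by (rule G_iff')
next
  case (17 i j k)
  have "el j \<in> G (par j)" "el k \<in> G (par k)"
    using 17 subspace_0[OF subspace_A] by (auto simp: el_def par_def I_def mat_gr_def \<xi>_unit_nth bpar_A)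
  from mat_gr_mult[OF this] show ?case using 17 by (auto simp: G_iff' M_simps)
next
  case (18 i)
  have "1\<^sub>m n \<in> G 0" using \<aa>_one \<aa>_even subspace_0[OF subspace_A] by (auto simp: mat_gr_def)
  then show ?case using 18 by (auto simp: G_iff' M_simps)
qed (auto simp: M_simps I_def el_def co_def rp_add rp_scale)

end

section \<open>Transfer of the hypothesis on \<open>A\<close> to invariants of tensors of
  matrices\<close>

lemma calg_type_alg:
  fixes scale :: "'k::comm_ring_1 \<Rightarrow> 'a::{ring,monoid_mult} \<Rightarrow> 'a"
  assumes "superalgebra scale A"
  shows "calg UNIV (*) 1 scale" and "faithful_rep (type_alg scale) id UNIV (*) 1 scale"
proof -
  interpret superalgebra scale A by fact
  show "calg UNIV (*) 1 scale"
    by unfold_locales (simp_all add: algebra_simps scale_mult_left[symmetric] scale_mult_right[symmetric])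
  show "faithful_rep (type_alg scale) id UNIV (*) 1 scale"
    by (rule faithful_repI) (simp_all add: type_alg_def)
qed

context graded_alg
begin

definition lc :: "'m \<Rightarrow> 'i \<Rightarrow> 'k" where "lc x = (\<lambda>i. if i \<in> I then co i x else 0)"

lemma lc_LC [simp]: "lc x \<in> LC" by (simp add: lc_def LC_def)

lemma faithful_rep_letters:
  assumes z: "\<zero>\<^bsub>M\<^esub> \<in> carrier M" "\<And>i. i \<in> I \<Longrightarrow> co i \<zero>\<^bsub>M\<^esub> = 0"
  shows "faithful_rep M lc LC lmul lone lscal"
proof (rule faithful_repI)
  show "bij_betw lc (carrier M) LC"
    unfolding bij_betw_def
  proof
    show "inj_on lc (carrier M)"
    proof (rule inj_onI)
      fix x y assume xy: "x \<in> carrier M" "y \<in> carrier M" "lc x = lc y"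
      show "x = y"
      proof (rule co_eq[OF xy(1,2)])
        fix i assume "i \<in> I"
        then show "co i x = co i y" using fun_cong[OF xy(3), of i] by (simp add: lc_def)
      qed
    qed
    show "lc ` carrier M = LC"
    proof (intro equalityI subsetI)
      fix f assume f: "f \<in> LC"
      obtain x where "x \<in> carrier M" "\<forall>i\<in>I. co i x = f i" using co_ex[of f] by blast
      then show "f \<in> lc ` carrier M" using f by (intro image_eqI[of _ _ x] ext) (auto simp: lc_def LC_def)
    qed auto
  qed
next
  fix x y assume "x \<in> carrier M" "y \<in> carrier M"
  then show "lc (x \<otimes>\<^bsub>M\<^esub> y) = lmul (lc x) (lc y)"
    by (intro LC_eqI) (simp_all add: lmul_expand, simp add: lc_def co_mult)
qed (auto simp: M_add M_mult M_smult M_one z lc_def lone_def co_add co_smult lscal_def fun_eq_iff)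

lemma tw_lc: "tens (map lc xs) = tw xs" if "length xs = d"
  using that by (intro tens_eqI) (simp add: lc_def)

lemma homog_cs: "x \<in> G 0 \<Longrightarrow> homog 0 (cs x)" by (simp add: homog_def G_iff)

lemma G_carrier: "x \<in> G p \<Longrightarrow> x \<in> carrier M" by (simp add: G_iff)

lemma tw_mult_even:
  assumes "\<And>p. p < d \<Longrightarrow> x p \<in> G 0" "\<And>p. p < d \<Longrightarrow> y p \<in> G 0"
  shows "tw (map x [0..<d]) \<star> tw (map y [0..<d]) = tw (map (\<lambda>p. x p \<otimes>\<^bsub>M\<^esub> y p) [0..<d])"
proof -
  have "tw (map x [0..<d]) \<star> tw (map y [0..<d]) = tens (map2 lmul (map cs (map x [0..<d])) (map cs (map y [0..<d])))"
    using assms by (intro tens_conv_even) (auto simp: homog_cs)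
  also have "\<dots> = tw (map (\<lambda>p. x p \<otimes>\<^bsub>M\<^esub> y p) [0..<d])"
    by (intro tens_eqI) (simp add: lmul_cs G_carrier[OF assms(1)] G_carrier[OF assms(2)])
  finally show ?thesis .
qed

lemma tw_act_even:
  assumes \<sigma>: "\<sigma> permutes {..<d}" and x: "\<And>p. p < d \<Longrightarrow> x p \<in> G 0"
  shows "actf \<sigma> (tw (map x [0..<d])) = tw (map (\<lambda>p. x (\<sigma> p)) [0..<d])"
proof -
  have "actf \<sigma> (tw (map x [0..<d])) = tens (permute_list \<sigma> (map cs (map x [0..<d])))"
    using x by (intro actf_tens_even[OF \<sigma>]) (auto simp: homog_cs)
  also have "permute_list \<sigma> (map cs (map x [0..<d])) = map cs (map (\<lambda>p. x (\<sigma> p)) [0..<d])"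
    using permutes_in_image[OF \<sigma>] \<sigma> by (intro nth_equalityI) (auto simp: permute_list_nth)
  finally show ?thesis .
qed

end

lemma calg_fmat:
  fixes scale :: "'k::comm_ring_1 \<Rightarrow> 'a::{ring,monoid_mult} \<Rightarrow> 'a"
  assumes "superalgebra scale A"
  shows "calg (fmat n) (fmul n) (fdiag n 1) (\<lambda>a g r s. scale a (g r s))"
proof -
  interpret superalgebra scale A by fact
  show ?thesis
  proof (unfold_locales, goal_cases)
    case (7 x y z)
    show ?case
    proof (rule fmat_eqI[of _ n])
      fix r s assume rs: "r < n" "s < n"
      have "(\<Sum>t<n. (\<Sum>u<n. x r u * y u t) * z t s) = (\<Sum>t<n. \<Sum>u<n. x r u * (y u t * z t s))"
        by (simp add: sum_distrib_right mult.assoc)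
      also have "\<dots> = (\<Sum>u<n. \<Sum>t<n. x r u * (y u t * z t s))" by (rule sum.swap)
      finally show "fmul n (fmul n x y) z r s = fmul n x (fmul n y z) r s"
        using rs by (simp add: fmul_def sum_distrib_left)
    qed simp_all
  qed (auto simp: fmul_fdiag fdiag_fmul, auto simp: fmat_def fmul_def fun_eq_iff algebra_simps sum.distrib
        scale_sum_right scale_mult_left[symmetric] scale_mult_right[symmetric])
qed

context schur_basis
begin

lemma superalgebra: "superalgebra (*s) A" by unfold_locales

definition fm :: "'a mat \<Rightarrow> nat \<Rightarrow> nat \<Rightarrow> 'a" where
  "fm m = (\<lambda>r s. if r < n \<and> s < n then m $$ (r, s) else 0)"

lemma faithful_rep_fmat: "faithful_rep M fm (fmat n) (fmul n) (fdiag n 1) (\<lambda>a g r s. a *s g r s)"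
proof (rule faithful_repI)
  show "bij_betw fm (carrier M) (fmat n)"
    unfolding bij_betw_def
  proof
    show "inj_on fm (carrier M)"
    proof (rule inj_onI)
      fix x y assume xy: "x \<in> carrier M" "y \<in> carrier M" "fm x = fm y"
      have "x $$ (r, s) = y $$ (r, s)" if "r < n" "s < n" for r s
        using fun_cong[OF fun_cong[OF xy(3), of r], of s] that by (simp add: fm_def)
      then show "x = y" using xy by (intro mat_eqI) (auto simp: M_simps)
    qed
    show "fm ` carrier M = fmat n"
    proof (intro equalityI subsetI)
      fix g :: "nat \<Rightarrow> nat \<Rightarrow> 'a" assume g: "g \<in> fmat n"
      then show "g \<in> fm ` carrier M"
        by (intro image_eqI[of _ _ "mat n n (\<lambda>(r, s). g r s)"] ext) (auto simp: M_simps fm_def fmat_def)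
    qed (auto simp: fm_def fmat_def)
  qed
qed (auto simp: M_simps fm_def fmul_def fdiag_def fun_eq_iff mult_mat_nth[of _ n] simp del: index_mult_mat(1))

lemma M_zero: "\<zero>\<^bsub>M\<^esub> \<in> carrier M" "i \<in> I \<Longrightarrow> co i \<zero>\<^bsub>M\<^esub> = 0"
  by (auto simp: M_simps I_def co_def)

end

locale schur_idem = schur_basis +
  fixes e :: 'b
  assumes pid: "principal_domain (ring_of_type_algebra :: 'a ring)"
    and n: "1 \<le> n" and d_le: "d \<le> n" and e_even: "e \<in> A 0" and e_idem: "e * e = e"
    and e_dc: "double_centralizer_idempotent (type_alg (*s)) e"
begin

abbreviation "Em \<equiv> E_idem (*s) n e"
abbreviation "eu \<equiv> \<xi>_unit n e"

lemma Em: "Em \<in> carrier M" "fm Em = fdiag n e"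
proof -
  interpret F: calg "fmat n" "fmul n" "fdiag n 1" "\<lambda>a g r s. a *s g r s" by (rule calg_fmat[OF superalgebra])
  have m: "eu r r \<in> carrier M" for r by (simp add: M_simps)
  show "Em \<in> carrier M"
    unfolding E_idem_def by (rule F.faithful_rep_finsum[OF faithful_rep_fmat]) (simp_all add: m)
  have "fm Em = (\<Sum>r<n. fm (eu r r))"
    unfolding E_idem_def by (rule F.faithful_rep_finsum[OF faithful_rep_fmat]) (simp_all add: m)
  also have "\<dots> = fdiag n e"
  proof (intro ext)
    fix r s
    have "(\<Sum>t<n. fm (eu t t)) r s = (\<Sum>t<n. if t = r then (if r < n \<and> s < n \<and> r = s then e else 0) else 0)"
      unfolding sum_fun_apply by (intro sum.cong refl) (auto simp: fm_def \<xi>_unit_nth)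
    then show "(\<Sum>t<n. fm (eu t t)) r s = fdiag n e r s" by (simp add: fdiag_def)
  qed
  finally show "fm Em = fdiag n e" .
qed

lemma Em_nth: "r < n \<Longrightarrow> s < n \<Longrightarrow> Em $$ (r, s) = (if r = s then e else 0)"
  using fun_cong[OF fun_cong[OF Em(2), of r], of s] by (simp add: fm_def fdiag_def)

lemma Em_G: "Em \<in> G 0"
  using Em(1) e_even subspace_0[OF subspace_A] by (auto simp: mat_gr_def M_simps Em_nth)

lemma eu_G: "eu r s \<in> G 0"
  using e_even subspace_0[OF subspace_A] by (auto simp: mat_gr_def \<xi>_unit_nth)

lemma Em_eu: assumes rs: "r < n" "s < n" shows "Em * eu r s = eu r s" "eu r s * Em = eu r s"
proof -
  have E: "Em \<in> carrier_mat n n" using Em(1) by (simp add: M_simps)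
  have "(\<Sum>t<n. Em $$ (i, t) * eu r s $$ (t, j)) = (\<Sum>t<n. if t = r then (if i = r \<and> j = s then e else 0) else 0)"
    if "i < n" "j < n" for i j
    using that by (intro sum.cong refl) (auto simp: \<xi>_unit_nth Em_nth e_idem)
  then show "Em * eu r s = eu r s"
    using E rs by (intro mat_eqI) (auto simp: mult_mat_nth[of _ n] \<xi>_unit_nth simp del: index_mult_mat(1))
  have "(\<Sum>t<n. eu r s $$ (i, t) * Em $$ (t, j)) = (\<Sum>t<n. if t = s then (if i = r \<and> j = s then e else 0) else 0)"
    if "i < n" "j < n" for i j
    using that by (intro sum.cong refl) (auto simp: \<xi>_unit_nth Em_nth e_idem)
  then show "eu r s * Em = eu r s"
    using E rs mult_carrier_mat[OF \<xi>_unit_carrier E] by (intro mat_eqI) (auto simp: mult_mat_nth[of _ n] \<xi>_unit_nth simp del: index_mult_mat(1))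
qed

text \<open>The property travels from \<open>A\<close> to matrices in functional form, from there to
  the matrix record, and from the record to coordinate letters. The last two moves are instances of
  isomorphism invariance.\<close>

lemma dci_Em: "dci LC lmul (lc Em)"
proof -
  interpret U: calg UNIV "(*)" "1 :: 'b" "(*s)" by (rule calg_type_alg[OF superalgebra])
  interpret F: calg "fmat n" "fmul n" "fdiag n 1" "\<lambda>a g r s. a *s g r s" by (rule calg_fmat[OF superalgebra])
  interpret L: calg LC lmul lone lscal by (rule calg_LC)
  have "dci UNIV (*) e"
    using U.double_centralizer_iff_dci[OF calg_type_alg(2)[OF superalgebra], of e] e_dc by (simp add: type_alg_def)
  then have "dci (fmat n) (fmul n) (fm Em)" using n by (simp add: Em dci_matrix)
  then have "double_centralizer_idempotent M Em"
    using F.double_centralizer_iff_dci[OF faithful_rep_fmat Em(1)] by simp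
  then show ?thesis using L.double_centralizer_iff_dci[OF faithful_rep_letters[OF M_zero] Em(1)] by simp
qed

abbreviation "F \<equiv> tw (replicate d Em)"

lemma dci_F: "dci TC (\<star>) F"
proof -
  have "homog 0 (lc Em)" using homog_cs[OF Em_G] by (simp add: homog_def lc_def)
  then have "dc_letter I par c o1 (lc Em)"
    using pid dci_Em by (intro dc_letter.intro dc_letter_axioms.intro graded_consts_axioms)
  from dc_letter.dci_tensor_letter[OF this, of d] show ?thesis using tw_lc[of "replicate d Em"] by simp
qed

lemma F_map: "replicate d x = map (\<lambda>p. x) [0..<d]" by (simp add: map_replicate_const)

lemma F_Inv: "F \<in> Inv"
proof -
  interpret A: calg_act TC "(\<star>)" T1 scal d actf by (rule calg_act_TC)
  show ?thesis unfolding A.invs_def F_map using tw_act_even[of _ "\<lambda>_. Em"] Em_G by simp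
qed

lemma dci_Inv: "dci Inv (\<star>) F"
proof -
  interpret A: calg_act TC "(\<star>)" T1 scal d actf by (rule calg_act_TC)
  \<comment> \<open>In position \<open>p\<close> the tensor \<open>a t\<close> has a unit in column
    \<open>p\<close> and \<open>b t\<close> one in row \<open>p\<close>; enough different indices
    exist because \<open>d \<le> n\<close>.\<close>
  define a where "a t = tw (map (\<lambda>p. eu (t ! p) p) [0..<d])" for t
  define b where "b t = tw (map (\<lambda>p. eu p (t ! p)) [0..<d])" for t
  define w where "w = tw (map (\<lambda>p. eu p p) [0..<d])"
  have dn: "p < n" if "p < d" for p using that d_le by simp
  have tn: "t ! p < n" if "t \<in> words {..<n} d" "p < d" for t p using words_nth[OF that] by simp
  have F: "F = tw (map (\<lambda>p. Em) [0..<d])" by (simp only: F_map)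
  have twm: "tw (map x [0..<d]) \<star> tw (map y [0..<d]) = tw (map z [0..<d])"
    if "\<And>p. p < d \<Longrightarrow> x p \<in> G 0" "\<And>p. p < d \<Longrightarrow> y p \<in> G 0" "\<And>p. p < d \<Longrightarrow> x p * y p = z p" for x y z
  proof -
    have "tw (map (\<lambda>p. x p \<otimes>\<^bsub>M\<^esub> y p) [0..<d]) = tw (map z [0..<d])"
      using that by (intro tens_eqI) (simp add: M_simps)
    then show ?thesis using tw_mult_even[of x y] that by simp
  qed
  show ?thesis
  proof (rule A.dci_invs[OF dci_F F_Inv, of w "words {..<n} d" a b])
    show "w \<in> TC" by (simp add: w_def)
    show "w \<star> w = w" "w \<star> F = w" "F \<star> w = w"
      unfolding w_def F by (rule twm; use dn in \<open>simp add: eu_G Em_G mult_\<xi>_unit e_idem Em_eu\<close>)+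
  next
    fix \<sigma> assume \<sigma>: "\<sigma> permutes {..<d}" "\<sigma> \<noteq> id"
    \<comment> \<open>A nontrivial permutation moves some position \<open>p\<close>, where the
      product of the diagonal units number \<open>p\<close> and \<open>\<sigma> p\<close> is
      zero.\<close>
    then obtain p where p: "\<sigma> p \<noteq> p" by (auto simp: fun_eq_iff)
    then have pd: "p < d" "\<sigma> p < d" using \<sigma>(1) permutes_in_image[OF \<sigma>(1), of p] by (auto simp: permutes_def)
    have act: "actf \<sigma> w = tw (map (\<lambda>p. eu (\<sigma> p) (\<sigma> p)) [0..<d])"
      unfolding w_def by (rule tw_act_even[OF \<sigma>(1)]) (rule eu_G)
    have "w \<star> actf \<sigma> w = tw (map (\<lambda>p. eu p p * eu (\<sigma> p) (\<sigma> p)) [0..<d])"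
      unfolding act unfolding w_def by (rule twm) (simp_all add: eu_G)
    also have "\<dots> = 0"
    proof (rule ext)
      fix v
      have "co (v ! p) (eu p p * eu (\<sigma> p) (\<sigma> p)) = 0" if "v \<in> W"
        using W_nth[OF that pd(1)] p pd dn by (auto simp: mult_\<xi>_unit I_def co_def)
      then show "tw (map (\<lambda>p. eu p p * eu (\<sigma> p) (\<sigma> p)) [0..<d]) v = 0 v"
        using pd by (auto simp: tens_def intro!: prod_zero bexI[of _ p])
    qed
    finally show "w \<star> actf \<sigma> w = 0" .
  next
    fix t assume t: "t \<in> words {..<n} d"
    show "a t \<in> TC \<and> a t \<star> w = a t \<and> F \<star> a t = a t"
      unfolding w_def F a_def using dn tn[OF t]
      by (intro conjI tens_TC twm) (simp_all add: eu_G Em_G mult_\<xi>_unit e_idem Em_eu)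
    show "b t \<in> TC \<and> w \<star> b t = b t \<and> b t \<star> F = b t"
      unfolding w_def F b_def using dn tn[OF t]
      by (intro conjI tens_TC twm) (simp_all add: eu_G Em_G mult_\<xi>_unit e_idem Em_eu)
  next
    \<comment> \<open>The product is the tensor of the diagonal units named by \<open>t\<close>;
      summing over all words multiplies out the tensor power of \<open>Em\<close>.\<close>
    have "a t \<star> b t = tw (map (\<lambda>p. eu (t ! p) (t ! p)) [0..<d])" if t: "t \<in> words {..<n} d" for t
      unfolding a_def b_def using dn tn[OF t] by (intro twm) (simp_all add: eu_G mult_\<xi>_unit e_idem)
    then have "(\<Sum>t\<in>words {..<n} d. a t \<star> b t) = (\<Sum>t\<in>words {..<n} d. tw (map (\<lambda>p. eu (t ! p) (t ! p)) [0..<d]))"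
      by (rule sum.cong[OF refl])
    also have "\<dots> = F"
    proof (rule ext)
      fix v
      show "(\<Sum>t\<in>words {..<n} d. tw (map (\<lambda>p. eu (t ! p) (t ! p)) [0..<d])) v = F v"
      proof (cases "v \<in> W")
        case True
        have co: "(\<Sum>r<n. co i (eu r r)) = co i Em" if "i \<in> I" for i
        proof -
          obtain b r s where i: "i = (b, r, s)" "b \<in> B" "r < n" "s < n" using \<open>i \<in> I\<close> by (auto simp: I_def)
          have "(\<Sum>t<n. co i (eu t t)) = (\<Sum>t<n. if t = r then (if r = s then rp e b else 0) else 0)"
            using i by (intro sum.cong refl) (auto simp: co_def \<xi>_unit_nth)
          then show ?thesis using i by (simp add: co_def Em_nth)
        qed
        have "(\<Sum>t\<in>words {..<n} d. tw (map (\<lambda>p. eu (t ! p) (t ! p)) [0..<d])) v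
            = (\<Sum>t\<in>words {..<n} d. \<Prod>p<d. co (v ! p) (eu (t ! p) (t ! p)))"
          unfolding sum_fun_apply using True by (intro sum.cong refl) (simp add: tens_def)
        also have "\<dots> = (\<Prod>p<d. \<Sum>r<n. co (v ! p) (eu r r))" by (rule sum_words_prod)
        also have "\<dots> = F v" using True by (simp add: tens_def co W_nth)
        finally show ?thesis .
      qed (simp add: sum_fun_apply tens_def)
    qed
    finally show "(\<Sum>t\<in>words {..<n} d. a t \<star> b t) = F" .
  qed
qed

abbreviation "\<xi> \<equiv> \<xi>_idem (*s) A n d e"

lemma \<xi>: "\<xi> \<in> carrier (schur_alg (*s) A n d)" "coords \<xi> = F"
proof -
  have r: "replicate d Em \<in> words (carrier M) d" using Em(1) by (auto simp: words_def)
  show "coords \<xi> = F" unfolding \<xi>_idem_def by (rule pure_tensor_props(2)[OF r])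
  then show "\<xi> \<in> carrier (schur_alg (*s) A n d)"
    unfolding schur_alg_def carrier_tensor_invariants using F_Inv pure_tensor_props(1)[OF r] by (simp add: \<xi>_idem_def)
qed

lemma double_centralizer_S: "double_centralizer_idempotent (schur_alg (*s) A n d) \<xi>"
proof -
  interpret A: calg_act TC "(\<star>)" T1 scal d actf by (rule calg_act_TC)
  interpret V: calg Inv "(\<star>)" T1 scal by (rule A.calg_invs)
  show ?thesis
    using V.double_centralizer_iff_dci[OF faithful_rep_tensor_invariants] \<xi> dci_Inv by (simp add: schur_alg_def)
qed

end

section \<open>Structure constants over the field of fractions and comparison of the two scalar
  extensions\<close>

locale fr_consts = graded_consts I par c o1 d
  for I :: "'i set" and par :: "'i \<Rightarrow> bit" and c :: "'i \<Rightarrow> 'i \<Rightarrow> 'i \<Rightarrow> 'k::idom"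
    and o1 :: "'i \<Rightarrow> 'k" and d :: nat
begin

sublocale K: graded_consts I par "\<lambda>i j k. fr (c i j k)" "\<lambda>i. fr (o1 i)" d
proof (unfold_locales, goal_cases)
  case (3 i j k m)
  have "(\<Sum>l\<in>I. fr (c m l k) * fr (c l i j)) = fr (\<Sum>l\<in>I. c m l k * c l i j)" by (simp add: fr_sum)
  then show ?case unfolding c_assoc[OF 3] by (simp add: fr_sum)
next
  case (4 i j)
  have "(\<Sum>l\<in>I. fr (c i l j) * fr (o1 l)) = fr (\<Sum>l\<in>I. c i l j * o1 l)" by (simp add: fr_sum)
  then show ?case unfolding c_one_l[OF 4] by (simp add: fr_0 fr_1)
next
  case (5 i j)
  have "(\<Sum>l\<in>I. fr (c i j l) * fr (o1 l)) = fr (\<Sum>l\<in>I. c i j l * o1 l)" by (simp add: fr_sum)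
  then show ?case unfolding c_one_r[OF 5] by (simp add: fr_0 fr_1)
qed (auto simp: finI fr_eq_0_iff par_c par_o1)

definition fx :: "('i list \<Rightarrow> 'k) \<Rightarrow> 'i list \<Rightarrow> 'k fract" where "fx f = (\<lambda>v. fr (f v))"

lemma fr_prod: "fr (prod g J) = (\<Prod>j\<in>J. fr (g j))"
  by (induction J rule: infinite_finite_induct) (simp_all add: fr_1 fr_mult del: mult_fract)

lemma fr_bit_sign: "fr (bit_sign p) = bit_sign p"
  by (simp add: bit_sign_def One_fract_def)

lemma fx_TC: "f \<in> TC \<Longrightarrow> fx f \<in> K.TC" by (simp add: fx_def TC_def K.TC_def fr_0)

lemma fx_add: "fx (f + g) = fx f + fx g" by (rule ext) (simp add: fx_def fr_add del: add_fract)

lemma fx_zero: "fx 0 = 0" by (rule ext) (simp add: fx_def fr_0)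

lemma fx_scal: "fx (scal a f) = scalK (fr a) (fx f)" by (rule ext) (simp add: fx_def scal_def scalK_def)

lemma fx_sum: "fx (sum g J) = (\<Sum>j\<in>J. fx (g j))"
  by (rule ext) (simp add: fx_def sum_fun_apply fr_sum)

lemma fx_inj: "fx f = fx g \<Longrightarrow> f = g" by (simp add: fx_def fun_eq_iff fr_eq_iff)

lemma fx_T1: "fx T1 = K.T1"
  by (rule ext) (simp add: fx_def T1_def K.T1_def tens_def K.tens_def fr_prod fr_0)

lemma fx_conv: "fx (conv f g) = K.conv (fx f) (fx g)"
proof (rule ext)
  fix w
  show "fx (conv f g) w = K.conv (fx f) (fx g) w"
  proof (cases "w \<in> W")
    case True
    then have "fx (conv f g) w = (\<Sum>x\<in>W. \<Sum>y\<in>W. fr (sg x y * cw w x y * (f x * g y)))"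
      by (simp add: fx_def conv_def fr_sum del: mult_fract)
    also have "\<dots> = K.conv (fx f) (fx g) w"
      using True by (simp add: K.conv_def fr_mult fr_bit_sign fx_def cw_def K.cw_def fr_prod del: mult_fract)
    finally show ?thesis .
  qed (simp add: fx_def conv_def K.conv_def fr_0)
qed

lemma ext_setting:
  assumes rep: "faithful_rep S h C conv T1 scal" and C: "C \<subseteq> TC"
  shows "ext_setting K.TC K.conv K.T1 S (\<lambda>s. fx (h s))"
proof -
  note Q = faithful_repD[OF rep]
  have s: "K.scal = scalK" by (simp add: K.scal_def scalK_def fun_eq_iff)
  show ?thesis
  proof (intro ext_setting.intro ext_setting_axioms.intro)
    show "calg K.TC K.conv K.T1 scalK" using K.calg_TC unfolding s .
    show "x \<in> carrier S \<Longrightarrow> y \<in> carrier S \<Longrightarrow> fx (h x) = fx (h y) \<Longrightarrow> x = y" for x y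
      using Q(11) by (auto simp: bij_betw_def inj_on_def dest: fx_inj)
    show "x \<in> carrier S \<Longrightarrow> fx (h x) \<in> K.TC" for x using Q(12) C fx_TC by blast
  qed (simp_all add: Q(1-10) fx_add fx_zero fx_scal fx_T1 fx_conv)
qed

end

text \<open>Both \<open>h\<close> and \<open>k\<close> are isomorphisms onto the same algebra and
  \<open>g\<close> followed by \<open>h\<close> is \<open>k\<close>, so \<open>g\<close> inherits
  bijectivity and compatibility with the operations from them.\<close>

lemma alg_isoI:
  assumes S: "faithful_rep S h C mul u sm" and T: "faithful_rep T k C mul u sm"
    and g: "\<And>x. x \<in> carrier T \<Longrightarrow> g x \<in> carrier S \<and> h (g x) = k x"
  shows "g \<in> alg_iso T S"
proof -
  note P = faithful_repD[OF S] and Q = faithful_repD[OF T]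
  have inj: "x \<in> carrier S \<Longrightarrow> y \<in> carrier S \<Longrightarrow> h x = h y \<Longrightarrow> x = y" for x y
    using P(11) by (auto simp: bij_betw_def inj_on_def)
  have "bij_betw g (carrier T) (carrier S)"
    unfolding bij_betw_def
  proof
    show "inj_on g (carrier T)"
    proof (rule inj_onI)
      fix x y assume xy: "x \<in> carrier T" "y \<in> carrier T" "g x = g y"
      then have "k x = k y" using g by metis
      then show "x = y" using bij_betw_imp_inj_on[OF Q(11)] xy by (simp add: inj_on_def)
    qed
    show "g ` carrier T = carrier S"
    proof (intro equalityI subsetI)
      fix y assume y: "y \<in> carrier S"
      have "h y \<in> k ` carrier T" using bij_betw_imp_surj_on[OF Q(11)] P(12)[OF y] by simp
      then obtain x where "x \<in> carrier T" "h y = k x" by blast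
      then show "y \<in> g ` carrier T" using g inj[of y "g x"] y by auto
    qed (use g in blast)
  qed
  moreover have "g (a \<odot>\<^bsub>T\<^esub> x) = a \<odot>\<^bsub>S\<^esub> g x" if "x \<in> carrier T" for a x
    using that g P(3,10) Q(3,10) by (intro inj) simp_all
  moreover have "g (x \<otimes>\<^bsub>T\<^esub> y) = g x \<otimes>\<^bsub>S\<^esub> g y" "g (x \<oplus>\<^bsub>T\<^esub> y) = g x \<oplus>\<^bsub>S\<^esub> g y"
    if "x \<in> carrier T" "y \<in> carrier T" for x y
    using that g P(1,2,8,9) Q(1,2,8,9) by (intro inj; simp)+
  moreover have "g \<one>\<^bsub>T\<^esub> = \<one>\<^bsub>S\<^esub>" using g[OF Q(4)] P(4,7) Q(7) by (intro inj) simp_all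
  ultimately show ?thesis
    using g unfolding alg_iso_def ring_iso_def Ring.ring_hom_def by simp
qed

text \<open>Two records with common coordinates, one inside the other, such that a nonzero
  \<open>N\<close> multiplies the larger into the smaller. Since \<open>N\<close> becomes invertible
  in the field, both have the same scalar extension.\<close>

locale ext_pair = ES: ext_setting D mulD uD S \<iota> + ET: ext_setting D mulD uD T \<iota>
  for D :: "('w \<Rightarrow> 'k::idom fract) set" and mulD uD and S T :: "('k, 's) module" and \<iota> +
  fixes N :: 'k
  assumes sub: "carrier T \<subseteq> carrier S" and N: "N \<noteq> 0"
    and N_mult: "s \<in> carrier S \<Longrightarrow> \<exists>t\<in>carrier T. scalK (fr N) (\<iota> s) = \<iota> t"
begin

lemma E_eq: "ET.E = ES.E"
proof (intro equalityI subsetI)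
  fix z assume "z \<in> ES.E"
  then obtain a s where z: "z \<in> D" "a \<noteq> 0" "s \<in> carrier S" "scalK (fr a) z = \<iota> s" by (auto simp: ES.E_def)
  then obtain t where t: "t \<in> carrier T" "scalK (fr N) (\<iota> s) = \<iota> t" using N_mult by blast
  have "scalK (fr (N * a)) z = \<iota> t" unfolding t(2)[symmetric] z(4)[symmetric] by (simp add: scalK_simps)
  then show "z \<in> ET.E" unfolding ET.E_def using z t N by (auto intro!: exI[of _ "N * a"])
qed (use sub in \<open>auto simp: ET.E_def ES.E_def\<close>)

text \<open>Elements of both extensions are fibres of coordinate maps given by the same formula, so
  all representatives of \<open>U\<close> land in one coset and the coordinates are kept.\<close>

lemma ext_incl_props:
  assumes U: "U \<in> carrier (scalar_ext T)"
  shows "ext_incl S U \<in> carrier (scalar_ext S) \<and> ES.ecoords (ext_incl S U) = ET.ecoords U"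
proof -
  obtain p where p: "p \<in> carrier (ext_free T)" "U = ext_rels T +>\<^bsub>ext_free T\<^esub> p"
    using U unfolding ET.carrier_scalar_ext by blast
  have TS: "q \<in> carrier (ext_free S)" if "q \<in> carrier (ext_free T)" for q
    using that sub by (auto simp: ext_free_def)
  have "ext_rels S +>\<^bsub>ext_free S\<^esub> q = ext_rels S +>\<^bsub>ext_free S\<^esub> p" if "q \<in> U" for q
    using that p by (simp add: ET.ext_coset ES.ext_coset TS)
  moreover have "p \<in> U" using p by (simp add: ET.ext_coset)
  ultimately have e: "ext_incl S U = ext_rels S +>\<^bsub>ext_free S\<^esub> p" unfolding ext_incl_def by blast
  show ?thesis
    unfolding e using p TS by (auto simp: ES.carrier_scalar_ext ES.ecoords_coset ET.ecoords_coset)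
qed

lemma ext_incl_iso: "ext_incl S \<in> alg_iso (scalar_ext T) (scalar_ext S)"
  using ES.faithful_rep_scalar_ext ET.faithful_rep_scalar_ext[unfolded E_eq] ext_incl_props by (rule alg_isoI)

lemma double_centralizer_ext:
  assumes dci: "dci ES.E mulD (\<iota> f)" and f: "f \<in> carrier S"
  shows "double_centralizer_idempotent (scalar_ext S) (ext_tensor S f 1)"
    and "double_centralizer_idempotent (scalar_ext T)
      (inv_into (carrier (scalar_ext T)) (ext_incl S) (ext_tensor S f 1))"
proof -
  interpret E: calg ES.E mulD uD scalK by (rule ES.calg_E)
  note p = ES.ext_tensor_props[OF f, of 1, unfolded scalK_simps]
  show "double_centralizer_idempotent (scalar_ext S) (ext_tensor S f 1)"
    using E.double_centralizer_iff_dci[OF ES.faithful_rep_scalar_ext p(1)] dci p(2) by simp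
  let ?y = "inv_into (carrier (scalar_ext T)) (ext_incl S) (ext_tensor S f 1)"
  have "bij_betw (ext_incl S) (carrier (scalar_ext T)) (carrier (scalar_ext S))"
    using ext_incl_iso by (simp add: alg_iso_def ring_iso_def)
  then have im: "ext_tensor S f 1 \<in> ext_incl S ` carrier (scalar_ext T)" using p(1) by (simp add: bij_betw_def)
  have y: "?y \<in> carrier (scalar_ext T)" "ext_incl S ?y = ext_tensor S f 1"
    by (rule inv_into_into[OF im], rule f_inv_into_f[OF im])
  have "ET.ecoords ?y = \<iota> f" using ext_incl_props[OF y(1)] unfolding y(2) p(2) by simp
  then show "double_centralizer_idempotent (scalar_ext T) ?y"
    using E.double_centralizer_iff_dci[OF ET.faithful_rep_scalar_ext[unfolded E_eq] y(1)] dci by simp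
qed

end

section \<open>The subalgebra of the statement, its dictionary to words, and the conclusion\<close>

section \<open>Generalized Schur algebras\<close>

lemma lin_span_sum:
  assumes rep: "faithful_rep S h C mul u sm" and Y: "Y \<subseteq> carrier S" and "finite J"
    and g: "\<And>j. j \<in> J \<Longrightarrow> \<exists>y\<in>Y. g j = sm (a j) (h y)"
  shows "\<exists>x\<in>lin_span S Y. h x = sum g J"
  using \<open>finite J\<close> g
proof (induction J rule: finite_induct)
  case empty
  then show ?case using lin_span.zero faithful_repD(6)[OF rep] by (auto intro!: bexI[of _ "\<zero>\<^bsub>S\<^esub>"])
next
  case (insert j J)
  note Q = faithful_repD[OF rep]
  have sp: "x \<in> carrier S" if "x \<in> lin_span S Y" for x using that by induction (use Y Q(1,3,5) in auto)
  obtain x where x: "x \<in> lin_span S Y" "h x = sum g J" using insert by auto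
  obtain y where y: "y \<in> Y" "g j = sm (a j) (h y)" using insert.prems by blast
  have y': "a j \<odot>\<^bsub>S\<^esub> y \<in> lin_span S Y" using y by (intro lin_span.smult lin_span.incl)
  have "h (a j \<odot>\<^bsub>S\<^esub> y \<oplus>\<^bsub>S\<^esub> x) = sum g (insert j J)"
    unfolding sum.insert[OF insert.hyps] using Q(8)[OF sp[OF y'] sp[OF x(1)]] Q(10)[of y "a j"] x(2) y Y by auto
  then show ?case using lin_span.add[OF y' x(1)] by blast
qed

context schur_basis
begin

definition Ia :: "('a \<times> nat \<times> nat) set" where "Ia = B\<^sub>\<aa> \<times> {..<n} \<times> {..<n}"
definition Ic :: "('a \<times> nat \<times> nat) set" where "Ic = B\<^sub>\<cc> \<times> {..<n} \<times> {..<n}"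

lemma rp_\<aa>: "y \<in> \<aa> \<Longrightarrow> b \<in> B\<^sub>\<cc> \<Longrightarrow> rp y b = 0"
proof -
  assume y: "y \<in> \<aa>" and b: "b \<in> B\<^sub>\<cc>"
  have "\<forall>b. rp y b \<noteq> 0 \<longrightarrow> b \<in> B\<^sub>\<aa>"
    unfolding rp_def using y bases(2) by (subst span_iff_representation[symmetric]) (simp_all add: indep_B span_B, simp add: B_def Un_assoc)
  then show ?thesis using b a_c_disjoint by blast
qed

lemma Ba_\<aa>: "b \<in> B\<^sub>\<aa> \<Longrightarrow> b \<in> \<aa>" using span_base[of b B\<^sub>\<aa>] by (simp add: bases)

sublocale div_consts I par c o1 d Ia Ic
proof (unfold_locales, goal_cases)
  case (1 i)
  then show ?case using even_odd_disjoint by (auto simp: Ic_def I_def B_def par_def bpar_def)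
next
  case (2 i)
  then show ?case by (auto simp: Ia_def Ic_def I_def B_def par_def bpar_def split: if_splits)
next
  case (3 i j k)
  then show ?case
    by (auto simp: Ia_def Ic_def co_def el_def M_simps mult_\<xi>_unit \<xi>_unit_nth rp_\<aa> \<aa>_mult Ba_\<aa>)
next
  case (4 i)
  then show ?case using \<aa>_one by (auto simp: Ic_def co_def M_simps rp_\<aa>)
qed

sublocale fr_consts I par c o1 d ..

abbreviation "S \<equiv> schur_alg (*s) A n d"
abbreviation "T \<equiv> T_alg (*s) A B\<^sub>\<aa> B\<^sub>\<cc> B\<^sub>1 n d"

lemma rep_S: "faithful_rep S coords Inv (\<star>) T1 scal"
  unfolding schur_alg_def by (rule faithful_rep_tensor_invariants)

text \<open>A triple becomes the word of its letters \<open>(b, r, s)\<close>. Through this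
  dictionary \<open>Tri\<close>, the stabilizers and the counts of the statement turn into their
  counterparts for words.\<close>

definition enc :: "'a triple \<Rightarrow> ('a \<times> nat \<times> nat) list" where
  "enc = (\<lambda>(bs, rs, ss). zip bs (zip rs ss))"

lemma even_iff: "b \<in> B \<Longrightarrow> b \<in> A 0 \<longleftrightarrow> bpar b = 0"
  by (auto simp: A_iff rp_basis split: if_splits)

lemma enc_good: assumes t: "t \<in> Tri A B n d" shows "enc t \<in> W" "good (enc t)"
proof -
  obtain bs rs ss where e: "t = (bs, rs, ss)" by (cases t)
  have w: "bs \<in> words B d" "rs \<in> words {..<n} d" "ss \<in> words {..<n} d"
    and g: "\<And>k l. k < d \<Longrightarrow> l < d \<Longrightarrow> k \<noteq> l \<Longrightarrow> (bs ! k, rs ! k, ss ! k) = (bs ! l, rs ! l, ss ! l) \<Longrightarrow> bs ! k \<in> A 0"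
    using t unfolding e Tri_def by auto
  note l = words_length[OF w(1)] words_length[OF w(2)] words_length[OF w(3)]
  show "enc t \<in> W" using l words_nth[OF w(1)] words_nth[OF w(2)] words_nth[OF w(3)]
    by (intro wordsI) (auto simp: e enc_def I_def)
  show "good (enc t)"
    unfolding good_def using l g words_nth[OF w(1)] by (auto simp: e enc_def par_def even_iff)
qed

lemma good_enc: assumes w: "w \<in> W" "good w" shows "w \<in> enc ` Tri A B n d"
proof (rule image_eqI)
  let ?t = "(map fst w, map (fst \<circ> snd) w, map (snd \<circ> snd) w)"
  show "w = enc ?t" by (simp add: enc_def zip_map_fst_snd flip: map_map)
  have nth: "w ! k = (fst (w ! k), fst (snd (w ! k)), snd (snd (w ! k)))" for k by simp
  have I: "fst (w ! k) \<in> B \<and> fst (snd (w ! k)) < n \<and> snd (snd (w ! k)) < n" if "k < d" for k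
    using W_nth[OF w(1) that] unfolding I_def by (auto simp: mem_Times_iff)
  have ev: "fst (w ! k) \<in> A 0" if "k < d" "l < d" "k \<noteq> l" "w ! k = w ! l" for k l
  proof -
    have "par (w ! k) = 0" using w(2) that unfolding good_def by blast
    then show ?thesis using I[OF that(1)] by (simp add: even_iff par_def case_prod_unfold)
  qed
  show "?t \<in> Tri A B n d"
    unfolding Tri_def using W_length[OF w(1)] I ev by (auto simp: prod_eq_iff intro!: wordsI)
qed

lemma stab_cosets_enc: assumes t: "t \<in> Tri A B n d" shows "stab_cosets d t = cosets (enc t)"
proof -
  obtain bs rs ss where e: "t = (bs, rs, ss)" by (cases t)
  have l: "length bs = d" "length rs = d" "length ss = d" using t by (auto simp: e Tri_def words_def)
  have "triple_stab d t = lstab (enc t)"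
    unfolding triple_stab_def lstab_def using l permute_list_zip3[OF l] by (auto simp: e enc_def triple_act_def)
  then show ?thesis by (simp add: stab_cosets_def cosets_def)
qed

lemma triple_word_enc: assumes t: "t \<in> Tri A B n d" shows "triple_word n t = map el (enc t)"
proof -
  obtain bs rs ss where e: "t = (bs, rs, ss)" by (cases t)
  have l: "length bs = d" "length rs = d" "length ss = d" using t by (auto simp: e Tri_def words_def)
  then show ?thesis by (intro nth_equalityI) (auto simp: e triple_word_def enc_def el_def)
qed

lemma triple_fact_enc: assumes t: "t \<in> Tri A B n d" shows "triple_fact B\<^sub>\<cc> n t = fc (enc t)"
proof -
  obtain bs rs ss where e: "t = (bs, rs, ss)" by (cases t)
  have l: "length bs = d" "length rs = d" "length ss = d" using t by (auto simp: e Tri_def words_def)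
  have "triple_count t b r s = cnt (enc t) (b, r, s)" for b r s
    unfolding triple_count_def cnt_def using l by (auto simp: e enc_def intro!: arg_cong[of _ _ card])
  then show ?thesis unfolding fc_def unfolding Ic_def by (simp add: triple_fact_def prod.cartesian_product case_prod_unfold)
qed

lemma tw_el: assumes w: "w \<in> W" shows "tw (map el w) = dl w"
proof (rule ext)
  fix v
  show "tw (map el w) v = dl w v"
  proof (cases "v \<in> W")
    case True
    have "tw (map el w) v = (\<Prod>p<d. if v ! p = w ! p then 1 else 0)"
      using True w by (auto simp: tens_def W_length W_nth co_el intro!: prod.cong)
    then show ?thesis using True w by (simp add: prod_delta_words W_length dl_def)
  qed (use w in \<open>auto simp: tens_def dl_def\<close>)
qed

text \<open>The sets of cosets for a triple and for its word coincide, so the same representatives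
  are chosen on both sides and the two sums correspond term by term.\<close>

lemma \<xi>_elem_props:
  assumes t: "t \<in> Tri A B n d"
  shows "\<xi>_elem (*s) A n d t \<in> carrier S" "coords (\<xi>_elem (*s) A n d t) = xi (enc t)"
proof -
  note w = enc_good[OF t]
  have tw: "triple_word n t \<in> words (carrier M) d"
    unfolding triple_word_enc[OF t] using w(1) W_nth[OF w(1)] by (intro wordsI) (auto simp: W_length el_M)
  have fin: "finite (cosets (enc t))" unfolding cosets_def by (intro finite_imageI) (simp add: finite_permutations)
  have perm: "(SOME \<sigma>. \<sigma> \<in> D) permutes {..<d}" if D: "D \<in> cosets (enc t)" for D
  proof -
    obtain \<sigma> where \<sigma>: "\<sigma> permutes {..<d}" "D = (\<lambda>\<tau>. \<tau> \<circ> \<sigma>) ` lstab (enc t)" using D unfolding cosets_def by blast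
    then have "\<exists>\<sigma>. \<sigma> \<in> D" using lstab_group(3) by blast
    then have "(SOME \<sigma>. \<sigma> \<in> D) \<in> D" by (rule someI_ex)
    then show ?thesis using \<sigma> w(1) by (auto simp: lstab_def W_length intro: permutes_compose)
  qed
  let ?g = "\<lambda>D. tensor_act M G d (SOME \<sigma>. \<sigma> \<in> D) (pure_tensor M G (triple_word n t))"
  have g: "?g D \<in> carrier (tensor_power M G d)" "coords (?g D) = actf (SOME \<sigma>. \<sigma> \<in> D) (dl (enc t))"
    if "D \<in> cosets (enc t)" for D
    using tensor_act_props[OF perm[OF that] pure_tensor_props(1)[OF tw]] pure_tensor_props(2)[OF tw]
    by (simp_all only: triple_word_enc[OF t] tw_el[OF w(1)])
  have e: "\<xi>_elem (*s) A n d t = finsum (tensor_power M G d) ?g (cosets (enc t))"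
    by (simp add: \<xi>_elem_def stab_cosets_enc[OF t])
  have 1: "\<xi>_elem (*s) A n d t \<in> carrier (tensor_power M G d)"
    unfolding e by (rule A.faithful_rep_finsum[OF faithful_rep_tensor_power fin g(1)])
  show 2: "coords (\<xi>_elem (*s) A n d t) = xi (enc t)"
    unfolding e using A.faithful_rep_finsum(2)[OF faithful_rep_tensor_power fin, of ?g] g by (simp add: xi_def)
  show "\<xi>_elem (*s) A n d t \<in> carrier S"
    unfolding schur_alg_def carrier_tensor_invariants using 1 2 xi_invs[OF w] by simp
qed

abbreviation "\<eta> \<equiv> \<eta>_elem (*s) A B\<^sub>\<cc> n d"

lemma \<eta>_props:
  assumes t: "t \<in> Tri A B n d"
  shows "\<eta> t \<in> carrier S" "coords (\<eta> t) = scal (of_nat (fc (enc t))) (xi (enc t))"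
  unfolding \<eta>_elem_def triple_fact_enc[OF t]
  using faithful_repD(3,10)[OF rep_S \<xi>_elem_props(1)[OF t]] by (simp_all add: \<xi>_elem_props(2)[OF t])

lemma T_simps: "monoid.mult T = monoid.mult S" "add T = add S" "\<one>\<^bsub>T\<^esub> = \<one>\<^bsub>S\<^esub>" "\<zero>\<^bsub>T\<^esub> = \<zero>\<^bsub>S\<^esub>"
    "Module.module.smult T = Module.module.smult S"
  by (simp_all add: T_alg_def)

lemma TT_closed: "0 \<in> TT" "x \<in> TT \<Longrightarrow> y \<in> TT \<Longrightarrow> x + y \<in> TT" "x \<in> TT \<Longrightarrow> scal a x \<in> TT"
proof -
  interpret V: calg Inv "(\<star>)" T1 scal by (rule A.calg_invs)
  show "0 \<in> TT" "x \<in> TT \<Longrightarrow> y \<in> TT \<Longrightarrow> x + y \<in> TT" "x \<in> TT \<Longrightarrow> scal a x \<in> TT"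
    by (auto simp: TT_def V.zero_closed V.add_closed V.sm_closed, simp add: scal_def)
qed

text \<open>Every generator satisfies the divisibility. Conversely, \<open>invs_span\<close> with
  factorial weights writes an invariant with divisible coordinates as a combination of the
  \<open>\<eta>\<close> elements.\<close>

lemma carrier_T: "carrier T = {U \<in> carrier S. coords U \<in> TT}"
proof (intro equalityI subsetI)
  note Q = faithful_repD[OF rep_S]
  have cT: "carrier T = lin_span S (\<eta> ` Tri A B n d)" by (simp add: T_alg_def B_def)
  show "U \<in> {U \<in> carrier S. coords U \<in> TT}" if "U \<in> carrier T" for U
    using that unfolding cT
  proof induction
    case (incl x)
    then show ?case using \<eta>_props enc_good eta_TT by auto
  qed (auto simp: Q TT_closed)
  fix U assume "U \<in> {U \<in> carrier S. coords U \<in> TT}"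
  then have U: "U \<in> carrier S" "coords U \<in> Inv" "\<And>w. w \<in> W \<Longrightarrow> of_nat (fc w) dvd coords U w" by (auto simp: TT_def)
  obtain a where a: "coords U = (\<Sum>t\<in>{t \<in> W. good t}. scal (a t) (scal (of_nat (fc t)) (xi t)))"
    using invs_span[OF U(2), of "\<lambda>w. of_nat (fc w)"] U(3) fc_permute by auto
  have "\<exists>x\<in>lin_span S (\<eta> ` Tri A B n d). coords x = coords U"
    unfolding a
  proof (rule lin_span_sum[OF rep_S])
    show "\<eta> ` Tri A B n d \<subseteq> carrier S" using \<eta>_props by blast
    show "finite {t \<in> W. good t}" using finW by simp
    fix w assume "w \<in> {t \<in> W. good t}"
    then obtain t where "t \<in> Tri A B n d" "w = enc t" using good_enc by blast
    then show "\<exists>y\<in>\<eta> ` Tri A B n d. scal (a w) (scal (of_nat (fc w)) (xi w)) = scal (a w) (coords y)"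
      by (intro bexI[of _ "\<eta> t"]) (simp_all add: \<eta>_props(2))
  qed
  then obtain x where x: "x \<in> carrier T" "coords x = coords U" unfolding cT by blast
  have "x \<in> carrier S" using x(1) unfolding cT by induction (auto simp: Q \<eta>_props)
  then have "x = U" using Q(11) x(2) U(1) by (auto simp: bij_betw_def inj_on_def)
  then show "U \<in> carrier T" using x(1) by simp
qed

lemma rep_T: "faithful_rep T coords TT (\<star>) T1 scal"
proof (rule faithful_repI)
  note Q = faithful_repD[OF rep_S]
  have im: "z \<in> coords ` carrier T" if z: "z \<in> TT" for z
  proof -
    have "z \<in> coords ` carrier S" using bij_betw_imp_surj_on[OF Q(11)] z by (simp add: TT_def)
    then show ?thesis using z unfolding carrier_T by blast
  qed
  have inj: "inj_on coords (carrier S)" using Q(11) by (rule bij_betw_imp_inj_on)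
  have "inj_on coords (carrier T)" by (rule inj_on_subset[OF inj]) (simp add: carrier_T)
  then show "bij_betw coords (carrier T) TT" unfolding bij_betw_def using im by (auto simp: carrier_T)
qed (auto simp: T_simps carrier_T faithful_repD[OF rep_S] TT_closed conv_TT T1_TT)

text \<open>A common multiple of the factorial weights of all words, so that it multiplies every
  invariant into the subalgebra.\<close>

definition N :: nat where "N = (\<Prod>w\<in>W. fc w)"

lemma ext_pair: "ext_pair K.TC K.conv K.T1 S T (\<lambda>s. fx (coords s)) (of_nat N)"
proof (intro ext_pair.intro ext_pair_axioms.intro)
  show "ext_setting K.TC K.conv K.T1 S (\<lambda>s. fx (coords s))"
    using A.invs_C by (intro ext_setting[OF rep_S]) blast
  show "ext_setting K.TC K.conv K.T1 T (\<lambda>s. fx (coords s))"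
    using A.invs_C by (intro ext_setting[OF rep_T]) (auto simp: TT_def)
  show "carrier T \<subseteq> carrier S" by (auto simp: carrier_T)
  show "of_nat N \<noteq> (0 :: 'k)" using finW by (simp add: N_def fc_def finIc)
  fix s assume s: "s \<in> carrier S"
  note Q = faithful_repD[OF rep_S]
  have "of_nat (fc w) dvd (of_nat N * coords s w :: 'k)" if "w \<in> W" for w
  proof -
    have "fc w dvd N" unfolding N_def using finW that by (rule dvd_prodI)
    then have "of_nat (fc w) dvd (of_nat N :: 'k)" by (elim dvdE) simp
    then show ?thesis by simp
  qed
  then have "of_nat N \<odot>\<^bsub>S\<^esub> s \<in> carrier T"
    using Q(3)[OF s] Q(12)[OF Q(3)[OF s]] by (simp add: carrier_T TT_def Q(10)[OF s]) (simp add: scal_def)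
  then show "\<exists>t\<in>carrier T. scalK (fr (of_nat N)) (fx (coords s)) = fx (coords t)"
    by (intro bexI[of _ "of_nat N \<odot>\<^bsub>S\<^esub> s"]) (simp_all add: Q(10)[OF s] fx_scal)
qed

text \<open>The elements with coordinates \<open>xi t\<close> for good \<open>t\<close> span, by
  \<open>invs_span\<close> with weight 1. Coefficients of words giving the same element are added
  up, as \<open>V\<close> is a set and not a family.\<close>

lemma finite_span_S:
  obtains V where "finite V" "V \<subseteq> carrier S"
    "\<And>s. s \<in> carrier S \<Longrightarrow> \<exists>a. fx (coords s) = (\<Sum>v\<in>V. scalK (fr (a v)) (fx (coords v)))"
proof
  note Q = faithful_repD[OF rep_S]
  define x where "x t = inv_into (carrier S) coords (xi t)" for t
  let ?J = "{t \<in> W. good t}"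
  have x: "x t \<in> carrier S" "coords (x t) = xi t" if "t \<in> ?J" for t
  proof -
    have "xi t \<in> coords ` carrier S" using bij_betw_imp_surj_on[OF Q(11)] xi_invs that by simp
    then show "x t \<in> carrier S" "coords (x t) = xi t" unfolding x_def by (rule inv_into_into, rule f_inv_into_f)
  qed
  show "finite (x ` ?J)" using finW by simp
  show "x ` ?J \<subseteq> carrier S" using x by blast
  fix s assume s: "s \<in> carrier S"
  obtain a where a: "coords s = (\<Sum>t\<in>?J. scal (a t) (scal 1 (xi t)))"
    using invs_span[OF Q(12)[OF s], of "\<lambda>_. 1"] by auto
  have e: "fx (coords s) = (\<Sum>t\<in>?J. scalK (fr (a t)) (fx (coords (x t))))"
    unfolding a fx_sum by (intro sum.cong refl) (simp add: x fx_scal scalK_simps fr_1)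
  have "\<dots> = (\<Sum>v\<in>x ` ?J. \<Sum>t\<in>{t \<in> ?J. x t = v}. scalK (fr (a t)) (fx (coords (x t))))"
    using finW by (intro sum.image_gen) simp
  also have "\<dots> = (\<Sum>v\<in>x ` ?J. scalK (fr (\<Sum>t\<in>{t \<in> ?J. x t = v}. a t)) (fx (coords v)))"
    by (intro sum.cong refl ext) (simp add: scalK_def fr_sum sum_fun_apply sum_distrib_right)
  finally show "\<exists>a. fx (coords s) = (\<Sum>v\<in>x ` ?J. scalK (fr (a v)) (fx (coords v)))"
    unfolding e by (intro exI[of _ "\<lambda>v. \<Sum>t\<in>{t \<in> ?J. x t = v}. a t"])
qed

end

context schur_idem
begin

lemma schur_double_centralizer:
  "double_centralizer_idempotent S \<xi> \<and>
    double_centralizer_idempotent (scalar_ext S) (ext_tensor S \<xi> 1) \<and>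
    ext_incl S \<in> alg_iso (scalar_ext T) (scalar_ext S) \<and>
    double_centralizer_idempotent (scalar_ext T)
      (inv_into (carrier (scalar_ext T)) (ext_incl S) (ext_tensor S \<xi> 1))"
proof -
  interpret P: ext_pair K.TC K.conv K.T1 S T "\<lambda>s. fx (coords s)" "of_nat N" by (rule ext_pair)
  obtain V where V: "finite V" "V \<subseteq> carrier S"
    "\<And>s. s \<in> carrier S \<Longrightarrow> \<exists>a. fx (coords s) = (\<Sum>v\<in>V. scalK (fr (a v)) (fx (coords v)))"
    using finite_span_S by blast
  have "dci Inv (\<star>) (coords \<xi>)" using dci_Inv by (simp add: \<xi>(2))
  from P.ES.dci_E[OF A.calg_invs rep_S this \<xi>(1) V]
  show ?thesis using double_centralizer_S P.ext_incl_iso P.double_centralizer_ext \<xi>(1) by blast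
qed

end

theorem theorem5:
  fixes scale :: "'k::{idom,ring_char_0} \<Rightarrow> 'a::{ring,monoid_mult} \<Rightarrow> 'a"
    and A :: "bit \<Rightarrow> 'a set"
    and \<aa> \<cc> B\<^sub>\<aa> B\<^sub>\<cc> B\<^sub>1 :: "'a set"
    and e :: 'a
    and n d :: nat
  assumes pid: "principal_domain (ring_of_type_algebra :: 'k ring)"
    and good: "unital_good_pair scale A \<aa>"
    and basis: "good_pair_basis scale A \<aa> \<cc> B\<^sub>\<aa> B\<^sub>\<cc> B\<^sub>1"
    and rank: "finite_rank scale"
    and n: "1 \<le> n" and d: "d \<le> n"
    and e_even: "e \<in> A 0" and e_idem: "e * e = e"
    and e_dc: "double_centralizer_idempotent (type_alg scale) e"
  defines "S \<equiv> schur_alg scale A n d"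
    and "T \<equiv> T_alg scale A B\<^sub>\<aa> B\<^sub>\<cc> B\<^sub>1 n d"
    and "\<xi> \<equiv> \<xi>_idem scale A n d e"
  shows "double_centralizer_idempotent S \<xi> \<and>
    double_centralizer_idempotent (scalar_ext S) (ext_tensor S \<xi> 1) \<and>
    ext_incl S \<in> alg_iso (scalar_ext T) (scalar_ext S) \<and>
    double_centralizer_idempotent (scalar_ext T)
      (inv_into (carrier (scalar_ext T)) (ext_incl S) (ext_tensor S \<xi> 1))"
proof -
  have "schur_idem scale A \<aa> \<cc> B\<^sub>\<aa> B\<^sub>\<cc> B\<^sub>1 n d e"
    using basis rank pid n d e_even e_idem e_dc
    by (intro schur_idem.intro schur_basis.intro schur_basis_axioms.intro schur_idem_axioms.intro)
  then show ?thesis unfolding S_def T_def \<xi>_def by (rule schur_idem.schur_double_centralizer)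
qed

end
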